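(* Let $d\ge 3$, $T\in(0,\infty)$, and let $b:\mathbb{R}^{d+1}\to\mathbb{R}^d$ be bounded and Borel measurable. Suppose that $$\bar b:=\|b\|_{L_{q_0,p_0}(\mathbb{R}^d_T)}<\infty$$ for some $p_0,q_0$ satisfying $$p_0\in(d,\infty],\qquad \frac{d}{p_0}+\frac{2}{q_0}=1.$$ Then for each $p,q$ satisfying $$p,q\in(1,\infty),\qquad \frac dp+\frac2q<2,$$ and every bounded Borel measurable real-valued $f$, the bounded solution $u$ of $$\partial_t u+\Delta u+b^iD_iu=-f\ \text{ in } \mathbb{R}^d_T,\qquad u(T,\cdot)=0,$$ satisfies $$|u(0,0)|\le N\|f\|_{L_{q,p}(\mathbb{R}^d_T)}$$ with $N=N'\,T^{1-d/(2p)-1/q}$, where $N'$ depends only on $d,\bar b,q,p$ if $p_0=\infty$, and otherwise only on $d,\bar b,p_0,q,p$ and the function $$b(t):=\Big(\int_{\mathbb{R}^d}|b(t,x)|^{p_0}\,dx\Big)^{1/(p_0-d)} .$$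
   Context: Notation: $\mathbb{R}^{d+1}=\{(t,x):t\in\mathbb{R},x\in\mathbb{R}^d\}$, $\mathbb{R}^d_T=[0,T)\times\mathbb{R}^d$, $D_i=\partial/\partial x^i$, and summation over repeated indices $i=1,\dots,d$ is understood. For $q,p\in(1,\infty)$, $$\|f\|^q_{L_{q,p}(\mathbb{R}^d_T)}=\int_0^T\Big(\int_{\mathbb{R}^d}|f(t,x)|^p\,dx\Big)^{q/p}dt,$$ with the usual essential-supremum modification if $q$ or $p$ is infinite. Standing assumption: all given functions ($f$, $b$) are Borel measurable and bounded (the bounds do not enter the constants). Under this assumption the terminal value problem has a unique bounded solution that belongs to $W^{1,2}_{r,\mathrm{loc}}(\mathbb{R}^d_T)$ for every $r\in(1,\infty)$ (one generalized derivative in $t$ and two in $x$, locally in $L_r$); "the solution" means this one. "Constant depends only on" certain data means that it can be chosen as a function of these data alone, the same for all $b$ and $f$ (as in the statement) sharing these data. *)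

theory Defs
  imports "HOL-Probability.Essential_Supremum"
begin

text \<open>Points of space-time are pairs \<open>(t, x)\<close> in \<open>real \<times> real^'d\<close>.\<close>

(* x^a for x in [0,\<infinity>] and a > 0. *)
definition epowr :: "ennreal \<Rightarrow> real \<Rightarrow> ennreal" where
  "epowr x a = (if x = \<infinity> then \<infinity> else ennreal (enn2real x powr a))"

definition Lp_norm :: "'a measure \<Rightarrow> ennreal \<Rightarrow> ('a \<Rightarrow> ennreal) \<Rightarrow> ennreal" where
  "Lp_norm M p g =
     (if p = \<infinity> then esssup M g
      else epowr (\<integral>\<^sup>+ x. epowr (g x) (enn2real p) \<partial>M) (1 / enn2real p))"

(* The norm of L_{q,p}([0,T) \<times> R^d): q is the exponent in time (outer integral),
   p the exponent in space (inner integral). *)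
definition mixed_norm ::
  "real \<Rightarrow> ennreal \<Rightarrow> ennreal \<Rightarrow> (real \<times> (real^'d) \<Rightarrow> 'b::real_normed_vector) \<Rightarrow> ennreal" where
  "mixed_norm T q p g =
     Lp_norm (restrict_space lborel {0..<T}) q
       (\<lambda>t. Lp_norm lborel p (\<lambda>x. ennreal (norm (g (t, x)))))"

(* The function b(t); it is defined for every real t and may take the value \<infinity>. *)
definition drift_profile ::
  "real \<Rightarrow> (real \<times> (real^'d) \<Rightarrow> real^'d) \<Rightarrow> real \<Rightarrow> ennreal" where
  "drift_profile p0 b t =
     epowr (\<integral>\<^sup>+ x. ennreal (norm (b (t, x)) powr p0) \<partial>lborel) (1 / (p0 - real CARD('d)))"

primrec Ck :: "nat \<Rightarrow> ('a::euclidean_space \<Rightarrow> real) \<Rightarrow> bool" where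
  "Ck 0 \<phi> = continuous_on UNIV \<phi>"
| "Ck (Suc k) \<phi> =
     ((\<forall>z. \<phi> differentiable (at z)) \<and>
      (\<forall>e\<in>Basis. Ck k (\<lambda>z. frechet_derivative \<phi> (at z) e)))"

definition test_function :: "'a::euclidean_space set \<Rightarrow> ('a \<Rightarrow> real) \<Rightarrow> bool" where
  "test_function \<Omega> \<phi> \<longleftrightarrow>
     (\<forall>k. Ck k \<phi>) \<and> (\<exists>K. compact K \<and> K \<subseteq> \<Omega> \<and> (\<forall>z. z \<notin> K \<longrightarrow> \<phi> z = 0))"

definition Lr_loc :: "real \<Rightarrow> 'a::euclidean_space set \<Rightarrow> ('a \<Rightarrow> real) \<Rightarrow> bool" where
  "Lr_loc r Q g \<longleftrightarrow>
     (\<forall>K. compact K \<and> K \<subseteq> Q \<longrightarrow>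
        set_borel_measurable lborel K g \<and>
        (\<integral>\<^sup>+ z\<in>K. ennreal (\<bar>g z\<bar> powr r) \<partial>lborel) < \<infinity>)"

(* g is the generalized derivative of h in the direction e on the open set \<Omega>.
   The integrands vanish outside the support of the test function, so the values of
   g and h outside \<Omega> are irrelevant. *)
definition gen_deriv ::
  "'a::euclidean_space set \<Rightarrow> 'a \<Rightarrow> ('a \<Rightarrow> real) \<Rightarrow> ('a \<Rightarrow> real) \<Rightarrow> bool" where
  "gen_deriv \<Omega> e h g \<longleftrightarrow>
     Lr_loc 1 \<Omega> h \<and> Lr_loc 1 \<Omega> g \<and>
     (\<forall>\<phi>. test_function \<Omega> \<phi> \<longrightarrow>
        (LINT z|lborel. h z * frechet_derivative \<phi> (at z) e) = - (LINT z|lborel. g z * \<phi> z))"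

definition layer :: "real \<Rightarrow> (real \<times> (real^'d)) set" where
  "layer T = {0..<T} \<times> UNIV"

(* u belongs to W^{1,2}_{r,loc}([0,T) \<times> R^d), and ut, Du i, D2u i j are (versions of) its
   generalized derivatives \<partial>_t u, D_i u, D_j D_i u.  Local integrability is up to t = 0. *)
definition W12_loc ::
  "real \<Rightarrow> real \<Rightarrow> (real \<times> (real^'d) \<Rightarrow> real) \<Rightarrow> (real \<times> (real^'d) \<Rightarrow> real) \<Rightarrow>
   ('d \<Rightarrow> real \<times> (real^'d) \<Rightarrow> real) \<Rightarrow> ('d \<Rightarrow> 'd \<Rightarrow> real \<times> (real^'d) \<Rightarrow> real) \<Rightarrow> bool" where
  "W12_loc r T u ut Du D2u \<longleftrightarrow>
     gen_deriv (interior (layer T)) (1, 0) u ut \<and>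
     (\<forall>i. gen_deriv (interior (layer T)) (0, axis i 1) u (Du i)) \<and>
     (\<forall>i j. gen_deriv (interior (layer T)) (0, axis j 1) (Du i) (D2u i j)) \<and>
     Lr_loc r (layer T) u \<and> Lr_loc r (layer T) ut \<and>
     (\<forall>i. Lr_loc r (layer T) (Du i)) \<and> (\<forall>i j. Lr_loc r (layer T) (D2u i j))"

(* Elements of W^{1,2}_{r,loc} with r > (d+2)/2 have continuous versions; u is that version,
   continuous up to t = T, so that u(0,0) and u(T,x) are meaningful point values. *)
definition bounded_solution ::
  "real \<Rightarrow> (real \<times> (real^'d) \<Rightarrow> real^'d) \<Rightarrow> (real \<times> (real^'d) \<Rightarrow> real) \<Rightarrow>
   (real \<times> (real^'d) \<Rightarrow> real) \<Rightarrow> bool" where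
  "bounded_solution T b f u \<longleftrightarrow>
     continuous_on ({0..T} \<times> UNIV) u \<and> bounded (u ` ({0..T} \<times> UNIV)) \<and>
     (\<forall>x. u (T, x) = 0) \<and>
     (\<exists>ut Du D2u.
        (\<forall>r>1. W12_loc r T u ut Du D2u) \<and>
        (AE z in lborel. z \<in> layer T \<longrightarrow>
           ut z + (\<Sum>i\<in>UNIV. D2u i i z) + (\<Sum>i\<in>UNIV. b z $ i * Du i z) = - f z))"

end

theory Submission
  imports Defs
begin

text \<open>
  Normalise so that \<open>T powr \<gamma>\<close> times the norm of \<open>f\<close> is at most one, where
  \<open>\<gamma> = 1 - d / (2 * p) - 1 / q\<close>, and test the equation, mollified in space-time, with
  \<open>exp (m * u)\<close> times the square of a cutoff at scale \<open>sqrt T\<close>.  Since \<open>p0 > d\<close>, the drift is form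
  bounded with a time-dependent constant whose integral over \<open>(0, T)\<close> is controlled by \<open>bbar\<close>, with no
  dependence on \<open>m\<close>, so Gronwall's inequality absorbs it; the source is subcritical and costs only a
  power of \<open>m\<close>.  A reverse Hoelder inequality results, uniformly over the centres of the cutoffs, and
  Moser's iteration \<open>m \<mapsto> (1 + 1/d) * m\<close> bounds \<open>u\<close>, and likewise \<open>- u\<close>, from above.  In
  particular the constant depends on the drift only through \<open>bbar\<close>, not on the drift profile.
\<close>

text \<open>Exponentials are tested instead of powers because the source then enters with a factor
  \<open>m\<close> and no power of \<open>u\<close>, and because in the drift term the factor
  \<open>m\<close> is part of the gradient of \<open>exp (m / 2 * u)\<close>, which is why the drift
  constant is free of \<open>m\<close>. The drift is critical: its form constant is merely
  integrable in time, no splitting parameter makes it small, and Gronwall takes over. For the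
  source, d/p + 2/q < 2 says that the form constant, which carries \<open>m powr a\<close> with
  \<open>a = 1 / (1 - d / (2 * p))\<close>, lies in L_\<rho> in time with
  \<open>\<rho> = q / a > 1\<close>; this excess turns it into a small multiple of the supremum plus
  a power of \<open>m\<close>. As \<open>exp (m * u)\<close> is not integrable over the whole space,
  all estimates are local, and the gradient of the cutoff produces an integral over a full ball
  where only half a ball is controlled. Taking all centres at once and covering a ball by finitely
  many half balls closes this loop. Bounds \<open>exp (\<Lambda> * m)\<close> of the cylinder
  integrals along \<open>m = (1 + 1/d) ^ n\<close> finally force
  \<open>u \<le> \<Lambda>\<close>.\<close>

section \<open>A weighted Poincare-type inequality\<close>

text \<open>Derivatives along lines with a continuous candidate gradient are all that the
  fundamental theorem of calculus and the integrations by parts ask for; product and chain rules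
  reduce to one real variable.\<close>

definition C1_grad :: "('a::euclidean_space \<Rightarrow> real) \<Rightarrow> ('a \<Rightarrow> 'a) \<Rightarrow> bool" where
  "C1_grad y G \<longleftrightarrow> continuous_on UNIV y \<and> continuous_on UNIV G \<and>
     (\<forall>x h. ((\<lambda>r. y (x + r *\<^sub>R h)) has_real_derivative G x \<bullet> h) (at 0))"

lemma C1_grad_line:
  assumes "C1_grad y G"
  shows "((\<lambda>r. y (x + r *\<^sub>R h)) has_real_derivative G (x + r *\<^sub>R h) \<bullet> h) (at r)"
proof -
  have "((\<lambda>r'. y ((x + r *\<^sub>R h) + r' *\<^sub>R h)) has_real_derivative G (x + r *\<^sub>R h) \<bullet> h) (at 0)"
    using assms unfolding C1_grad_def by blast
  then have "((\<lambda>r'. y (x + (r' + r) *\<^sub>R h)) has_real_derivative G (x + r *\<^sub>R h) \<bullet> h) (at 0)"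
    by (simp add: algebra_simps)
  then show ?thesis
    using DERIV_shift[of "\<lambda>r. y (x + r *\<^sub>R h)" "G (x + r *\<^sub>R h) \<bullet> h" 0 r] by simp
qed

lemma cball_in_borel [measurable]: "cball (a::'a::euclidean_space) r \<in> sets borel"
  by (rule borel_closed) (rule closed_cball)

lemma nn_integral_affine_euclidean:
  fixes f :: "'a::euclidean_space \<Rightarrow> ennreal"
  assumes [measurable]: "f \<in> borel_measurable borel" and c: "c \<noteq> 0"
  shows "(\<integral>\<^sup>+x. f x \<partial>lborel) = ennreal (\<bar>c\<bar> ^ DIM('a)) * (\<integral>\<^sup>+x. f (t + c *\<^sub>R x) \<partial>lborel)"
  by (subst lborel_affine[OF c, of t])
     (simp add: nn_integral_density nn_integral_distr nn_integral_cmult)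

lemma nn_integral_translate:
  fixes f :: "'a::euclidean_space \<Rightarrow> ennreal"
  assumes "f \<in> borel_measurable borel"
  shows "(\<integral>\<^sup>+x. f (x + t) \<partial>lborel) = (\<integral>\<^sup>+x. f x \<partial>lborel)"
  using nn_integral_affine_euclidean[OF assms, of 1 t] by (simp add: add.commute)

lemma nn_integral_powr_from_0:
  assumes "a > -1" "R \<ge> 0"
  shows "(\<integral>\<^sup>+s. ennreal (s powr a) * indicator {0..R} s \<partial>lborel) = ennreal (R powr (a + 1) / (a + 1))"
proof -
  have "((\<lambda>s. s powr a) has_integral (R powr (a + 1) / (a + 1))) {0..R}"
    using has_integral_powr_from_0[OF assms] .
  from nn_integral_has_integral_lebesgue'[OF _ this] show ?thesis by simp
qed

text \<open>Stands in for Hoelder's inequality: integrated over a set of finite measure, with \<mu>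
  at the right level, it bounds an L_1 norm by an L_p norm. It is used in space for averages over
  balls and in time for the source.\<close>

lemma young_split:
  fixes a \<mu> p :: real
  assumes "a \<ge> 0" "\<mu> > 0" "p \<ge> 1"
  shows "a \<le> \<mu> + \<mu> powr (1 - p) * a powr p"
proof (cases "a \<le> \<mu>")
  case True then show ?thesis using assms by (simp add: add_increasing2)
next
  case False
  then have "1 \<le> (a / \<mu>) powr (p - 1)" using assms by (intro ge_one_powr_ge_zero) auto
  also have "\<dots> = \<mu> powr (1 - p) * a powr (p - 1)"
    using False assms by (simp add: powr_divide powr_diff field_simps)
  finally have "a * 1 \<le> a * (\<mu> powr (1 - p) * a powr (p - 1))"
    using assms(1) by (intro mult_left_mono)
  also have "\<dots> = \<mu> powr (1 - p) * a powr p"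
    using False assms by (simp add: powr_diff)
  finally show ?thesis using assms by simp
qed

text \<open>The factor \<open>s powr (-\<theta>/2)\<close> split off in Cauchy-Schwarz is square
  integrable at 0 because \<open>\<theta> < 1\<close>. Its partner leaves the weight
  \<open>s powr \<theta>\<close>, which later tames the singularity of the averages of
  \<open>g\<close> at small radii.\<close>

lemma square_le_line_integral:
  fixes y :: "'a::euclidean_space \<Rightarrow> real"
  assumes C1: "C1_grad y G" and R: "R > 0" and th: "0 < \<theta>" "\<theta> < 1" and h: "norm h \<le> 1"
  shows "ennreal ((y x)\<^sup>2) \<le> 2 * ennreal ((y (x + R *\<^sub>R h))\<^sup>2) +
     ennreal (2 * R powr (1 - \<theta>) / (1 - \<theta>)) *
     (\<integral>\<^sup>+s. ennreal (s powr \<theta>) * ennreal ((norm (G (x + s *\<^sub>R h)))\<^sup>2) * indicator {0..R} s \<partial>lborel)"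
proof -
  have cG: "continuous_on UNIV G" using C1 unfolding C1_grad_def by simp
  have cl: "continuous_on A (\<lambda>s. G (x + s *\<^sub>R h))" for A
    by (rule continuous_on_compose2[OF cG]) (auto intro!: continuous_intros)
  have [measurable]: "(\<lambda>s. G (x + s *\<^sub>R h)) \<in> borel_measurable borel"
    by (rule borel_measurable_continuous_onI[OF cl])
  let ?D = "y (x + R *\<^sub>R h) - y x"
  have dv: "((\<lambda>s. y (x + s *\<^sub>R h)) has_vector_derivative G (x + s *\<^sub>R h) \<bullet> h) (at s within {0..R})" for s
    using C1_grad_line[OF C1, of x h s]
    by (simp add: has_real_derivative_iff_has_vector_derivative has_vector_derivative_at_within)
  have FTC: "(LBINT s. indicator {0..R} s *\<^sub>R (G (x + s *\<^sub>R h) \<bullet> h)) = ?D"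
    using integral_FTC_atLeastAtMost[of 0 R "\<lambda>s. y (x + s *\<^sub>R h)" "\<lambda>s. G (x + s *\<^sub>R h) \<bullet> h", OF _ dv] R
    by (simp add: continuous_on_inner[OF cl continuous_on_const])
  have "ennreal \<bar>?D\<bar> \<le> (\<integral>\<^sup>+s. ennreal (norm (indicator {0..R} s *\<^sub>R (G (x + s *\<^sub>R h) \<bullet> h))) \<partial>lborel)"
    unfolding FTC[symmetric] real_norm_def[symmetric] by (rule integral_norm_bound_ennreal)
       (intro borel_integrable_compact compact_Icc continuous_on_inner[OF cl continuous_on_const])
  also have "\<dots> \<le> (\<integral>\<^sup>+s. (ennreal (s powr (-\<theta>/2)) * indicator {0..R} s) *
        (ennreal (s powr (\<theta>/2) * norm (G (x + s *\<^sub>R h))) * indicator {0..R} s) \<partial>lborel)"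
  proof (rule nn_integral_mono_AE)
    have le: "\<bar>G (x + s *\<^sub>R h) \<bullet> h\<bar> \<le> norm (G (x + s *\<^sub>R h))" for s
      using Cauchy_Schwarz_ineq2[of "G (x + s *\<^sub>R h)" h] h
      by (meson mult_left_le norm_ge_zero order_trans)
    show "AE s in lborel. ennreal (norm (indicator {0..R} s *\<^sub>R (G (x + s *\<^sub>R h) \<bullet> h)))
       \<le> (ennreal (s powr (-\<theta>/2)) * indicator {0..R} s) *
        (ennreal (s powr (\<theta>/2) * norm (G (x + s *\<^sub>R h))) * indicator {0..R} s)"
      \<comment> \<open>At \<open>s = 0\<close> both weights vanish, since
        \<open>0 powr x = 0\<close>, so the two factors fail to multiply to 1 there.\<close>
      using AE_lborel_singleton[of 0]
      by eventually_elim
        (auto simp: indicator_def le ennreal_mult'[symmetric] mult.assoc[symmetric] powr_add[symmetric] intro!: ennreal_leI)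
  qed
  finally have 1: "ennreal \<bar>?D\<bar> \<le> (\<integral>\<^sup>+s. (ennreal (s powr (-\<theta>/2)) * indicator {0..R} s) *
        (ennreal (s powr (\<theta>/2) * norm (G (x + s *\<^sub>R h))) * indicator {0..R} s) \<partial>lborel)" .
  have "(ennreal \<bar>?D\<bar>)\<^sup>2 \<le> (\<integral>\<^sup>+s. (ennreal (s powr (-\<theta>/2)) * indicator {0..R} s)\<^sup>2 \<partial>lborel) *
      (\<integral>\<^sup>+s. (ennreal (s powr (\<theta>/2) * norm (G (x + s *\<^sub>R h))) * indicator {0..R} s)\<^sup>2 \<partial>lborel)"
    by (rule order_trans[OF power_mono[OF 1] Cauchy_Schwarz_nn_integral]) auto
  also have "(\<integral>\<^sup>+s. (ennreal (s powr (-\<theta>/2)) * indicator {0..R} s)\<^sup>2 \<partial>lborel) =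
     (\<integral>\<^sup>+s. ennreal (s powr (-\<theta>)) * indicator {0..R} s \<partial>lborel)"
    by (intro nn_integral_cong)
      (auto simp: indicator_def power2_eq_square ennreal_mult'[symmetric] powr_add[symmetric])
  also have "\<dots> = ennreal (R powr (1 - \<theta>) / (1 - \<theta>))"
    using nn_integral_powr_from_0[of "-\<theta>" R] th R by (simp add: add.commute)
  also have "(\<integral>\<^sup>+s. (ennreal (s powr (\<theta>/2) * norm (G (x + s *\<^sub>R h))) * indicator {0..R} s)\<^sup>2 \<partial>lborel) =
     (\<integral>\<^sup>+s. ennreal (s powr \<theta>) * ennreal ((norm (G (x + s *\<^sub>R h)))\<^sup>2) * indicator {0..R} s \<partial>lborel)" (is "_ = ?I")
  proof (intro nn_integral_cong)
    fix s :: real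
    have "(s powr (\<theta>/2) * norm (G (x + s *\<^sub>R h)))\<^sup>2 = s powr \<theta> * (norm (G (x + s *\<^sub>R h)))\<^sup>2"
      by (auto simp: power_mult_distrib power2_eq_square powr_add[symmetric])
    then show "(ennreal (s powr (\<theta>/2) * norm (G (x + s *\<^sub>R h))) * indicator {0..R} s)\<^sup>2 =
      ennreal (s powr \<theta>) * ennreal ((norm (G (x + s *\<^sub>R h)))\<^sup>2) * indicator {0..R} s"
      by (auto simp: indicator_def ennreal_power ennreal_mult'[symmetric])
  qed
  finally have 2: "ennreal (?D\<^sup>2) \<le> ennreal (R powr (1 - \<theta>) / (1 - \<theta>)) * ?I"
    by (simp add: ennreal_power)
  have "(y x)\<^sup>2 \<le> 2 * (y (x + R *\<^sub>R h))\<^sup>2 + 2 * ?D\<^sup>2"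
    by (use sum_squares_bound[of "y (x + R *\<^sub>R h)" "?D"] zero_le_power2[of "2 * y (x + R *\<^sub>R h) - y x"] in \<open>simp add: power2_eq_square algebra_simps\<close>)
  then have "ennreal ((y x)\<^sup>2) \<le> 2 * ennreal ((y (x + R *\<^sub>R h))\<^sup>2) + 2 * ennreal (?D\<^sup>2)"
    by (simp add: ennreal_leI flip: ennreal_plus ennreal_mult' ennreal_numeral)
  also have "2 * ennreal (?D\<^sup>2) \<le> 2 * (ennreal (R powr (1 - \<theta>) / (1 - \<theta>)) * ?I)"
    by (intro mult_left_mono 2) auto
  also have "\<dots> = ennreal (2 * R powr (1 - \<theta>) / (1 - \<theta>)) * ?I"
    using th by (simp add: mult.assoc[symmetric] flip: ennreal_mult' ennreal_numeral)
  finally show ?thesis by (simp add: add_left_mono)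
qed

text \<open>Translating \<open>x\<close> by \<open>- s *\<^sub>R h\<close> moves the average over
  the ball from \<open>q\<close> to \<open>g\<close>. The average of \<open>g\<close> at scale
  \<open>s\<close> is then bounded uniformly in the point, with \<open>young_split\<close> in the
  role of Hoelder's inequality, and comes out of the integral.\<close>

lemma nn_integral_average_le:
  fixes g :: "'a::euclidean_space \<Rightarrow> real" and q :: "'a \<Rightarrow> ennreal"
  assumes [measurable]: "g \<in> borel_measurable borel" "q \<in> borel_measurable borel"
    and g0: "\<And>x. g x \<ge> 0" and s: "s > 0" and P: "P > 0" and p: "p \<ge> 1"
    and gp: "(\<integral>\<^sup>+x. ennreal (g x powr p) \<partial>lborel) \<le> ennreal (P powr p)"
  shows "(\<integral>\<^sup>+x. \<integral>\<^sup>+h. ennreal (g x) * q (x + s *\<^sub>R h) * indicator (cball 0 1) h \<partial>lborel \<partial>lborel)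
     \<le> ennreal ((measure lborel (cball 0 1 :: 'a set) + 1) * P * s powr (- real DIM('a) / p)) * (\<integral>\<^sup>+x. q x \<partial>lborel)"
proof -
  let ?n = "real DIM('a)"
  let ?k = "measure lborel (cball 0 1 :: 'a set)"
  \<comment> \<open>The level at which both terms of \<open>young_split\<close> have the same size:
    after rescaling the ball, \<open>\<mu> powr (1 - p) * P powr p / s ^ DIM('a)\<close> is again
    \<mu>.\<close>
  define \<mu> where "\<mu> = P * s powr (- ?n / p)"
  have \<mu>: "\<mu> > 0" using P s by (simp add: \<mu>_def)
  have \<mu>2: "\<mu> powr (1 - p) * (P powr p / s ^ DIM('a)) = \<mu>"
  proof -
    have "\<mu> powr (1 - p) = \<mu> / \<mu> powr p" using \<mu> by (simp add: powr_diff)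
    moreover have "\<mu> powr p = P powr p / s ^ DIM('a)"
    proof -
      have "(s powr (- ?n / p)) powr p = s powr (- ?n)" using p by (simp add: powr_powr)
      also have "\<dots> = 1 / s ^ DIM('a)" using s by (simp add: powr_minus_divide powr_realpow)
      finally show ?thesis unfolding \<mu>_def using P s by (subst powr_mult) auto
    qed
    ultimately show ?thesis using P s by simp
  qed
  have fin: "emeasure lborel (cball 0 1 :: 'a set) = ennreal ?k"
    using emeasure_lborel_cball_finite[of "0::'a" 1]
    by (intro emeasure_eq_ennreal_measure) (simp add: less_top[symmetric])
  have mI: "(\<lambda>h::'a. ennreal c * indicator (cball 0 1) h) \<in> borel_measurable borel" for c
    by measurable
  have inner: "(\<integral>\<^sup>+h. ennreal (g (z + (-s) *\<^sub>R h)) * indicator (cball 0 1) h \<partial>lborel) \<le> ennreal ((?k + 1) * \<mu>)" for z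
  proof -
    have "(\<integral>\<^sup>+h. ennreal (g (z + (-s) *\<^sub>R h)) * indicator (cball 0 1) h \<partial>lborel) \<le>
      (\<integral>\<^sup>+h. ennreal \<mu> * indicator (cball 0 1) h + ennreal (\<mu> powr (1 - p)) * ennreal (g (z + (-s) *\<^sub>R h) powr p) \<partial>lborel)"
    proof (intro nn_integral_mono)
      fix h :: 'a
      show "ennreal (g (z + (-s) *\<^sub>R h)) * indicator (cball 0 1) h \<le>
         ennreal \<mu> * indicator (cball 0 1) h + ennreal (\<mu> powr (1 - p)) * ennreal (g (z + (-s) *\<^sub>R h) powr p)"
        using young_split[OF g0 \<mu> p, of "z + (-s) *\<^sub>R h"] \<mu>
        by (auto simp: indicator_def ennreal_leI simp flip: ennreal_plus ennreal_mult')
    qed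
    also have "\<dots> = ennreal \<mu> * ennreal ?k +
        ennreal (\<mu> powr (1 - p)) * (\<integral>\<^sup>+h. ennreal (g (z + (-s) *\<^sub>R h) powr p) \<partial>lborel)"
      by (subst nn_integral_add) (auto simp: nn_integral_cmult fin nn_integral_cmult_indicator mI)
    also have "(\<integral>\<^sup>+h. ennreal (g (z + (-s) *\<^sub>R h) powr p) \<partial>lborel) \<le> ennreal (P powr p / s ^ DIM('a))"
    proof -
      have "(\<integral>\<^sup>+h. ennreal (g (z + (-s) *\<^sub>R h) powr p) \<partial>lborel) =
        ennreal (1 / s ^ DIM('a)) * (ennreal (s ^ DIM('a)) * (\<integral>\<^sup>+h. ennreal (g (z + (-s) *\<^sub>R h) powr p) \<partial>lborel))"
        using s by (simp add: mult.assoc[symmetric] flip: ennreal_mult')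
      also have "ennreal (s ^ DIM('a)) * (\<integral>\<^sup>+h. ennreal (g (z + (-s) *\<^sub>R h) powr p) \<partial>lborel) = (\<integral>\<^sup>+x. ennreal (g x powr p) \<partial>lborel)"
        using s by (subst nn_integral_affine_euclidean[of "\<lambda>x. ennreal (g x powr p)" "-s" z]) auto
      also have "ennreal (1 / s ^ DIM('a)) * \<dots> \<le> ennreal (1 / s ^ DIM('a)) * ennreal (P powr p)"
        by (intro mult_left_mono gp) auto
      finally show ?thesis using s by (simp flip: ennreal_mult')
    qed
    then have "ennreal \<mu> * ennreal ?k + ennreal (\<mu> powr (1 - p)) * (\<integral>\<^sup>+h. ennreal (g (z + (-s) *\<^sub>R h) powr p) \<partial>lborel)
       \<le> ennreal \<mu> * ennreal ?k + ennreal (\<mu> powr (1 - p)) * ennreal (P powr p / s ^ DIM('a))"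
      by (intro add_left_mono mult_left_mono) auto
    also have "\<dots> = ennreal ((?k + 1) * \<mu>)"
      using \<mu> \<mu>2 s by (simp add: algebra_simps flip: ennreal_plus ennreal_mult')
    finally show ?thesis .
  qed
  have "(\<integral>\<^sup>+x. \<integral>\<^sup>+h. ennreal (g x) * q (x + s *\<^sub>R h) * indicator (cball 0 1) h \<partial>lborel \<partial>lborel) =
      (\<integral>\<^sup>+h. \<integral>\<^sup>+x. ennreal (g x) * q (x + s *\<^sub>R h) * indicator (cball 0 1) h \<partial>lborel \<partial>lborel)"
    by (rule lborel_pair.Fubini') measurable
  also have "\<dots> = (\<integral>\<^sup>+h. \<integral>\<^sup>+x. ennreal (g (x + (-s) *\<^sub>R h)) * q x * indicator (cball 0 1) h \<partial>lborel \<partial>lborel)"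
  proof (rule nn_integral_cong)
    fix h :: 'a
    show "(\<integral>\<^sup>+x. ennreal (g x) * q (x + s *\<^sub>R h) * indicator (cball 0 1) h \<partial>lborel) =
       (\<integral>\<^sup>+x. ennreal (g (x + (-s) *\<^sub>R h)) * q x * indicator (cball 0 1) h \<partial>lborel)"
      using nn_integral_translate[of "\<lambda>x. ennreal (g (x + (-s) *\<^sub>R h)) * q x * indicator (cball 0 1) h" "s *\<^sub>R h"]
      by (simp add: algebra_simps)
  qed
  also have "\<dots> = (\<integral>\<^sup>+x. \<integral>\<^sup>+h. ennreal (g (x + (-s) *\<^sub>R h)) * q x * indicator (cball 0 1) h \<partial>lborel \<partial>lborel)"
    by (rule lborel_pair.Fubini') measurable
  also have "\<dots> = (\<integral>\<^sup>+x. (\<integral>\<^sup>+h. ennreal (g (x + (-s) *\<^sub>R h)) * indicator (cball 0 1) h \<partial>lborel) * q x \<partial>lborel)"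
    by (rule nn_integral_cong, subst nn_integral_multc[symmetric], measurable) (simp add: ac_simps)
  also have "\<dots> \<le> (\<integral>\<^sup>+x. ennreal ((?k + 1) * \<mu>) * q x \<partial>lborel)"
    by (intro nn_integral_mono mult_right_mono inner) auto
  also have "\<dots> = ennreal ((?k + 1) * \<mu>) * (\<integral>\<^sup>+x. q x \<partial>lborel)"
    by (simp add: nn_integral_cmult)
  finally show ?thesis by (simp add: \<mu>_def mult.assoc)
qed

lemma nn_integral_double_linear:
  fixes A B :: "'a::euclidean_space \<Rightarrow> 'b::euclidean_space \<Rightarrow> ennreal"
  assumes [measurable]: "case_prod A \<in> borel_measurable (borel \<Otimes>\<^sub>M borel)" "case_prod B \<in> borel_measurable (borel \<Otimes>\<^sub>M borel)"
  shows "(\<integral>\<^sup>+x. \<integral>\<^sup>+h. c * A x h + d * B x h \<partial>lborel \<partial>lborel) =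
    c * (\<integral>\<^sup>+x. \<integral>\<^sup>+h. A x h \<partial>lborel \<partial>lborel) + d * (\<integral>\<^sup>+x. \<integral>\<^sup>+h. B x h \<partial>lborel \<partial>lborel)"
proof -
  have "(\<lambda>h. A x h) \<in> borel_measurable borel" "(\<lambda>h. B x h) \<in> borel_measurable borel" for x
    by measurable
  then have "(\<integral>\<^sup>+h. c * A x h + d * B x h \<partial>lborel) = c * (\<integral>\<^sup>+h. A x h \<partial>lborel) + d * (\<integral>\<^sup>+h. B x h \<partial>lborel)" for x
    by (simp add: nn_integral_add nn_integral_cmult)
  then show ?thesis by (simp add: nn_integral_add nn_integral_cmult)
qed

text \<open>Write \<open>y x\<close> as \<open>y (x + R *\<^sub>R h)\<close> minus an integral of the gradient along the segment, apply
  Cauchy-Schwarz with the weight \<open>s powr \<theta>\<close>, and average over \<open>h\<close> in the unit ball.  The average of \<open>g\<close>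
  over a ball of radius \<open>s\<close> is at most of order \<open>P * s powr (- DIM('a) / p)\<close>, and the resulting
  integral in \<open>s\<close> converges since \<open>DIM('a) < 2 * p\<close>.\<close>

lemma weighted_L2_bound:
  fixes p :: real
  assumes p: "p \<ge> 1" "2 * p > DIM('a::euclidean_space)"
  obtains C where "C > 0"
    "\<And>(y::'a \<Rightarrow> real) G g R P. C1_grad y G \<Longrightarrow> g \<in> borel_measurable borel \<Longrightarrow> (\<And>x. g x \<ge> 0) \<Longrightarrow> R > 0 \<Longrightarrow> P > 0 \<Longrightarrow>
      (\<integral>\<^sup>+x. ennreal (g x powr p) \<partial>lborel) \<le> ennreal (P powr p) \<Longrightarrow>
      (\<integral>\<^sup>+x. ennreal (g x * (y x)\<^sup>2) \<partial>lborel) \<le>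
        ennreal (C * P * R powr (2 - DIM('a) / p)) * (\<integral>\<^sup>+x. ennreal ((norm (G x))\<^sup>2) \<partial>lborel) +
        ennreal (C * P * R powr (- (DIM('a) / p))) * (\<integral>\<^sup>+x. ennreal ((y x)\<^sup>2) \<partial>lborel)"
proof -
  let ?n = "real DIM('a)"
  let ?B = "cball 0 1 :: 'a set"
  define k where "k = measure lborel ?B"
  \<comment> \<open>Half of the exponent \<open>DIM('a) / p\<close> of the averages: their
    singularity \<open>s powr (- 2 * \<theta>)\<close> times the weight
    \<open>s powr \<theta>\<close> leaves \<open>s powr (- \<theta>)\<close>, integrable at
    0.\<close>
  define \<theta> where "\<theta> = ?n / (2 * p)"
  have th: "0 < \<theta>" "\<theta> < 1" using p by (auto simp: \<theta>_def)
  have th2: "?n / p = 2 * \<theta>" by (simp add: \<theta>_def)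
  have k: "k > 0" unfolding k_def using content_cball_pos[of 1 "0::'a"]
    by simp
  have fin: "emeasure lborel ?B = ennreal k"
    unfolding k_def using emeasure_lborel_cball_finite[of "0::'a" 1]
    by (intro emeasure_eq_ennreal_measure) (simp add: less_top[symmetric])
  \<comment> \<open>The summand 2 belongs to the endpoint \<open>y (x + R *\<^sub>R h)\<close>;
    \<open>2 / (1 - \<theta>)\<^sup>2\<close> to the two integrals of
    \<open>s powr (- \<theta>)\<close>, one from Cauchy-Schwarz and one from the averages. Dividing
    by \<open>k\<close> undoes the integration over the unit ball.\<close>
  define C where "C = (k + 1) / k * (2 + 2 / (1 - \<theta>)\<^sup>2)"
  have C: "C > 0" unfolding C_def using k th by (intro mult_pos_pos divide_pos_pos add_pos_nonneg) auto
  show ?thesis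
  proof (rule that[OF C])
    fix y :: "'a \<Rightarrow> real" and G and g :: "'a \<Rightarrow> real" and R P :: real
    assume C1: "C1_grad y G" and g[measurable]: "g \<in> borel_measurable borel" and g0: "\<And>x. g x \<ge> 0"
      and R: "R > 0" and P: "P > 0" and gp: "(\<integral>\<^sup>+x. ennreal (g x powr p) \<partial>lborel) \<le> ennreal (P powr p)"
    have [measurable]: "y \<in> borel_measurable borel" "G \<in> borel_measurable borel"
      using C1 unfolding C1_grad_def by (auto intro: borel_measurable_continuous_onI)
    let ?Y = "\<integral>\<^sup>+x. ennreal ((y x)\<^sup>2) \<partial>lborel"
    let ?G = "\<integral>\<^sup>+x. ennreal ((norm (G x))\<^sup>2) \<partial>lborel"
    let ?c = "2 * R powr (1 - \<theta>) / (1 - \<theta>)"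
    have c0: "?c \<ge> 0" using th by simp
    have "ennreal k * (\<integral>\<^sup>+x. ennreal (g x * (y x)\<^sup>2) \<partial>lborel) =
       (\<integral>\<^sup>+x. \<integral>\<^sup>+h. ennreal (g x * (y x)\<^sup>2) * indicator ?B h \<partial>lborel \<partial>lborel)"
    proof -
      have "(\<integral>\<^sup>+h. ennreal (g x * (y x)\<^sup>2) * indicator ?B h \<partial>lborel) = ennreal k * ennreal (g x * (y x)\<^sup>2)" for x
        by (subst nn_integral_cmult_indicator) (auto simp: fin mult.commute)
      then show ?thesis by (simp add: nn_integral_cmult)
    qed
    also have "\<dots> \<le> (\<integral>\<^sup>+x. \<integral>\<^sup>+h. 2 * (ennreal (g x) * ennreal ((y (x + R *\<^sub>R h))\<^sup>2) * indicator ?B h) +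
        ennreal ?c * (\<integral>\<^sup>+s. ennreal (g x) * ennreal ((norm (G (x + s *\<^sub>R h)))\<^sup>2) * indicator ?B h * (ennreal (s powr \<theta>) * indicator {0..R} s) \<partial>lborel) \<partial>lborel \<partial>lborel)"
    proof (intro nn_integral_mono)
      fix x h :: 'a
      show "ennreal (g x * (y x)\<^sup>2) * indicator ?B h \<le> 2 * (ennreal (g x) * ennreal ((y (x + R *\<^sub>R h))\<^sup>2) * indicator ?B h) +
        ennreal ?c * (\<integral>\<^sup>+s. ennreal (g x) * ennreal ((norm (G (x + s *\<^sub>R h)))\<^sup>2) * indicator ?B h * (ennreal (s powr \<theta>) * indicator {0..R} s) \<partial>lborel)"
      proof (cases "h \<in> ?B")
        case True
        then have "norm h \<le> 1" by simp
        note sq = square_le_line_integral[OF C1 R th this, of x]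
        have "ennreal (g x * (y x)\<^sup>2) \<le> ennreal (g x) * (2 * ennreal ((y (x + R *\<^sub>R h))\<^sup>2) +
          ennreal ?c * (\<integral>\<^sup>+s. ennreal (s powr \<theta>) * ennreal ((norm (G (x + s *\<^sub>R h)))\<^sup>2) * indicator {0..R} s \<partial>lborel))"
          unfolding ennreal_mult'[OF g0] by (intro mult_left_mono sq) auto
        also have "\<dots> = ennreal (g x) * (2 * ennreal ((y (x + R *\<^sub>R h))\<^sup>2)) +
          ennreal ?c * (ennreal (g x) * (\<integral>\<^sup>+s. ennreal (s powr \<theta>) * ennreal ((norm (G (x + s *\<^sub>R h)))\<^sup>2) * indicator {0..R} s \<partial>lborel))"
          by (simp add: distrib_left ac_simps)
        also have "ennreal (g x) * (\<integral>\<^sup>+s. ennreal (s powr \<theta>) * ennreal ((norm (G (x + s *\<^sub>R h)))\<^sup>2) * indicator {0..R} s \<partial>lborel) =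
          (\<integral>\<^sup>+s. ennreal (g x) * ennreal ((norm (G (x + s *\<^sub>R h)))\<^sup>2) * indicator ?B h * (ennreal (s powr \<theta>) * indicator {0..R} s) \<partial>lborel)"
          using True by (subst nn_integral_cmult[symmetric]) (auto simp: ac_simps)
        finally show ?thesis using True by (simp add: ac_simps)
      qed simp
    qed
    also have "\<dots> = 2 * (\<integral>\<^sup>+x. \<integral>\<^sup>+h. ennreal (g x) * ennreal ((y (x + R *\<^sub>R h))\<^sup>2) * indicator ?B h \<partial>lborel \<partial>lborel) +
        ennreal ?c * (\<integral>\<^sup>+x. \<integral>\<^sup>+h. \<integral>\<^sup>+s. ennreal (g x) * ennreal ((norm (G (x + s *\<^sub>R h)))\<^sup>2) * indicator ?B h * (ennreal (s powr \<theta>) * indicator {0..R} s) \<partial>lborel \<partial>lborel \<partial>lborel)"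
      by (rule nn_integral_double_linear) measurable
    also have "(\<integral>\<^sup>+x. \<integral>\<^sup>+h. \<integral>\<^sup>+s. ennreal (g x) * ennreal ((norm (G (x + s *\<^sub>R h)))\<^sup>2) * indicator ?B h * (ennreal (s powr \<theta>) * indicator {0..R} s) \<partial>lborel \<partial>lborel \<partial>lborel)
      = (\<integral>\<^sup>+x. \<integral>\<^sup>+s. \<integral>\<^sup>+h. ennreal (g x) * ennreal ((norm (G (x + s *\<^sub>R h)))\<^sup>2) * indicator ?B h * (ennreal (s powr \<theta>) * indicator {0..R} s) \<partial>lborel \<partial>lborel \<partial>lborel)"
      by (intro nn_integral_cong lborel_pair.Fubini') measurable
    also have "\<dots> = (\<integral>\<^sup>+s. \<integral>\<^sup>+x. \<integral>\<^sup>+h. ennreal (g x) * ennreal ((norm (G (x + s *\<^sub>R h)))\<^sup>2) * indicator ?B h * (ennreal (s powr \<theta>) * indicator {0..R} s) \<partial>lborel \<partial>lborel \<partial>lborel)"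
      by (rule lborel_pair.Fubini') measurable
    also have "\<dots> = (\<integral>\<^sup>+s. (\<integral>\<^sup>+x. \<integral>\<^sup>+h. ennreal (g x) * ennreal ((norm (G (x + s *\<^sub>R h)))\<^sup>2) * indicator ?B h \<partial>lborel \<partial>lborel) * (ennreal (s powr \<theta>) * indicator {0..R} s) \<partial>lborel)"
      by (simp add: nn_integral_multc)
    also have "\<dots> \<le> (\<integral>\<^sup>+s. ennreal ((k + 1) * P) * ?G * (ennreal (s powr (- \<theta>)) * indicator {0..R} s) \<partial>lborel)"
    proof (intro nn_integral_mono_AE, use AE_lborel_singleton[of "0::real"] in eventually_elim)
      fix s :: real assume s: "s \<noteq> 0"
      show "(\<integral>\<^sup>+x. \<integral>\<^sup>+h. ennreal (g x) * ennreal ((norm (G (x + s *\<^sub>R h)))\<^sup>2) * indicator ?B h \<partial>lborel \<partial>lborel) * (ennreal (s powr \<theta>) * indicator {0..R} s)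
         \<le> ennreal ((k + 1) * P) * ?G * (ennreal (s powr (- \<theta>)) * indicator {0..R} s)"
      proof (cases "s \<in> {0..R}")
        case True
        then have s: "s > 0" using s by auto
        have "(\<integral>\<^sup>+x. \<integral>\<^sup>+h. ennreal (g x) * ennreal ((norm (G (x + s *\<^sub>R h)))\<^sup>2) * indicator ?B h \<partial>lborel \<partial>lborel) \<le>
          ennreal ((k + 1) * P * s powr (- ?n / p)) * ?G"
          unfolding k_def by (rule nn_integral_average_le[OF g _ g0 s P p(1) gp]) measurable
        then have "(\<integral>\<^sup>+x. \<integral>\<^sup>+h. ennreal (g x) * ennreal ((norm (G (x + s *\<^sub>R h)))\<^sup>2) * indicator ?B h \<partial>lborel \<partial>lborel) * ennreal (s powr \<theta>)
           \<le> ennreal ((k + 1) * P * s powr (- ?n / p)) * ?G * ennreal (s powr \<theta>)"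
          by (intro mult_right_mono) auto
        also have "\<dots> = ennreal ((k + 1) * P) * ?G * ennreal (s powr (- ?n / p) * s powr \<theta>)"
          using k P by (simp add: ennreal_mult' ac_simps)
        also have "s powr (- ?n / p) * s powr \<theta> = s powr (-\<theta>)"
          using th2 by (simp add: powr_add[symmetric])
        finally show ?thesis using True by simp
      qed simp
    qed
    also have "\<dots> = ennreal ((k + 1) * P) * ?G * ennreal (R powr (1 - \<theta>) / (1 - \<theta>))"
      using nn_integral_powr_from_0[of "-\<theta>" R] th R by (simp add: nn_integral_cmult add.commute)
    also have "(\<integral>\<^sup>+x. \<integral>\<^sup>+h. ennreal (g x) * ennreal ((y (x + R *\<^sub>R h))\<^sup>2) * indicator ?B h \<partial>lborel \<partial>lborel)
      \<le> ennreal ((k + 1) * P * R powr (- ?n / p)) * ?Y"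
      unfolding k_def by (rule nn_integral_average_le[OF g _ g0 R P p(1) gp]) measurable
    finally have main: "ennreal k * (\<integral>\<^sup>+x. ennreal (g x * (y x)\<^sup>2) \<partial>lborel) \<le>
       2 * (ennreal ((k + 1) * P * R powr (- ?n / p)) * ?Y) +
       ennreal ?c * (ennreal ((k + 1) * P) * ?G * ennreal (R powr (1 - \<theta>) / (1 - \<theta>)))"
      by (simp add: add_left_mono add_right_mono mult_left_mono add_mono)
    have "(\<integral>\<^sup>+x. ennreal (g x * (y x)\<^sup>2) \<partial>lborel) = ennreal (1 / k) * (ennreal k * (\<integral>\<^sup>+x. ennreal (g x * (y x)\<^sup>2) \<partial>lborel))"
      using k by (simp add: mult.assoc[symmetric] flip: ennreal_mult')
    also have "\<dots> \<le> ennreal (1 / k) * (2 * (ennreal ((k + 1) * P * R powr (- ?n / p)) * ?Y) +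
       ennreal ?c * (ennreal ((k + 1) * P) * ?G * ennreal (R powr (1 - \<theta>) / (1 - \<theta>))))"
      by (intro mult_left_mono main) auto
    also have "\<dots> = ennreal (1 / k * 2 * ((k + 1) * P * R powr (- ?n / p))) * ?Y +
       ennreal (1 / k * ?c * ((k + 1) * P) * (R powr (1 - \<theta>) / (1 - \<theta>))) * ?G"
    proof -
      have e1: "ennreal u * (2 * (ennreal v * Y)) = ennreal (u * 2 * v) * Y" if "u \<ge> 0" "v \<ge> 0" for u v Y
        using that by (simp add: ennreal_mult mult.assoc mult.left_commute)
      have e2: "ennreal u * (ennreal v * (ennreal w * Y * ennreal r)) = ennreal (u * v * w * r) * Y"
        if "u \<ge> 0" "v \<ge> 0" "w \<ge> 0" "r \<ge> 0" for u v w r Y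
        using that by (simp add: ennreal_mult mult.assoc mult.left_commute mult.commute)
      show ?thesis
        unfolding distrib_left by (subst e1, use k P in simp, use k P in simp, subst e2) (use k P c0 th in auto)
    qed
    also have "1 / k * 2 * ((k + 1) * P * R powr (- ?n / p)) \<le> C * P * R powr (- (?n / p))"
      using k P th by (simp add: C_def field_simps)
    also have "1 / k * ?c * ((k + 1) * P) * (R powr (1 - \<theta>) / (1 - \<theta>)) \<le> C * P * R powr (2 - ?n / p)"
    proof -
      have alg: "1 / k * (2 * r / t) * (n * P) * (r / t) = n / k * (2 / t\<^sup>2) * P * (r * r)" for r t n :: real
        by (simp add: power2_eq_square mult_ac)
      have "R powr (1 - \<theta>) * R powr (1 - \<theta>) = R powr (2 - ?n / p)"
        unfolding powr_add[symmetric] th2 by simp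
      have "1 / k * ?c * ((k + 1) * P) * (R powr (1 - \<theta>) / (1 - \<theta>)) = (k + 1) / k * (2 / (1 - \<theta>)\<^sup>2) * P * R powr (2 - ?n / p)"
        unfolding \<open>R powr (1 - \<theta>) * R powr (1 - \<theta>) = R powr (2 - ?n / p)\<close>[symmetric]
        by (rule alg)
      also have "\<dots> \<le> C * P * R powr (2 - ?n / p)"
        unfolding C_def using k P th by (intro mult_right_mono mult_left_mono) auto
      finally show ?thesis .
    qed
    finally show "(\<integral>\<^sup>+x. ennreal (g x * (y x)\<^sup>2) \<partial>lborel) \<le>
        ennreal (C * P * R powr (2 - ?n / p)) * ?G + ennreal (C * P * R powr (- (?n / p))) * ?Y"
      by (simp add: add.commute ennreal_leI mult_right_mono add_mono)
  qed
qed

text \<open>Optimising \<open>R\<close> absorbs the gradient.\<close>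

lemma weighted_L2_absorb:
  fixes p :: real
  assumes p: "p \<ge> 1" "2 * p > DIM('a::euclidean_space)"
  defines "a \<equiv> 1 / (1 - DIM('a) / (2 * p))"
  obtains K where "K > 0"
    "\<And>(y::'a \<Rightarrow> real) G g P. C1_grad y G \<Longrightarrow> g \<in> borel_measurable borel \<Longrightarrow> (\<And>x. g x \<ge> 0) \<Longrightarrow> P \<ge> 0 \<Longrightarrow>
      (\<integral>\<^sup>+x. ennreal (g x powr p) \<partial>lborel) \<le> ennreal (P powr p) \<Longrightarrow>
      (\<integral>\<^sup>+x. ennreal (g x * (y x)\<^sup>2) \<partial>lborel) \<le>
        ennreal (1/4) * (\<integral>\<^sup>+x. ennreal ((norm (G x))\<^sup>2) \<partial>lborel) +
        ennreal (K * P powr a) * (\<integral>\<^sup>+x. ennreal ((y x)\<^sup>2) \<partial>lborel)"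
proof -
  obtain C where C: "C > 0"
    "\<And>(y::'a \<Rightarrow> real) G g R P. C1_grad y G \<Longrightarrow> g \<in> borel_measurable borel \<Longrightarrow> (\<And>x. g x \<ge> 0) \<Longrightarrow> R > 0 \<Longrightarrow> P > 0 \<Longrightarrow>
      (\<integral>\<^sup>+x. ennreal (g x powr p) \<partial>lborel) \<le> ennreal (P powr p) \<Longrightarrow>
      (\<integral>\<^sup>+x. ennreal (g x * (y x)\<^sup>2) \<partial>lborel) \<le>
        ennreal (C * P * R powr (2 - DIM('a) / p)) * (\<integral>\<^sup>+x. ennreal ((norm (G x))\<^sup>2) \<partial>lborel) +
        ennreal (C * P * R powr (- (DIM('a) / p))) * (\<integral>\<^sup>+x. ennreal ((y x)\<^sup>2) \<partial>lborel)"
    using weighted_L2_bound[OF p] by blast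
  have a: "a > 0" using p by (simp add: a_def)
  have a2: "2 - DIM('a) / p = 2 / a" using p by (simp add: a_def)
  define K where "K = (1/4) * (4 * C) powr a"
  have K: "K > 0" using C(1) by (simp add: K_def)
  show ?thesis
  proof (rule that[OF K])
    fix y :: "'a \<Rightarrow> real" and G and g :: "'a \<Rightarrow> real" and P :: real
    assume C1: "C1_grad y G" and g[measurable]: "g \<in> borel_measurable borel" and g0: "\<And>x. g x \<ge> 0"
      and P: "P \<ge> 0" and gp: "(\<integral>\<^sup>+x. ennreal (g x powr p) \<partial>lborel) \<le> ennreal (P powr p)"
    show "(\<integral>\<^sup>+x. ennreal (g x * (y x)\<^sup>2) \<partial>lborel) \<le>
        ennreal (1/4) * (\<integral>\<^sup>+x. ennreal ((norm (G x))\<^sup>2) \<partial>lborel) +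
        ennreal (K * P powr a) * (\<integral>\<^sup>+x. ennreal ((y x)\<^sup>2) \<partial>lborel)"
    \<comment> \<open>For \<open>P = 0\<close> the radius chosen in the other case would be 0; here
      \<open>g\<close> vanishes almost everywhere.\<close>
    proof (cases "P = 0")
      case True
      then have "(\<integral>\<^sup>+x. ennreal (g x powr p) \<partial>lborel) = 0" using gp by simp
      then have "AE x in lborel. ennreal (g x powr p) = 0" by (subst (asm) nn_integral_0_iff_AE) auto
      then have "AE x in lborel. ennreal (g x * (y x)\<^sup>2) = 0"
        by eventually_elim (simp add: ennreal_eq_0_iff powr_eq_0_iff le_less)
      then have "(\<integral>\<^sup>+x. ennreal (g x * (y x)\<^sup>2) \<partial>lborel) = 0"
        by (subst nn_integral_cong_AE[of _ "\<lambda>_. 0"]) auto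
      then show ?thesis by simp
    next
      case False
      then have P: "P > 0" using P by simp
      \<comment> \<open>The radius at which the gradient coefficient
        \<open>C * P * R powr (2 / a)\<close> equals 1/4.\<close>
      define R where "R = (4 * C * P) powr (- a / 2)"
      have R: "R > 0" using C(1) P by (simp add: R_def)
      have 1: "C * P * R powr (2 - DIM('a) / p) = 1 / 4"
        unfolding a2 R_def powr_powr using C(1) P a by (simp add: powr_minus field_simps)
      have "R powr (- (DIM('a) / p)) = R powr (2 - DIM('a) / p) * R powr (- 2)"
        by (simp add: powr_add[symmetric])
      then have "C * P * R powr (- (DIM('a) / p)) = (1 / 4) * R powr (-2)"
        using 1 by (simp add: mult.assoc)
      also have "R powr (-2) = (4 * C * P) powr a"
        unfolding R_def powr_powr by simp
      finally have 2: "C * P * R powr (- (DIM('a) / p)) = K * P powr a"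
        using C(1) P by (simp add: K_def powr_mult)
      show ?thesis using C(2)[OF C1 g g0 R P gp] unfolding 1 2 .
    qed
  qed
qed

section \<open>The energy inequality for smooth functions\<close>

lemma integrable_continuous_compact_support:
  fixes P :: "'a::euclidean_space \<Rightarrow> real"
  assumes "continuous_on UNIV P" "compact K" "\<And>x. x \<notin> K \<Longrightarrow> P x = 0"
  shows "integrable lborel P"
proof -
  have "integrable lborel (\<lambda>x. indicator K x *\<^sub>R P x)"
    by (rule borel_integrable_compact) (auto intro: assms(2) continuous_on_subset[OF assms(1)])
  moreover have "(\<lambda>x. indicator K x *\<^sub>R P x) = P"
    using assms(3) by (auto simp: indicator_def fun_eq_iff)
  ultimately show ?thesis by simp
qed

lemma integral_translate:
  fixes f :: "'a::euclidean_space \<Rightarrow> real"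
  assumes [measurable]: "f \<in> borel_measurable borel"
  shows "(LINT x|lborel. f (x + t)) = (LINT x|lborel. f x)"
proof -
  have "(LINT x|lborel. f x) = (LINT x|distr lborel borel ((+) t). f x)"
    by (simp add: lborel_distr_plus)
  also have "\<dots> = (LINT x|lborel. f (t + x))"
    by (rule integral_distr) measurable
  finally show ?thesis by (simp add: add.commute)
qed

text \<open>Integrate \<open>P (x + e) - P x\<close>, the integral of \<open>Q (x + r *\<^sub>R e)\<close> over \<open>r \<in> {0..1}\<close>, and use
  translation invariance.\<close>

lemma integral_directional_derivative_eq_0:
  fixes P Q :: "'a::euclidean_space \<Rightarrow> real"
  assumes cP: "continuous_on UNIV P" and cQ: "continuous_on UNIV Q"
    and K: "compact K" "\<And>x. x \<notin> K \<Longrightarrow> P x = 0" "\<And>x. x \<notin> K \<Longrightarrow> Q x = 0"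
    and der: "\<And>x. ((\<lambda>r. P (x + r *\<^sub>R e)) has_real_derivative Q x) (at 0)"
  shows "(LINT x|lborel. Q x) = 0"
proof -
  have [measurable]: "P \<in> borel_measurable borel" "Q \<in> borel_measurable borel"
    using cP cQ by (auto intro: borel_measurable_continuous_onI)
  have iP: "integrable lborel P" and iQ: "integrable lborel Q"
    using integrable_continuous_compact_support[OF cP K(1,2)] integrable_continuous_compact_support[OF cQ K(1,3)] by auto
  have der': "((\<lambda>r. P (x + r *\<^sub>R e)) has_vector_derivative Q (x + r *\<^sub>R e)) (at r within {0..1})" for x r
  proof -
    have "((\<lambda>r'. P (x + (r' + r) *\<^sub>R e)) has_real_derivative Q (x + r *\<^sub>R e)) (at 0)"
      using der[of "x + r *\<^sub>R e"] by (simp add: algebra_simps)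
    then have "((\<lambda>r. P (x + r *\<^sub>R e)) has_real_derivative Q (x + r *\<^sub>R e)) (at r)"
      using DERIV_shift[of "\<lambda>r. P (x + r *\<^sub>R e)" "Q (x + r *\<^sub>R e)" 0 r] by simp
    then show ?thesis
      by (simp add: has_real_derivative_iff_has_vector_derivative has_vector_derivative_at_within)
  qed
  have cl: "continuous_on {0..1} (\<lambda>r. Q (x + r *\<^sub>R e))" for x
    by (rule continuous_on_compose2[OF cQ]) (auto intro!: continuous_intros)
  have FTC: "(LINT r|lborel. indicator {0..1} r *\<^sub>R Q (x + r *\<^sub>R e)) = P (x + e) - P x" for x
    using integral_FTC_atLeastAtMost[of 0 1, OF _ der' cl] by simp
  \<comment> \<open>The points from which the segment in direction \<open>e\<close> can meet
    \<open>K\<close>. Its compactness gives the joint integrability in \<open>(x, r)\<close> that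
    Fubini requires.\<close>
  let ?K2 = "(\<lambda>(k, r). k - r *\<^sub>R e) ` (K \<times> {0..1::real})"
  have K2: "compact ?K2"
    by (intro compact_continuous_image compact_Times K(1)) (auto simp: case_prod_beta intro!: continuous_intros)
  have int2: "integrable (lborel \<Otimes>\<^sub>M lborel) (\<lambda>(x, r). indicator {0..1::real} r *\<^sub>R Q (x + r *\<^sub>R e))"
  proof -
    have "integrable lborel (\<lambda>z. indicator (?K2 \<times> {0..1::real}) z *\<^sub>R Q (fst z + snd z *\<^sub>R e))"
      by (intro borel_integrable_compact compact_Times K2 compact_Icc continuous_on_compose2[OF cQ])
         (auto intro!: continuous_intros)
    moreover have "(\<lambda>z. indicator (?K2 \<times> {0..1::real}) z *\<^sub>R Q (fst z + snd z *\<^sub>R e)) =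
       (\<lambda>(x, r). indicator {0..1::real} r *\<^sub>R Q (x + r *\<^sub>R e))"
    proof (rule ext)
      fix z :: "'a \<times> real"
      obtain x r where z: "z = (x, r)" by (cases z)
      show "indicator (?K2 \<times> {0..1::real}) z *\<^sub>R Q (fst z + snd z *\<^sub>R e) = (case z of (x, r) \<Rightarrow> indicator {0..1} r *\<^sub>R Q (x + r *\<^sub>R e))"
      proof (cases "Q (x + r *\<^sub>R e) = 0")
        case False
        then have "x + r *\<^sub>R e \<in> K" using K(3) by blast
        moreover have "x = (x + r *\<^sub>R e) - r *\<^sub>R e" by simp
        ultimately have "x \<in> ?K2" if "r \<in> {0..1}"
          using that by (metis (mono_tags, lifting) SigmaI case_prod_conv image_eqI)
        then show ?thesis by (auto simp: indicator_def z)
      qed (simp add: z)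
    qed
    ultimately show ?thesis by (simp add: lborel_prod)
  qed
  have "0 = (LINT x|lborel. P (x + e)) - (LINT x|lborel. P x)"
    by (simp add: integral_translate)
  also have "\<dots> = (LINT x|lborel. P (x + e) - P x)"
  proof (rule Bochner_Integration.integral_diff[symmetric])
    have "integrable (distr lborel borel ((+) e)) P" using iP by (simp add: lborel_distr_plus)
    then show "integrable lborel (\<lambda>x. P (x + e))"
      by (subst (asm) integrable_distr_eq) (auto simp: add.commute)
  qed (rule iP)
  also have "\<dots> = (LINT x|lborel. LINT r|lborel. indicator {0..1} r *\<^sub>R Q (x + r *\<^sub>R e))"
    unfolding FTC ..
  also have "\<dots> = (LINT r|lborel. LINT x|lborel. indicator {0..1} r *\<^sub>R Q (x + r *\<^sub>R e))"
    using lborel_pair.Fubini_integral[OF int2] by simp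
  also have "\<dots> = (LINT r|lborel. indicator {0..1::real} r *\<^sub>R (LINT x|lborel. Q x))"
    by (simp add: integral_translate)
  also have "\<dots> = (LINT x|lborel. Q x)"
    by simp
  finally show ?thesis by simp
qed

text \<open>Classical regularity of a mollified solution, with \<open>wt\<close>, \<open>W\<close>
  and \<open>H i\<close> as time derivative, spatial gradient and pure second derivatives; mixed
  second derivatives do not occur in the operator.\<close>

definition smooth_fun :: "(real \<times> (real^'d) \<Rightarrow> real) \<Rightarrow> (real \<times> (real^'d) \<Rightarrow> real) \<Rightarrow>
    (real \<times> (real^'d) \<Rightarrow> real^'d) \<Rightarrow> ('d \<Rightarrow> real \<times> (real^'d) \<Rightarrow> real) \<Rightarrow> bool" where
  "smooth_fun w wt W H \<longleftrightarrow>
     continuous_on UNIV w \<and> continuous_on UNIV wt \<and> continuous_on UNIV W \<and> (\<forall>i. continuous_on UNIV (H i)) \<and>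
     (\<forall>t x. ((\<lambda>r. w (r, x)) has_real_derivative wt (t, x)) (at t)) \<and>
     (\<forall>t x h. ((\<lambda>r. w (t, x + r *\<^sub>R h)) has_real_derivative W (t, x) \<bullet> h) (at 0)) \<and>
     (\<forall>t x i. ((\<lambda>r. W (t, x + r *\<^sub>R axis i 1) $ i) has_real_derivative H i (t, x)) (at 0))"


text \<open>Here \<open>E = exp (m * w)\<close>, \<open>c\<close> is the cutoff and \<open>Z\<close>
  its gradient. With \<open>L\<close> the time derivative plus the Laplacian of \<open>w\<close>,
  the first three terms on the right are the time derivative of \<open>E * c\<^sup>2\<close> plus
  the divergence of \<open>m * E * c\<^sup>2 * W\<close>. With
  \<open>V = (m/2 * c) *\<^sub>R W\<close> the drift term
  \<open>m * c\<^sup>2 * \<bar>B \<bullet> W\<bar>\<close> equals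
  \<open>2 * \<bar>c\<bar> * \<bar>B \<bullet> V\<bar>\<close>, so Cauchy-Schwarz bounds it by
  \<open>(norm V)\<^sup>2 + c\<^sup>2 * (norm B)\<^sup>2\<close> without any
  \<open>m\<close>.\<close>

lemma energy_pointwise:
  fixes W Z B :: "'a::real_inner" and E c m L f :: real
  assumes "E \<ge> 0" "m > 0"
  shows "E * (norm ((m/2 * c) *\<^sub>R W + Z))\<^sup>2 \<le>
    m * E * c\<^sup>2 * L + m\<^sup>2 * E * c\<^sup>2 * (norm W)\<^sup>2 + 2 * m * E * c * (Z \<bullet> W) +
    (6 * (E * (norm Z)\<^sup>2) + (norm B)\<^sup>2 * (E * c\<^sup>2) + m * (\<bar>f\<bar> * (E * c\<^sup>2)) + m * (\<bar>L + B \<bullet> W + f\<bar> * (E * c\<^sup>2)))"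
proof -
  define V where "V = (m/2 * c) *\<^sub>R W"
  have cB: "2 * (\<bar>c\<bar> * \<bar>B \<bullet> V\<bar>) \<le> (norm V)\<^sup>2 + c\<^sup>2 * (norm B)\<^sup>2"
  proof -
    have "2 * (\<bar>c\<bar> * \<bar>B \<bullet> V\<bar>) \<le> 2 * (\<bar>c\<bar> * (norm B * norm V))"
      by (intro mult_left_mono Cauchy_Schwarz_ineq2) auto
    also have "\<dots> \<le> (norm V)\<^sup>2 + (\<bar>c\<bar> * norm B)\<^sup>2"
      using sum_squares_bound[of "norm V" "\<bar>c\<bar> * norm B"] by (simp add: mult_ac)
    finally show ?thesis by (simp add: power_mult_distrib)
  qed
  have BV: "2 * (\<bar>c\<bar> * \<bar>B \<bullet> V\<bar>) = m * c\<^sup>2 * \<bar>B \<bullet> W\<bar>"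
    using assms(2) by (simp add: V_def abs_mult power2_eq_square)
  have L: "- L \<le> \<bar>B \<bullet> W\<bar> + \<bar>f\<bar> + \<bar>L + B \<bullet> W + f\<bar>" by linarith
  have "m * c\<^sup>2 * (- L) \<le> m * c\<^sup>2 * (\<bar>B \<bullet> W\<bar> + \<bar>f\<bar> + \<bar>L + B \<bullet> W + f\<bar>)"
    using assms(2) by (intro mult_left_mono L) auto
  then have 1: "0 \<le> m * c\<^sup>2 * L + (norm V)\<^sup>2 + c\<^sup>2 * (norm B)\<^sup>2 + m * c\<^sup>2 * \<bar>f\<bar> + m * c\<^sup>2 * \<bar>L + B \<bullet> W + f\<bar>"
    using cB unfolding BV by (simp add: algebra_simps)
  have V2: "m\<^sup>2 * c\<^sup>2 * (norm W)\<^sup>2 = 4 * (norm V)\<^sup>2"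
    using assms(2) by (simp add: V_def power_mult_distrib power_divide)
  have ZV: "2 * m * c * (Z \<bullet> W) = 4 * (V \<bullet> Z)"
    by (simp add: V_def inner_commute)
  have nVZ: "(norm (V + Z))\<^sup>2 = (norm V)\<^sup>2 + 2 * (V \<bullet> Z) + (norm Z)\<^sup>2"
    by (simp add: power2_norm_eq_inner inner_simps inner_commute)
  \<comment> \<open>After one \<open>(norm V)\<^sup>2\<close> has gone to the drift, this sum is
    exactly the surplus of the right side over the left; the constant 6 makes it a sum of
    squares.\<close>
  have "0 \<le> (norm (V + Z))\<^sup>2 + (norm V)\<^sup>2 + 4 * (norm Z)\<^sup>2" by simp
  then have "(norm (V + Z))\<^sup>2 \<le> m * c\<^sup>2 * L + 4 * (norm V)\<^sup>2 + 4 * (V \<bullet> Z) +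
     (6 * (norm Z)\<^sup>2 + c\<^sup>2 * (norm B)\<^sup>2 + m * c\<^sup>2 * \<bar>f\<bar> + m * c\<^sup>2 * \<bar>L + B \<bullet> W + f\<bar>)"
    using 1 unfolding nVZ by linarith
  from mult_left_mono[OF this assms(1)] show ?thesis
    unfolding V2[symmetric] ZV[symmetric] unfolding V_def by (simp add: algebra_simps)
qed

context
  fixes w wt :: "real \<times> (real^'d) \<Rightarrow> real" and W H and \<zeta> :: "real^'d \<Rightarrow> real" and Z K and m :: real
  assumes sm: "smooth_fun w wt W H" and Z: "C1_grad \<zeta> Z" and K: "compact K"
    and supp: "\<And>x. x \<notin> K \<Longrightarrow> \<zeta> x = 0" "\<And>x. x \<notin> K \<Longrightarrow> Z x = 0" and m: "m > 0"
begin

lemma cont_w [continuous_intros]: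
  assumes "continuous_on A f"
  shows "continuous_on A (\<lambda>x. w (f x))" "continuous_on A (\<lambda>x. wt (f x))"
    "continuous_on A (\<lambda>x. W (f x))" "continuous_on A (\<lambda>x. H i (f x))"
  using sm assms unfolding smooth_fun_def by (blast intro: continuous_on_compose2[OF _ _ subset_UNIV])+

lemma cont_zeta [continuous_intros]:
  assumes "continuous_on A f"
  shows "continuous_on A (\<lambda>x. \<zeta> (f x))" "continuous_on A (\<lambda>x. Z (f x))"
  using Z assms unfolding C1_grad_def by (blast intro: continuous_on_compose2[OF _ _ subset_UNIV])+

text \<open>The square of this function is the test function \<open>exp (m * w)\<close> times the
  squared cutoff, so the form bounds are applied to it.\<close>

lemma C1_grad_test:
  "C1_grad (\<lambda>x. exp (m/2 * w (\<tau>, x)) * \<zeta> x) (\<lambda>x. exp (m/2 * w (\<tau>, x)) *\<^sub>R ((m/2 * \<zeta> x) *\<^sub>R W (\<tau>, x) + Z x))"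
  unfolding C1_grad_def
proof (intro conjI allI)
  fix x h
  have 1: "((\<lambda>r. w (\<tau>, x + r *\<^sub>R h)) has_real_derivative W (\<tau>, x) \<bullet> h) (at 0)"
    using sm unfolding smooth_fun_def by blast
  have 2: "((\<lambda>r. \<zeta> (x + r *\<^sub>R h)) has_real_derivative Z x \<bullet> h) (at 0)"
    using Z unfolding C1_grad_def by blast
  show "((\<lambda>r. exp (m/2 * w (\<tau>, x + r *\<^sub>R h)) * \<zeta> (x + r *\<^sub>R h)) has_real_derivative
     exp (m/2 * w (\<tau>, x)) *\<^sub>R ((m/2 * \<zeta> x) *\<^sub>R W (\<tau>, x) + Z x) \<bullet> h) (at 0)"
    by (rule derivative_eq_intros 1 2 refl)+ (simp add: inner_simps algebra_simps)
qed (auto intro!: continuous_intros)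

text \<open>The integrand is the divergence of the compactly supported field
  \<open>m * exp (m * w) * \<zeta>\<^sup>2 * W\<close>, written out by the product rule.\<close>

lemma integral_divergence_eq_0:
  "(LINT x|lborel. m\<^sup>2 * exp (m * w (\<tau>, x)) * (\<zeta> x)\<^sup>2 * (norm (W (\<tau>, x)))\<^sup>2 +
     2 * m * exp (m * w (\<tau>, x)) * \<zeta> x * (Z x \<bullet> W (\<tau>, x)) +
     m * exp (m * w (\<tau>, x)) * (\<zeta> x)\<^sup>2 * (\<Sum>i\<in>UNIV. H i (\<tau>, x))) = 0" (is "(LINT x|lborel. ?D x) = 0")
proof -
  define P where "P i x = m * exp (m * w (\<tau>, x)) * (\<zeta> x)\<^sup>2 * W (\<tau>, x) $ i" for i x
  define Q where "Q i x = m * (m * W (\<tau>, x) $ i * exp (m * w (\<tau>, x)) * (\<zeta> x)\<^sup>2 * W (\<tau>, x) $ i +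
     exp (m * w (\<tau>, x)) * (2 * \<zeta> x * Z x $ i) * W (\<tau>, x) $ i +
     exp (m * w (\<tau>, x)) * (\<zeta> x)\<^sup>2 * H i (\<tau>, x))" for i x
  have cP: "continuous_on UNIV (P i)" and cQ: "continuous_on UNIV (Q i)" for i
    unfolding P_def Q_def by (intro continuous_intros)+
  have iQ: "integrable lborel (Q i)" for i
    by (rule integrable_continuous_compact_support[OF cQ K]) (simp add: Q_def supp)
  have "(LINT x|lborel. Q i x) = 0" for i
  proof (rule integral_directional_derivative_eq_0[OF cP cQ K])
    fix x
    have 1: "((\<lambda>r. w (\<tau>, x + r *\<^sub>R axis i 1)) has_real_derivative W (\<tau>, x) \<bullet> axis i 1) (at 0)"
      "((\<lambda>r. W (\<tau>, x + r *\<^sub>R axis i 1) $ i) has_real_derivative H i (\<tau>, x)) (at 0)"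
      using sm unfolding smooth_fun_def by blast+
    have 2: "((\<lambda>r. \<zeta> (x + r *\<^sub>R axis i 1)) has_real_derivative Z x \<bullet> axis i 1) (at 0)"
      using Z unfolding C1_grad_def by blast
    show "((\<lambda>r. P i (x + r *\<^sub>R axis i 1)) has_real_derivative Q i x) (at 0)"
      unfolding P_def Q_def by (rule derivative_eq_intros 1 2 refl)+ (simp add: inner_axis algebra_simps power2_eq_square)
  qed (auto simp: P_def Q_def supp)
  then have "(LINT x|lborel. (\<Sum>i\<in>UNIV. Q i x)) = 0"
    by (simp add: Bochner_Integration.integral_sum[OF iQ])
  moreover have nW: "(norm v)\<^sup>2 = (\<Sum>i\<in>UNIV. v $ i * v $ i)" for v :: "real^'d"
    by (simp add: power2_norm_eq_inner inner_vec_def)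
  have "(\<Sum>i\<in>UNIV. Q i x) = ?D x" for x
    unfolding Q_def nW by (simp add: inner_vec_def sum_distrib_left sum.distrib power2_eq_square algebra_simps)
  with calculation show ?thesis by simp
qed

text \<open>Integrates \<open>energy_pointwise\<close>: the time derivative gives the two boundary
  terms and the divergence gives 0. Finiteness of the gradient integral is recorded because half of
  it is later cancelled from both sides of an inequality in [0, \<infinity>].\<close>

lemma energy_smooth:
  fixes b :: "real \<times> (real^'d) \<Rightarrow> real^'d" and f
  assumes [measurable]: "b \<in> borel_measurable borel" "f \<in> borel_measurable borel" and st: "s \<le> t"
  defines "E \<equiv> \<lambda>\<tau> x. exp (m * w (\<tau>, x))"
  shows "(\<integral>\<^sup>+\<tau>. (\<integral>\<^sup>+x. ennreal ((norm (exp (m/2 * w (\<tau>, x)) *\<^sub>R ((m/2 * \<zeta> x) *\<^sub>R W (\<tau>, x) + Z x)))\<^sup>2) \<partial>lborel) * indicator {s..t} \<tau> \<partial>lborel) < \<infinity> \<and>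
   (\<integral>\<^sup>+x. ennreal (E s x * (\<zeta> x)\<^sup>2) \<partial>lborel) +
     (\<integral>\<^sup>+\<tau>. (\<integral>\<^sup>+x. ennreal ((norm (exp (m/2 * w (\<tau>, x)) *\<^sub>R ((m/2 * \<zeta> x) *\<^sub>R W (\<tau>, x) + Z x)))\<^sup>2) \<partial>lborel) * indicator {s..t} \<tau> \<partial>lborel)
   \<le> (\<integral>\<^sup>+x. ennreal (E t x * (\<zeta> x)\<^sup>2) \<partial>lborel) +
     (\<integral>\<^sup>+\<tau>. (\<integral>\<^sup>+x. ennreal (6 * (E \<tau> x * (norm (Z x))\<^sup>2) + (norm (b (\<tau>, x)))\<^sup>2 * (E \<tau> x * (\<zeta> x)\<^sup>2) + m * (\<bar>f (\<tau>, x)\<bar> * (E \<tau> x * (\<zeta> x)\<^sup>2)) +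
        m * (\<bar>(wt (\<tau>, x) + (\<Sum>i\<in>UNIV. H i (\<tau>, x))) + b (\<tau>, x) \<bullet> W (\<tau>, x) + f (\<tau>, x)\<bar> * (E \<tau> x * (\<zeta> x)\<^sup>2))) \<partial>lborel) * indicator {s..t} \<tau> \<partial>lborel)"
  (is "_ \<and> ?Fs + ?DD \<le> ?Ft + ?RR")
proof -
  have [measurable]: "w \<in> borel_measurable borel" "wt \<in> borel_measurable borel" "W \<in> borel_measurable borel" "H i \<in> borel_measurable borel" for i
    using sm unfolding smooth_fun_def by (auto intro: borel_measurable_continuous_onI)
  have [measurable]: "\<zeta> \<in> borel_measurable borel" "Z \<in> borel_measurable borel"
    using Z unfolding C1_grad_def by (auto intro: borel_measurable_continuous_onI)
  \<comment> \<open>\<open>J\<close> is the time derivative of \<open>exp (m * w)\<close> times the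
    squared cutoff, \<open>D\<close> the divergence, \<open>Y\<close> the squared gradient of the
    test function, and \<open>R\<close> collects the remaining terms of
    \<open>energy_pointwise\<close>.\<close>
  define J where "J = (\<lambda>z. m * exp (m * w z) * (\<zeta> (snd z))\<^sup>2 * wt z)"
  define D where "D = (\<lambda>z. m\<^sup>2 * exp (m * w z) * (\<zeta> (snd z))\<^sup>2 * (norm (W z))\<^sup>2 +
     2 * m * exp (m * w z) * \<zeta> (snd z) * (Z (snd z) \<bullet> W z) +
     m * exp (m * w z) * (\<zeta> (snd z))\<^sup>2 * (\<Sum>i\<in>UNIV. H i z))"
  define Y where "Y = (\<lambda>z. exp (m * w z) * (norm ((m/2 * \<zeta> (snd z)) *\<^sub>R W z + Z (snd z)))\<^sup>2)"
  define R where "R = (\<lambda>z. 6 * (exp (m * w z) * (norm (Z (snd z)))\<^sup>2) + (norm (b z))\<^sup>2 * (exp (m * w z) * (\<zeta> (snd z))\<^sup>2) + m * (\<bar>f z\<bar> * (exp (m * w z) * (\<zeta> (snd z))\<^sup>2)) +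
        m * (\<bar>(wt z + (\<Sum>i\<in>UNIV. H i z)) + b z \<bullet> W z + f z\<bar> * (exp (m * w z) * (\<zeta> (snd z))\<^sup>2)))"
  define I where "I = (\<lambda>z::real \<times> (real^'d). indicator {s..t} (fst z) :: real)"
  have [measurable]: "I \<in> borel_measurable borel" unfolding I_def borel_prod[symmetric] by measurable
  have int: "integrable lborel (\<lambda>z. I z * X z)" if "continuous_on UNIV X" "\<And>z. snd z \<notin> K \<Longrightarrow> X z = 0" for X
  proof -
    have "integrable lborel (\<lambda>z. indicator ({s..t} \<times> K) z *\<^sub>R X z)"
      by (intro borel_integrable_compact compact_Times K compact_Icc continuous_on_subset[OF that(1)]) auto
    moreover have "(\<lambda>z. indicator ({s..t} \<times> K) z *\<^sub>R X z) = (\<lambda>z. I z * X z)"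
      using that(2) by (auto simp: fun_eq_iff I_def indicator_def)
    ultimately show ?thesis by simp
  qed
  have iJ: "integrable lborel (\<lambda>z. I z * J z)" and iD: "integrable lborel (\<lambda>z. I z * D z)" and iY: "integrable lborel (\<lambda>z. I z * Y z)"
    by (rule int; auto simp: J_def D_def Y_def supp intro!: continuous_intros)+
  have iF: "integrable lborel (\<lambda>x. exp (m * w (\<tau>, x)) * (\<zeta> x)\<^sup>2)" for \<tau>
    by (rule integrable_continuous_compact_support[OF _ K]) (auto simp: supp intro!: continuous_intros)
  have intJ: "(LINT z|lborel. I z * J z) = (LINT x|lborel. exp (m * w (t, x)) * (\<zeta> x)\<^sup>2) - (LINT x|lborel. exp (m * w (s, x)) * (\<zeta> x)\<^sup>2)"
  proof -
    have "(LINT z|lborel. I z * J z) = (LINT x|lborel. LINT \<tau>|lborel. I (\<tau>, x) * J (\<tau>, x))"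
      using lborel_pair.integral_snd[of "\<lambda>\<tau> x. I (\<tau>, x) * J (\<tau>, x)"] iJ
      by (simp add: lborel_prod case_prod_beta')
    also have "\<dots> = (LINT x|lborel. exp (m * w (t, x)) * (\<zeta> x)\<^sup>2 - exp (m * w (s, x)) * (\<zeta> x)\<^sup>2)"
    proof (rule Bochner_Integration.integral_cong)
      fix x :: "real^'d"
      have 1: "((\<lambda>r. w (r, x)) has_real_derivative wt (\<tau>, x)) (at \<tau>)" for \<tau>
        using sm unfolding smooth_fun_def by blast
      have "((\<lambda>r. exp (m * w (r, x)) * (\<zeta> x)\<^sup>2) has_real_derivative J (\<tau>, x)) (at \<tau>)" for \<tau>
        by (rule derivative_eq_intros 1 refl)+ (simp add: J_def)
      then have "((\<lambda>r. exp (m * w (r, x)) * (\<zeta> x)\<^sup>2) has_vector_derivative J (\<tau>, x)) (at \<tau> within {s..t})" for \<tau>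
        by (simp add: has_real_derivative_iff_has_vector_derivative has_vector_derivative_at_within)
      moreover have "continuous_on {s..t} (\<lambda>\<tau>. J (\<tau>, x))"
        by (auto simp: J_def intro!: continuous_intros)
      ultimately show "(LINT \<tau>|lborel. I (\<tau>, x) * J (\<tau>, x)) = exp (m * w (t, x)) * (\<zeta> x)\<^sup>2 - exp (m * w (s, x)) * (\<zeta> x)\<^sup>2"
        using integral_FTC_atLeastAtMost[OF st, of "\<lambda>r. exp (m * w (r, x)) * (\<zeta> x)\<^sup>2" "\<lambda>\<tau>. J (\<tau>, x)"] by (simp add: I_def)
    qed simp
    also have "\<dots> = (LINT x|lborel. exp (m * w (t, x)) * (\<zeta> x)\<^sup>2) - (LINT x|lborel. exp (m * w (s, x)) * (\<zeta> x)\<^sup>2)"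
      by (rule Bochner_Integration.integral_diff[OF iF iF])
    finally show ?thesis .
  qed
  have intD: "(LINT z|lborel. I z * D z) = 0"
  proof -
    have "(LINT z|lborel. I z * D z) = (LINT \<tau>|lborel. LINT x|lborel. I (\<tau>, x) * D (\<tau>, x))"
      using lborel_pair.integral_fst[of "\<lambda>\<tau> x. I (\<tau>, x) * D (\<tau>, x)"] iD
      by (simp add: lborel_prod case_prod_beta')
    also have "\<dots> = (LINT \<tau>|lborel. indicator {s..t} \<tau> * (LINT x|lborel. D (\<tau>, x)))"
      by (simp add: I_def)
    also have "\<dots> = 0"
      unfolding D_def fst_conv snd_conv integral_divergence_eq_0 by simp
    finally show ?thesis .
  qed
  have pw: "I z * Y z \<le> I z * J z + I z * D z + I z * R z" for z
  proof -
    have "Y z \<le> J z + D z + R z"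
      using energy_pointwise[OF exp_ge_zero m, of "m * w z" "\<zeta> (snd z)" "W z" "Z (snd z)" "wt z + (\<Sum>i\<in>UNIV. H i z)" "b z" "f z"]
      unfolding Y_def J_def D_def R_def by (simp add: algebra_simps)
    then have "I z * Y z \<le> I z * (J z + D z + R z)" by (intro mult_left_mono) (auto simp: I_def)
    then show ?thesis by (simp add: algebra_simps)
  qed
  have R0: "R z \<ge> 0" and Y0: "Y z \<ge> 0" for z
    using m by (auto simp: R_def Y_def intro!: add_nonneg_nonneg mult_nonneg_nonneg)
  have I0: "I z \<ge> 0" for z by (simp add: I_def)
  have [measurable]: "(\<lambda>z::real \<times> (real^'d). \<zeta> (snd z)) \<in> borel_measurable borel"
    "(\<lambda>z::real \<times> (real^'d). Z (snd z)) \<in> borel_measurable borel"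
    by (auto intro!: borel_measurable_continuous_onI continuous_intros)
  have [measurable]: "R \<in> borel_measurable borel" unfolding R_def by measurable
  have mY[measurable]: "Y \<in> borel_measurable borel" unfolding Y_def by measurable
  have RR: "?RR = (\<integral>\<^sup>+z. ennreal (I z * R z) \<partial>lborel)"
  proof -
    have "(\<integral>\<^sup>+z. ennreal (I z * R z) \<partial>lborel) = (\<integral>\<^sup>+\<tau>. \<integral>\<^sup>+x. ennreal (I (\<tau>, x) * R (\<tau>, x)) \<partial>lborel \<partial>lborel)"
      by (subst lborel.nn_integral_fst) (simp_all add: lborel_prod)
    also have "\<dots> = ?RR"
      by (intro nn_integral_cong) (auto simp: I_def R_def E_def indicator_def)
    finally show ?thesis ..
  qed
  have DD: "?DD = (\<integral>\<^sup>+z. ennreal (I z * Y z) \<partial>lborel)"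
  proof -
    have "(\<integral>\<^sup>+z. ennreal (I z * Y z) \<partial>lborel) = (\<integral>\<^sup>+\<tau>. \<integral>\<^sup>+x. ennreal (I (\<tau>, x) * Y (\<tau>, x)) \<partial>lborel \<partial>lborel)"
      by (subst lborel.nn_integral_fst) (simp_all add: lborel_prod)
    also have "\<dots> = ?DD"
    proof (intro nn_integral_cong)
      fix \<tau>
      have "(exp (m * w z / 2))\<^sup>2 = exp (m * w z)" for z
        by (simp add: power2_eq_square flip: exp_add)
      then show "(\<integral>\<^sup>+x. ennreal (I (\<tau>, x) * Y (\<tau>, x)) \<partial>lborel) =
        (\<integral>\<^sup>+x. ennreal ((norm (exp (m/2 * w (\<tau>, x)) *\<^sub>R ((m/2 * \<zeta> x) *\<^sub>R W (\<tau>, x) + Z x)))\<^sup>2) \<partial>lborel) * indicator {s..t} \<tau>"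
        by (auto simp: I_def Y_def indicator_def power_mult_distrib)
    qed
    finally show ?thesis ..
  qed
  have FF: "(\<integral>\<^sup>+x. ennreal (E \<tau> x * (\<zeta> x)\<^sup>2) \<partial>lborel) = ennreal (LINT x|lborel. exp (m * w (\<tau>, x)) * (\<zeta> x)\<^sup>2)" for \<tau>
    unfolding E_def by (rule nn_integral_eq_integral[OF iF]) auto
  have F0: "0 \<le> (LINT x|lborel. exp (m * w (\<tau>, x)) * (\<zeta> x)\<^sup>2)" for \<tau>
    by (intro integral_nonneg_AE) auto
  have Yi: "(\<integral>\<^sup>+z. ennreal (I z * Y z) \<partial>lborel) = ennreal (LINT z|lborel. I z * Y z)"
    by (rule nn_integral_eq_integral[OF iY]) (auto simp: I0 Y0)
  show ?thesis
  \<comment> \<open>\<open>b\<close> and \<open>f\<close> are merely measurable here, so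
    \<open>R\<close> need not be integrable; if it is not, the right side is infinite.\<close>
  proof (cases "(\<integral>\<^sup>+z. ennreal (I z * R z) \<partial>lborel) = \<infinity>")
    case True then show ?thesis unfolding RR DD Yi by simp
  next
    case False
    have iR: "integrable lborel (\<lambda>z. I z * R z)"
      by (rule integrableI_nonneg) (use False in \<open>auto simp: I0 R0 top.not_eq_extremum\<close>)
    have Ri: "(\<integral>\<^sup>+z. ennreal (I z * R z) \<partial>lborel) = ennreal (LINT z|lborel. I z * R z)"
      by (rule nn_integral_eq_integral[OF iR]) (auto simp: I0 R0)
    have "(LINT z|lborel. I z * Y z) \<le> (LINT z|lborel. I z * J z + I z * D z + I z * R z)"
      by (intro integral_mono pw iY Bochner_Integration.integrable_add iJ iD iR)
    also have "\<dots> = (LINT z|lborel. I z * J z) + (LINT z|lborel. I z * D z) + (LINT z|lborel. I z * R z)"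
      by (simp add: iJ iD iR)
    finally have "(LINT x|lborel. exp (m * w (s, x)) * (\<zeta> x)\<^sup>2) + (LINT z|lborel. I z * Y z) \<le>
      (LINT x|lborel. exp (m * w (t, x)) * (\<zeta> x)\<^sup>2) + (LINT z|lborel. I z * R z)"
      unfolding intJ intD by simp
    moreover have "0 \<le> (LINT z|lborel. I z * Y z)" "0 \<le> (LINT z|lborel. I z * R z)"
      by (auto intro!: integral_nonneg_AE simp: I0 Y0 R0)
    ultimately show ?thesis
      unfolding RR DD FF Yi Ri by (simp add: F0 ennreal_leI less_top[symmetric] flip: ennreal_plus)
  qed
qed

end

section \<open>Mollification\<close>

lemma Ck_Suc_imp: "Ck (Suc k) \<phi> \<Longrightarrow> Ck k \<phi>"
proof (induction k arbitrary: \<phi>)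
  case 0
  then show ?case
    by (auto intro!: continuous_at_imp_continuous_on differentiable_imp_continuous_within)
next
  case (Suc k)
  have d: "\<And>z. \<phi> differentiable at z" and D: "\<And>e. e \<in> Basis \<Longrightarrow> Ck (Suc k) (\<lambda>z. frechet_derivative \<phi> (at z) e)"
    using Suc.prems by (simp_all only: Ck.simps) blast+
  show ?case using d Suc.IH[OF D] by (simp only: Ck.simps) blast
qed

lemma Ck_imp_continuous: "Ck k \<phi> \<Longrightarrow> continuous_on UNIV \<phi>"
  by (induction k) (auto simp del: Ck.simps(2) dest: Ck_Suc_imp)

lemma frechet_derivative_eqI: "(f has_derivative f') (at z) \<Longrightarrow> frechet_derivative f (at z) = f'"
  using frechet_derivative_at by metis

lemma Ck_const: "Ck k (\<lambda>_. c)"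
proof (induction k arbitrary: c)
  case (Suc k)
  have "frechet_derivative (\<lambda>_::'a. c) (at z) = (\<lambda>_. 0)" for z
    by (rule frechet_derivative_eqI) simp
  then show ?case using Suc by simp
qed simp

lemma Ck_inner: "Ck k (\<lambda>z. z \<bullet> e)"
proof (cases k)
  case (Suc j)
  have "((\<lambda>z. z \<bullet> e) has_derivative (\<lambda>h. h \<bullet> e)) (at z)" for z
    by (auto intro!: derivative_eq_intros)
  then have "frechet_derivative (\<lambda>z. z \<bullet> e) (at z) = (\<lambda>h. h \<bullet> e)" "(\<lambda>z. z \<bullet> e) differentiable (at z)" for z
    using frechet_derivative_eqI differentiable_def by blast+
  then show ?thesis using Suc by (simp add: Ck_const)
qed (auto intro!: continuous_intros)

lemma Ck_add: "Ck k f \<Longrightarrow> Ck k g \<Longrightarrow> Ck k (\<lambda>z. f z + g z)"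
proof (induction k arbitrary: f g)
  case (Suc k)
  have "(\<lambda>z. frechet_derivative (\<lambda>z. f z + g z) (at z) e) = (\<lambda>z. frechet_derivative f (at z) e + frechet_derivative g (at z) e)" for e
    using Suc.prems
    by (auto intro!: fun_cong[OF frechet_derivative_eqI] has_derivative_add frechet_derivative_works[THEN iffD1])
  then show ?case using Suc by simp
qed (auto intro!: continuous_intros)

lemma Ck_mult: "Ck k f \<Longrightarrow> Ck k g \<Longrightarrow> Ck k (\<lambda>z. f z * g z)"
proof (induction k arbitrary: f g)
  case (Suc k)
  have "(\<lambda>z. frechet_derivative (\<lambda>z. f z * g z) (at z) e) = (\<lambda>z. f z * frechet_derivative g (at z) e + frechet_derivative f (at z) e * g z)" for e
    using Suc.prems
    by (auto intro!: fun_cong[OF frechet_derivative_eqI] has_derivative_mult frechet_derivative_works[THEN iffD1])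
  moreover have "Ck k f" "Ck k g" using Suc.prems Ck_Suc_imp by blast+
  ultimately show ?case using Suc by (simp add: Ck_add)
qed (auto intro!: continuous_intros)

lemma Ck_sum: "finite I \<Longrightarrow> (\<And>i. i \<in> I \<Longrightarrow> Ck k (f i)) \<Longrightarrow> Ck k (\<lambda>z. \<Sum>i\<in>I. f i z)"
  by (induction I rule: finite_induct) (auto simp: Ck_const Ck_add)

lemma Ck_translate: "Ck k \<phi> \<Longrightarrow> Ck k (\<lambda>y. \<phi> (y - z))"
  and frechet_derivative_translate:
    "\<phi> differentiable (at (y - z)) \<Longrightarrow> frechet_derivative (\<lambda>y. \<phi> (y - z)) (at y) = frechet_derivative \<phi> (at (y - z))"
proof -
  have hd: "((\<lambda>y. \<phi> (y - z)) has_derivative frechet_derivative \<phi> (at (y - z))) (at y)"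
    if "\<phi> differentiable (at (y - z))" for \<phi> :: "'b::euclidean_space \<Rightarrow> real" and y z
  proof -
    have "((\<lambda>y. y - z) has_derivative (\<lambda>h. h - 0)) (at y)"
      by (intro has_derivative_diff has_derivative_ident has_derivative_const)
    then show ?thesis
      using has_derivative_compose[of "\<lambda>y. y - z" "\<lambda>h. h" y UNIV \<phi> "frechet_derivative \<phi> (at (y - z))"]
        frechet_derivative_works[THEN iffD1, OF that] by simp
  qed
  then show "\<phi> differentiable (at (y - z)) \<Longrightarrow> frechet_derivative (\<lambda>y. \<phi> (y - z)) (at y) = frechet_derivative \<phi> (at (y - z))"
    by (intro frechet_derivative_eqI)
  show "Ck k \<phi> \<Longrightarrow> Ck k (\<lambda>y. \<phi> (y - z))"
  proof (induction k arbitrary: \<phi>)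
    case 0 then show ?case by (auto intro!: continuous_on_compose2[of UNIV \<phi>] continuous_intros)
  next
    case (Suc k)
    have "(\<lambda>y. frechet_derivative (\<lambda>y. \<phi> (y - z)) (at y) e) = (\<lambda>y. frechet_derivative \<phi> (at (y - z)) e)" for e
      using Suc.prems by (intro ext fun_cong[OF frechet_derivative_eqI] hd) auto
    moreover have "(\<lambda>y. \<phi> (y - z)) differentiable (at y)" for y
      using hd[of \<phi> y z] Suc.prems by (auto intro: differentiableI)
    moreover have "Ck k (\<lambda>y. (\<lambda>x. frechet_derivative \<phi> (at x) e) (y - z))" if "e \<in> Basis" for e
      by (rule Suc.IH) (use Suc.prems that in simp)
    ultimately show ?case by simp
  qed
qed

text \<open>Carrying all derivatives of the outer function as a family closes the induction on
  \<open>k\<close>: differentiating \<psi> n after q gives \<psi> (Suc n) after q times a derivative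
  of q, and \<open>n\<close> is arbitrary in the induction hypothesis.\<close>

lemma Ck_compose_family:
  fixes \<psi> :: "nat \<Rightarrow> real \<Rightarrow> real"
  assumes der: "\<And>n x. (\<psi> n has_real_derivative \<psi> (Suc n) x) (at x)" and q: "\<And>k. Ck k q"
  shows "Ck k (\<lambda>z. \<psi> n (q z))"
proof (induction k arbitrary: n)
  case 0
  have "continuous_on UNIV (\<psi> n)"
    by (intro continuous_at_imp_continuous_on ballI DERIV_isCont) (rule der)
  moreover have "continuous_on UNIV q" using Ck_imp_continuous[OF q] .
  ultimately show ?case by (auto intro: continuous_on_compose2)
next
  case (Suc k)
  have dq: "q differentiable (at z)" for z using q[of "Suc 0"] by simp
  have hd: "((\<lambda>z. \<psi> n (q z)) has_derivative (\<lambda>h. \<psi> (Suc n) (q z) * frechet_derivative q (at z) h)) (at z)" for z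
    using has_derivative_compose[of q "frechet_derivative q (at z)" z UNIV "\<psi> n" "\<lambda>h. \<psi> (Suc n) (q z) * h"]
      frechet_derivative_works[THEN iffD1, OF dq, of z] der[of n "q z"] by (simp add: has_field_derivative_def)
  have "Ck k (\<lambda>z. frechet_derivative q (at z) e)" if "e \<in> Basis" for e
    using q[of "Suc k"] that by simp
  then show ?case using hd Suc
    by (auto simp: differentiable_def frechet_derivative_eqI[OF hd] intro!: Ck_mult)
qed

text \<open>The n-th derivative of \<open>exp (- (1 / x))\<close> for \<open>x > 0\<close> is this
  polynomial in \<open>1 / x\<close> times \<open>exp (- (1 / x))\<close>; differentiating
  \<open>P (1 / x) * exp (- (1 / x))\<close> multiplies \<open>P - P'\<close> by the square of the
  variable.\<close>

primrec flat_poly :: "nat \<Rightarrow> real poly" where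
  "flat_poly 0 = 1"
| "flat_poly (Suc n) = [:0, 0, 1:] * (flat_poly n - pderiv (flat_poly n))"

definition flat :: "nat \<Rightarrow> real \<Rightarrow> real" where
  "flat n x = (if x > 0 then poly (flat_poly n) (1 / x) * exp (- (1 / x)) else 0)"

lemma poly_div_exp_tendsto_0: "((\<lambda>x::real. poly p x * exp (- x)) \<longlongrightarrow> 0) at_top"
proof -
  have "((\<lambda>x. \<Sum>i\<le>degree p. coeff p i * (x ^ i / exp x)) \<longlongrightarrow> (\<Sum>i\<le>degree p. coeff p i * 0)) at_top"
    by (intro tendsto_intros tendsto_power_div_exp_0)
  then show ?thesis by (simp add: poly_altdef exp_minus divide_inverse sum_distrib_right mult.assoc)
qed

text \<open>Only \<open>x = 0\<close> needs an argument: the difference quotient from the right is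
  again a polynomial in \<open>1 / h\<close> times \<open>exp (- (1 / h))\<close> and tends to
  0.\<close>

lemma flat_derivative: "(flat n has_real_derivative flat (Suc n) x) (at x)"
proof -
  consider "x > 0" | "x < 0" | "x = 0" by linarith
  then show ?thesis
  proof cases
    case 1
    have "((\<lambda>x. poly (flat_poly n) (1 / x) * exp (- (1 / x))) has_real_derivative flat (Suc n) x) (at x)"
      using 1 by (auto intro!: derivative_eq_intros poly_DERIV[THEN DERIV_chain2] simp: flat_def field_simps power2_eq_square)
    then show ?thesis
      by (rule has_field_derivative_transform_within_open[of _ _ _ "{0<..}"]) (use 1 in \<open>auto simp: flat_def\<close>)
  next
    case 2
    have "((\<lambda>x. 0) has_real_derivative flat (Suc n) x) (at x)" using 2 by (simp add: flat_def)
    then show ?thesis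
      by (rule has_field_derivative_transform_within_open[of _ _ _ "{..<0}"]) (use 2 in \<open>auto simp: flat_def\<close>)
  next
    case 3
    have "((\<lambda>h. flat n h / h) \<longlongrightarrow> 0) (at 0)"
    proof (rule filterlim_split_at)
      show "((\<lambda>h. flat n h / h) \<longlongrightarrow> 0) (at_left 0)"
        by (rule tendsto_eventually) (auto simp: flat_def eventually_at_filter)
      have "((\<lambda>x. poly ([:0, 1:] * flat_poly n) (inverse x) * exp (- inverse x)) \<longlongrightarrow> 0) (at_right (0::real))"
        by (rule filterlim_compose[OF poly_div_exp_tendsto_0 filterlim_inverse_at_top_right])
      moreover have "\<forall>\<^sub>F x in at_right (0::real). poly ([:0, 1:] * flat_poly n) (inverse x) * exp (- inverse x) = flat n x / x"
        by (auto simp: eventually_at_filter flat_def divide_inverse)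
      ultimately show "((\<lambda>h. flat n h / h) \<longlongrightarrow> 0) (at_right 0)"
        by (rule Lim_transform_eventually)
    qed
    then show ?thesis using 3 by (simp add: has_field_derivative_iff flat_def)
  qed
qed

lemma flat_0_pos: "flat 0 x \<ge> 0" "flat 0 x > 0 \<longleftrightarrow> x > 0" "flat 0 x = 0 \<longleftrightarrow> x \<le> 0"
  by (auto simp: flat_def)

lemma exists_mollifier:
  assumes "\<epsilon> > (0::real)"
  obtains \<eta> :: "'a::euclidean_space \<Rightarrow> real"
  where "\<And>k. Ck k \<eta>" "\<And>y. \<eta> y \<ge> 0" "\<And>y. y \<notin> cball 0 \<epsilon> \<Longrightarrow> \<eta> y = 0" "(LINT y|lborel. \<eta> y) = 1"
proof -
  \<comment> \<open>\<open>\<epsilon>\<^sup>2 - (norm y)\<^sup>2\<close>, expanded over the basis so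
    that the \<open>Ck\<close> rules for sums and products apply. It is positive exactly on the open
    ball, where the flat function of it is positive too.\<close>
  define q :: "'a \<Rightarrow> real" where "q y = \<epsilon>\<^sup>2 + (\<Sum>e\<in>Basis. (-1) * ((y \<bullet> e) * (y \<bullet> e)))" for y
  have q: "q y = \<epsilon>\<^sup>2 - (norm y)\<^sup>2" for y
    unfolding q_def by (simp add: sum_negf power2_norm_eq_inner euclidean_inner[of y y])
  define \<eta>0 where "\<eta>0 y = flat 0 (q y)" for y
  have Ck0: "Ck k \<eta>0" for k
  proof -
    have "Ck k q" for k
      unfolding q_def[abs_def]
      by (rule Ck_add, rule Ck_const, rule Ck_sum, rule finite_Basis, rule Ck_mult, rule Ck_const, rule Ck_mult; rule Ck_inner)
    then show ?thesis unfolding \<eta>0_def[abs_def] by (rule Ck_compose_family[of flat q, OF flat_derivative])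
  qed
  have supp: "\<eta>0 y = 0" if "y \<notin> cball 0 \<epsilon>" for y
  proof -
    have "\<epsilon>\<^sup>2 \<le> (norm y)\<^sup>2" using that assms by (intro power_mono) auto
    then show ?thesis by (simp add: \<eta>0_def flat_0_pos q)
  qed
  have c0: "continuous_on UNIV \<eta>0" using Ck_imp_continuous[OF Ck0] .
  have i0: "integrable lborel \<eta>0"
    by (rule integrable_continuous_compact_support[OF c0 compact_cball supp])
  have pos: "(LINT y|lborel. \<eta>0 y) > 0"
  proof -
    have "(LINT y|lborel. \<eta>0 y) \<noteq> 0"
    proof
      assume "(LINT y|lborel. \<eta>0 y) = 0"
      then have "AE y in lborel. \<eta>0 y = 0"
        by (subst (asm) integral_nonneg_eq_0_iff_AE) (use i0 in \<open>auto simp: \<eta>0_def flat_0_pos\<close>)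
      then have "AE y in lborel. y \<notin> ball (0::'a) \<epsilon>"
      proof eventually_elim
        case (elim y)
        then have "\<epsilon>\<^sup>2 \<le> (norm y)\<^sup>2" by (simp add: \<eta>0_def flat_0_pos q)
        then have "\<epsilon> \<le> norm y" by (rule power2_le_imp_le) simp
        then show ?case by simp
      qed
      then have "emeasure lborel (ball (0::'a) \<epsilon>) = 0"
        by (subst (asm) AE_iff_measurable[of "ball 0 \<epsilon>"]) auto
      then show False using content_ball_pos[OF assms, of "0::'a"] by (simp add: measure_def)
    qed
    moreover have "(LINT y|lborel. \<eta>0 y) \<ge> 0" by (auto intro!: integral_nonneg_AE simp: \<eta>0_def flat_0_pos)
    ultimately show ?thesis by simp
  qed
  let ?c = "LINT y|lborel. \<eta>0 y"
  show ?thesis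
  proof (rule that[of "\<lambda>y. (1 / ?c) * \<eta>0 y"])
    show "Ck k (\<lambda>y. (1 / ?c) * \<eta>0 y)" for k by (intro Ck_mult Ck_const Ck0)
    show "(1 / ?c) * \<eta>0 y \<ge> 0" for y using pos by (simp add: \<eta>0_def flat_0_pos)
    show "y \<notin> cball 0 \<epsilon> \<Longrightarrow> (1 / ?c) * \<eta>0 y = 0" for y using supp by simp
    show "(LINT y|lborel. (1 / ?c) * \<eta>0 y) = 1" using pos by simp
  qed
qed

section \<open>Mollification by correlation with a kernel\<close>

lemma frechet_derivative_zero_outside:
  assumes "closed K" "\<And>y. y \<notin> K \<Longrightarrow> \<phi> y = (0::real)" "z \<notin> K"
  shows "frechet_derivative \<phi> (at z) = (\<lambda>_. 0)"
proof (rule frechet_derivative_eqI)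
  have "((\<lambda>_. 0) has_derivative (\<lambda>_. 0)) (at z)" by simp
  then show "(\<phi> has_derivative (\<lambda>_. 0)) (at z)"
    by (rule has_derivative_transform_within_open[of _ _ _ _ "- K"]) (use assms in auto)
qed

text \<open>Convolution with the reflected kernel. In this form
  \<open>\<lambda>y. \<kappa> (y - z)\<close> is itself the test function to which the definition of
  the generalized derivative applies.\<close>

definition correlation :: "('a::euclidean_space \<Rightarrow> real) \<Rightarrow> ('a \<Rightarrow> real) \<Rightarrow> 'a \<Rightarrow> real" where
  "correlation \<kappa> k z = (LINT y|lborel. k y * \<kappa> (y - z))"

lemma integrable_correlation:
  fixes k \<kappa> :: "'a::euclidean_space \<Rightarrow> real"
  assumes k: "integrable lborel k" and c: "continuous_on UNIV \<kappa>" and B: "\<And>x. \<bar>\<kappa> x\<bar> \<le> B"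
  shows "integrable lborel (\<lambda>y. k y * \<kappa> (y - z))"
proof (rule Bochner_Integration.integrable_bound[of _ "\<lambda>y. B * \<bar>k y\<bar>"])
  have [measurable]: "\<kappa> \<in> borel_measurable borel" using c by (rule borel_measurable_continuous_onI)
  have [measurable]: "k \<in> borel_measurable borel" using k by auto
  show "(\<lambda>y. k y * \<kappa> (y - z)) \<in> borel_measurable lborel" by measurable
  show "AE y in lborel. norm (k y * \<kappa> (y - z)) \<le> norm (B * \<bar>k y\<bar>)"
  proof (rule AE_I2)
    fix y
    have "\<bar>k y\<bar> * \<bar>\<kappa> (y - z)\<bar> \<le> \<bar>k y\<bar> * \<bar>B\<bar>"
      using B[of "y - z"] by (intro mult_left_mono) auto
    then show "norm (k y * \<kappa> (y - z)) \<le> norm (B * \<bar>k y\<bar>)" by (simp add: abs_mult mult.commute)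
  qed
qed (use k in auto)

lemma continuous_correlation:
  fixes k \<kappa> :: "'a::euclidean_space \<Rightarrow> real"
  assumes k: "integrable lborel k" and c: "continuous_on UNIV \<kappa>" and B: "\<And>x. \<bar>\<kappa> x\<bar> \<le> B"
  shows "continuous_on UNIV (correlation \<kappa> k)"
proof (intro continuous_at_imp_continuous_on ballI)
  fix z
  have [measurable]: "\<kappa> \<in> borel_measurable borel" using c by (rule borel_measurable_continuous_onI)
  have [measurable]: "k \<in> borel_measurable borel" using k by auto
  show "isCont (correlation \<kappa> k) z"
    unfolding continuous_at_sequentially o_def correlation_def
  proof safe
    fix X :: "nat \<Rightarrow> 'a" assume X: "X \<longlonglongrightarrow> z"
    show "(\<lambda>n. LINT y|lborel. k y * \<kappa> (y - X n)) \<longlonglongrightarrow> (LINT y|lborel. k y * \<kappa> (y - z))"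
    proof (rule integral_dominated_convergence[where w="\<lambda>y. B * \<bar>k y\<bar>"])
      show "AE y in lborel. (\<lambda>n. k y * \<kappa> (y - X n)) \<longlonglongrightarrow> k y * \<kappa> (y - z)"
      proof (rule AE_I2)
        fix y
        have "(\<lambda>n. \<kappa> (y - X n)) \<longlonglongrightarrow> \<kappa> (y - z)"
          by (rule isCont_tendsto_compose[of _ \<kappa>]) (use c X in \<open>auto simp: continuous_on_eq_continuous_at intro!: tendsto_intros\<close>)
        then show "(\<lambda>n. k y * \<kappa> (y - X n)) \<longlonglongrightarrow> k y * \<kappa> (y - z)" by (intro tendsto_intros)
      qed
      show "AE y in lborel. norm (k y * \<kappa> (y - X n)) \<le> B * \<bar>k y\<bar>" for n
        using mult_right_mono[OF B abs_ge_zero] by (auto simp: abs_mult mult.commute[of "\<bar>k _\<bar>"] intro!: AE_I2)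
    qed (use k in auto)
  qed
qed

text \<open>The parameter enters the kernel as \<open>\<kappa> (y - z - r *\<^sub>R e)\<close>,
  hence the minus sign. The bound of \<open>\<kappa>'\<close> makes \<kappa> Lipschitz along lines,
  so \<open>B' * \<bar>k y\<bar>\<close> dominates all difference quotients.\<close>

lemma correlation_has_derivative:
  fixes k \<kappa> \<kappa>' :: "'a::euclidean_space \<Rightarrow> real"
  assumes k: "integrable lborel k" and c: "continuous_on UNIV \<kappa>" and B: "\<And>x. \<bar>\<kappa> x\<bar> \<le> B"
    and c': "continuous_on UNIV \<kappa>'" and B': "\<And>x. \<bar>\<kappa>' x\<bar> \<le> B'"
    and der: "\<And>x. ((\<lambda>r. \<kappa> (x + r *\<^sub>R e)) has_real_derivative \<kappa>' x) (at 0)"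
  shows "((\<lambda>r. correlation \<kappa> k (z + r *\<^sub>R e)) has_real_derivative - correlation \<kappa>' k z) (at 0)"
proof -
  have [measurable]: "\<kappa> \<in> borel_measurable borel" "\<kappa>' \<in> borel_measurable borel" using c c' by (auto intro: borel_measurable_continuous_onI)
  have [measurable]: "k \<in> borel_measurable borel" using k by auto
  have der2: "((\<lambda>r. \<kappa> (x + r *\<^sub>R e)) has_real_derivative \<kappa>' (x + r *\<^sub>R e)) (at r)" for x r
    using der[of "x + r *\<^sub>R e"] DERIV_shift[of "\<lambda>r. \<kappa> (x + r *\<^sub>R e)" "\<kappa>' (x + r *\<^sub>R e)" 0 r]
    by (simp add: algebra_simps)
  have lip: "\<bar>\<kappa> (x + r *\<^sub>R e) - \<kappa> x\<bar> \<le> B' * \<bar>r\<bar>" for x r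
    using field_differentiable_bound[of UNIV "\<lambda>r. \<kappa> (x + r *\<^sub>R e)" "\<lambda>r. \<kappa>' (x + r *\<^sub>R e)" B' r 0] der2[of x] B'
    by simp
  have dern: "((\<lambda>r. \<kappa> (x + r *\<^sub>R (- e))) has_real_derivative - \<kappa>' x) (at 0)" for x
  proof -
    have "((\<lambda>r::real. - r) has_real_derivative - 1) (at 0)" by (auto intro!: derivative_eq_intros)
    from DERIV_chain2[OF _ this, of "\<lambda>r. \<kappa> (x + r *\<^sub>R e)" "\<kappa>' x"] der[of x]
    show ?thesis by simp
  qed
  have "((\<lambda>h. (correlation \<kappa> k (z + h *\<^sub>R e) - correlation \<kappa> k z) / h) \<longlongrightarrow> - correlation \<kappa>' k z) (at 0)"
    unfolding tendsto_at_iff_sequentially o_def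
  proof (intro allI impI)
    fix X :: "nat \<Rightarrow> real" assume X: "\<forall>i. X i \<in> UNIV - {0}" "X \<longlonglongrightarrow> 0"
    have X0: "X n \<noteq> 0" for n using X by auto
    have eq: "(correlation \<kappa> k (z + X n *\<^sub>R e) - correlation \<kappa> k z) / X n = (LINT y|lborel. k y * ((\<kappa> ((y - z) + X n *\<^sub>R (- e)) - \<kappa> (y - z)) / X n))" for n
    proof -
      have "correlation \<kappa> k (z + X n *\<^sub>R e) - correlation \<kappa> k z = (LINT y|lborel. k y * \<kappa> (y - (z + X n *\<^sub>R e)) - k y * \<kappa> (y - z))"
        unfolding correlation_def by (rule Bochner_Integration.integral_diff[symmetric]; rule integrable_correlation[OF k c B])
      then show ?thesis by (simp add: algebra_simps diff_divide_distrib flip: integral_divide_zero)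
    qed
    have "(\<lambda>n. LINT y|lborel. k y * ((\<kappa> ((y - z) + X n *\<^sub>R (- e)) - \<kappa> (y - z)) / X n)) \<longlonglongrightarrow> (LINT y|lborel. k y * (- \<kappa>' (y - z)))"
    proof (rule integral_dominated_convergence[where w="\<lambda>y. B' * \<bar>k y\<bar>"])
      show "AE y in lborel. (\<lambda>n. k y * ((\<kappa> ((y - z) + X n *\<^sub>R (- e)) - \<kappa> (y - z)) / X n)) \<longlonglongrightarrow> k y * (- \<kappa>' (y - z))"
      proof (rule AE_I2)
        fix y
        have "(\<lambda>n. (\<kappa> ((y - z) + X n *\<^sub>R (- e)) - \<kappa> (y - z)) / X n) \<longlonglongrightarrow> - \<kappa>' (y - z)"
          using dern[of "y - z"] X unfolding has_field_derivative_iff tendsto_at_iff_sequentially o_def by simp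
        then show "(\<lambda>n. k y * ((\<kappa> ((y - z) + X n *\<^sub>R (- e)) - \<kappa> (y - z)) / X n)) \<longlonglongrightarrow> k y * (- \<kappa>' (y - z))"
          by (intro tendsto_intros)
      qed
      show "AE y in lborel. norm (k y * ((\<kappa> ((y - z) + X n *\<^sub>R (- e)) - \<kappa> (y - z)) / X n)) \<le> B' * \<bar>k y\<bar>" for n
      proof (rule AE_I2)
        fix y
        have "\<bar>\<kappa> ((y - z) + X n *\<^sub>R (- e)) - \<kappa> (y - z)\<bar> / \<bar>X n\<bar> \<le> B'"
          using lip[of "y - z" "- X n"] X0[of n] by (simp add: divide_le_eq)
        from mult_left_mono[OF this abs_ge_zero[of "k y"]]
        show "norm (k y * ((\<kappa> ((y - z) + X n *\<^sub>R (- e)) - \<kappa> (y - z)) / X n)) \<le> B' * \<bar>k y\<bar>"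
          by (simp add: abs_mult mult.commute)
      qed
    qed (use k in auto)
    then show "(\<lambda>n. (correlation \<kappa> k (z + X n *\<^sub>R e) - correlation \<kappa> k z) / X n) \<longlonglongrightarrow> - correlation \<kappa>' k z"
      unfolding eq by (simp add: correlation_def)
  qed
  then show ?thesis by (simp add: has_field_derivative_iff)
qed

section \<open>Continuity of translations in L_1\<close>

lemma ennreal_tendsto_0I:
  fixes f :: "'b \<Rightarrow> ennreal"
  assumes "\<And>e. e > 0 \<Longrightarrow> eventually (\<lambda>n. f n \<le> ennreal e) F"
  shows "(f \<longlongrightarrow> 0) F"
proof (rule order_tendstoI)
  fix a :: ennreal assume "0 < a"
  then obtain b where b: "0 < b" "b < a" using dense by blast
  have b': "b = ennreal (enn2real b)"
    using less_le_trans[OF b(2) top_greatest] by simp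
  with b(1) have "enn2real b > 0" by (metis ennreal_less_zero_iff)
  from assms[OF this] show "eventually (\<lambda>n. f n < a) F"
    using b(2) b' by (auto elim!: eventually_mono)
qed simp

lemma integrable_translate:
  fixes f :: "'a::euclidean_space \<Rightarrow> real"
  assumes "integrable lborel f"
  shows "integrable lborel (\<lambda>x. f (x + t))"
proof -
  have "integrable (distr lborel borel ((+) t)) f" using assms by (simp add: lborel_distr_plus)
  then show ?thesis using assms by (subst (asm) integrable_distr_eq) (auto simp: add.commute)
qed

text \<open>A set of finite measure and its translate have equal measure, so the L_1 distance is
  twice the measure of the points that leave \<open>U\<close>. For open \<open>U\<close> each point
  stays in \<open>U\<close> under small shifts, and the indicator of \<open>U\<close>
  dominates.\<close>

lemma L1_translation_indicator:
  fixes U :: "'a::euclidean_space set"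
  assumes U: "open U" "emeasure lborel U < \<infinity>" and Y: "Y \<longlonglongrightarrow> 0"
  shows "(\<lambda>n. \<integral>\<^sup>+x. ennreal \<bar>indicator U (x + Y n) - indicator U x\<bar> \<partial>lborel) \<longlonglongrightarrow> 0"
proof -
  have [measurable]: "U \<in> sets borel" using U(1) by simp
  have eq: "(\<integral>\<^sup>+x. ennreal \<bar>indicator U (x + y) - indicator U x\<bar> \<partial>lborel) =
      2 * (\<integral>\<^sup>+x. indicator U x * indicator (- U) (x + y) \<partial>lborel)" for y
  proof -
    have "emeasure lborel U + (\<integral>\<^sup>+x. ennreal \<bar>indicator U (x + y) - indicator U x\<bar> \<partial>lborel) =
       (\<integral>\<^sup>+x. indicator U x + ennreal \<bar>indicator U (x + y) - indicator U x\<bar> \<partial>lborel)"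
      by (simp add: nn_integral_add)
    also have "\<dots> = (\<integral>\<^sup>+x. indicator U (x + y) + 2 * (indicator U x * indicator (- U) (x + y)) \<partial>lborel)"
      by (intro nn_integral_cong) (auto simp: indicator_def)
    also have "\<dots> = (\<integral>\<^sup>+x. indicator U (x + y) \<partial>lborel) + 2 * (\<integral>\<^sup>+x. indicator U x * indicator (- U) (x + y) \<partial>lborel)"
      by (simp add: nn_integral_add nn_integral_cmult)
    also have "(\<integral>\<^sup>+x. indicator U (x + y) \<partial>lborel) = emeasure lborel U"
      using nn_integral_translate[of "indicator U" y] by simp
    finally show ?thesis using U(2) by (auto simp: ennreal_add_left_cancel)
  qed
  have "(\<lambda>n. \<integral>\<^sup>+x. indicator U x * indicator (- U) (x + Y n) \<partial>lborel) \<longlonglongrightarrow> (\<integral>\<^sup>+x. 0 \<partial>(lborel::'a measure))"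
  proof (rule nn_integral_dominated_convergence[where w="indicator U"])
    show "AE x in lborel. (\<lambda>n. indicator U x * indicator (- U) (x + Y n)) \<longlonglongrightarrow> (0::ennreal)"
    proof (rule AE_I2)
      fix x
      show "(\<lambda>n. indicator U x * indicator (- U) (x + Y n)) \<longlonglongrightarrow> (0::ennreal)"
      proof (cases "x \<in> U")
        case True
        have "(\<lambda>n. x + Y n) \<longlonglongrightarrow> x + 0" by (intro tendsto_intros Y)
        then have "eventually (\<lambda>n. x + Y n \<in> U) sequentially"
          using topological_tendstoD[OF _ U(1)] True by fastforce
        then show ?thesis by (rule tendsto_eventually[OF eventually_mono]) simp
      qed simp
    qed
    show "(\<integral>\<^sup>+x. indicator U x \<partial>lborel) < \<infinity>" using U(2) by simp
    show "AE x in lborel. indicator U x * indicator (- U) (x + Y n) \<le> (indicator U x :: ennreal)" for n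
      by (auto simp: indicator_def)
  qed auto
  then have "(\<lambda>n. 2 * (\<integral>\<^sup>+x. indicator U x * indicator (- U) (x + Y n) \<partial>lborel)) \<longlonglongrightarrow> 2 * 0"
    by (intro ennreal_tendsto_cmult) auto
  then show ?thesis unfolding eq by simp
qed

lemma L1_translation_perturb:
  fixes f g :: "'a::euclidean_space \<Rightarrow> real"
  assumes [measurable]: "f \<in> borel_measurable borel" "g \<in> borel_measurable borel"
    and d: "(\<integral>\<^sup>+x. ennreal \<bar>f x - g x\<bar> \<partial>lborel) \<le> ennreal e" and e: "e \<ge> 0"
  shows "(\<integral>\<^sup>+x. ennreal \<bar>f (x + y) - f x\<bar> \<partial>lborel) \<le> ennreal (2 * e) + (\<integral>\<^sup>+x. ennreal \<bar>g (x + y) - g x\<bar> \<partial>lborel)"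
proof -
  have "(\<integral>\<^sup>+x. ennreal \<bar>f (x + y) - f x\<bar> \<partial>lborel) \<le>
     (\<integral>\<^sup>+x. (ennreal \<bar>f (x + y) - g (x + y)\<bar> + ennreal \<bar>f x - g x\<bar>) + ennreal \<bar>g (x + y) - g x\<bar> \<partial>lborel)"
    by (intro nn_integral_mono) (auto intro!: ennreal_leI simp flip: ennreal_plus)
  also have "\<dots> = ((\<integral>\<^sup>+x. ennreal \<bar>f (x + y) - g (x + y)\<bar> \<partial>lborel) + (\<integral>\<^sup>+x. ennreal \<bar>f x - g x\<bar> \<partial>lborel)) +
      (\<integral>\<^sup>+x. ennreal \<bar>g (x + y) - g x\<bar> \<partial>lborel)"
    by (simp add: nn_integral_add)
  also have "(\<integral>\<^sup>+x. ennreal \<bar>f (x + y) - g (x + y)\<bar> \<partial>lborel) = (\<integral>\<^sup>+x. ennreal \<bar>f x - g x\<bar> \<partial>lborel)"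
    by (rule nn_integral_translate[of "\<lambda>x. ennreal \<bar>f x - g x\<bar>"]) measurable
  also have "(\<integral>\<^sup>+x. ennreal \<bar>f x - g x\<bar> \<partial>lborel) + (\<integral>\<^sup>+x. ennreal \<bar>f x - g x\<bar> \<partial>lborel) \<le> ennreal e + ennreal e"
    by (intro add_mono d)
  also have "ennreal e + ennreal e = ennreal (2 * e)" using e by (simp flip: ennreal_plus)
  finally show ?thesis by (simp add: add_right_mono)
qed

text \<open>\<open>integrable_induct\<close> reduces to multiples of indicators. Outer regularity
  replaces a measurable set by an open one at small cost in L_1, and translation invariance lets
  such an approximation pass to translated functions.\<close>

lemma L1_translation_tendsto_0:
  fixes g :: "'a::euclidean_space \<Rightarrow> real"
  assumes "integrable lborel g" and Y: "Y \<longlonglongrightarrow> 0"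
  shows "(\<lambda>n. \<integral>\<^sup>+x. ennreal \<bar>g (x + Y n) - g x\<bar> \<partial>lborel) \<longlonglongrightarrow> 0"
proof -
  have perturb: "(\<lambda>n. \<integral>\<^sup>+x. ennreal \<bar>f (x + Y n) - f x\<bar> \<partial>lborel) \<longlonglongrightarrow> 0"
    if f: "f \<in> borel_measurable borel" and ap: "\<And>e. e > 0 \<Longrightarrow> \<exists>g. g \<in> borel_measurable borel \<and> (\<integral>\<^sup>+x. ennreal \<bar>f x - g x\<bar> \<partial>lborel) \<le> ennreal e \<and>
        (\<lambda>n. \<integral>\<^sup>+x. ennreal \<bar>g (x + Y n) - g x\<bar> \<partial>lborel) \<longlonglongrightarrow> 0" for f :: "'a \<Rightarrow> real"
  proof (rule ennreal_tendsto_0I)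
    fix e :: real assume e: "e > 0"
    then obtain g where g: "g \<in> borel_measurable borel" "(\<integral>\<^sup>+x. ennreal \<bar>f x - g x\<bar> \<partial>lborel) \<le> ennreal (e / 4)"
      "(\<lambda>n. \<integral>\<^sup>+x. ennreal \<bar>g (x + Y n) - g x\<bar> \<partial>lborel) \<longlonglongrightarrow> 0" using ap[of "e / 4"] by auto
    have "eventually (\<lambda>n. (\<integral>\<^sup>+x. ennreal \<bar>g (x + Y n) - g x\<bar> \<partial>lborel) < ennreal (e / 2)) sequentially"
      using order_tendstoD(2)[OF g(3), of "ennreal (e / 2)"] e by simp
    then show "eventually (\<lambda>n. (\<integral>\<^sup>+x. ennreal \<bar>f (x + Y n) - f x\<bar> \<partial>lborel) \<le> ennreal e) sequentially"
    proof eventually_elim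
      case (elim n)
      have "(\<integral>\<^sup>+x. ennreal \<bar>f (x + Y n) - f x\<bar> \<partial>lborel) \<le> ennreal (2 * (e / 4)) + (\<integral>\<^sup>+x. ennreal \<bar>g (x + Y n) - g x\<bar> \<partial>lborel)"
        by (rule L1_translation_perturb[OF f g(1,2)]) (use e in simp)
      also have "\<dots> \<le> ennreal (2 * (e / 4)) + ennreal (e / 2)" using elim by (intro add_left_mono) auto
      also have "\<dots> = ennreal e" using e by (simp flip: ennreal_plus)
      finally show ?case .
    qed
  qed
  show ?thesis
    using assms(1)
  proof (induction g rule: integrable_induct)
    case (base A c)
    have [measurable]: "A \<in> sets borel" using base by simp
    show ?case
    proof (rule perturb)
      show "(\<lambda>x. indicator A x *\<^sub>R c) \<in> borel_measurable borel" by measurable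
      fix e :: real assume e: "e > 0"
      \<comment> \<open>The \<open>+ 1\<close> keeps \<open>\<bar>c\<bar> * \<delta> \<le> e\<close>
        meaningful also for \<open>c = 0\<close>.\<close>
      define \<delta> where "\<delta> = e / (\<bar>c\<bar> + 1)"
      have \<delta>: "\<delta> > 0" using e by (simp add: \<delta>_def)
      have "A \<in> sets lebesgue" by simp
      then obtain U where U: "open U" "A \<subseteq> U" "U - A \<in> lmeasurable" "emeasure lebesgue (U - A) < ennreal \<delta>"
        by (rule sets_lebesgue_outer_open[OF _ \<delta>])
      have [measurable]: "U \<in> sets borel" using U(1) by simp
      have eUA: "emeasure lborel (U - A) < ennreal \<delta>" using U(4) by simp
      have "emeasure lborel U = emeasure lborel A + emeasure lborel (U - A)"
        using U(2) by (subst plus_emeasure) (auto simp: Un_absorb1)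
      moreover have "emeasure lborel (U - A) < \<infinity>" using eUA by (rule order.strict_trans) simp
      ultimately have finU: "emeasure lborel U < \<infinity>" using base by (simp add: ennreal_add_less_top)
      show "\<exists>g. g \<in> borel_measurable borel \<and> (\<integral>\<^sup>+x. ennreal \<bar>indicator A x *\<^sub>R c - g x\<bar> \<partial>lborel) \<le> ennreal e \<and>
         (\<lambda>n. \<integral>\<^sup>+x. ennreal \<bar>g (x + Y n) - g x\<bar> \<partial>lborel) \<longlonglongrightarrow> 0"
      proof (rule exI[of _ "\<lambda>x. indicator U x * c"]; intro conjI)
        have "(\<integral>\<^sup>+x. ennreal \<bar>indicator A x *\<^sub>R c - indicator U x * c\<bar> \<partial>lborel) = (\<integral>\<^sup>+x. ennreal \<bar>c\<bar> * indicator (U - A) x \<partial>lborel)"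
          using U(2) by (intro nn_integral_cong) (auto simp: indicator_def)
        also have "\<dots> = ennreal \<bar>c\<bar> * emeasure lborel (U - A)" by (simp add: nn_integral_cmult)
        also have "\<dots> \<le> ennreal \<bar>c\<bar> * ennreal \<delta>" using eUA by (intro mult_left_mono) auto
        also have "\<dots> = ennreal (\<bar>c\<bar> * \<delta>)" by (simp add: ennreal_mult')
        also have "\<dots> \<le> ennreal e" using e by (intro ennreal_leI) (simp add: \<delta>_def field_simps)
        finally show "(\<integral>\<^sup>+x. ennreal \<bar>indicator A x *\<^sub>R c - indicator U x * c\<bar> \<partial>lborel) \<le> ennreal e" .
        have "(\<lambda>n. ennreal \<bar>c\<bar> * (\<integral>\<^sup>+x. ennreal \<bar>indicator U (x + Y n) - indicator U x\<bar> \<partial>lborel)) \<longlonglongrightarrow> ennreal \<bar>c\<bar> * 0"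
          by (intro ennreal_tendsto_cmult L1_translation_indicator U finU Y) auto
        moreover have "ennreal \<bar>c\<bar> * (\<integral>\<^sup>+x. ennreal \<bar>indicator U (x + Y n) - indicator U x\<bar> \<partial>lborel) =
           (\<integral>\<^sup>+x. ennreal \<bar>indicator U (x + Y n) * c - indicator U x * c\<bar> \<partial>lborel)" for n
        proof -
          have "\<bar>c\<bar> * \<bar>p - q\<bar> = \<bar>p * c - q * c\<bar>" for p q :: real
            by (simp add: left_diff_distrib[symmetric] abs_mult)
          then show ?thesis
            by (subst nn_integral_cmult[symmetric], measurable) (simp flip: ennreal_mult')
        qed
        ultimately show "(\<lambda>n. \<integral>\<^sup>+x. ennreal \<bar>indicator U (x + Y n) * c - indicator U x * c\<bar> \<partial>lborel) \<longlonglongrightarrow> 0"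
          by simp
      qed measurable
    qed
  next
    case (add f g)
    have [measurable]: "f \<in> borel_measurable borel" "g \<in> borel_measurable borel" using add by auto
    have "(\<lambda>n. (\<integral>\<^sup>+x. ennreal \<bar>f (x + Y n) - f x\<bar> \<partial>lborel) + (\<integral>\<^sup>+x. ennreal \<bar>g (x + Y n) - g x\<bar> \<partial>lborel)) \<longlonglongrightarrow> 0 + 0"
      by (intro tendsto_add add)
    then have lim: "(\<lambda>n. (\<integral>\<^sup>+x. ennreal \<bar>f (x + Y n) - f x\<bar> \<partial>lborel) + (\<integral>\<^sup>+x. ennreal \<bar>g (x + Y n) - g x\<bar> \<partial>lborel)) \<longlonglongrightarrow> 0" by simp
    show ?case
    proof (rule tendsto_sandwich[OF _ _ tendsto_const lim]; rule always_eventually; rule allI)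
      fix n
      show "(\<integral>\<^sup>+x. ennreal \<bar>(f (x + Y n) + g (x + Y n)) - (f x + g x)\<bar> \<partial>lborel) \<le>
        (\<integral>\<^sup>+x. ennreal \<bar>f (x + Y n) - f x\<bar> \<partial>lborel) + (\<integral>\<^sup>+x. ennreal \<bar>g (x + Y n) - g x\<bar> \<partial>lborel)"
        by (subst nn_integral_add[symmetric])
           (auto intro!: nn_integral_mono ennreal_leI simp flip: ennreal_plus)
    qed simp
  next
    case (lim f s)
    have [measurable]: "f \<in> borel_measurable borel" "\<And>i. s i \<in> borel_measurable borel" using lim by auto
    have conv: "(\<lambda>i. \<integral>\<^sup>+x. ennreal (norm (f x - s i x)) \<partial>lborel) \<longlonglongrightarrow> 0"
    proof (rule nn_integral_dominated_convergence_norm[where w="\<lambda>x. 2 * norm (f x)"])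
      have "integrable lborel (\<lambda>x. 2 * norm (f x))" using lim by auto
      then have "(\<integral>\<^sup>+x. ennreal (norm (2 * norm (f x))) \<partial>lborel) < \<infinity>"
        unfolding integrable_iff_bounded by blast
      then show "(\<integral>\<^sup>+x. ennreal (2 * norm (f x)) \<partial>lborel) < \<infinity>" by simp
    qed (use lim in auto)
    show ?case
    proof (rule perturb)
      fix e :: real assume "e > 0"
      then have "eventually (\<lambda>i. (\<integral>\<^sup>+x. ennreal (norm (f x - s i x)) \<partial>lborel) < ennreal e) sequentially"
        using order_tendstoD(2)[OF conv, of "ennreal e"] by simp
      then obtain i where "(\<integral>\<^sup>+x. ennreal (norm (f x - s i x)) \<partial>lborel) < ennreal e"
        by (auto simp: eventually_sequentially)
      then show "\<exists>g. g \<in> borel_measurable borel \<and> (\<integral>\<^sup>+x. ennreal \<bar>f x - g x\<bar> \<partial>lborel) \<le> ennreal e \<and>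
         (\<lambda>n. \<integral>\<^sup>+x. ennreal \<bar>g (x + Y n) - g x\<bar> \<partial>lborel) \<longlonglongrightarrow> 0"
        using lim by (intro exI[of _ "s i"]) auto
    qed measurable
  qed
qed

text \<open>A mollifier averages over all shifts in a ball, so smallness along a sequence is not
  enough; a failure of uniformity would yield a bad sequence of shifts tending to 0.\<close>

lemma L1_translation_uniform:
  fixes g :: "'a::euclidean_space \<Rightarrow> real"
  assumes g: "integrable lborel g" and e: "e > 0"
  obtains \<delta> where "\<delta> > 0" "\<And>y. norm y \<le> \<delta> \<Longrightarrow> (\<integral>\<^sup>+x. ennreal \<bar>g (x + y) - g x\<bar> \<partial>lborel) \<le> ennreal e"
proof (rule ccontr)
  assume "\<not> thesis"
  then have "\<forall>\<delta>>0. \<exists>y. norm y \<le> \<delta> \<and> \<not> (\<integral>\<^sup>+x. ennreal \<bar>g (x + y) - g x\<bar> \<partial>lborel) \<le> ennreal e"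
    using that by blast
  then have "\<forall>n. \<exists>y. norm y \<le> inverse (real (Suc n)) \<and> \<not> (\<integral>\<^sup>+x. ennreal \<bar>g (x + y) - g x\<bar> \<partial>lborel) \<le> ennreal e"
    by simp
  then obtain Y where Y: "\<And>n. norm (Y n) \<le> inverse (real (Suc n))"
    "\<And>n. \<not> (\<integral>\<^sup>+x. ennreal \<bar>g (x + Y n) - g x\<bar> \<partial>lborel) \<le> ennreal e" by metis
  have "Y \<longlonglongrightarrow> 0"
    by (rule Lim_null_comparison[OF always_eventually LIMSEQ_inverse_real_of_nat]) (use Y in auto)
  from L1_translation_tendsto_0[OF g this] have "eventually (\<lambda>n. (\<integral>\<^sup>+x. ennreal \<bar>g (x + Y n) - g x\<bar> \<partial>lborel) < ennreal e) sequentially"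
    by (rule order_tendstoD(2)) (use e in simp)
  then obtain n where "(\<integral>\<^sup>+x. ennreal \<bar>g (x + Y n) - g x\<bar> \<partial>lborel) < ennreal e"
    unfolding eventually_sequentially by blast
  then show False using Y(2)[of n] by (simp add: less_imp_le)
qed

lemma bounded_continuous_compact_support:
  fixes P :: "'a::euclidean_space \<Rightarrow> real"
  assumes "continuous_on UNIV P" "compact K" "\<And>x. x \<notin> K \<Longrightarrow> P x = 0"
  obtains B where "B \<ge> 0" "\<And>x. \<bar>P x\<bar> \<le> B"
proof -
  have "compact (P ` K)" using assms continuous_on_subset compact_continuous_image by blast
  then obtain B where B: "\<And>x. x \<in> K \<Longrightarrow> \<bar>P x\<bar> \<le> B"
    using compact_imp_bounded bounded_iff by (metis imageI real_norm_def)
  show ?thesis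
  proof (rule that[of "max 0 B"])
    show "\<bar>P x\<bar> \<le> max 0 B" for x using B[of x] assms(3)[of x] by (cases "x \<in> K") auto
  qed simp
qed

text \<open>The mollification error is an average of \<open>g (z + h) - g z\<close> with the
  probability density \<kappa>, so by Tonelli its L_1 norm is at most the largest translation
  error.\<close>

lemma mollifier_L1:
  fixes g \<kappa> :: "'a::euclidean_space \<Rightarrow> real"
  assumes g: "integrable lborel g" and c: "continuous_on UNIV \<kappa>" and k0: "\<And>y. \<kappa> y \<ge> 0"
    and supp: "\<And>y. y \<notin> cball 0 \<delta> \<Longrightarrow> \<kappa> y = 0" and one: "(LINT y|lborel. \<kappa> y) = 1"
    and le: "\<And>y. norm y \<le> \<delta> \<Longrightarrow> (\<integral>\<^sup>+x. ennreal \<bar>g (x + y) - g x\<bar> \<partial>lborel) \<le> e"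
  shows "(\<integral>\<^sup>+z. ennreal \<bar>correlation \<kappa> g z - g z\<bar> \<partial>lborel) \<le> e"
proof -
  have [measurable]: "\<kappa> \<in> borel_measurable borel" using c by (rule borel_measurable_continuous_onI)
  have [measurable]: "g \<in> borel_measurable borel" using g by auto
  obtain B where B: "B \<ge> 0" "\<And>x. \<bar>\<kappa> x\<bar> \<le> B"
    using bounded_continuous_compact_support[OF c compact_cball supp] by blast
  have ik: "integrable lborel \<kappa>" by (rule integrable_continuous_compact_support[OF c compact_cball supp])
  have "ennreal \<bar>correlation \<kappa> g z - g z\<bar> \<le> (\<integral>\<^sup>+h. ennreal \<bar>g (z + h) - g z\<bar> * ennreal (\<kappa> h) \<partial>lborel)" for z
  proof -
    have i1: "integrable lborel (\<lambda>h. g (h + z) * \<kappa> h)"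
      using integrable_translate[OF integrable_correlation[OF g c B(2), of z], of z] by simp
    have "correlation \<kappa> g z = (LINT h|lborel. g (h + z) * \<kappa> h)"
      using integral_translate[of "\<lambda>y. g y * \<kappa> (y - z)" z] unfolding correlation_def by simp
    moreover have "g z = (LINT h|lborel. g z * \<kappa> h)" using one by simp
    ultimately have "correlation \<kappa> g z - g z = (LINT h|lborel. g (h + z) * \<kappa> h - g z * \<kappa> h)"
      using ik i1 by (subst Bochner_Integration.integral_diff) auto
    then have "ennreal \<bar>correlation \<kappa> g z - g z\<bar> \<le> (\<integral>\<^sup>+h. ennreal (norm (g (h + z) * \<kappa> h - g z * \<kappa> h)) \<partial>lborel)"
      using integral_norm_bound_ennreal[of lborel "\<lambda>h. g (h + z) * \<kappa> h - g z * \<kappa> h"] ik i1 by simp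
    also have "\<dots> = (\<integral>\<^sup>+h. ennreal \<bar>g (z + h) - g z\<bar> * ennreal (\<kappa> h) \<partial>lborel)"
      by (intro nn_integral_cong) (simp add: k0 left_diff_distrib[symmetric] abs_mult ennreal_mult add.commute)
    finally show ?thesis .
  qed
  then have "(\<integral>\<^sup>+z. ennreal \<bar>correlation \<kappa> g z - g z\<bar> \<partial>lborel) \<le> (\<integral>\<^sup>+z. \<integral>\<^sup>+h. ennreal \<bar>g (z + h) - g z\<bar> * ennreal (\<kappa> h) \<partial>lborel \<partial>lborel)"
    by (intro nn_integral_mono) auto
  also have "\<dots> = (\<integral>\<^sup>+h. \<integral>\<^sup>+z. ennreal \<bar>g (z + h) - g z\<bar> * ennreal (\<kappa> h) \<partial>lborel \<partial>lborel)"
    by (rule lborel_pair.Fubini') measurable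
  also have "\<dots> \<le> (\<integral>\<^sup>+h. e * ennreal (\<kappa> h) \<partial>lborel)"
  proof (rule nn_integral_mono)
    fix h :: 'a
    have "(\<integral>\<^sup>+z. ennreal \<bar>g (z + h) - g z\<bar> \<partial>lborel) * ennreal (\<kappa> h) \<le> e * ennreal (\<kappa> h)"
      using le[of h] supp[of h] by (cases "norm h \<le> \<delta>") (auto intro: mult_right_mono)
    then show "(\<integral>\<^sup>+z. ennreal \<bar>g (z + h) - g z\<bar> * ennreal (\<kappa> h) \<partial>lborel) \<le> e * ennreal (\<kappa> h)"
      by (subst nn_integral_multc) auto
  qed
  also have "\<dots> = e * ennreal (LINT h|lborel. \<kappa> h)"
    by (simp add: nn_integral_cmult nn_integral_eq_integral[OF ik] k0)
  finally show ?thesis using one by simp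
qed

lemma Ck_line:
  assumes "Ck (Suc 0) \<kappa>"
  shows "((\<lambda>r. \<kappa> (x + r *\<^sub>R e)) has_real_derivative frechet_derivative \<kappa> (at x) e) (at 0)"
proof -
  have d: "\<kappa> differentiable (at x)" using assms by simp
  have 1: "((\<lambda>r. x + r *\<^sub>R e) has_derivative (\<lambda>r. 0 + r *\<^sub>R e)) (at (0::real))"
    by (intro has_derivative_add has_derivative_const has_derivative_scaleR_left has_derivative_ident)
  have 2: "(\<kappa> has_derivative frechet_derivative \<kappa> (at x)) (at x)"
    using d frechet_derivative_works by blast
  have "((\<lambda>r. \<kappa> (x + r *\<^sub>R e)) has_derivative (\<lambda>r. frechet_derivative \<kappa> (at x) (r *\<^sub>R e))) (at 0)"
    using has_derivative_compose[OF 1, of \<kappa> "frechet_derivative \<kappa> (at x)"] 2 by simp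
  moreover have "frechet_derivative \<kappa> (at x) (r *\<^sub>R e) = frechet_derivative \<kappa> (at x) e * r" for r
    using linear_frechet_derivative[OF d] by (simp add: linear_scale)
  ultimately show ?thesis by (simp add: has_field_derivative_def fun_eq_iff mult_commute_abs)
qed

lemma test_function_translate:
  assumes "\<And>k. Ck k \<kappa>" "\<And>y. y \<notin> cball 0 \<epsilon> \<Longrightarrow> \<kappa> y = 0" "cball z \<epsilon> \<subseteq> \<Omega>"
  shows "test_function \<Omega> (\<lambda>y. \<kappa> (y - z))"
  unfolding test_function_def
proof (intro conjI allI exI[of _ "cball z \<epsilon>"])
  show "Ck k (\<lambda>y. \<kappa> (y - z))" for k using assms(1) Ck_translate by blast
  show "y \<notin> cball z \<epsilon> \<longrightarrow> \<kappa> (y - z) = 0" for y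
    using assms(2)[of "y - z"] by (auto simp: dist_norm norm_minus_commute)
qed (use assms(3) in auto)

text \<open>The kernel centred at \<open>z\<close> is supported in \<open>K\<close>, so cutting
  \<open>h\<close> and \<open>g\<close> off to \<open>K\<close> changes neither integral while it
  makes them globally integrable.\<close>

lemma correlation_gen_deriv:
  fixes h g :: "'a::euclidean_space \<Rightarrow> real"
  assumes gd: "gen_deriv \<Omega> e h g" and Ck: "\<And>k. Ck k \<kappa>" and supp: "\<And>y. y \<notin> cball 0 \<epsilon> \<Longrightarrow> \<kappa> y = 0"
    and K: "cball z \<epsilon> \<subseteq> K" "K \<subseteq> \<Omega>"
  shows "correlation (\<lambda>y. frechet_derivative \<kappa> (at y) e) (\<lambda>y. indicator K y * h y) z = - correlation \<kappa> (\<lambda>y. indicator K y * g y) z"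
proof -
  have sub: "cball z \<epsilon> \<subseteq> \<Omega>" using K by blast
  have out: "y - z \<notin> cball 0 \<epsilon>" if "y \<notin> K" for y
    using K(1) that by (auto simp: dist_norm norm_minus_commute subset_iff)
  have fd: "frechet_derivative (\<lambda>y. \<kappa> (y - z)) (at y) e = frechet_derivative \<kappa> (at (y - z)) e" for y
    using frechet_derivative_translate[of \<kappa> y z] Ck[of "Suc 0"] by simp
  have d0: "frechet_derivative \<kappa> (at (y - z)) e = 0" "\<kappa> (y - z) = 0" if "y \<notin> K" for y
    using frechet_derivative_zero_outside[OF closed_cball supp out[OF that]] supp[OF out[OF that]] by auto
  have "(LINT y|lborel. h y * frechet_derivative (\<lambda>y. \<kappa> (y - z)) (at y) e) = - (LINT y|lborel. g y * \<kappa> (y - z))"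
    using gd test_function_translate[OF Ck supp sub] unfolding gen_deriv_def by blast
  moreover have "(\<lambda>y. indicator K y * h y * frechet_derivative \<kappa> (at (y - z)) e) = (\<lambda>y. h y * frechet_derivative \<kappa> (at (y - z)) e)"
    "(\<lambda>y. indicator K y * g y * \<kappa> (y - z)) = (\<lambda>y. g y * \<kappa> (y - z))"
    using d0 by (auto simp: fun_eq_iff indicator_def)
  ultimately show ?thesis unfolding correlation_def fd by simp
qed

lemma Lr_loc_integrable:
  assumes "Lr_loc 1 Q g" "compact K" "K \<subseteq> Q"
  shows "integrable lborel (\<lambda>y. indicator K y * g y)"
proof -
  have m: "set_borel_measurable lborel K g" and i: "(\<integral>\<^sup>+z\<in>K. ennreal (\<bar>g z\<bar> powr 1) \<partial>lborel) < \<infinity>"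
    using assms unfolding Lr_loc_def by blast+
  have "(\<integral>\<^sup>+z. ennreal (norm (indicator K z * g z)) \<partial>lborel) = (\<integral>\<^sup>+z\<in>K. ennreal (\<bar>g z\<bar> powr 1) \<partial>lborel)"
    by (intro nn_integral_cong) (auto simp: indicator_def)
  then show ?thesis using m i by (intro integrableI_bounded) (auto simp: set_borel_measurable_def)
qed

text \<open>Derivatives of the mollified solution are mollifications of the generalized derivatives,
  so the residual of the equation consists of L_1 mollification errors, those of the gradient
  multiplied by the bounded \<open>b\<close>, which is not mollified. Smallness in L_1 is the right
  notion: the residual will only be integrated against a bounded function. The bound of
  \<open>b\<close> influences the mollification scale, not any constant of the estimate.\<close>

lemma exists_smooth_approximation:
  fixes u f :: "real \<times> (real^'d) \<Rightarrow> real" and b :: "real \<times> (real^'d) \<Rightarrow> real^'d"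
  assumes sol: "bounded_solution T b f u"
    and [measurable]: "b \<in> borel_measurable borel" "f \<in> borel_measurable borel" and bb: "bounded (range b)"
    and st: "0 < s" "s \<le> t" "t < T" and \<delta>: "\<delta> > 0"
  obtains w wt W H where "smooth_fun w wt W H"
    "\<And>\<tau> x. \<tau> \<in> {s..t} \<Longrightarrow> norm x \<le> \<rho> \<Longrightarrow> \<bar>w (\<tau>, x) - u (\<tau>, x)\<bar> \<le> \<delta>"
    "(\<integral>\<^sup>+\<tau>. (\<integral>\<^sup>+x. ennreal \<bar>(wt (\<tau>, x) + (\<Sum>i\<in>UNIV. H i (\<tau>, x))) + b (\<tau>, x) \<bullet> W (\<tau>, x) + f (\<tau>, x)\<bar> * indicator (cball 0 \<rho>) x \<partial>lborel) * indicator {s..t} \<tau> \<partial>lborel) \<le> ennreal \<delta>"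
proof -
  obtain ut Du D2u where W12: "\<And>r. r > 1 \<Longrightarrow> W12_loc r T u ut Du D2u"
    and pde: "AE z in lborel. z \<in> layer T \<longrightarrow> ut z + (\<Sum>i\<in>UNIV. D2u i i z) + (\<Sum>i\<in>UNIV. b z $ i * Du i z) = - f z"
    and cu: "continuous_on ({0..T} \<times> UNIV) u"
    using sol unfolding bounded_solution_def by blast
  define \<Omega> where "\<Omega> = interior (layer T :: (real \<times> (real^'d)) set)"
  have gt: "gen_deriv \<Omega> (1, 0) u ut" and gx: "\<And>i. gen_deriv \<Omega> (0, axis i 1) u (Du i)"
    and gxx: "\<And>i. gen_deriv \<Omega> (0, axis i 1) (Du i) (D2u i i)"
    using W12[of 2] unfolding W12_loc_def \<Omega>_def by auto
  \<comment> \<open>Half the distance from \<open>{s..t}\<close> to 0 and \<open>T\<close>, so that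
    all mollification balls around \<open>K0\<close> stay in the compact \<open>K1\<close> inside
    the open layer.\<close>
  define \<epsilon>0 where "\<epsilon>0 = min s (T - t) / 2"
  have \<epsilon>0: "\<epsilon>0 > 0" "\<epsilon>0 < s" "t + \<epsilon>0 < T" using st by (auto simp: \<epsilon>0_def min_def field_simps)
  define K0 where "K0 = {s..t} \<times> cball (0::real^'d) \<rho>"
  define K1 where "K1 = {s - \<epsilon>0..t + \<epsilon>0} \<times> cball (0::real^'d) (\<rho> + \<epsilon>0)"
  have K1: "compact K1" unfolding K1_def by (intro compact_Times) auto
  have "{0<..<T} \<times> (UNIV :: (real^'d) set) \<subseteq> \<Omega>"
    unfolding \<Omega>_def layer_def by (intro interior_maximal open_Times) auto
  moreover have K1s: "K1 \<subseteq> {0<..<T} \<times> UNIV" using \<epsilon>0 by (auto simp: K1_def)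
  ultimately have K1\<Omega>: "K1 \<subseteq> \<Omega>" by blast
  have K1l: "K1 \<subseteq> layer T" using K1s by (auto simp: layer_def)
  have K01: "cball z \<epsilon> \<subseteq> K1" if "z \<in> K0" "\<epsilon> \<le> \<epsilon>0" for z \<epsilon>
  proof
    fix y assume y: "y \<in> cball z \<epsilon>"
    have "dist (fst z) (fst y) \<le> \<epsilon>0" "dist (snd z) (snd y) \<le> \<epsilon>0"
      using dist_fst_le[of z y] dist_snd_le[of z y] y that(2) by auto
    moreover have "norm (snd y) \<le> norm (snd z) + dist (snd z) (snd y)"
      using norm_triangle_ineq2[of "snd y" "snd z"] by (simp add: dist_norm norm_minus_commute)
    ultimately show "y \<in> K1" using that(1)
      by (cases y; cases z) (auto simp: K0_def K1_def dist_real_def)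
  qed
  define k where "k g = (\<lambda>y. indicator K1 y * g y)" for g :: "real \<times> (real^'d) \<Rightarrow> real"
  have ik: "integrable lborel (k g)" if "Lr_loc 1 \<Omega> g" for g
    unfolding k_def by (rule Lr_loc_integrable[OF that K1 K1\<Omega>])
  have iu: "integrable lborel (k u)" and iut: "integrable lborel (k ut)" and iD: "\<And>i. integrable lborel (k (Du i))"
    and iD2: "\<And>i. integrable lborel (k (D2u i i))"
    using gt gx gxx unfolding gen_deriv_def by (auto intro: ik)
  define G0 where "G0 y = k ut y + (\<Sum>i\<in>UNIV. k (D2u i i) y)" for y
  have iG0: "integrable lborel G0" unfolding G0_def[abs_def] by (intro Bochner_Integration.integrable_add Bochner_Integration.integrable_sum iut iD2)
  obtain B where B: "B > 0" "\<And>z. norm (b z) \<le> B" using bb unfolding bounded_pos by auto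
  \<comment> \<open>The final error consists of \<open>e1\<close> for \<open>G0\<close> and
    \<open>B * e1\<close> for each component of the gradient; the total is \<delta>.\<close>
  define e1 where "e1 = \<delta> / (1 + real CARD('d) * B)"
  have e1: "e1 > 0" using \<delta> B by (auto simp: e1_def intro!: divide_pos_pos add_pos_nonneg)
  obtain \<delta>0 where \<delta>0: "\<delta>0 > 0" "\<And>y. norm y \<le> \<delta>0 \<Longrightarrow> (\<integral>\<^sup>+x. ennreal \<bar>G0 (x + y) - G0 x\<bar> \<partial>lborel) \<le> ennreal e1"
    using L1_translation_uniform[OF iG0 e1] by blast
  have "\<forall>i. \<exists>\<delta>>0. \<forall>y. norm y \<le> \<delta> \<longrightarrow> (\<integral>\<^sup>+x. ennreal \<bar>k (Du i) (x + y) - k (Du i) x\<bar> \<partial>lborel) \<le> ennreal e1"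
  proof
    fix i
    obtain \<delta> where "\<delta> > 0" "\<And>y. norm y \<le> \<delta> \<Longrightarrow> (\<integral>\<^sup>+x. ennreal \<bar>k (Du i) (x + y) - k (Du i) x\<bar> \<partial>lborel) \<le> ennreal e1"
      by (rule L1_translation_uniform[OF iD[of i] e1]) blast
    then show "\<exists>\<delta>>0. \<forall>y. norm y \<le> \<delta> \<longrightarrow> (\<integral>\<^sup>+x. ennreal \<bar>k (Du i) (x + y) - k (Du i) x\<bar> \<partial>lborel) \<le> ennreal e1" by blast
  qed
  from choice[OF this] obtain \<delta>i where di: "\<forall>i. \<delta>i i > 0 \<and> (\<forall>y. norm y \<le> \<delta>i i \<longrightarrow> (\<integral>\<^sup>+x. ennreal \<bar>k (Du i) (x + y) - k (Du i) x\<bar> \<partial>lborel) \<le> ennreal e1)" ..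
  have \<delta>i: "\<And>i. \<delta>i i > 0" "\<And>i y. norm y \<le> \<delta>i i \<Longrightarrow> (\<integral>\<^sup>+x. ennreal \<bar>k (Du i) (x + y) - k (Du i) x\<bar> \<partial>lborel) \<le> ennreal e1"
    using di by auto
  have cuK: "continuous_on K1 u" by (rule continuous_on_subset[OF cu]) (use K1s in auto)
  have "uniformly_continuous_on K1 u" using compact_uniformly_continuous[OF cuK K1] .
  then obtain \<delta>u where \<delta>u: "\<delta>u > 0" "\<And>y z. y \<in> K1 \<Longrightarrow> z \<in> K1 \<Longrightarrow> dist y z < \<delta>u \<Longrightarrow> \<bar>u y - u z\<bar> < \<delta>"
    using \<delta> unfolding uniformly_continuous_on_def dist_real_def by blast
  \<comment> \<open>One scale for all requirements: room inside the layer, uniform continuity of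
    \<open>u\<close>, and the translation errors of \<open>G0\<close> and of each component of the
    gradient.\<close>
  define \<epsilon> where "\<epsilon> = Min ({\<epsilon>0, \<delta>0, \<delta>u / 2} \<union> range \<delta>i)"
  have \<epsilon>: "\<epsilon> > 0" "\<epsilon> \<le> \<epsilon>0" "\<epsilon> \<le> \<delta>0" "\<epsilon> < \<delta>u" "\<And>i. \<epsilon> \<le> \<delta>i i"
  proof -
    show "\<epsilon> > 0" unfolding \<epsilon>_def using \<epsilon>0 \<delta>0 \<delta>u \<delta>i by (subst Min_gr_iff) auto
    have le: "\<epsilon> \<le> a" if "a \<in> {\<epsilon>0, \<delta>0, \<delta>u / 2} \<union> range \<delta>i" for a
      unfolding \<epsilon>_def using that by (intro Min_le) auto
    show "\<epsilon> \<le> \<epsilon>0" "\<epsilon> \<le> \<delta>0" "\<And>i. \<epsilon> \<le> \<delta>i i" using le by auto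
    have "\<epsilon> \<le> \<delta>u / 2" by (rule le) simp
    then show "\<epsilon> < \<delta>u" using \<delta>u by simp
  qed
  obtain \<eta> :: "real \<times> (real^'d) \<Rightarrow> real" where \<eta>: "\<And>k. Ck k \<eta>" "\<And>y. \<eta> y \<ge> 0" "\<And>y. y \<notin> cball 0 \<epsilon> \<Longrightarrow> \<eta> y = 0" "(LINT y|lborel. \<eta> y) = 1"
    using exists_mollifier[OF \<epsilon>(1)] by blast
  define \<eta>t where "\<eta>t y = frechet_derivative \<eta> (at y) (1, 0)" for y
  define \<eta>x where "\<eta>x i y = frechet_derivative \<eta> (at y) (0, axis i 1)" for i y
  define \<eta>xx where "\<eta>xx i y = frechet_derivative (\<eta>x i) (at y) (0, axis i 1)" for i y
  have Bt: "(1, 0) \<in> (Basis :: (real \<times> (real^'d)) set)" and Bx: "(0, axis i 1) \<in> (Basis :: (real \<times> (real^'d)) set)" for i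
    by (auto simp: Basis_prod_def axis_in_Basis_iff)
  have CkD: "Ck k (\<lambda>y. frechet_derivative \<kappa> (at y) e)" if "\<And>k. Ck k \<kappa>" "e \<in> Basis" for \<kappa> :: "real \<times> (real^'d) \<Rightarrow> real" and e k
    using that(1)[of "Suc k"] that(2) by simp
  have Ckt: "Ck k \<eta>t" and Ckx: "Ck k (\<eta>x i)" for k i
    unfolding \<eta>t_def[abs_def] \<eta>x_def[abs_def] by (intro CkD \<eta> Bt Bx)+
  have Ckxx: "Ck k (\<eta>xx i)" for k i
    unfolding \<eta>xx_def[abs_def] by (intro CkD Ckx Bx)
  have st0: "\<eta>t y = 0" and sx0: "\<eta>x i y = 0" if "y \<notin> cball 0 \<epsilon>" for i y
    using frechet_derivative_zero_outside[OF closed_cball \<eta>(3) that] by (auto simp: \<eta>t_def \<eta>x_def)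
  have sxx0: "\<eta>xx i y = 0" if "y \<notin> cball 0 \<epsilon>" for i y
    using frechet_derivative_zero_outside[OF closed_cball sx0 that] by (auto simp: \<eta>xx_def)
  note c = Ck_imp_continuous
  obtain B0 where B0: "\<And>x. \<bar>\<eta> x\<bar> \<le> B0" using bounded_continuous_compact_support[OF c[OF \<eta>(1)] compact_cball \<eta>(3)] by blast
  obtain Bt' where Bt': "\<And>x. \<bar>\<eta>t x\<bar> \<le> Bt'" using bounded_continuous_compact_support[OF c[OF Ckt] compact_cball st0] by blast
  have "\<exists>B. \<forall>x. \<bar>\<eta>x i x\<bar> \<le> B" for i
    by (rule bounded_continuous_compact_support[OF c[OF Ckx[where i=i]] compact_cball sx0]) blast+
  then obtain Bx' where Bx': "\<And>i x. \<bar>\<eta>x i x\<bar> \<le> Bx' i"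
    using choice[of "\<lambda>i B. \<forall>x. \<bar>\<eta>x i x\<bar> \<le> B"] by blast
  have "\<exists>B. \<forall>x. \<bar>\<eta>xx i x\<bar> \<le> B" for i
    by (rule bounded_continuous_compact_support[OF c[OF Ckxx[where i=i]] compact_cball sxx0]) blast+
  then obtain Bxx' where Bxx': "\<And>i x. \<bar>\<eta>xx i x\<bar> \<le> Bxx' i"
    using choice[of "\<lambda>i B. \<forall>x. \<bar>\<eta>xx i x\<bar> \<le> B"] by blast
  define w where "w = correlation \<eta> (k u)"
  define wt where "wt z = - correlation \<eta>t (k u) z" for z
  define W :: "real \<times> (real^'d) \<Rightarrow> real^'d" where "W z = (\<chi> i. - correlation (\<eta>x i) (k u) z)" for z
  define H where "H i = correlation (\<eta>xx i) (k u)" for i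
  have smooth: "smooth_fun w wt W H"
    unfolding smooth_fun_def
  proof (intro conjI allI)
    show "continuous_on UNIV w" unfolding w_def by (rule continuous_correlation[OF iu c[OF \<eta>(1)] B0])
    show "continuous_on UNIV wt" unfolding wt_def[abs_def] by (intro continuous_on_minus continuous_correlation[OF iu c[OF Ckt] Bt'])
    show "continuous_on UNIV W" unfolding W_def[abs_def]
      by (intro continuous_on_vec_lambda continuous_on_minus continuous_correlation[OF iu c[OF Ckx] Bx'])
    show "continuous_on UNIV (H i)" for i unfolding H_def by (rule continuous_correlation[OF iu c[OF Ckxx] Bxx'])
    show "((\<lambda>r. w (r, x)) has_real_derivative wt (t, x)) (at t)" for t x
    proof -
      have "((\<lambda>r. correlation \<eta> (k u) ((t, x) + r *\<^sub>R (1, 0))) has_real_derivative - correlation \<eta>t (k u) (t, x)) (at 0)"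
        unfolding \<eta>t_def[abs_def]
        by (rule correlation_has_derivative[OF iu c[OF \<eta>(1)] B0 _ _ Ck_line[OF \<eta>(1)]])
           (use c[OF Ckt] Bt' in \<open>auto simp: \<eta>t_def[abs_def]\<close>)
      then have "((\<lambda>r. w (r + t, x)) has_real_derivative wt (t, x)) (at 0)"
        by (simp add: w_def wt_def add.commute)
      then show ?thesis using DERIV_shift[of "\<lambda>r. w (r, x)" "wt (t, x)" 0 t] by simp
    qed
    show "((\<lambda>r. W (t, x + r *\<^sub>R axis i 1) $ i) has_real_derivative H i (t, x)) (at 0)" for t x i
    proof -
      have "((\<lambda>r. correlation (\<eta>x i) (k u) ((t, x) + r *\<^sub>R (0, axis i 1))) has_real_derivative - correlation (\<eta>xx i) (k u) (t, x)) (at 0)"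
        unfolding \<eta>xx_def[abs_def]
        by (rule correlation_has_derivative[OF iu c[OF Ckx] Bx' _ _ Ck_line[OF Ckx]])
           (use c[OF Ckxx] Bxx' in \<open>auto simp: \<eta>xx_def[abs_def]\<close>)
      from DERIV_minus[OF this] show ?thesis by (simp add: W_def H_def)
    qed
    show "((\<lambda>r. w (t, x + r *\<^sub>R h)) has_real_derivative W (t, x) \<bullet> h) (at 0)" for t x h
    proof -
      define \<eta>h where "\<eta>h y = frechet_derivative \<eta> (at y) (0, h)" for y
      have eh: "\<eta>h y = (\<Sum>i\<in>UNIV. h $ i * \<eta>x i y)" for y
      proof -
        have hs: "(\<Sum>i\<in>UNIV. h $ i *\<^sub>R axis i 1) = h"
          using basis_expansion[of h] by (simp add: scalar_mult_eq_scaleR)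
        have "(0, h) = (\<Sum>i\<in>UNIV. h $ i *\<^sub>R (0::real, axis i 1))"
          by (rule prod_eqI) (simp_all add: fst_sum snd_sum hs)
        moreover have lin: "linear (frechet_derivative \<eta> (at y))"
          by (rule linear_frechet_derivative) (use \<eta>(1)[of "Suc 0"] in \<open>unfold Ck.simps, blast\<close>)
        ultimately show ?thesis
          unfolding \<eta>h_def \<eta>x_def by (simp only: linear_sum[OF lin] linear_scale[OF lin] real_scaleR_def)
      qed
      have "((\<lambda>r. correlation \<eta> (k u) ((t, x) + r *\<^sub>R (0, h))) has_real_derivative - correlation \<eta>h (k u) (t, x)) (at 0)"
      proof (rule correlation_has_derivative[OF iu c[OF \<eta>(1)] B0])
        show "continuous_on UNIV \<eta>h" unfolding eh[abs_def]
          by (rule continuous_on_sum, rule continuous_on_mult, rule continuous_on_const, rule c[OF Ckx])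
        show "\<bar>\<eta>h y\<bar> \<le> (\<Sum>i\<in>UNIV. \<bar>h $ i\<bar> * Bx' i)" for y
          unfolding eh by (rule order_trans[OF sum_abs]) (auto simp: abs_mult intro!: sum_mono mult_left_mono Bx')
        show "((\<lambda>r. \<eta> (x + r *\<^sub>R (0, h))) has_real_derivative \<eta>h x) (at 0)" for x
          unfolding \<eta>h_def by (rule Ck_line[OF \<eta>(1)])
      qed
      moreover have "- correlation \<eta>h (k u) (t, x) = W (t, x) \<bullet> h"
      proof -
        have "correlation \<eta>h (k u) (t, x) = (\<Sum>i\<in>UNIV. h $ i * correlation (\<eta>x i) (k u) (t, x))"
          unfolding correlation_def eh sum_distrib_left
          by (subst Bochner_Integration.integral_sum)
             (auto simp: mult.left_commute intro!: integrable_mult_right integrable_correlation[OF iu c[OF Ckx] Bx'])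
        then show ?thesis by (simp add: W_def inner_vec_def sum_negf mult.commute)
      qed
      ultimately show ?thesis by (simp add: w_def)
    qed
  qed
  have close: "\<bar>w z - u z\<bar> \<le> \<delta>" if z: "z \<in> K0" for z
  proof -
    have i1: "integrable lborel (\<lambda>y. k u y * \<eta> (y - z))" by (rule integrable_correlation[OF iu c[OF \<eta>(1)] B0])
    have i\<eta>: "integrable lborel (\<lambda>y. \<eta> (y - z))"
    proof -
      have "integrable lborel \<eta>" by (rule integrable_continuous_compact_support[OF c[OF \<eta>(1)] compact_cball \<eta>(3)])
      from integrable_translate[OF this, of "- z"] show ?thesis by simp
    qed
    have one: "(LINT y|lborel. \<eta> (y - z)) = 1"
      using integral_translate[of \<eta> "- z"] \<eta>(4) c[OF \<eta>(1)] by (simp add: borel_measurable_continuous_onI)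
    have "w z - u z = (LINT y|lborel. k u y * \<eta> (y - z) - u z * \<eta> (y - z))"
      using i1 i\<eta> one by (simp add: w_def correlation_def)
    moreover have "\<bar>LINT y|lborel. k u y * \<eta> (y - z) - u z * \<eta> (y - z)\<bar> \<le> (LINT y|lborel. \<bar>k u y * \<eta> (y - z) - u z * \<eta> (y - z)\<bar>)"
      by (rule integral_abs_bound)
    moreover have "(LINT y|lborel. \<bar>k u y * \<eta> (y - z) - u z * \<eta> (y - z)\<bar>) \<le> (LINT y|lborel. \<delta> * \<eta> (y - z))"
    proof (rule integral_mono)
      fix y
      show "\<bar>k u y * \<eta> (y - z) - u z * \<eta> (y - z)\<bar> \<le> \<delta> * \<eta> (y - z)"
      proof (cases "y - z \<in> cball 0 \<epsilon>")
        case True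
        then have y: "y \<in> cball z \<epsilon>" by (auto simp: dist_norm norm_minus_commute)
        then have yK: "y \<in> K1" using K01[OF z \<epsilon>(2)] by blast
        have zK: "z \<in> K1" using K01[OF z \<epsilon>(2)] \<epsilon>(1) by auto
        have "\<bar>u y - u z\<bar> < \<delta>" using \<delta>u(2)[OF yK zK] y \<epsilon>(4) by (auto simp: dist_commute)
        then have "\<bar>u y - u z\<bar> * \<eta> (y - z) \<le> \<delta> * \<eta> (y - z)" using \<eta>(2) by (intro mult_right_mono) auto
        then show ?thesis using yK \<eta>(2) by (simp add: k_def abs_mult left_diff_distrib[symmetric])
      qed (use \<eta>(3) in simp)
    qed (use i1 i\<eta> in auto)
    moreover have "(LINT y|lborel. \<delta> * \<eta> (y - z)) = \<delta>" using one by simp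
    ultimately show ?thesis by linarith
  qed
  have wtz: "wt z = correlation \<eta> (k ut) z" and Wz: "W z $ i = correlation \<eta> (k (Du i)) z" and Hz: "H i z = correlation \<eta> (k (D2u i i)) z" if z: "z \<in> K0" for z i
  proof -
    note cg = correlation_gen_deriv[OF _ _ _ K01[OF z \<epsilon>(2)] K1\<Omega>, folded k_def]
    show "wt z = correlation \<eta> (k ut) z" using cg[OF gt \<eta>(1,3)] by (simp add: wt_def \<eta>t_def[abs_def])
    show "W z $ i = correlation \<eta> (k (Du i)) z" using cg[OF gx \<eta>(1,3)] by (simp add: W_def \<eta>x_def[abs_def])
    have "H i z = - correlation (\<eta>x i) (k (Du i)) z" using cg[OF gx Ckx sx0] by (simp add: H_def \<eta>xx_def[abs_def])
    also have "\<dots> = correlation \<eta> (k (D2u i i)) z" using cg[OF gxx \<eta>(1,3)] by (simp add: \<eta>x_def[abs_def])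
    finally show "H i z = correlation \<eta> (k (D2u i i)) z" .
  qed
  have G0z: "wt z + (\<Sum>i\<in>UNIV. H i z) = correlation \<eta> G0 z" if z: "z \<in> K0" for z
  proof -
    have "correlation \<eta> G0 z = (LINT y|lborel. k ut y * \<eta> (y - z) + (\<Sum>i\<in>UNIV. k (D2u i i) y * \<eta> (y - z)))"
      unfolding correlation_def G0_def by (simp add: distrib_right sum_distrib_right)
    also have "\<dots> = correlation \<eta> (k ut) z + (\<Sum>i\<in>UNIV. correlation \<eta> (k (D2u i i)) z)"
      unfolding correlation_def
      by (subst Bochner_Integration.integral_add, rule integrable_correlation[OF iut c[OF \<eta>(1)] B0],
          rule Bochner_Integration.integrable_sum, rule integrable_correlation[OF iD2 c[OF \<eta>(1)] B0],
          subst Bochner_Integration.integral_sum, rule integrable_correlation[OF iD2 c[OF \<eta>(1)] B0], rule refl)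
    finally show ?thesis using wtz[OF z] Hz[OF z] by simp
  qed
  define e where "e z = \<bar>(wt z + (\<Sum>i\<in>UNIV. H i z)) + b z \<bullet> W z + f z\<bar>" for z
  have cG: "continuous_on UNIV (correlation \<eta> g)" if "integrable lborel g" for g by (rule continuous_correlation[OF that c[OF \<eta>(1)] B0])
  have [measurable]: "correlation \<eta> G0 \<in> borel_measurable borel" "\<And>i. correlation \<eta> (k (Du i)) \<in> borel_measurable borel"
    using cG[OF iG0] cG[OF iD] by (auto intro: borel_measurable_continuous_onI)
  have [measurable]: "G0 \<in> borel_measurable borel" "\<And>i. k (Du i) \<in> borel_measurable borel" using iG0 iD by auto
  have [measurable]: "w \<in> borel_measurable borel" "wt \<in> borel_measurable borel" "W \<in> borel_measurable borel" "\<And>i. H i \<in> borel_measurable borel"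
    using smooth unfolding smooth_fun_def by (auto intro: borel_measurable_continuous_onI)
  have me[measurable]: "e \<in> borel_measurable borel" unfolding e_def[abs_def] by measurable
  have [measurable]: "K0 \<in> sets borel" unfolding K0_def by (intro borel_closed closed_Times) auto
  have "(\<integral>\<^sup>+z. ennreal (e z) * indicator K0 z \<partial>lborel) \<le>
     (\<integral>\<^sup>+z. ennreal \<bar>correlation \<eta> G0 z - G0 z\<bar> + (\<Sum>i\<in>UNIV. ennreal B * ennreal \<bar>correlation \<eta> (k (Du i)) z - k (Du i) z\<bar>) \<partial>lborel)"
  proof (intro nn_integral_mono_AE, use pde in eventually_elim)
    fix z assume pz: "z \<in> layer T \<longrightarrow> ut z + (\<Sum>i\<in>UNIV. D2u i i z) + (\<Sum>i\<in>UNIV. b z $ i * Du i z) = - f z"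
    show "ennreal (e z) * indicator K0 z \<le> ennreal \<bar>correlation \<eta> G0 z - G0 z\<bar> + (\<Sum>i\<in>UNIV. ennreal B * ennreal \<bar>correlation \<eta> (k (Du i)) z - k (Du i) z\<bar>)"
    proof (cases "z \<in> K0")
      case True
      have zK: "z \<in> K1" using K01[OF True \<epsilon>(2)] \<epsilon>(1) by auto
      have "b z \<bullet> W z = (\<Sum>i\<in>UNIV. b z $ i * correlation \<eta> (k (Du i)) z)"
        using Wz[OF True] by (simp add: inner_vec_def)
      \<comment> \<open>On \<open>K1\<close> the cut-off functions agree with the originals, so this
        is the equation itself. Subtracting it from the mollified expression removes
        \<open>f\<close> and leaves differences between functions and their mollifications.\<close>
      moreover have "G0 z + (\<Sum>i\<in>UNIV. b z $ i * k (Du i) z) + f z = 0"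
        using pz zK K1l by (auto simp: G0_def k_def)
      ultimately have ez: "e z = \<bar>(correlation \<eta> G0 z - G0 z) + (\<Sum>i\<in>UNIV. b z $ i * (correlation \<eta> (k (Du i)) z - k (Du i) z))\<bar>"
        unfolding e_def G0z[OF True] by (simp add: right_diff_distrib sum_subtractf algebra_simps)
      have "\<bar>b z $ i\<bar> \<le> B" for i using component_le_norm_cart[of "b z" i] B(2)[of z] by linarith
      then have "\<bar>\<Sum>i\<in>UNIV. b z $ i * (correlation \<eta> (k (Du i)) z - k (Du i) z)\<bar> \<le> (\<Sum>i\<in>UNIV. B * \<bar>correlation \<eta> (k (Du i)) z - k (Du i) z\<bar>)"
        by (intro order_trans[OF sum_abs] sum_mono) (auto simp: abs_mult intro!: mult_right_mono)
      then have "e z \<le> \<bar>correlation \<eta> G0 z - G0 z\<bar> + (\<Sum>i\<in>UNIV. B * \<bar>correlation \<eta> (k (Du i)) z - k (Du i) z\<bar>)"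
        unfolding ez by linarith
      then have "ennreal (e z) \<le> ennreal (\<bar>correlation \<eta> G0 z - G0 z\<bar> + (\<Sum>i\<in>UNIV. B * \<bar>correlation \<eta> (k (Du i)) z - k (Du i) z\<bar>))"
        by (rule ennreal_leI)
      also have "\<dots> = ennreal \<bar>correlation \<eta> G0 z - G0 z\<bar> + (\<Sum>i\<in>UNIV. ennreal B * ennreal \<bar>correlation \<eta> (k (Du i)) z - k (Du i) z\<bar>)"
        using B by (subst ennreal_plus) (auto intro!: sum_nonneg simp: ennreal_mult'[symmetric])
      finally show ?thesis using True by simp
    qed simp
  qed
  also have "\<dots> = (\<integral>\<^sup>+z. ennreal \<bar>correlation \<eta> G0 z - G0 z\<bar> \<partial>lborel) + (\<Sum>i\<in>UNIV. ennreal B * (\<integral>\<^sup>+z. ennreal \<bar>correlation \<eta> (k (Du i)) z - k (Du i) z\<bar> \<partial>lborel))"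
    by (subst nn_integral_add) (auto simp: nn_integral_sum nn_integral_cmult)
  also have "\<dots> \<le> ennreal e1 + (\<Sum>i\<in>(UNIV::'d set). ennreal B * ennreal e1)"
  proof (intro add_mono sum_mono mult_left_mono)
    show "(\<integral>\<^sup>+z. ennreal \<bar>correlation \<eta> G0 z - G0 z\<bar> \<partial>lborel) \<le> ennreal e1"
      by (rule mollifier_L1[OF iG0 c[OF \<eta>(1)] \<eta>(2,3,4)]) (use \<delta>0 \<epsilon> in auto)
    show "(\<integral>\<^sup>+z. ennreal \<bar>correlation \<eta> (k (Du i)) z - k (Du i) z\<bar> \<partial>lborel) \<le> ennreal e1" for i
      by (rule mollifier_L1[OF iD c[OF \<eta>(1)] \<eta>(2,3,4)]) (use \<delta>i(2)[of _ i] \<epsilon>(5)[of i] in auto)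
  qed auto
  also have "\<dots> = ennreal \<delta>"
  proof -
    have "\<delta> = e1 + real CARD('d) * (B * e1)"
    proof -
      have "1 + real CARD('d) * B \<noteq> 0" using B(1) by (smt (verit) mult_nonneg_nonneg of_nat_0_le_iff)
      then have "e1 * (1 + real CARD('d) * B) = \<delta>" by (simp add: e1_def)
      then show ?thesis by (simp add: algebra_simps)
    qed
    then show ?thesis using B(1) e1 by (simp add: ennreal_of_nat_eq_real_of_nat ennreal_plus ennreal_mult)
  qed
  finally have fin: "(\<integral>\<^sup>+z. ennreal (e z) * indicator K0 z \<partial>lborel) \<le> ennreal \<delta>" .
  have "(\<integral>\<^sup>+z. ennreal (e z) * indicator K0 z \<partial>lborel) = (\<integral>\<^sup>+\<tau>. \<integral>\<^sup>+x. ennreal (e (\<tau>, x)) * indicator K0 (\<tau>, x) \<partial>lborel \<partial>lborel)"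
    by (subst lborel.nn_integral_fst) (simp_all add: lborel_prod)
  also have "\<dots> = (\<integral>\<^sup>+\<tau>. (\<integral>\<^sup>+x. ennreal (e (\<tau>, x)) * indicator (cball 0 \<rho>) x \<partial>lborel) * indicator {s..t} \<tau> \<partial>lborel)"
    by (intro nn_integral_cong) (auto simp: K0_def indicator_def)
  finally have fin2: "(\<integral>\<^sup>+\<tau>. (\<integral>\<^sup>+x. ennreal (e (\<tau>, x)) * indicator (cball 0 \<rho>) x \<partial>lborel) * indicator {s..t} \<tau> \<partial>lborel) \<le> ennreal \<delta>"
    using fin by simp
  show ?thesis
  proof (rule that[OF smooth])
    show "\<bar>w (\<tau>, x) - u (\<tau>, x)\<bar> \<le> \<delta>" if "\<tau> \<in> {s..t}" "norm x \<le> \<rho>" for \<tau> x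
      using close[of "(\<tau>, x)"] that by (simp add: K0_def)
  qed (use fin2 in \<open>simp add: e_def\<close>)
qed

section \<open>Exponential moments of the solution\<close>

definition zeta :: "real \<Rightarrow> 'a::euclidean_space \<Rightarrow> real" where
  "zeta R x = (max 0 (1 - (norm x)\<^sup>2 / R\<^sup>2))\<^sup>2"

definition zeta_grad :: "real \<Rightarrow> 'a::euclidean_space \<Rightarrow> 'a" where
  "zeta_grad R x = (- 4 * max 0 (1 - (norm x)\<^sup>2 / R\<^sup>2) / R\<^sup>2) *\<^sub>R x"

lemma measurable_zeta [measurable]: "zeta R \<in> borel_measurable borel"
  unfolding zeta_def[abs_def] by measurable

text \<open>Squaring the positive part makes it continuously differentiable across 0, so the
  explicit cutoff \<open>zeta\<close> is regular enough for \<open>C1_grad\<close> without any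
  smooth bump function.\<close>

lemma max_square_derivative: "((\<lambda>s. (max 0 s)\<^sup>2) has_real_derivative 2 * max 0 s) (at (s::real))"
proof -
  consider "s > 0" | "s < 0" | "s = 0" by linarith
  then show ?thesis
  proof cases
    case 1
    have "((\<lambda>s. s\<^sup>2) has_real_derivative 2 * max 0 s) (at s)" using 1 by (auto intro!: derivative_eq_intros)
    then show ?thesis
      by (rule has_field_derivative_transform_within_open[of _ _ _ "{0<..}"]) (use 1 in auto)
  next
    case 2
    have "((\<lambda>s. 0) has_real_derivative 2 * max 0 s) (at s)" using 2 by simp
    then show ?thesis
      by (rule has_field_derivative_transform_within_open[of _ _ _ "{..<0}"]) (use 2 in auto)
  next
    case 3
    have "((\<lambda>h::real. (max 0 h)\<^sup>2 / h) \<longlongrightarrow> 0) (at 0)"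
    proof (rule Lim_null_comparison)
      show "\<forall>\<^sub>F h in at 0. norm ((max 0 h)\<^sup>2 / h) \<le> \<bar>h\<bar>"
        by (rule always_eventually) (auto simp: max_def power2_eq_square)
      show "((\<lambda>h::real. \<bar>h\<bar>) \<longlongrightarrow> 0) (at 0)" by (auto intro!: tendsto_eq_intros)
    qed
    then show ?thesis using 3 by (simp add: has_field_derivative_iff)
  qed
qed

lemma C1_grad_zeta:
  assumes "R > 0"
  shows "C1_grad (\<lambda>x. zeta R (x - z)) (\<lambda>x. zeta_grad R (x - z))"
  unfolding C1_grad_def
proof (intro conjI allI)
  show "continuous_on UNIV (\<lambda>x. zeta R (x - z))" "continuous_on UNIV (\<lambda>x. zeta_grad R (x - z))"
    unfolding zeta_def zeta_grad_def using assms by (auto intro!: continuous_intros)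
  fix x h
  have eq: "(norm (x + r *\<^sub>R h - z))\<^sup>2 = (norm (x - z))\<^sup>2 + r * (2 * ((x - z) \<bullet> h)) + r\<^sup>2 * (norm h)\<^sup>2" for r
    unfolding power2_norm_eq_inner by (simp add: inner_simps inner_commute power2_eq_square algebra_simps)
  have "((\<lambda>r. 1 - (norm (x + r *\<^sub>R h - z))\<^sup>2 / R\<^sup>2) has_real_derivative - (2 * ((x - z) \<bullet> h)) / R\<^sup>2) (at 0)"
  proof -
    have "((\<lambda>r. 1 - c * (a + r * p + r\<^sup>2 * q)) has_real_derivative - (c * p)) (at 0)" for a c p q :: real
      by (auto intro!: derivative_eq_intros)
    from this[of "1 / R\<^sup>2" "(norm (x - z))\<^sup>2" "2 * ((x - z) \<bullet> h)" "(norm h)\<^sup>2"] show ?thesis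
      unfolding eq by simp
  qed
  from DERIV_chain2[OF max_square_derivative this]
  show "((\<lambda>r. zeta R (x + r *\<^sub>R h - z)) has_real_derivative zeta_grad R (x - z) \<bullet> h) (at 0)"
    unfolding zeta_def zeta_grad_def by (simp add: mult_ac)
qed

lemma zeta_props:
  assumes R: "R > 0"
  shows "zeta R x \<ge> 0" "zeta R x \<le> 1" "x \<notin> cball 0 R \<Longrightarrow> zeta R x = 0" "x \<notin> cball 0 R \<Longrightarrow> zeta_grad R x = 0"
    "norm x \<le> R / 2 \<Longrightarrow> 1 / 2 \<le> zeta R x" "(norm (zeta_grad R x))\<^sup>2 \<le> 16 / R\<^sup>2"
proof -
  show "zeta R x \<ge> 0" by (simp add: zeta_def)
  have m: "max 0 (1 - (norm x)\<^sup>2 / R\<^sup>2) \<le> 1" by simp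
  then show "zeta R x \<le> 1" unfolding zeta_def by (intro power_le_one) auto
  have z: "max 0 (1 - (norm x)\<^sup>2 / R\<^sup>2) = 0" if "x \<notin> cball 0 R"
  proof -
    have "R\<^sup>2 \<le> (norm x)\<^sup>2" using that R by (intro power_mono) auto
    then show ?thesis using R by (simp add: max_def field_simps)
  qed
  show z1: "x \<notin> cball 0 R \<Longrightarrow> zeta R x = 0" and z2: "x \<notin> cball 0 R \<Longrightarrow> zeta_grad R x = 0"
    using z by (auto simp: zeta_def zeta_grad_def)
  show "1 / 2 \<le> zeta R x" if "norm x \<le> R / 2"
  proof -
    have "(norm x)\<^sup>2 \<le> (R / 2)\<^sup>2" using that by (intro power_mono) auto
    then have "(norm x)\<^sup>2 / R\<^sup>2 \<le> 1 / 4" using R by (simp add: power_divide field_simps)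
    then have "3 / 4 \<le> max 0 (1 - (norm x)\<^sup>2 / R\<^sup>2)" by (intro max.coboundedI2) linarith
    then have "(3 / 4)\<^sup>2 \<le> zeta R x" unfolding zeta_def by (rule power_mono) simp
    then show ?thesis by (simp add: power2_eq_square)
  qed
  show "(norm (zeta_grad R x))\<^sup>2 \<le> 16 / R\<^sup>2"
  proof (cases "x \<in> cball 0 R")
    case True
    have "norm (zeta_grad R x) = 4 / R\<^sup>2 * (max 0 (1 - (norm x)\<^sup>2 / R\<^sup>2) * norm x)"
      by (simp add: zeta_grad_def abs_mult)
    also have "\<dots> \<le> 4 / R\<^sup>2 * (1 * R)"
      using True m R by (intro mult_left_mono mult_mono) auto
    also have "\<dots> = 4 / R" using R by (simp add: power2_eq_square)
    finally have "(norm (zeta_grad R x))\<^sup>2 \<le> (4 / R)\<^sup>2" by (intro power_mono) auto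
    then show ?thesis by (simp add: power_divide)
  qed (use z2 in simp)
qed

text \<open>Removes the approximation parameter: estimates for smooth approximants hold with
  explicit continuous bounds in \<delta>, and their values at 0 are the estimates for the
  solution.\<close>

lemma ennreal_le_limit:
  assumes le: "\<And>\<delta>. 0 < \<delta> \<Longrightarrow> \<delta> < 1 \<Longrightarrow> A \<le> ennreal (g \<delta>)" and c: "isCont g (0::real)"
  shows "A \<le> ennreal (g 0)"
proof (rule tendsto_lowerbound[of "\<lambda>\<delta>. ennreal (g \<delta>)" _ "at_right 0"])
  have "(g \<longlongrightarrow> g 0) (at_right 0)" using c by (auto simp: isCont_def filterlim_at_split)
  then show "((\<lambda>\<delta>. ennreal (g \<delta>)) \<longlongrightarrow> ennreal (g 0)) (at_right 0)" by (rule tendsto_ennrealI)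
  show "\<forall>\<^sub>F \<delta> in at_right 0. A \<le> ennreal (g \<delta>)"
    using eventually_at_right_real[of 0 "1::real"]
    by (auto elim!: eventually_mono intro: le)
qed simp

definition exp_moment :: "(real \<times> (real^'d) \<Rightarrow> real) \<Rightarrow> real \<Rightarrow> real \<Rightarrow> real^'d \<Rightarrow> real \<Rightarrow> ennreal" where
  "exp_moment u R m z \<tau> = (\<integral>\<^sup>+x. ennreal (exp (m * u (\<tau>, x)) * (zeta R (x - z))\<^sup>2) \<partial>lborel)"

text \<open>The moment without cutoff is forced by the gradient of the cutoff:
  \<open>(norm (zeta_grad R x))\<^sup>2\<close> is not dominated by a multiple of
  \<open>(zeta R x)\<^sup>2\<close> near the boundary of the ball.\<close>

definition ball_moment :: "(real \<times> (real^'d) \<Rightarrow> real) \<Rightarrow> real \<Rightarrow> real \<Rightarrow> real^'d \<Rightarrow> real \<Rightarrow> ennreal" where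
  "ball_moment u R m z \<tau> = (\<integral>\<^sup>+x. ennreal (exp (m * u (\<tau>, x))) * indicator (cball z R) x \<partial>lborel)"

text \<open>The only form in which the iteration sees the equation. It involves \<open>u\<close> on
  the open time interval alone and passes directly to multiples \<open>c * u\<close> with source
  \<open>c * f\<close>, which the normalisation and the change of sign need.\<close>

definition smooth_approximable ::
  "real \<Rightarrow> (real \<times> (real^'d) \<Rightarrow> real^'d) \<Rightarrow> (real \<times> (real^'d) \<Rightarrow> real) \<Rightarrow> (real \<times> (real^'d) \<Rightarrow> real) \<Rightarrow> bool" where
  "smooth_approximable T b f u \<longleftrightarrow> (\<forall>s t \<delta> \<rho>. 0 < s \<longrightarrow> s \<le> t \<longrightarrow> t < T \<longrightarrow> 0 < \<delta> \<longrightarrow>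
    (\<exists>w wt W H. smooth_fun w wt W H \<and>
    (\<forall>\<tau> x. \<tau> \<in> {s..t} \<longrightarrow> norm x \<le> \<rho> \<longrightarrow> \<bar>w (\<tau>, x) - u (\<tau>, x)\<bar> \<le> \<delta>) \<and>
    (\<integral>\<^sup>+\<tau>. (\<integral>\<^sup>+x. ennreal \<bar>(wt (\<tau>, x) + (\<Sum>i\<in>UNIV. H i (\<tau>, x))) + b (\<tau>, x) \<bullet> W (\<tau>, x) + f (\<tau>, x)\<bar> * indicator (cball 0 \<rho>) x \<partial>lborel) * indicator {s..t} \<tau> \<partial>lborel) \<le> ennreal \<delta>))"

text \<open>The fraction 1/2 adds up a quarter for the drift and a quarter for the source. Half of
  the gradient integral in the energy inequality thus survives and pays for the gain of
  integrability.\<close>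

definition form_bounded ::
  "real \<Rightarrow> (real \<times> (real^'d) \<Rightarrow> real^'d) \<Rightarrow> (real \<times> (real^'d) \<Rightarrow> real) \<Rightarrow> real \<Rightarrow> (real \<Rightarrow> ennreal) \<Rightarrow> bool" where
  "form_bounded T b f m \<kappa> \<longleftrightarrow> \<kappa> \<in> borel_measurable borel \<and> (AE \<tau> in lborel. \<tau> \<in> {0<..<T} \<longrightarrow> (\<forall>y G. C1_grad y G \<longrightarrow>
     (\<integral>\<^sup>+x. ennreal ((norm (b (\<tau>, x)))\<^sup>2 * (y x)\<^sup>2) + ennreal (m * (\<bar>f (\<tau>, x)\<bar> * (y x)\<^sup>2)) \<partial>lborel) \<le>
       ennreal (1/2) * (\<integral>\<^sup>+x. ennreal ((norm (G x))\<^sup>2) \<partial>lborel) + \<kappa> \<tau> * (\<integral>\<^sup>+x. ennreal ((y x)\<^sup>2) \<partial>lborel)))"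

text \<open>A Sobolev-type gain. The exponent \<open>1 + 1/d\<close> is below the parabolic Sobolev
  exponent \<open>1 + 2/d\<close>, but the iteration only needs an exponent above 1.\<close>

definition gain_constant :: "'d::finite itself \<Rightarrow> real \<Rightarrow> bool" where
  "gain_constant _ C \<longleftrightarrow> C > 0 \<and> (\<forall>(y :: real^'d \<Rightarrow> real) G R S. C1_grad y G \<longrightarrow> R > 0 \<longrightarrow> S > 0 \<longrightarrow>
     (\<integral>\<^sup>+x. ennreal ((y x)\<^sup>2) \<partial>lborel) \<le> ennreal S \<longrightarrow>
     (\<integral>\<^sup>+x. ennreal ((y x)\<^sup>2 powr (1 + 1 / CARD('d))) \<partial>lborel) \<le>
       ennreal (C * S powr (1 / CARD('d)) * R) * (\<integral>\<^sup>+x. ennreal ((norm (G x))\<^sup>2) \<partial>lborel) +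
       ennreal (C * S powr (1 / CARD('d)) / R) * (\<integral>\<^sup>+x. ennreal ((y x)\<^sup>2) \<partial>lborel))"

text \<open>Take the weight \<open>g = ((y x)\<^sup>2) powr (1/d)\<close> and exponent
  \<open>d\<close> in \<open>weighted_L2_bound\<close>: the integral of \<open>g powr d\<close> is
  then that of \<open>y\<^sup>2\<close>, and the powers of the radius become \<open>R\<close> and
  \<open>1 / R\<close>.\<close>

lemma exists_gain_constant: "\<exists>C. gain_constant TYPE('d::finite) C"
proof -
  let ?d = "real CARD('d)"
  have p: "?d \<ge> 1" "2 * ?d > real DIM(real^'d)" by simp_all
  obtain C where C: "C > 0"
    "\<And>(y::real^'d \<Rightarrow> real) G g R P. C1_grad y G \<Longrightarrow> g \<in> borel_measurable borel \<Longrightarrow> (\<And>x. g x \<ge> 0) \<Longrightarrow> R > 0 \<Longrightarrow> P > 0 \<Longrightarrow>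
      (\<integral>\<^sup>+x. ennreal (g x powr ?d) \<partial>lborel) \<le> ennreal (P powr ?d) \<Longrightarrow>
      (\<integral>\<^sup>+x. ennreal (g x * (y x)\<^sup>2) \<partial>lborel) \<le>
        ennreal (C * P * R powr (2 - DIM(real^'d) / ?d)) * (\<integral>\<^sup>+x. ennreal ((norm (G x))\<^sup>2) \<partial>lborel) +
        ennreal (C * P * R powr (- (DIM(real^'d) / ?d))) * (\<integral>\<^sup>+x. ennreal ((y x)\<^sup>2) \<partial>lborel)"
    using weighted_L2_bound[OF p] by blast
  have "gain_constant TYPE('d) C"
    unfolding gain_constant_def
  proof (intro conjI allI impI C(1))
    fix y :: "real^'d \<Rightarrow> real" and G and R S :: real
    assume y: "C1_grad y G" and R: "R > 0" and S: "S > 0" and le: "(\<integral>\<^sup>+x. ennreal ((y x)\<^sup>2) \<partial>lborel) \<le> ennreal S"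
    have [measurable]: "y \<in> borel_measurable borel" using y unfolding C1_grad_def by (auto intro: borel_measurable_continuous_onI)
    let ?g = "\<lambda>x. (y x)\<^sup>2 powr (1 / ?d)"
    have g: "?g x powr ?d = (y x)\<^sup>2" for x by (simp add: powr_powr)
    have g2: "?g x * (y x)\<^sup>2 = (y x)\<^sup>2 powr (1 + 1 / ?d)" for x
      by (simp add: powr_add mult.commute)
    have "(\<integral>\<^sup>+x. ennreal (?g x powr ?d) \<partial>lborel) \<le> ennreal ((S powr (1 / ?d)) powr ?d)"
      unfolding g using le S by (simp add: powr_powr)
    from C(2)[OF y _ _ R _ this]
    show "(\<integral>\<^sup>+x. ennreal ((y x)\<^sup>2 powr (1 + 1 / ?d)) \<partial>lborel) \<le>
       ennreal (C * S powr (1 / ?d) * R) * (\<integral>\<^sup>+x. ennreal ((norm (G x))\<^sup>2) \<partial>lborel) +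
       ennreal (C * S powr (1 / ?d) / R) * (\<integral>\<^sup>+x. ennreal ((y x)\<^sup>2) \<partial>lborel)"
      unfolding g2 using R S by (simp add: powr_minus_divide)
  qed
  then show ?thesis by blast
qed


text \<open>The energy inequality for a mollified \<open>w\<close>, with the drift and source terms
  absorbed by the form bound. \<open>y\<close> and \<open>G\<close> belong to \<open>w\<close>;
  passing between \<open>w\<close> and \<open>u\<close> costs factors
  \<open>exp (m * \<delta>)\<close>, and the residual of the equation costs the last summand, which
  vanishes with \<delta>.\<close>

lemma smooth_energy_form_bounded:
  fixes u f :: "real \<times> (real^'d) \<Rightarrow> real" and b :: "real \<times> (real^'d) \<Rightarrow> real^'d"
  assumes [measurable]: "b \<in> borel_measurable borel" "f \<in> borel_measurable borel" "u \<in> borel_measurable borel"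
    and M: "\<And>z. \<bar>u z\<bar> \<le> M" and ap: "smooth_approximable T b f u"
    and R: "R > 0" and m: "m > 0" and st: "0 < s" "s \<le> t" "t < T"
    and fb: "form_bounded T b f m \<kappa>"
    and X: "exp_moment u R m z t + (\<integral>\<^sup>+\<tau>. (ennreal (96 / R\<^sup>2) * ball_moment u R m z \<tau> + \<kappa> \<tau> * exp_moment u R m z \<tau>) * indicator {s..t} \<tau> \<partial>lborel) \<le> ennreal X" "X \<ge> 0"
    and \<delta>: "0 < \<delta>" "\<delta> < 1"
  obtains y G where "\<And>\<tau>. C1_grad (y \<tau>) (G \<tau>)"
    "\<And>\<tau> x. \<tau> \<in> {s..t} \<Longrightarrow> exp (m * u (\<tau>, x)) * (zeta R (x - z))\<^sup>2 \<le> exp (m * \<delta>) * (y \<tau> x)\<^sup>2"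
    "\<And>\<tau> x. \<tau> \<in> {s..t} \<Longrightarrow> (y \<tau> x)\<^sup>2 \<le> exp (m * \<delta>) * (exp (m * u (\<tau>, x)) * (zeta R (x - z))\<^sup>2)"
    "(\<integral>\<^sup>+x. ennreal ((y s x)\<^sup>2) \<partial>lborel) + ennreal (1/2) * (\<integral>\<^sup>+\<tau>. (\<integral>\<^sup>+x. ennreal ((norm (G \<tau> x))\<^sup>2) \<partial>lborel) * indicator {s..t} \<tau> \<partial>lborel)
      \<le> ennreal (exp (m * \<delta>) * X + m * exp (m * (M + 1)) * \<delta>)"
    "(\<lambda>(\<tau>, x). G \<tau> x) \<in> borel_measurable (borel \<Otimes>\<^sub>M borel)"
    "(\<lambda>(\<tau>, x). y \<tau> x) \<in> borel_measurable (borel \<Otimes>\<^sub>M borel)"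
proof -
  have M0: "M \<ge> 0" using M[of undefined] by simp
  \<comment> \<open>The ball of radius \<rho> about 0, on which the approximation is controlled,
    contains the support of the cutoff.\<close>
  define \<rho> where "\<rho> = norm z + R"
  obtain w wt W H where sm: "smooth_fun w wt W H"
    and wu: "\<And>\<tau> x. \<tau> \<in> {s..t} \<Longrightarrow> norm x \<le> \<rho> \<Longrightarrow> \<bar>w (\<tau>, x) - u (\<tau>, x)\<bar> \<le> \<delta>"
    and we: "(\<integral>\<^sup>+\<tau>. (\<integral>\<^sup>+x. ennreal \<bar>(wt (\<tau>, x) + (\<Sum>i\<in>UNIV. H i (\<tau>, x))) + b (\<tau>, x) \<bullet> W (\<tau>, x) + f (\<tau>, x)\<bar> * indicator (cball 0 \<rho>) x \<partial>lborel) * indicator {s..t} \<tau> \<partial>lborel) \<le> ennreal \<delta>"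
    using ap st \<delta>(1) unfolding smooth_approximable_def by blast
  define \<zeta> where "\<zeta> x = zeta R (x - z)" for x
  define Z where "Z x = zeta_grad R (x - z)" for x
  have \<zeta>Z: "C1_grad \<zeta> Z" unfolding \<zeta>_def[abs_def] Z_def[abs_def] by (rule C1_grad_zeta[OF R])
  have ball: "x - z \<in> cball 0 R \<longleftrightarrow> x \<in> cball z R" for x by (auto simp: dist_norm norm_minus_commute)
  have supp: "x \<notin> cball z R \<Longrightarrow> \<zeta> x = 0" "x \<notin> cball z R \<Longrightarrow> Z x = 0" for x
    using zeta_props(3,4)[OF R, of "x - z"] unfolding ball \<zeta>_def Z_def by blast+
  have nx: "norm x \<le> \<rho>" if "x \<in> cball z R" for x
    using that norm_triangle_ineq2[of x z] by (simp add: \<rho>_def dist_norm norm_minus_commute)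
  have \<zeta>01: "0 \<le> \<zeta> x" "\<zeta> x \<le> 1" for x using zeta_props[OF R] by (auto simp: \<zeta>_def)
  have [measurable]: "w \<in> borel_measurable borel" "wt \<in> borel_measurable borel" "W \<in> borel_measurable borel" "\<And>i. H i \<in> borel_measurable borel"
    using sm unfolding smooth_fun_def by (auto intro: borel_measurable_continuous_onI)
  have [measurable]: "\<zeta> \<in> borel_measurable borel" "Z \<in> borel_measurable borel"
    using \<zeta>Z unfolding C1_grad_def by (auto intro: borel_measurable_continuous_onI)
  have m\<kappa>[measurable]: "\<kappa> \<in> borel_measurable borel" using fb unfolding form_bounded_def by blast
  define y where "y \<tau> x = exp (m/2 * w (\<tau>, x)) * \<zeta> x" for \<tau> x
  define G where "G \<tau> x = exp (m/2 * w (\<tau>, x)) *\<^sub>R ((m/2 * \<zeta> x) *\<^sub>R W (\<tau>, x) + Z x)" for \<tau> x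
  have yG: "C1_grad (y \<tau>) (G \<tau>)" for \<tau>
    unfolding y_def[abs_def] G_def[abs_def]
    by (rule C1_grad_test[OF sm \<zeta>Z compact_cball supp m])
  have [measurable]: "(\<lambda>(\<tau>, x). G \<tau> x) \<in> borel_measurable (borel \<Otimes>\<^sub>M borel)" "(\<lambda>(\<tau>, x). y \<tau> x) \<in> borel_measurable (borel \<Otimes>\<^sub>M borel)"
    unfolding y_def G_def by measurable
  have [measurable]: "G \<tau> \<in> borel_measurable borel" "y \<tau> \<in> borel_measurable borel" for \<tau>
    using yG[of \<tau>] unfolding C1_grad_def by (auto intro: borel_measurable_continuous_onI)
  have y2: "(y \<tau> x)\<^sup>2 = exp (m * w (\<tau>, x)) * (\<zeta> x)\<^sup>2" for \<tau> x
    unfolding y_def power_mult_distrib by (simp add: power2_eq_square flip: exp_add)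
  have exp_uw: "exp (m * u (\<tau>, x)) \<le> exp (m * \<delta>) * exp (m * w (\<tau>, x))" "exp (m * w (\<tau>, x)) \<le> exp (m * \<delta>) * exp (m * u (\<tau>, x))"
    if "\<tau> \<in> {s..t}" "x \<in> cball z R" for \<tau> x
  proof -
    have le: "\<bar>w (\<tau>, x) - u (\<tau>, x)\<bar> \<le> \<delta>" using wu that nx by blast
    have "m * u (\<tau>, x) \<le> m * (\<delta> + w (\<tau>, x))" "m * w (\<tau>, x) \<le> m * (\<delta> + u (\<tau>, x))"
      using le m by (auto intro!: mult_left_mono)
    then show "exp (m * u (\<tau>, x)) \<le> exp (m * \<delta>) * exp (m * w (\<tau>, x))" "exp (m * w (\<tau>, x)) \<le> exp (m * \<delta>) * exp (m * u (\<tau>, x))"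
      by (simp_all add: distrib_left flip: exp_add)
  qed
  have yu1: "exp (m * u (\<tau>, x)) * (zeta R (x - z))\<^sup>2 \<le> exp (m * \<delta>) * (y \<tau> x)\<^sup>2" if "\<tau> \<in> {s..t}" for \<tau> x
  proof (cases "x \<in> cball z R")
    case True
    from mult_right_mono[OF exp_uw(1)[OF that True], of "(\<zeta> x)\<^sup>2"] show ?thesis by (simp add: y2 \<zeta>_def mult.assoc)
  qed (use supp in \<open>simp add: \<zeta>_def\<close>)
  have yu2: "(y \<tau> x)\<^sup>2 \<le> exp (m * \<delta>) * (exp (m * u (\<tau>, x)) * (zeta R (x - z))\<^sup>2)" if "\<tau> \<in> {s..t}" for \<tau> x
  proof (cases "x \<in> cball z R")
    case True
    from mult_right_mono[OF exp_uw(2)[OF that True], of "(\<zeta> x)\<^sup>2"] show ?thesis by (simp add: y2 \<zeta>_def mult.assoc)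
  qed (use supp in \<open>simp add: y2 \<zeta>_def\<close>)
  let ?e = "\<lambda>\<tau> x. \<bar>(wt (\<tau>, x) + (\<Sum>i\<in>UNIV. H i (\<tau>, x))) + b (\<tau>, x) \<bullet> W (\<tau>, x) + f (\<tau>, x)\<bar>"
  let ?DD = "\<integral>\<^sup>+\<tau>. (\<integral>\<^sup>+x. ennreal ((norm (G \<tau> x))\<^sup>2) \<partial>lborel) * indicator {s..t} \<tau> \<partial>lborel"
  let ?Y = "\<lambda>\<tau>. \<integral>\<^sup>+x. ennreal ((y \<tau> x)\<^sup>2) \<partial>lborel"
  note en = energy_smooth[OF sm \<zeta>Z compact_cball supp m assms(1,2) st(2), folded G_def, folded y2]
  have DDfin: "?DD < \<infinity>" using en by blast
  have YF: "?Y \<tau> \<le> ennreal (exp (m * \<delta>)) * exp_moment u R m z \<tau>" if "\<tau> \<in> {s..t}" for \<tau>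
    unfolding exp_moment_def
    by (subst nn_integral_cmult[symmetric], measurable)
       (use yu2[OF that] in \<open>auto intro!: nn_integral_mono simp: ennreal_mult'[symmetric] ennreal_leI\<close>)
  have inner: "(\<integral>\<^sup>+x. ennreal (6 * (exp (m * w (\<tau>, x)) * (norm (Z x))\<^sup>2) + (norm (b (\<tau>, x)))\<^sup>2 * (y \<tau> x)\<^sup>2 + m * (\<bar>f (\<tau>, x)\<bar> * (y \<tau> x)\<^sup>2) +
        m * (?e \<tau> x * (y \<tau> x)\<^sup>2)) \<partial>lborel) \<le>
      ennreal (exp (m * \<delta>)) * (ennreal (96 / R\<^sup>2) * ball_moment u R m z \<tau> + \<kappa> \<tau> * exp_moment u R m z \<tau>) + (ennreal (1/2) * (\<integral>\<^sup>+x. ennreal ((norm (G \<tau> x))\<^sup>2) \<partial>lborel) +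
      ennreal (m * exp (m * (M + 1))) * (\<integral>\<^sup>+x. ennreal (?e \<tau> x) * indicator (cball 0 \<rho>) x \<partial>lborel))"
    if \<tau>: "\<tau> \<in> {s..t}" and form: "\<forall>y G. C1_grad y G \<longrightarrow>
     (\<integral>\<^sup>+x. ennreal ((norm (b (\<tau>, x)))\<^sup>2 * (y x)\<^sup>2) + ennreal (m * (\<bar>f (\<tau>, x)\<bar> * (y x)\<^sup>2)) \<partial>lborel) \<le>
       ennreal (1/2) * (\<integral>\<^sup>+x. ennreal ((norm (G x))\<^sup>2) \<partial>lborel) + \<kappa> \<tau> * (\<integral>\<^sup>+x. ennreal ((y x)\<^sup>2) \<partial>lborel)" for \<tau>
  proof -
    \<comment> \<open>96 = 6 * 16: the factor of the cutoff gradient in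
      \<open>energy_pointwise\<close> times its bound \<open>16 / R\<^sup>2\<close>.\<close>
    have eq96: "ennreal (exp (m * \<delta>) * (96 / R\<^sup>2)) = ennreal (exp (m * \<delta>)) * ennreal (96 / R\<^sup>2)"
      by (rule ennreal_mult) auto
    have "(\<integral>\<^sup>+x. ennreal (6 * (exp (m * w (\<tau>, x)) * (norm (Z x))\<^sup>2) + (norm (b (\<tau>, x)))\<^sup>2 * (y \<tau> x)\<^sup>2 + m * (\<bar>f (\<tau>, x)\<bar> * (y \<tau> x)\<^sup>2) +
        m * (?e \<tau> x * (y \<tau> x)\<^sup>2)) \<partial>lborel) \<le>
      (\<integral>\<^sup>+x. ennreal (exp (m * \<delta>) * (96 / R\<^sup>2)) * (ennreal (exp (m * u (\<tau>, x))) * indicator (cball z R) x) +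
         (ennreal ((norm (b (\<tau>, x)))\<^sup>2 * (y \<tau> x)\<^sup>2) + ennreal (m * (\<bar>f (\<tau>, x)\<bar> * (y \<tau> x)\<^sup>2))) +
         ennreal (m * exp (m * (M + 1))) * (ennreal (?e \<tau> x) * indicator (cball 0 \<rho>) x) \<partial>lborel)"
    proof (rule nn_integral_mono)
      fix x
      show "ennreal (6 * (exp (m * w (\<tau>, x)) * (norm (Z x))\<^sup>2) + (norm (b (\<tau>, x)))\<^sup>2 * (y \<tau> x)\<^sup>2 + m * (\<bar>f (\<tau>, x)\<bar> * (y \<tau> x)\<^sup>2) +
        m * (?e \<tau> x * (y \<tau> x)\<^sup>2)) \<le> ennreal (exp (m * \<delta>) * (96 / R\<^sup>2)) * (ennreal (exp (m * u (\<tau>, x))) * indicator (cball z R) x) +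
         (ennreal ((norm (b (\<tau>, x)))\<^sup>2 * (y \<tau> x)\<^sup>2) + ennreal (m * (\<bar>f (\<tau>, x)\<bar> * (y \<tau> x)\<^sup>2))) +
         ennreal (m * exp (m * (M + 1))) * (ennreal (?e \<tau> x) * indicator (cball 0 \<rho>) x)"
      proof (cases "x \<in> cball z R")
        case True
        have "exp (m * w (\<tau>, x)) * (norm (Z x))\<^sup>2 \<le> (exp (m * \<delta>) * exp (m * u (\<tau>, x))) * (16 / R\<^sup>2)"
          using exp_uw(2)[OF \<tau> True] zeta_props(6)[OF R] by (intro mult_mono) (auto simp: Z_def)
        then have "6 * (exp (m * w (\<tau>, x)) * (norm (Z x))\<^sup>2) \<le> 6 * ((exp (m * \<delta>) * exp (m * u (\<tau>, x))) * (16 / R\<^sup>2))"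
          by (rule mult_left_mono) simp
        then have 1: "6 * (exp (m * w (\<tau>, x)) * (norm (Z x))\<^sup>2) \<le> exp (m * \<delta>) * (96 / R\<^sup>2) * exp (m * u (\<tau>, x))"
          by (simp add: mult_ac)
        \<comment> \<open>The bound \<open>M\<close> is used for the residual only, and there a
          factor \<delta> accompanies it.\<close>
        have "w (\<tau>, x) \<le> M + 1" using wu[OF \<tau> nx[OF True]] M[of "(\<tau>, x)"] \<delta>(2) by linarith
        then have "exp (m * w (\<tau>, x)) * (\<zeta> x)\<^sup>2 \<le> exp (m * (M + 1)) * 1"
          using \<zeta>01[of x] m by (intro mult_mono) (auto simp: power_le_one)
        then have "m * (?e \<tau> x * (y \<tau> x)\<^sup>2) \<le> m * (?e \<tau> x * exp (m * (M + 1)))"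
          unfolding y2 using m by (intro mult_left_mono) auto
        then have 2: "m * (?e \<tau> x * (y \<tau> x)\<^sup>2) \<le> m * exp (m * (M + 1)) * ?e \<tau> x" by (simp add: mult_ac)
        have "ennreal (6 * (exp (m * w (\<tau>, x)) * (norm (Z x))\<^sup>2) + (norm (b (\<tau>, x)))\<^sup>2 * (y \<tau> x)\<^sup>2 + m * (\<bar>f (\<tau>, x)\<bar> * (y \<tau> x)\<^sup>2) +
          m * (?e \<tau> x * (y \<tau> x)\<^sup>2)) \<le> ennreal (exp (m * \<delta>) * (96 / R\<^sup>2) * exp (m * u (\<tau>, x)) + ((norm (b (\<tau>, x)))\<^sup>2 * (y \<tau> x)\<^sup>2 + m * (\<bar>f (\<tau>, x)\<bar> * (y \<tau> x)\<^sup>2)) +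
          m * exp (m * (M + 1)) * ?e \<tau> x)"
          using 1 2 by (intro ennreal_leI) linarith
        also have "\<dots> = ennreal (exp (m * \<delta>) * (96 / R\<^sup>2)) * ennreal (exp (m * u (\<tau>, x))) +
         (ennreal ((norm (b (\<tau>, x)))\<^sup>2 * (y \<tau> x)\<^sup>2) + ennreal (m * (\<bar>f (\<tau>, x)\<bar> * (y \<tau> x)\<^sup>2))) +
         ennreal (m * exp (m * (M + 1))) * ennreal (?e \<tau> x)"
          using m by (simp add: ennreal_plus ennreal_mult'[symmetric])
        finally show ?thesis using True nx[OF True] by simp
      next
        case False
        then have "y \<tau> x = 0" "Z x = 0" using supp by (auto simp: y_def)
        then show ?thesis by simp
      qed
    qed
    also have "\<dots> = ennreal (exp (m * \<delta>) * (96 / R\<^sup>2)) * ball_moment u R m z \<tau> +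
        (\<integral>\<^sup>+x. ennreal ((norm (b (\<tau>, x)))\<^sup>2 * (y \<tau> x)\<^sup>2) + ennreal (m * (\<bar>f (\<tau>, x)\<bar> * (y \<tau> x)\<^sup>2)) \<partial>lborel) +
        ennreal (m * exp (m * (M + 1))) * (\<integral>\<^sup>+x. ennreal (?e \<tau> x) * indicator (cball 0 \<rho>) x \<partial>lborel)"
      unfolding ball_moment_def by (simp add: nn_integral_add nn_integral_cmult)
    also have "(\<integral>\<^sup>+x. ennreal ((norm (b (\<tau>, x)))\<^sup>2 * (y \<tau> x)\<^sup>2) + ennreal (m * (\<bar>f (\<tau>, x)\<bar> * (y \<tau> x)\<^sup>2)) \<partial>lborel) \<le>
        ennreal (1/2) * (\<integral>\<^sup>+x. ennreal ((norm (G \<tau> x))\<^sup>2) \<partial>lborel) + \<kappa> \<tau> * ?Y \<tau>"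
      using form yG by blast
    also have "\<kappa> \<tau> * ?Y \<tau> \<le> \<kappa> \<tau> * (ennreal (exp (m * \<delta>)) * exp_moment u R m z \<tau>)"
      by (intro mult_left_mono YF \<tau>) auto
    finally show ?thesis
      unfolding eq96 by (simp add: add_left_mono add_right_mono distrib_left ac_simps)
  qed
  have "?Y s + ?DD \<le> ?Y t + (\<integral>\<^sup>+\<tau>. (\<integral>\<^sup>+x. ennreal (6 * (exp (m * w (\<tau>, x)) * (norm (Z x))\<^sup>2) + (norm (b (\<tau>, x)))\<^sup>2 * (y \<tau> x)\<^sup>2 + m * (\<bar>f (\<tau>, x)\<bar> * (y \<tau> x)\<^sup>2) +
        m * (?e \<tau> x * (y \<tau> x)\<^sup>2)) \<partial>lborel) * indicator {s..t} \<tau> \<partial>lborel)"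
    using en by blast
  also have "\<dots> \<le> ennreal (exp (m * \<delta>)) * exp_moment u R m z t + (\<integral>\<^sup>+\<tau>.
      ennreal (exp (m * \<delta>)) * ((ennreal (96 / R\<^sup>2) * ball_moment u R m z \<tau> + \<kappa> \<tau> * exp_moment u R m z \<tau>) * indicator {s..t} \<tau>) +
      (ennreal (1/2) * ((\<integral>\<^sup>+x. ennreal ((norm (G \<tau> x))\<^sup>2) \<partial>lborel) * indicator {s..t} \<tau>) +
      ennreal (m * exp (m * (M + 1))) * ((\<integral>\<^sup>+x. ennreal (?e \<tau> x) * indicator (cball 0 \<rho>) x \<partial>lborel) * indicator {s..t} \<tau>)) \<partial>lborel)"
  proof (intro add_mono nn_integral_mono_AE YF)
    show "AE \<tau> in lborel. (\<integral>\<^sup>+x. ennreal (6 * (exp (m * w (\<tau>, x)) * (norm (Z x))\<^sup>2) + (norm (b (\<tau>, x)))\<^sup>2 * (y \<tau> x)\<^sup>2 + m * (\<bar>f (\<tau>, x)\<bar> * (y \<tau> x)\<^sup>2) +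
        m * (?e \<tau> x * (y \<tau> x)\<^sup>2)) \<partial>lborel) * indicator {s..t} \<tau> \<le>
      ennreal (exp (m * \<delta>)) * ((ennreal (96 / R\<^sup>2) * ball_moment u R m z \<tau> + \<kappa> \<tau> * exp_moment u R m z \<tau>) * indicator {s..t} \<tau>) +
      (ennreal (1/2) * ((\<integral>\<^sup>+x. ennreal ((norm (G \<tau> x))\<^sup>2) \<partial>lborel) * indicator {s..t} \<tau>) +
      ennreal (m * exp (m * (M + 1))) * ((\<integral>\<^sup>+x. ennreal (?e \<tau> x) * indicator (cball 0 \<rho>) x \<partial>lborel) * indicator {s..t} \<tau>))"
      using fb[unfolded form_bounded_def, THEN conjunct2]
    proof eventually_elim
      case (elim \<tau>)
      show ?case
      proof (cases "\<tau> \<in> {s..t}")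
        case True
        then have "\<tau> \<in> {0<..<T}" using st by auto
        then show ?thesis using inner[OF True] elim True by simp
      qed simp
    qed
  qed (use st in auto)
  also have "\<dots> = (ennreal (exp (m * \<delta>)) * (exp_moment u R m z t + (\<integral>\<^sup>+\<tau>. (ennreal (96 / R\<^sup>2) * ball_moment u R m z \<tau> + \<kappa> \<tau> * exp_moment u R m z \<tau>) * indicator {s..t} \<tau> \<partial>lborel)) +
      ennreal (m * exp (m * (M + 1))) * (\<integral>\<^sup>+\<tau>. (\<integral>\<^sup>+x. ennreal (?e \<tau> x) * indicator (cball 0 \<rho>) x \<partial>lborel) * indicator {s..t} \<tau> \<partial>lborel)) + ennreal (1/2) * ?DD"
    unfolding ball_moment_def exp_moment_def zeta_def
    by (subst nn_integral_add, measurable, subst nn_integral_add, measurable, subst nn_integral_cmult, measurable, subst nn_integral_cmult, measurable,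
        subst nn_integral_cmult, measurable) (simp add: distrib_left ac_simps)
  also have "\<dots> \<le> (ennreal (exp (m * \<delta>)) * ennreal X + ennreal (m * exp (m * (M + 1))) * ennreal \<delta>) + ennreal (1/2) * ?DD"
    by (intro add_mono mult_left_mono X(1) we) auto
  also have "ennreal (exp (m * \<delta>)) * ennreal X + ennreal (m * exp (m * (M + 1))) * ennreal \<delta> = ennreal (exp (m * \<delta>) * X + m * exp (m * (M + 1)) * \<delta>)"
    using m \<delta> X(2) by (simp add: ennreal_plus ennreal_mult'[symmetric])
  finally have fin: "?Y s + ?DD \<le> ennreal (exp (m * \<delta>) * X + m * exp (m * (M + 1)) * \<delta>) + ennreal (1/2) * ?DD" .
  \<comment> \<open>Since the gradient integral is finite, half of it can be subtracted from both
    sides in [0, \<infinity>].\<close>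
  obtain D where D: "?DD = ennreal D" "D \<ge> 0" using DDfin by (cases ?DD) auto
  have half: "ennreal (1/2) * ennreal D = ennreal (D / 2)" using D(2) by (subst ennreal_mult[symmetric]) auto
  have Xd: "exp (m * \<delta>) * X + m * exp (m * (M + 1)) * \<delta> \<ge> 0" using X(2) m \<delta> by simp
  have "?Y s + ennreal (1/2) * ?DD \<le> ennreal (exp (m * \<delta>) * X + m * exp (m * (M + 1)) * \<delta>)"
  proof (cases "?Y s")
    case (real r)
    show ?thesis using fin real Xd D(2) unfolding D(1) half
      by (simp add: ennreal_le_iff flip: ennreal_plus)
  next
    case top
    then show ?thesis using fin unfolding D(1) half by (simp add: ennreal_plus[symmetric] top_unique)
  qed
  then show ?thesis
    using that[OF yG yu1 yu2] by simp
qed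

text \<open>Both conclusions let \<delta> tend to 0 in \<open>smooth_energy_form_bounded\<close>;
  the term with the qualitative bound \<open>M\<close> disappears. The second applies the gain at
  each time and integrates: the supremum \<open>S\<close> of the moment supplies the factor, the
  energy inequality the gradient.\<close>

lemma moser_limit:
  fixes u f :: "real \<times> (real^'d) \<Rightarrow> real" and b :: "real \<times> (real^'d) \<Rightarrow> real^'d"
  assumes meas[measurable]: "b \<in> borel_measurable borel" "f \<in> borel_measurable borel" "u \<in> borel_measurable borel"
    and M: "\<And>z. \<bar>u z\<bar> \<le> M" and ap: "smooth_approximable T b f u"
    and R: "R > 0" and m: "m > 0" and st: "0 < s" "s \<le> t" "t < T"
    and fb: "form_bounded T b f m \<kappa>"
    and X: "exp_moment u R m z t + (\<integral>\<^sup>+\<tau>. (ennreal (96 / R\<^sup>2) * ball_moment u R m z \<tau> + \<kappa> \<tau> * exp_moment u R m z \<tau>) * indicator {s..t} \<tau> \<partial>lborel) \<le> ennreal X" "X \<ge> 0"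
  shows "exp_moment u R m z s \<le> ennreal X"
    and "gain_constant TYPE('d) C \<Longrightarrow> S > 0 \<Longrightarrow> Q \<ge> 0 \<Longrightarrow> (\<And>\<tau>. \<tau> \<in> {s..t} \<Longrightarrow> exp_moment u R m z \<tau> \<le> ennreal S) \<Longrightarrow>
      (\<integral>\<^sup>+\<tau>. exp_moment u R m z \<tau> * indicator {s..t} \<tau> \<partial>lborel) \<le> ennreal Q \<Longrightarrow>
      (\<integral>\<^sup>+\<tau>. (\<integral>\<^sup>+x. ennreal ((exp (m * u (\<tau>, x)) * (zeta R (x - z))\<^sup>2) powr (1 + 1 / CARD('d))) \<partial>lborel) * indicator {s..t} \<tau> \<partial>lborel)
       \<le> ennreal (C * S powr (1 / CARD('d)) * (2 * R * X + Q / R))"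
proof -
  define c where "c = m * exp (m * (M + 1))"
  have c: "c \<ge> 0" using m by (simp add: c_def)
  note se = smooth_energy_form_bounded[OF meas M ap R m st fb X, folded c_def]
  show "exp_moment u R m z s \<le> ennreal X"
  proof -
    have "exp_moment u R m z s \<le> ennreal (exp (m * \<delta>) * (exp (m * \<delta>) * X + c * \<delta>))" if \<delta>: "0 < \<delta>" "\<delta> < 1" for \<delta>
    proof -
      obtain y and G :: "real \<Rightarrow> real^'d \<Rightarrow> real^'d" where yG: "\<And>\<tau>. C1_grad (y \<tau>) (G \<tau>)"
        and y1: "\<And>\<tau> x. \<tau> \<in> {s..t} \<Longrightarrow> exp (m * u (\<tau>, x)) * (zeta R (x - z))\<^sup>2 \<le> exp (m * \<delta>) * (y \<tau> x)\<^sup>2"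
        and en: "(\<integral>\<^sup>+x. ennreal ((y s x)\<^sup>2) \<partial>lborel) + ennreal (1/2) * (\<integral>\<^sup>+\<tau>. (\<integral>\<^sup>+x. ennreal ((norm (G \<tau> x))\<^sup>2) \<partial>lborel) * indicator {s..t} \<tau> \<partial>lborel)
      \<le> ennreal (exp (m * \<delta>) * X + c * \<delta>)"
        by (rule se[OF \<delta>]) blast
      have [measurable]: "y s \<in> borel_measurable borel" using yG[of s] unfolding C1_grad_def by (auto intro: borel_measurable_continuous_onI)
      have "exp_moment u R m z s \<le> (\<integral>\<^sup>+x. ennreal (exp (m * \<delta>)) * ennreal ((y s x)\<^sup>2) \<partial>lborel)"
        unfolding exp_moment_def using y1[of s] st by (auto intro!: nn_integral_mono simp: ennreal_mult'[symmetric] ennreal_leI)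
      also have "\<dots> = ennreal (exp (m * \<delta>)) * (\<integral>\<^sup>+x. ennreal ((y s x)\<^sup>2) \<partial>lborel)" by (simp add: nn_integral_cmult)
      also have "(\<integral>\<^sup>+x. ennreal ((y s x)\<^sup>2) \<partial>lborel) \<le> ennreal (exp (m * \<delta>) * X + c * \<delta>)"
        by (rule order_trans[OF _ en]) simp
      finally show ?thesis by (simp add: ennreal_mult' mult_left_mono)
    qed
    from ennreal_le_limit[of "exp_moment u R m z s" "\<lambda>\<delta>. exp (m * \<delta>) * (exp (m * \<delta>) * X + c * \<delta>)", OF this]
    have "exp_moment u R m z s \<le> ennreal (exp (m * 0) * (exp (m * 0) * X + c * 0))"
      by (auto intro!: continuous_intros)
    then show ?thesis by simp
  qed
  let ?d = "real CARD('d)"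
  define \<gamma> where "\<gamma> = 1 + 1 / ?d"
  have \<gamma>: "\<gamma> > 0" by (simp add: \<gamma>_def add_pos_nonneg)
  assume C: "gain_constant TYPE('d) C" and S: "S > 0" and Q: "Q \<ge> 0"
    and FS: "\<And>\<tau>. \<tau> \<in> {s..t} \<Longrightarrow> exp_moment u R m z \<tau> \<le> ennreal S"
    and FQ: "(\<integral>\<^sup>+\<tau>. exp_moment u R m z \<tau> * indicator {s..t} \<tau> \<partial>lborel) \<le> ennreal Q"
  have C0: "C > 0" using C unfolding gain_constant_def by blast
  let ?I = "\<integral>\<^sup>+\<tau>. (\<integral>\<^sup>+x. ennreal ((exp (m * u (\<tau>, x)) * (zeta R (x - z))\<^sup>2) powr \<gamma>) \<partial>lborel) * indicator {s..t} \<tau> \<partial>lborel"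
  \<comment> \<open>The bound valid for the approximant. The \<open>exp (m * \<delta>)\<close> come
    from comparing \<open>u\<close> with \<open>w\<close>, and the 2 from having only half of the
    gradient integral at disposal.\<close>
  define g where "g \<delta> = exp (m * \<delta> * \<gamma>) * (C * (exp (m * \<delta>) * S) powr (1 / ?d) * R * (2 * (exp (m * \<delta>) * X + c * \<delta>)) +
     C * (exp (m * \<delta>) * S) powr (1 / ?d) / R * (exp (m * \<delta>) * Q))" for \<delta>
  have "?I \<le> ennreal (g \<delta>)" if \<delta>: "0 < \<delta>" "\<delta> < 1" for \<delta>
  proof -
    obtain y and G :: "real \<Rightarrow> real^'d \<Rightarrow> real^'d" where yG: "\<And>\<tau>. C1_grad (y \<tau>) (G \<tau>)"
      and y1: "\<And>\<tau> x. \<tau> \<in> {s..t} \<Longrightarrow> exp (m * u (\<tau>, x)) * (zeta R (x - z))\<^sup>2 \<le> exp (m * \<delta>) * (y \<tau> x)\<^sup>2"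
      and y2: "\<And>\<tau> x. \<tau> \<in> {s..t} \<Longrightarrow> (y \<tau> x)\<^sup>2 \<le> exp (m * \<delta>) * (exp (m * u (\<tau>, x)) * (zeta R (x - z))\<^sup>2)"
      and en: "(\<integral>\<^sup>+x. ennreal ((y s x)\<^sup>2) \<partial>lborel) + ennreal (1/2) * (\<integral>\<^sup>+\<tau>. (\<integral>\<^sup>+x. ennreal ((norm (G \<tau> x))\<^sup>2) \<partial>lborel) * indicator {s..t} \<tau> \<partial>lborel)
    \<le> ennreal (exp (m * \<delta>) * X + c * \<delta>)"
      and [measurable]: "(\<lambda>(\<tau>, x). G \<tau> x) \<in> borel_measurable (borel \<Otimes>\<^sub>M borel)" "(\<lambda>(\<tau>, x). y \<tau> x) \<in> borel_measurable (borel \<Otimes>\<^sub>M borel)"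
      by (rule se[OF \<delta>]) blast
    have [measurable]: "y \<tau> \<in> borel_measurable borel" "G \<tau> \<in> borel_measurable borel" for \<tau>
      using yG[of \<tau>] unfolding C1_grad_def by (auto intro: borel_measurable_continuous_onI)
    let ?S = "exp (m * \<delta>) * S"
    have S': "?S > 0" using S by simp
    let ?c1 = "C * ?S powr (1 / ?d) * R" and ?c2 = "C * ?S powr (1 / ?d) / R"
    have c12: "?c1 \<ge> 0" "?c2 \<ge> 0" using C0 R by auto
    let ?DD = "\<integral>\<^sup>+\<tau>. (\<integral>\<^sup>+x. ennreal ((norm (G \<tau> x))\<^sup>2) \<partial>lborel) * indicator {s..t} \<tau> \<partial>lborel"
    have YF: "(\<integral>\<^sup>+x. ennreal ((y \<tau> x)\<^sup>2) \<partial>lborel) \<le> ennreal (exp (m * \<delta>)) * exp_moment u R m z \<tau>" if "\<tau> \<in> {s..t}" for \<tau>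
      unfolding exp_moment_def
      by (subst nn_integral_cmult[symmetric], measurable)
         (use y2[OF that] in \<open>auto intro!: nn_integral_mono simp: ennreal_mult'[symmetric] ennreal_leI\<close>)
    have YS: "(\<integral>\<^sup>+x. ennreal ((y \<tau> x)\<^sup>2) \<partial>lborel) \<le> ennreal ?S" if "\<tau> \<in> {s..t}" for \<tau>
    proof -
      have "ennreal (exp (m * \<delta>)) * exp_moment u R m z \<tau> \<le> ennreal (exp (m * \<delta>)) * ennreal S"
        by (intro mult_left_mono FS that) auto
      then show ?thesis using YF[OF that] by (simp add: ennreal_mult')
    qed
    have inner: "(\<integral>\<^sup>+x. ennreal ((exp (m * u (\<tau>, x)) * (zeta R (x - z))\<^sup>2) powr \<gamma>) \<partial>lborel) \<le>
       ennreal (exp (m * \<delta> * \<gamma>)) * (ennreal ?c1 * (\<integral>\<^sup>+x. ennreal ((norm (G \<tau> x))\<^sup>2) \<partial>lborel) + ennreal ?c2 * (ennreal (exp (m * \<delta>)) * exp_moment u R m z \<tau>))"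
      if \<tau>: "\<tau> \<in> {s..t}" for \<tau>
    proof -
      have "(\<integral>\<^sup>+x. ennreal ((exp (m * u (\<tau>, x)) * (zeta R (x - z))\<^sup>2) powr \<gamma>) \<partial>lborel) \<le>
         (\<integral>\<^sup>+x. ennreal (exp (m * \<delta> * \<gamma>)) * ennreal ((y \<tau> x)\<^sup>2 powr \<gamma>) \<partial>lborel)"
      proof (rule nn_integral_mono)
        fix x
        have "(exp (m * u (\<tau>, x)) * (zeta R (x - z))\<^sup>2) powr \<gamma> \<le> (exp (m * \<delta>) * (y \<tau> x)\<^sup>2) powr \<gamma>"
          using y1[OF \<tau>] \<gamma> by (intro powr_mono2) auto
        also have "\<dots> = exp (m * \<delta> * \<gamma>) * (y \<tau> x)\<^sup>2 powr \<gamma>"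
          by (simp add: powr_mult exp_powr_real)
        finally show "ennreal ((exp (m * u (\<tau>, x)) * (zeta R (x - z))\<^sup>2) powr \<gamma>) \<le> ennreal (exp (m * \<delta> * \<gamma>)) * ennreal ((y \<tau> x)\<^sup>2 powr \<gamma>)"
          by (simp add: ennreal_mult'[symmetric] ennreal_leI)
      qed
      also have "\<dots> = ennreal (exp (m * \<delta> * \<gamma>)) * (\<integral>\<^sup>+x. ennreal ((y \<tau> x)\<^sup>2 powr \<gamma>) \<partial>lborel)"
        by (simp add: nn_integral_cmult)
      also have "(\<integral>\<^sup>+x. ennreal ((y \<tau> x)\<^sup>2 powr \<gamma>) \<partial>lborel) \<le>
         ennreal ?c1 * (\<integral>\<^sup>+x. ennreal ((norm (G \<tau> x))\<^sup>2) \<partial>lborel) + ennreal ?c2 * (\<integral>\<^sup>+x. ennreal ((y \<tau> x)\<^sup>2) \<partial>lborel)"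
        using C yG[of \<tau>] R S' YS[OF \<tau>] unfolding gain_constant_def \<gamma>_def by blast
      also have "(\<integral>\<^sup>+x. ennreal ((y \<tau> x)\<^sup>2) \<partial>lborel) \<le> ennreal (exp (m * \<delta>)) * exp_moment u R m z \<tau>"
        by (rule YF[OF \<tau>])
      finally show ?thesis by (simp add: mult_left_mono add_left_mono)
    qed
    have "?I \<le> (\<integral>\<^sup>+\<tau>. ennreal (exp (m * \<delta> * \<gamma>)) * (ennreal ?c1 * ((\<integral>\<^sup>+x. ennreal ((norm (G \<tau> x))\<^sup>2) \<partial>lborel) * indicator {s..t} \<tau>) +
        ennreal ?c2 * (ennreal (exp (m * \<delta>)) * (exp_moment u R m z \<tau> * indicator {s..t} \<tau>))) \<partial>lborel)"
    proof (rule nn_integral_mono)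
      fix \<tau>
      show "(\<integral>\<^sup>+x. ennreal ((exp (m * u (\<tau>, x)) * (zeta R (x - z))\<^sup>2) powr \<gamma>) \<partial>lborel) * indicator {s..t} \<tau> \<le>
        ennreal (exp (m * \<delta> * \<gamma>)) * (ennreal ?c1 * ((\<integral>\<^sup>+x. ennreal ((norm (G \<tau> x))\<^sup>2) \<partial>lborel) * indicator {s..t} \<tau>) +
        ennreal ?c2 * (ennreal (exp (m * \<delta>)) * (exp_moment u R m z \<tau> * indicator {s..t} \<tau>)))"
      proof (cases "\<tau> \<in> {s..t}")
        case True
        then show ?thesis using inner[of \<tau>] by (simp only: indicator_simps mult_1_right)
      next
        case False
        then show ?thesis by (simp only: indicator_simps mult_zero_right zero_le not_False_eq_True)
      qed
    qed
    also have "\<dots> = ennreal (exp (m * \<delta> * \<gamma>)) * (ennreal ?c1 * ?DD + ennreal ?c2 * (ennreal (exp (m * \<delta>)) * (\<integral>\<^sup>+\<tau>. exp_moment u R m z \<tau> * indicator {s..t} \<tau> \<partial>lborel)))"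
    proof -
      have [measurable]: "(\<lambda>\<tau>. exp_moment u R m z \<tau>) \<in> borel_measurable borel" unfolding exp_moment_def by measurable
      have [measurable]: "(\<lambda>\<tau>. \<integral>\<^sup>+x. ennreal ((norm (G \<tau> x))\<^sup>2) \<partial>lborel) \<in> borel_measurable borel" by measurable
      show ?thesis
        by (subst nn_integral_cmult, measurable, subst nn_integral_add, measurable, subst nn_integral_cmult, measurable, subst nn_integral_cmult, measurable,
          subst nn_integral_cmult, measurable)
    qed
    also have "\<dots> \<le> ennreal (exp (m * \<delta> * \<gamma>)) * (ennreal ?c1 * ennreal (2 * (exp (m * \<delta>) * X + c * \<delta>)) + ennreal ?c2 * (ennreal (exp (m * \<delta>)) * ennreal Q))"
    proof (intro mult_left_mono add_mono FQ)
      have "ennreal (1/2) * ?DD \<le> ennreal (exp (m * \<delta>) * X + c * \<delta>)"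
        by (rule order_trans[OF _ en]) simp
      then have "ennreal 2 * (ennreal (1/2) * ?DD) \<le> ennreal 2 * ennreal (exp (m * \<delta>) * X + c * \<delta>)"
        by (rule mult_left_mono) simp
      moreover have "ennreal 2 * (ennreal (1/2) * ?DD) = ?DD"
        unfolding mult.assoc[symmetric] ennreal_mult'[symmetric, OF zero_le_numeral] by simp
      moreover have "ennreal 2 * ennreal (exp (m * \<delta>) * X + c * \<delta>) = ennreal (2 * (exp (m * \<delta>) * X + c * \<delta>))"
        by (rule ennreal_mult'[symmetric]) simp
      ultimately show "?DD \<le> ennreal (2 * (exp (m * \<delta>) * X + c * \<delta>))" by simp
    qed auto
    also have "\<dots> = ennreal (g \<delta>)"
    proof -
      have n: "2 * (exp (m * \<delta>) * X + c * \<delta>) \<ge> 0" using X(2) c \<delta> by simp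
      have alg: "ennreal e * (ennreal p * ennreal q + ennreal r * (ennreal e' * ennreal q')) = ennreal (e * (p * q + r * (e' * q')))"
        if "e \<ge> 0" "p \<ge> 0" "q \<ge> 0" "r \<ge> 0" "e' \<ge> 0" "q' \<ge> 0" for e p q r e' q'
        using that by (simp add: ennreal_mult ennreal_plus)
      show ?thesis
        unfolding g_def by (rule alg[OF exp_ge_zero c12(1) n c12(2) exp_ge_zero Q])
    qed
    finally show ?thesis .
  qed
  moreover have "isCont g 0"
    unfolding g_def using S R by (intro continuous_intros) auto
  ultimately have "?I \<le> ennreal (g 0)" by (rule ennreal_le_limit)
  also have "g 0 = C * S powr (1 / ?d) * (2 * R * X + Q / R)"
    by (simp add: g_def distrib_left mult_ac)
  finally show "(\<integral>\<^sup>+\<tau>. (\<integral>\<^sup>+x. ennreal ((exp (m * u (\<tau>, x)) * (zeta R (x - z))\<^sup>2) powr (1 + 1 / CARD('d))) \<partial>lborel) * indicator {s..t} \<tau> \<partial>lborel)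
       \<le> ennreal (C * S powr (1 / CARD('d)) * (2 * R * X + Q / R))"
    unfolding \<gamma>_def .
qed


lemma nn_integral_open_interval_le:
  fixes h :: "real \<Rightarrow> ennreal"
  assumes [measurable]: "h \<in> borel_measurable borel" and T: "T > 0"
    and le: "\<And>s t. 0 < s \<Longrightarrow> s \<le> t \<Longrightarrow> t < T \<Longrightarrow> (\<integral>\<^sup>+\<tau>. h \<tau> * indicator {s..t} \<tau> \<partial>lborel) \<le> c"
  shows "(\<integral>\<^sup>+\<tau>. h \<tau> * indicator {0<..<T} \<tau> \<partial>lborel) \<le> c"
proof -
  \<comment> \<open>The \<open>+ 3\<close> keeps \<open>T / (n + 3)\<close> below
    \<open>T / 2\<close>, so each interval is nonempty, also for \<open>n = 0\<close>.\<close>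
  define A where "A n = {T / (real n + 3)..T - T / (real n + 3)}" for n
  have inc: "incseq A"
    unfolding incseq_Suc_iff A_def using T by (auto simp: field_simps)
  have UN: "(\<Union>n. A n) = {0<..<T}"
  proof (intro set_eqI iffI)
    fix x assume "x \<in> (\<Union>n. A n)"
    then obtain n where n: "T / (real n + 3) \<le> x" "x \<le> T - T / (real n + 3)" by (auto simp: A_def)
    have "T / (real n + 3) > 0" using T by simp
    then show "x \<in> {0<..<T}" using n by auto
  next
    fix x assume x: "x \<in> {0<..<T}"
    define y where "y = min x (T - x)"
    have y: "y > 0" using x by (simp add: y_def)
    obtain n where "T / y < real n" using reals_Archimedean2 by blast
    then have "T < real n * y" using y by (simp add: field_simps)
    also have "\<dots> \<le> (real n + 3) * y" using y by (intro mult_right_mono) auto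
    finally have "T / (real n + 3) \<le> y" by (simp add: field_simps)
    then have "T / (real n + 3) \<le> x" "T / (real n + 3) \<le> T - x" by (auto simp: y_def)
    then show "x \<in> (\<Union>n. A n)" unfolding A_def by (intro UN_I[of n]) auto
  qed
  have "(\<integral>\<^sup>+\<tau>. h \<tau> * indicator {0<..<T} \<tau> \<partial>lborel) = emeasure (density lborel h) (\<Union>n. A n)"
    unfolding UN by (subst emeasure_density) auto
  also have "\<dots> = (SUP n. emeasure (density lborel h) (A n))"
    by (rule SUP_emeasure_incseq[symmetric, OF _ inc]) (auto simp: A_def)
  also have "\<dots> \<le> c"
  proof (rule SUP_least)
    fix n
    have "T / (real n + 3) \<le> T / 2" using T by (intro divide_left_mono) auto
    then have "T / (real n + 3) > 0" "T / (real n + 3) \<le> T - T / (real n + 3)" "T - T / (real n + 3) < T" using T by (auto simp: field_simps)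
    from le[OF this] show "emeasure (density lborel h) (A n) \<le> c"
      unfolding A_def by (subst emeasure_density) auto
  qed
  finally show ?thesis .
qed

text \<open>Mollification needs room before \<open>T\<close>, so the terminal value is reached by a
  limit: near \<open>T\<close> the function is at most \<delta> on the ball, hence its moment is at
  most \<open>exp (m * \<delta>)\<close> times the volume \<open>V\<close>. The gain is then
  extended to the whole open interval by exhaustion.\<close>

lemma moser_terminal:
  fixes u f :: "real \<times> (real^'d) \<Rightarrow> real" and b :: "real \<times> (real^'d) \<Rightarrow> real^'d"
  assumes meas[measurable]: "b \<in> borel_measurable borel" "f \<in> borel_measurable borel" "u \<in> borel_measurable borel"
    and M: "\<And>z. \<bar>u z\<bar> \<le> M" and ap: "smooth_approximable T b f u"
    and T: "T > 0" and R: "R > 0" and m: "m > 0"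
    and fb: "form_bounded T b f m \<kappa>"
    and tm: "\<And>\<delta>. \<delta> > 0 \<Longrightarrow> \<exists>t0<T. \<forall>t\<in>{t0<..<T}. \<forall>x\<in>cball z R. u (t, x) \<le> \<delta>"
  defines "V \<equiv> unit_ball_vol (real CARD('d)) * R ^ CARD('d)"
  shows "0 < s \<Longrightarrow> s < T \<Longrightarrow> exp_moment u R m z s \<le> ennreal V + (\<integral>\<^sup>+\<tau>. (ennreal (96 / R\<^sup>2) * ball_moment u R m z \<tau> + \<kappa> \<tau> * exp_moment u R m z \<tau>) * indicator {s<..<T} \<tau> \<partial>lborel)"
    and "gain_constant TYPE('d) C \<Longrightarrow> S > 0 \<Longrightarrow> Q \<ge> 0 \<Longrightarrow> X \<ge> 0 \<Longrightarrow>
      ennreal V + (\<integral>\<^sup>+\<tau>. (ennreal (96 / R\<^sup>2) * ball_moment u R m z \<tau> + \<kappa> \<tau> * exp_moment u R m z \<tau>) * indicator {0<..<T} \<tau> \<partial>lborel) \<le> ennreal X \<Longrightarrow>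
      (\<And>\<tau>. \<tau> \<in> {0<..<T} \<Longrightarrow> exp_moment u R m z \<tau> \<le> ennreal S) \<Longrightarrow>
      (\<integral>\<^sup>+\<tau>. exp_moment u R m z \<tau> * indicator {0<..<T} \<tau> \<partial>lborel) \<le> ennreal Q \<Longrightarrow>
      (\<integral>\<^sup>+\<tau>. (\<integral>\<^sup>+x. ennreal ((exp (m * u (\<tau>, x)) * (zeta R (x - z))\<^sup>2) powr (1 + 1 / CARD('d))) \<partial>lborel) * indicator {0<..<T} \<tau> \<partial>lborel)
       \<le> ennreal (C * S powr (1 / CARD('d)) * (2 * R * X + Q / R))"
proof -
  have V0: "V \<ge> 0" using R by (simp add: V_def)
  have m\<kappa>[measurable]: "\<kappa> \<in> borel_measurable borel" using fb unfolding form_bounded_def by blast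
  let ?h = "\<lambda>\<tau>. ennreal (96 / R\<^sup>2) * ball_moment u R m z \<tau> + \<kappa> \<tau> * exp_moment u R m z \<tau>"
  have Ft: "exp_moment u R m z t \<le> ennreal (exp (m * \<delta>) * V)" if "\<forall>x\<in>cball z R. u (t, x) \<le> \<delta>" for t \<delta>
  proof -
    have "exp_moment u R m z t \<le> (\<integral>\<^sup>+x. ennreal (exp (m * \<delta>)) * indicator (cball z R) x \<partial>lborel)"
      unfolding exp_moment_def
    proof (rule nn_integral_mono)
      fix x
      show "ennreal (exp (m * u (t, x)) * (zeta R (x - z))\<^sup>2) \<le> ennreal (exp (m * \<delta>)) * indicator (cball z R) x"
      proof (cases "x \<in> cball z R")
        case True
        have "exp (m * u (t, x)) * (zeta R (x - z))\<^sup>2 \<le> exp (m * \<delta>) * 1"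
          using that True m zeta_props(1,2)[OF R, of "x - z"] by (intro mult_mono) (auto simp: power_le_one)
        then show ?thesis using True by (simp add: ennreal_leI)
      next
        case False
        then have "x - z \<notin> cball 0 R" by (auto simp: dist_norm norm_minus_commute)
        from zeta_props(3)[OF R this] show ?thesis by simp
      qed
    qed
    also have "\<dots> = ennreal (exp (m * \<delta>)) * ennreal V"
      using R by (simp add: nn_integral_cmult_indicator emeasure_cball V_def)
    finally show ?thesis by (simp add: ennreal_mult')
  qed
  have premise: "exp_moment u R m z t + (\<integral>\<^sup>+\<tau>. ?h \<tau> * indicator {s..t} \<tau> \<partial>lborel) \<le> ennreal (exp (m * \<delta>) * X)"
    if s: "0 < s" "s \<le> t" "t < T" and u: "\<forall>x\<in>cball z R. u (t, x) \<le> \<delta>" and \<delta>: "\<delta> > 0" and X: "X \<ge> 0"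
      "ennreal V + (\<integral>\<^sup>+\<tau>. ?h \<tau> * indicator {s<..<T} \<tau> \<partial>lborel) \<le> ennreal X" for s t \<delta> X
  proof -
    have "(\<integral>\<^sup>+\<tau>. ?h \<tau> * indicator {s..t} \<tau> \<partial>lborel) \<le> (\<integral>\<^sup>+\<tau>. ?h \<tau> * indicator {s<..<T} \<tau> \<partial>lborel)"
    proof (rule nn_integral_mono_AE, use AE_lborel_singleton[of s] in eventually_elim)
      fix \<tau> assume "\<tau> \<noteq> s"
      then show "?h \<tau> * indicator {s..t} \<tau> \<le> ?h \<tau> * indicator {s<..<T} \<tau>"
        using s by (auto simp: indicator_def)
    qed
    also have "\<dots> \<le> ennreal (exp (m * \<delta>)) * (\<integral>\<^sup>+\<tau>. ?h \<tau> * indicator {s<..<T} \<tau> \<partial>lborel)"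
    proof -
      have "ennreal 1 \<le> ennreal (exp (m * \<delta>))" using m \<delta> by (intro ennreal_leI) simp
      then have "1 * c \<le> ennreal (exp (m * \<delta>)) * c" for c by (intro mult_right_mono) auto
      then show ?thesis by simp
    qed
    finally have "exp_moment u R m z t + (\<integral>\<^sup>+\<tau>. ?h \<tau> * indicator {s..t} \<tau> \<partial>lborel) \<le>
       ennreal (exp (m * \<delta>)) * (ennreal V + (\<integral>\<^sup>+\<tau>. ?h \<tau> * indicator {s<..<T} \<tau> \<partial>lborel))"
      using add_mono[OF Ft[OF u]] by (simp add: distrib_left ennreal_mult')
    also have "\<dots> \<le> ennreal (exp (m * \<delta>)) * ennreal X" by (intro mult_left_mono X) auto
    finally show ?thesis by (simp add: ennreal_mult')
  qed
  show "exp_moment u R m z s \<le> ennreal V + (\<integral>\<^sup>+\<tau>. ?h \<tau> * indicator {s<..<T} \<tau> \<partial>lborel)" if s: "0 < s" "s < T"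
  proof (cases "ennreal V + (\<integral>\<^sup>+\<tau>. ?h \<tau> * indicator {s<..<T} \<tau> \<partial>lborel)")
    case (real X)
    have "exp_moment u R m z s \<le> ennreal (exp (m * \<delta>) * X)" if \<delta>: "0 < \<delta>" "\<delta> < 1" for \<delta>
    proof -
      obtain t0 where t0: "t0 < T" "\<forall>t\<in>{t0<..<T}. \<forall>x\<in>cball z R. u (t, x) \<le> \<delta>" using tm[OF \<delta>(1)] by blast
      obtain t where t: "max s t0 < t" "t < T" using dense[of "max s t0" T] s t0 by auto
      have u: "\<forall>x\<in>cball z R. u (t, x) \<le> \<delta>" using t0 t by auto
      have "exp (m * \<delta>) * X \<ge> 0" using real by simp
      from moser_limit(1)[OF meas M ap R m s(1) _ t(2) fb premise[OF s(1) _ t(2) u \<delta>(1)] this]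
      show ?thesis using t real by auto
    qed
    from ennreal_le_limit[of "exp_moment u R m z s" "\<lambda>\<delta>. exp (m * \<delta>) * X", OF this]
    have "exp_moment u R m z s \<le> ennreal (exp (m * 0) * X)" by (auto intro!: continuous_intros)
    then show ?thesis using real by simp
  qed simp
  assume C: "gain_constant TYPE('d) C" and S: "S > 0" and Q: "Q \<ge> 0" and X: "X \<ge> 0"
    "ennreal V + (\<integral>\<^sup>+\<tau>. ?h \<tau> * indicator {0<..<T} \<tau> \<partial>lborel) \<le> ennreal X"
    and FS: "\<And>\<tau>. \<tau> \<in> {0<..<T} \<Longrightarrow> exp_moment u R m z \<tau> \<le> ennreal S"
    and FQ: "(\<integral>\<^sup>+\<tau>. exp_moment u R m z \<tau> * indicator {0<..<T} \<tau> \<partial>lborel) \<le> ennreal Q"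
  let ?J = "\<lambda>\<tau>. \<integral>\<^sup>+x. ennreal ((exp (m * u (\<tau>, x)) * (zeta R (x - z))\<^sup>2) powr (1 + 1 / CARD('d))) \<partial>lborel"
  show "(\<integral>\<^sup>+\<tau>. ?J \<tau> * indicator {0<..<T} \<tau> \<partial>lborel) \<le> ennreal (C * S powr (1 / CARD('d)) * (2 * R * X + Q / R))"
  proof (rule nn_integral_open_interval_le[OF _ T])
    fix s t assume st: "0 < s" "s \<le> t" "t < T"
    have "(\<integral>\<^sup>+\<tau>. ?J \<tau> * indicator {s..t} \<tau> \<partial>lborel) \<le> ennreal (C * S powr (1 / CARD('d)) * (2 * R * (exp (m * \<delta>) * X) + Q / R))"
      if \<delta>: "0 < \<delta>" "\<delta> < 1" for \<delta>
    proof -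
      obtain t0 where t0: "t0 < T" "\<forall>t\<in>{t0<..<T}. \<forall>x\<in>cball z R. u (t, x) \<le> \<delta>" using tm[OF \<delta>(1)] by blast
      obtain t' where t': "max t t0 < t'" "t' < T" using dense[of "max t t0" T] st t0 by auto
      have u: "\<forall>x\<in>cball z R. u (t', x) \<le> \<delta>" using t0 t' by auto
      have st': "s \<le> t'" using st t' by simp
      have "(\<integral>\<^sup>+\<tau>. ?h \<tau> * indicator {s<..<T} \<tau> \<partial>lborel) \<le> (\<integral>\<^sup>+\<tau>. ?h \<tau> * indicator {0<..<T} \<tau> \<partial>lborel)"
        using st by (intro nn_integral_mono) (auto simp: indicator_def)
      then have X': "ennreal V + (\<integral>\<^sup>+\<tau>. ?h \<tau> * indicator {s<..<T} \<tau> \<partial>lborel) \<le> ennreal X"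
        using X(2) by (meson add_left_mono order_trans)
      have eX: "exp (m * \<delta>) * X \<ge> 0" using X by simp
      have "(\<integral>\<^sup>+\<tau>. exp_moment u R m z \<tau> * indicator {s..t'} \<tau> \<partial>lborel) \<le> (\<integral>\<^sup>+\<tau>. exp_moment u R m z \<tau> * indicator {0<..<T} \<tau> \<partial>lborel)"
        using st t' by (intro nn_integral_mono) (auto simp: indicator_def)
      then have FQ': "(\<integral>\<^sup>+\<tau>. exp_moment u R m z \<tau> * indicator {s..t'} \<tau> \<partial>lborel) \<le> ennreal Q" using FQ by (rule order_trans)
      have "(\<integral>\<^sup>+\<tau>. ?J \<tau> * indicator {s..t} \<tau> \<partial>lborel) \<le> (\<integral>\<^sup>+\<tau>. ?J \<tau> * indicator {s..t'} \<tau> \<partial>lborel)"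
        using t' by (intro nn_integral_mono) (auto simp: indicator_def)
      also have "\<dots> \<le> ennreal (C * S powr (1 / CARD('d)) * (2 * R * (exp (m * \<delta>) * X) + Q / R))"
        by (rule moser_limit(2)[OF meas M ap R m st(1) st' t'(2) fb premise[OF st(1) st' t'(2) u \<delta>(1) X(1) X'] eX C S Q _ FQ'])
           (use FS st t' in auto)
      finally show ?thesis .
    qed
    from ennreal_le_limit[of _ "\<lambda>\<delta>. C * S powr (1 / CARD('d)) * (2 * R * (exp (m * \<delta>) * X) + Q / R)", OF this]
    have "(\<integral>\<^sup>+\<tau>. ?J \<tau> * indicator {s..t} \<tau> \<partial>lborel) \<le> ennreal (C * S powr (1 / CARD('d)) * (2 * R * (exp (m * 0) * X) + Q / R))"
      using R by (auto intro!: continuous_intros)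
    then show "(\<integral>\<^sup>+\<tau>. ?J \<tau> * indicator {s..t} \<tau> \<partial>lborel) \<le> ennreal (C * S powr (1 / CARD('d)) * (2 * R * X + Q / R))" by simp
  qed measurable
qed

section \<open>A Gronwall lemma\<close>

text \<open>The \<nu>-mass of \<open>{r<..<T}\<close> depends continuously on \<open>r\<close> and
  decreases to 0 at \<open>T\<close>, so every intermediate value is attained. This cuts time into
  pieces of prescribed mass.\<close>

lemma exists_time_cut:
  fixes \<nu> :: "real \<Rightarrow> ennreal"
  assumes [measurable]: "\<nu> \<in> borel_measurable borel" and fin: "(\<integral>\<^sup>+\<tau>. \<nu> \<tau> * indicator {0<..<T} \<tau> \<partial>lborel) < \<infinity>"
    and s: "0 < s" "s < T" and \<theta>: "\<theta> > 0" "ennreal \<theta> \<le> (\<integral>\<^sup>+\<tau>. \<nu> \<tau> * indicator {s<..<T} \<tau> \<partial>lborel)"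
  obtains s' where "s \<le> s'" "s' < T" "(\<integral>\<^sup>+\<tau>. \<nu> \<tau> * indicator {s'<..<T} \<tau> \<partial>lborel) = ennreal \<theta>"
proof -
  \<comment> \<open>A real-valued version of \<nu>, which is finite almost everywhere on the
    interval; continuity and the intermediate value theorem are applied to its real
    integral.\<close>
  define l where "l \<tau> = enn2real (\<nu> \<tau> * indicator {0<..<T} \<tau>)" for \<tau>
  have l0: "l \<tau> \<ge> 0" for \<tau> by (simp add: l_def)
  have [measurable]: "l \<in> borel_measurable borel" unfolding l_def[abs_def] by measurable
  have "AE \<tau> in lborel. \<nu> \<tau> * indicator {0<..<T} \<tau> \<noteq> \<infinity>"
    using fin by (intro nn_integral_PInf_AE) auto
  then have AEl: "AE \<tau> in lborel. \<nu> \<tau> * indicator {0<..<T} \<tau> = ennreal (l \<tau>)"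
    by eventually_elim (simp add: l_def less_top)
  have "(\<integral>\<^sup>+\<tau>. ennreal (l \<tau>) \<partial>lborel) = (\<integral>\<^sup>+\<tau>. \<nu> \<tau> * indicator {0<..<T} \<tau> \<partial>lborel)"
    using AEl by (intro nn_integral_cong_AE) auto
  then have il: "integrable lborel l" using fin l0 by (intro integrableI_nonneg) auto
  have sil: "set_integrable lborel A l" if "A \<in> sets borel" for A
    unfolding set_integrable_def using il that by (intro integrable_mult_indicator) auto
  define G where "G r = integral {r..T} l" for r
  have h: "(\<integral>\<^sup>+\<tau>. \<nu> \<tau> * indicator {r<..<T} \<tau> \<partial>lborel) = ennreal (G r)" if r: "0 < r" for r
  proof -
    have "(\<integral>\<^sup>+\<tau>. \<nu> \<tau> * indicator {r<..<T} \<tau> \<partial>lborel) = (\<integral>\<^sup>+\<tau>. ennreal (indicator {r..T} \<tau> *\<^sub>R l \<tau>) \<partial>lborel)"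
      using AEl AE_lborel_singleton[of r] AE_lborel_singleton[of T]
    proof (intro nn_integral_cong_AE, eventually_elim)
      fix \<tau> assume 1: "\<nu> \<tau> * indicator {0<..<T} \<tau> = ennreal (l \<tau>)" "\<tau> \<noteq> r" "\<tau> \<noteq> T"
      show "\<nu> \<tau> * indicator {r<..<T} \<tau> = ennreal (indicator {r..T} \<tau> *\<^sub>R l \<tau>)"
        using 1 r by (cases "\<tau> \<in> {r<..<T}") auto
    qed
    also have "\<dots> = ennreal (LINT \<tau>:{r..T}|lborel. l \<tau>)"
      unfolding set_lebesgue_integral_def
      by (rule nn_integral_eq_integral) (use sil[of "{r..T}"] l0 in \<open>auto simp: set_integrable_def\<close>)
    also have "(LINT \<tau>:{r..T}|lborel. l \<tau>) = G r"
      unfolding G_def by (rule set_borel_integral_eq_integral(2)[OF sil]) simp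
    finally show ?thesis .
  qed
  have io: "l integrable_on {s..T}" by (rule set_borel_integral_eq_integral(1)[OF sil]) simp
  have G_eq: "G r = integral {s..T} l - integral {s..r} l" if "r \<in> {s..T}" for r
    using Henstock_Kurzweil_Integration.integral_combine[of s r T l] that io by (simp add: G_def)
  have "continuous_on {s..T} (\<lambda>r. integral {s..T} l - integral {s..r} l)"
    by (intro continuous_intros indefinite_integral_continuous_1 io)
  then have cG: "continuous_on {s..T} G"
    by (rule continuous_on_eq) (simp add: G_eq)
  have G0: "G r \<ge> 0" for r unfolding G_def by (intro Henstock_Kurzweil_Integration.integral_nonneg set_borel_integral_eq_integral(1)[OF sil]) (auto simp: l0)
  have "G T \<le> \<theta>" using \<theta> by (simp add: G_def)
  moreover have "\<theta> \<le> G s" using \<theta>(2) h[OF s(1)] G0[of s] by simp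
  ultimately obtain s' where s': "s \<le> s'" "s' \<le> T" "G s' = \<theta>"
    using IVT2'[of G T \<theta> s] s cG by auto
  moreover have "s' \<noteq> T" using s'(3) \<theta>(1) by (auto simp: G_def)
  ultimately show ?thesis using that[of s'] h[of s'] s by auto
qed

text \<open>One step per further quarter of the mass of \<nu>. With \<open>c\<close> the previous
  constant, the new one solves \<open>\<Gamma> = H * (1 + B * c + c) + \<Gamma> / 2\<close>:
  \<open>B * c\<close> pays for the integral over later times, and the extra \<open>c\<close> covers
  the estimate at those times themselves.\<close>

primrec gronwall_const :: "real \<Rightarrow> nat \<Rightarrow> real" where
  "gronwall_const B 0 = 2"
| "gronwall_const B (Suc n) = 2 * (1 + B * gronwall_const B n + gronwall_const B n)"

lemma gronwall_const_ge: "B \<ge> 0 \<Longrightarrow> gronwall_const B n \<ge> 2"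
  by (induction n) (auto simp: add_increasing2)

text \<open>The hypothesis is quantified over bounds \<open>g\<close> and \<open>\<Gamma>\<close> valid from time \<open>s\<close> on, so that the
  supremum of the family need not be measurable in time.\<close>

lemma gronwall_family:
  fixes F :: "'i \<Rightarrow> real \<Rightarrow> ennreal" and \<nu> :: "real \<Rightarrow> ennreal"
  assumes B: "B \<ge> 0" and [measurable]: "\<nu> \<in> borel_measurable borel"
    and \<nu>B: "(\<integral>\<^sup>+\<tau>. \<nu> \<tau> * indicator {0<..<T} \<tau> \<partial>lborel) \<le> ennreal B"
    and H: "H \<ge> 0" and bd: "\<And>z \<tau>. \<tau> \<in> {0<..<T} \<Longrightarrow> F z \<tau> \<le> ennreal Smax"
    and step: "\<And>s g \<Gamma> z. 0 < s \<Longrightarrow> s < T \<Longrightarrow> \<Gamma> \<ge> 0 \<Longrightarrow> g \<in> borel_measurable borel \<Longrightarrow> (\<And>z \<tau>. \<tau> \<in> {s..<T} \<Longrightarrow> F z \<tau> \<le> g \<tau>) \<Longrightarrow>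
      (\<And>z \<tau>. \<tau> \<in> {s..<T} \<Longrightarrow> F z \<tau> \<le> ennreal \<Gamma>) \<Longrightarrow>
      F z s \<le> ennreal H + ennreal (\<Gamma> / 4) + (\<integral>\<^sup>+\<tau>. \<nu> \<tau> * g \<tau> * indicator {s<..<T} \<tau> \<partial>lborel)"
    and \<tau>: "\<tau> \<in> {0<..<T}"
  shows "F z \<tau> \<le> ennreal (gronwall_const B (nat \<lceil>4 * B\<rceil>) * H)"
proof -
  let ?h = "\<lambda>s. \<integral>\<^sup>+\<tau>. \<nu> \<tau> * indicator {s<..<T} \<tau> \<partial>lborel"
  have hB: "?h s \<le> ennreal B" if "0 < s" for s
    by (rule order_trans[OF nn_integral_mono \<nu>B]) (use that in \<open>auto simp: indicator_def\<close>)
  have finB: "(\<integral>\<^sup>+\<tau>. \<nu> \<tau> * indicator {0<..<T} \<tau> \<partial>lborel) < \<infinity>"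
    using \<nu>B by (rule order_le_less_trans) simp
  have hmono: "?h r \<le> ?h s" if "s \<le> r" for r s
    using that by (intro nn_integral_mono) (auto simp: indicator_def)
  \<comment> \<open>\<open>enn2real\<close> would turn an infinite supremum into 0; the bound
    \<open>Smax\<close> excludes this. Finiteness permits absorbing half of \<Gamma>, while the size
    of \<open>Smax\<close> does not enter the result.\<close>
  define \<Gamma> where "\<Gamma> s = enn2real (SUP z. SUP \<tau>\<in>{s..<T}. F z \<tau>)" for s
  have \<Gamma>0: "\<Gamma> s \<ge> 0" for s by (simp add: \<Gamma>_def)
  have sup_fin: "(SUP z. SUP \<tau>\<in>{s..<T}. F z \<tau>) \<le> ennreal Smax" if "0 < s" for s
    using that by (intro SUP_least bd) auto
  have \<Gamma>: "F z \<tau> \<le> ennreal (\<Gamma> s)" if "0 < s" "\<tau> \<in> {s..<T}" for s z \<tau>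
  proof -
    have "F z \<tau> \<le> (SUP z. SUP \<tau>\<in>{s..<T}. F z \<tau>)"
      using that by (meson SUP_upper SUP_upper2 UNIV_I order_refl)
    also have "\<dots> = ennreal (\<Gamma> s)"
      unfolding \<Gamma>_def using sup_fin[OF that(1)] by (intro ennreal_enn2real[symmetric]) (auto intro: order_le_less_trans)
    finally show ?thesis .
  qed
  have \<Gamma>_le: "\<Gamma> s \<le> r" if "0 < s" "r \<ge> 0" "\<And>z \<tau>. \<tau> \<in> {s..<T} \<Longrightarrow> F z \<tau> \<le> ennreal r" for s r
  proof -
    have "(SUP z. SUP \<tau>\<in>{s..<T}. F z \<tau>) \<le> ennreal r" by (intro SUP_least that)
    then show ?thesis unfolding \<Gamma>_def using that(2) by (metis enn2real_ennreal enn2real_mono ennreal_less_top)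
  qed
  \<comment> \<open>Induction backwards in time over the remaining \<nu>-mass in quarters. A piece
    of mass at most 1/4 contributes at most \<open>\<Gamma> s / 4\<close>; together with the quarter
    allowed by the hypothesis, half of \<open>\<Gamma> s\<close> is absorbed.\<close>
  have claim: "F z s \<le> ennreal (gronwall_const B n * H)" if "0 < s" "s < T" "?h s \<le> ennreal ((real n + 1) / 4)" for n s z
    using that
  proof (induction n arbitrary: s z)
    case 0
    have "F z \<tau> \<le> ennreal (H + \<Gamma> s / 2)" if \<tau>: "\<tau> \<in> {s..<T}" for z \<tau>
    proof -
      have "F z \<tau> \<le> ennreal H + ennreal (\<Gamma> s / 4) + (\<integral>\<^sup>+\<sigma>. \<nu> \<sigma> * ennreal (\<Gamma> s) * indicator {\<tau><..<T} \<sigma> \<partial>lborel)"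
        by (rule step) (use \<tau> 0 \<Gamma>0 \<Gamma> in auto)
      also have "(\<integral>\<^sup>+\<sigma>. \<nu> \<sigma> * ennreal (\<Gamma> s) * indicator {\<tau><..<T} \<sigma> \<partial>lborel) = ennreal (\<Gamma> s) * ?h \<tau>"
        by (subst nn_integral_cmult[symmetric]) (auto simp: ac_simps)
      also have "ennreal (\<Gamma> s) * ?h \<tau> \<le> ennreal (\<Gamma> s) * ennreal ((real 0 + 1) / 4)"
        using hmono[of s \<tau>] \<tau> 0 by (intro mult_left_mono) (auto intro: order_trans)
      also have "ennreal H + ennreal (\<Gamma> s / 4) + ennreal (\<Gamma> s) * ennreal ((real 0 + 1) / 4) = ennreal (H + \<Gamma> s / 2)"
        using H \<Gamma>0[of s] by (simp add: ennreal_mult[symmetric] ennreal_plus[symmetric] del: ennreal_plus)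
      finally show ?thesis by (simp add: add_left_mono)
    qed
    then have "\<Gamma> s \<le> H + \<Gamma> s / 2" using 0 H \<Gamma>0[of s] by (intro \<Gamma>_le) auto
    then have "\<Gamma> s \<le> gronwall_const B 0 * H" by simp
    then show ?case using \<Gamma>[of s s z] 0 by (auto intro: order_trans ennreal_leI)
  next
    case (Suc n)
    let ?c = "gronwall_const B n"
    have c: "?c \<ge> 2" using gronwall_const_ge[OF B] .
    have cle: "?c * H \<le> gronwall_const B (Suc n) * H" using c B H by (intro mult_right_mono) auto
    show ?case
    proof (cases "?h s \<le> ennreal ((real n + 1) / 4)")
      case True
      then show ?thesis using Suc.IH[OF Suc.prems(1,2)] cle by (meson ennreal_leI order_trans)
    next
      case False
      then have "ennreal ((real n + 1) / 4) \<le> ?h s" by simp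
      then obtain s' where s': "s \<le> s'" "s' < T" "?h s' = ennreal ((real n + 1) / 4)"
        using exists_time_cut[OF _ finB Suc.prems(1,2), of "(real n + 1) / 4"] by auto
      have late: "F z \<tau> \<le> ennreal (?c * H)" if "\<tau> \<in> {s'..<T}" for z \<tau>
      proof (rule Suc.IH)
        show "?h \<tau> \<le> ennreal ((real n + 1) / 4)" using hmono[of s' \<tau>] that s'(3) by auto
      qed (use that s' Suc.prems in auto)
      have split: "?h s = (\<integral>\<^sup>+\<sigma>. \<nu> \<sigma> * indicator {s<..<s'} \<sigma> \<partial>lborel) + ?h s'"
      proof -
        have "?h s = (\<integral>\<^sup>+\<sigma>. \<nu> \<sigma> * indicator {s<..<s'} \<sigma> + \<nu> \<sigma> * indicator {s'<..<T} \<sigma> \<partial>lborel)"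
          by (rule nn_integral_cong_AE, use AE_lborel_singleton[of s'] in eventually_elim)
             (use s' in \<open>auto simp: indicator_def\<close>)
        then show ?thesis by (simp add: nn_integral_add)
      qed
      have early: "(\<integral>\<^sup>+\<sigma>. \<nu> \<sigma> * indicator {s<..<s'} \<sigma> \<partial>lborel) \<le> ennreal (1 / 4)"
      proof -
        have "(\<integral>\<^sup>+\<sigma>. \<nu> \<sigma> * indicator {s<..<s'} \<sigma> \<partial>lborel) + ennreal ((real n + 1) / 4) \<le> ennreal (1 / 4) + ennreal ((real n + 1) / 4)"
        proof -
          have "ennreal (1 / 4) + ennreal ((real n + 1) / 4) = ennreal ((real (Suc n) + 1) / 4)"
            by (subst ennreal_plus[symmetric]) (auto simp: field_simps)
          then show ?thesis using Suc.prems(3) unfolding split s'(3) by simp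
        qed
        then show ?thesis
          unfolding add.commute[of _ "ennreal ((real n + 1) / 4)"] by (simp add: ennreal_add_left_cancel_le)
      qed
      have Fb: "F z \<tau> \<le> ennreal (H * (1 + B * ?c + ?c) + \<Gamma> s / 2)" if \<tau>: "\<tau> \<in> {s..<T}" for z \<tau>
      proof (cases "\<tau> < s'")
        case True
        \<comment> \<open>The step majorant: the unknown supremum before the cut, where \<nu> has
          mass at most 1/4, and the bound from the induction hypothesis after it.\<close>
        define g where "g \<sigma> = (if \<sigma> < s' then ennreal (\<Gamma> s) else ennreal (?c * H))" for \<sigma>
        have [measurable]: "g \<in> borel_measurable borel" unfolding g_def by measurable
        have "F z \<tau> \<le> ennreal H + ennreal (\<Gamma> s / 4) + (\<integral>\<^sup>+\<sigma>. \<nu> \<sigma> * g \<sigma> * indicator {\<tau><..<T} \<sigma> \<partial>lborel)"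
          by (rule step) (use \<tau> Suc.prems \<Gamma>0 \<Gamma> late in \<open>auto simp: g_def\<close>)
        also have "(\<integral>\<^sup>+\<sigma>. \<nu> \<sigma> * g \<sigma> * indicator {\<tau><..<T} \<sigma> \<partial>lborel) \<le>
            (\<integral>\<^sup>+\<sigma>. ennreal (\<Gamma> s) * (\<nu> \<sigma> * indicator {s<..<s'} \<sigma>) + ennreal (?c * H) * (\<nu> \<sigma> * indicator {s'<..<T} \<sigma>) \<partial>lborel)"
          by (rule nn_integral_mono_AE, use AE_lborel_singleton[of s'] in eventually_elim)
             (use \<tau> True in \<open>auto simp: indicator_def g_def mult.commute\<close>)
        also have "\<dots> = ennreal (\<Gamma> s) * (\<integral>\<^sup>+\<sigma>. \<nu> \<sigma> * indicator {s<..<s'} \<sigma> \<partial>lborel) + ennreal (?c * H) * ?h s'"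
          by (simp add: nn_integral_add nn_integral_cmult)
        also have "\<dots> \<le> ennreal (\<Gamma> s) * ennreal (1 / 4) + ennreal (?c * H) * ennreal B"
          using hB[of s'] s' Suc.prems by (intro add_mono mult_left_mono early) auto
        also have "ennreal H + ennreal (\<Gamma> s / 4) + (ennreal (\<Gamma> s) * ennreal (1 / 4) + ennreal (?c * H) * ennreal B) =
            ennreal (H + \<Gamma> s / 2 + ?c * H * B)"
          using H \<Gamma>0[of s] c B by (simp add: ennreal_mult[symmetric] ennreal_plus[symmetric] del: ennreal_plus)
        finally have "F z \<tau> \<le> ennreal (H + \<Gamma> s / 2 + ?c * H * B)" by (simp add: add_left_mono)
        also have "\<dots> \<le> ennreal (H * (1 + B * ?c + ?c) + \<Gamma> s / 2)"
          using c H B by (intro ennreal_leI) (simp add: algebra_simps)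
        finally show ?thesis .
      next
        case False
        then have "F z \<tau> \<le> ennreal (?c * H)" using late \<tau> by auto
        also have "\<dots> \<le> ennreal (H * (1 + B * ?c + ?c) + \<Gamma> s / 2)"
          using c H B \<Gamma>0[of s] by (intro ennreal_leI) (simp add: algebra_simps)
        finally show ?thesis .
      qed
      have "H * (1 + B * ?c + ?c) + \<Gamma> s / 2 \<ge> 0" using H B c \<Gamma>0[of s] by simp
      from \<Gamma>_le[OF Suc.prems(1) this Fb] have "\<Gamma> s \<le> gronwall_const B (Suc n) * H" by (simp add: algebra_simps)
      then show ?thesis using \<Gamma>[of s s z] Suc.prems by (auto intro: order_trans ennreal_leI)
    qed
  qed
  show ?thesis
  proof (rule claim)
    have "?h \<tau> \<le> ennreal B" using hB \<tau> by auto
    also have "\<dots> \<le> ennreal ((real (nat \<lceil>4 * B\<rceil>) + 1) / 4)"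
      using real_nat_ceiling_ge[of "4 * B"] by (intro ennreal_leI) simp
    finally show "?h \<tau> \<le> ennreal ((real (nat \<lceil>4 * B\<rceil>) + 1) / 4)" .
  qed (use \<tau> in auto)
qed

section \<open>Covering a ball by half balls\<close>

lemma exists_half_ball_cover:
  obtains P :: "(real^'d) set" where "finite P" "P \<noteq> {}" "cball 0 1 \<subseteq> (\<Union>c\<in>P. cball c (1/2))"
proof -
  have "compact (cball (0::real^'d) 1)" by simp
  moreover have "cball (0::real^'d) 1 \<subseteq> (\<Union>c\<in>UNIV. ball c (1/2))"
  proof
    fix x :: "real^'d"
    have "x \<in> ball x (1/2)" by simp
    then show "x \<in> (\<Union>c\<in>UNIV. ball c (1/2))" by blast
  qed
  ultimately obtain P :: "(real^'d) set" where P: "finite P" "cball 0 1 \<subseteq> (\<Union>c\<in>P. ball c (1/2))"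
    using compactE_image[of "cball (0::real^'d) 1" UNIV "\<lambda>c. ball c (1/2)"] by (metis open_ball subset_UNIV)
  moreover have "P \<noteq> {}"
  proof
    assume "P = {}"
    then have "cball (0::real^'d) 1 = {}" using P(2) by simp
    then show False by simp
  qed
  moreover have "cball (0::real^'d) 1 \<subseteq> (\<Union>c\<in>P. cball c (1/2))"
    by (rule order_trans[OF P(2)]) (intro UN_mono order_refl ball_subset_cball)
  ultimately show ?thesis using that by blast
qed

text \<open>Scaling and translating one fixed cover of the unit ball gives covers whose number of
  balls does not depend on \<open>R\<close> or \<open>z\<close>. Half balls are used because the
  cutoff is bounded below there.\<close>

lemma nn_integral_half_ball_cover:
  fixes h :: "real^'d \<Rightarrow> ennreal"
  assumes P: "finite P" "cball 0 1 \<subseteq> (\<Union>c\<in>P. cball c (1/2))" and R: "R > 0" and [measurable]: "h \<in> borel_measurable borel"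
  shows "(\<integral>\<^sup>+x. h x * indicator (cball z R) x \<partial>lborel) \<le> (\<Sum>c\<in>P. \<integral>\<^sup>+x. h x * indicator (cball (z + R *\<^sub>R c) (R / 2)) x \<partial>lborel)"
proof -
  have "h x * indicator (cball z R) x \<le> (\<Sum>c\<in>P. h x * indicator (cball (z + R *\<^sub>R c) (R / 2)) x)" for x
  proof (cases "x \<in> cball z R")
    case True
    then have "(1 / R) *\<^sub>R (x - z) \<in> cball 0 1" using R by (simp add: dist_norm norm_minus_commute)
    then obtain c where c: "c \<in> P" "(1 / R) *\<^sub>R (x - z) \<in> cball c (1/2)" using P(2) by blast
    have "z + R *\<^sub>R c - x = R *\<^sub>R (c - (1 / R) *\<^sub>R (x - z))" using R by (simp add: scaleR_diff_right)
    then have "norm (z + R *\<^sub>R c - x) = R * norm (c - (1 / R) *\<^sub>R (x - z))" using R by simp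
    also have "\<dots> \<le> R * (1 / 2)" using c(2) R by (intro mult_left_mono) (auto simp: dist_norm)
    finally have "x \<in> cball (z + R *\<^sub>R c) (R / 2)" by (simp add: dist_norm)
    then have "h x * indicator (cball z R) x = h x * indicator (cball (z + R *\<^sub>R c) (R / 2)) x" using True by simp
    also have "\<dots> \<le> (\<Sum>c\<in>P. h x * indicator (cball (z + R *\<^sub>R c) (R / 2)) x)"
      using P(1) c(1) by (intro member_le_sum) auto
    finally show ?thesis .
  qed simp
  then have "(\<integral>\<^sup>+x. h x * indicator (cball z R) x \<partial>lborel) \<le> (\<integral>\<^sup>+x. (\<Sum>c\<in>P. h x * indicator (cball (z + R *\<^sub>R c) (R / 2)) x) \<partial>lborel)"
    by (intro nn_integral_mono) auto
  also have "\<dots> = (\<Sum>c\<in>P. \<integral>\<^sup>+x. h x * indicator (cball (z + R *\<^sub>R c) (R / 2)) x \<partial>lborel)"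
    by (rule nn_integral_sum) measurable
  finally show ?thesis .
qed

section \<open>Moser iteration\<close>

text \<open>The hypothesis relating \<open>\<phi>\<close> and \<open>\<psi>\<close> is the pointwise form of \<open>\<psi> = \<phi>\<^sup>\<rho>\<close> that the proof uses.\<close>

definition moser_data ::
  "real \<Rightarrow> real \<Rightarrow> real \<Rightarrow> real \<Rightarrow> real \<Rightarrow> real \<Rightarrow> (real \<times> (real^'d) \<Rightarrow> real) \<Rightarrow> (real \<times> (real^'d) \<Rightarrow> real^'d) \<Rightarrow>
    (real \<times> (real^'d) \<Rightarrow> real) \<Rightarrow> (real \<Rightarrow> ennreal) \<Rightarrow> (real \<Rightarrow> ennreal) \<Rightarrow> (real \<Rightarrow> ennreal) \<Rightarrow> bool" where
  "moser_data T M B L a \<rho> u b f \<beta> \<phi> \<psi> \<longleftrightarrow>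
     0 < T \<and> b \<in> borel_measurable borel \<and> f \<in> borel_measurable borel \<and> u \<in> borel_measurable borel \<and>
     (\<forall>z. \<bar>u z\<bar> \<le> M) \<and> smooth_approximable T b f u \<and>
     (\<forall>z R \<delta>. \<delta> > 0 \<longrightarrow> (\<exists>t0<T. \<forall>t\<in>{t0<..<T}. \<forall>x\<in>cball z R. u (t, x) \<le> \<delta>)) \<and>
     \<beta> \<in> borel_measurable borel \<and> \<phi> \<in> borel_measurable borel \<and> \<psi> \<in> borel_measurable borel \<and>
     (\<integral>\<^sup>+\<tau>. \<beta> \<tau> * indicator {0<..<T} \<tau> \<partial>lborel) \<le> ennreal B \<and>
     (\<forall>m\<ge>1. form_bounded T b f m (\<lambda>\<tau>. \<beta> \<tau> + ennreal (m powr a) * \<phi> \<tau>)) \<and>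
     (\<forall>\<mu>>0. \<forall>\<tau>. \<phi> \<tau> \<le> ennreal \<mu> + ennreal (\<mu> powr (1 - \<rho>)) * \<psi> \<tau>) \<and>
     (\<integral>\<^sup>+\<tau>. \<psi> \<tau> * indicator {0<..<T} \<tau> \<partial>lborel) \<le> ennreal (L * T powr (1 - \<rho>))"

text \<open>Normalised by the volume, up to a constant of the dimension, of the parabolic cylinder
  of height \<open>T\<close> and radius \<open>sqrt T\<close>, so that \<open>A\<close> is scale
  invariant. All centres must share one \<open>A\<close> for the covering argument.\<close>

definition cylinder_bound :: "real \<Rightarrow> (real \<times> (real^'d) \<Rightarrow> real) \<Rightarrow> real \<Rightarrow> real \<Rightarrow> bool" where
  "cylinder_bound T u m A \<longleftrightarrow>
     (\<forall>z. (\<integral>\<^sup>+\<tau>. ball_moment u (sqrt T) m z \<tau> * indicator {0<..<T} \<tau> \<partial>lborel) \<le> ennreal (A * T * sqrt T ^ CARD('d)))"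

lemma measurable_exp_moment [measurable]:
  assumes [measurable]: "u \<in> borel_measurable borel"
  shows "exp_moment u R m z \<in> borel_measurable borel"
  unfolding exp_moment_def[abs_def] by measurable

lemma measurable_ball_moment [measurable]:
  assumes [measurable]: "u \<in> borel_measurable borel"
  shows "ball_moment u R m z \<in> borel_measurable borel"
  unfolding ball_moment_def[abs_def] by measurable

lemma exp_moment_le_ball_moment:
  assumes R: "R > 0"
  shows "exp_moment u R m z \<tau> \<le> ball_moment u R m z \<tau>"
  unfolding exp_moment_def ball_moment_def
proof (rule nn_integral_mono)
  fix x
  show "ennreal (exp (m * u (\<tau>, x)) * (zeta R (x - z))\<^sup>2) \<le> ennreal (exp (m * u (\<tau>, x))) * indicator (cball z R) x"
  proof (cases "x \<in> cball z R")
    case True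
    have "(zeta R (x - z))\<^sup>2 \<le> 1" using zeta_props(1,2)[OF R] by (intro power_le_one) auto
    then show ?thesis using True by (simp add: ennreal_leI mult_left_le)
  next
    case False
    then have "x - z \<notin> cball 0 R" by (auto simp: dist_norm norm_minus_commute)
    from zeta_props(3)[OF R this] show ?thesis by simp
  qed
qed

text \<open>A qualitative bound depending on \<open>M\<close>; it only guarantees that the suprema
  in \<open>gronwall_family\<close> are finite.\<close>

lemma ball_moment_bounded:
  fixes u :: "real \<times> (real^'d) \<Rightarrow> real"
  assumes R: "R > 0" and m: "m \<ge> 0" and M: "\<And>z. \<bar>u z\<bar> \<le> M"
  shows "ball_moment u R m z \<tau> \<le> ennreal (exp (m * M) * (unit_ball_vol (real CARD('d)) * R ^ CARD('d)))"
proof -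
  have "ball_moment u R m z \<tau> \<le> (\<integral>\<^sup>+x. ennreal (exp (m * M)) * indicator (cball z R) x \<partial>lborel)"
    unfolding ball_moment_def
  proof (intro nn_integral_mono mult_right_mono ennreal_leI)
    show "exp (m * u (\<tau>, x)) \<le> exp (m * M)" for x
      using M[of "(\<tau>, x)"] m by (simp add: mult_left_mono)
  qed auto
  also have "\<dots> = ennreal (exp (m * M)) * ennreal (unit_ball_vol (real CARD('d)) * R ^ CARD('d))"
    using R by (simp add: nn_integral_cmult_indicator emeasure_cball)
  finally show ?thesis by (simp add: ennreal_mult')
qed

lemma half_ball_zeta:
  assumes R: "R > 0" and x: "x \<in> cball z (R / 2)"
  shows "1 / 4 \<le> (zeta R (x - z))\<^sup>2"
proof -
  have "1 / 2 \<le> zeta R (x - z)" using zeta_props(5)[OF R] x by (simp add: dist_norm norm_minus_commute)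
  from power_mono[OF this, of 2] show ?thesis by (simp add: power2_eq_square)
qed

text \<open>The squared cutoff is at least 1/4 on each half ball, whence \<open>4 powr p\<close>.
  Used with \<open>p = 1\<close> to return from cutoff moments to full balls, and with
  \<open>p = 1 + 1/d\<close> to read the gain of integrability as a ball moment with exponent
  \<open>m * p\<close>.\<close>

lemma ball_moment_cover:
  fixes u :: "real \<times> (real^'d) \<Rightarrow> real"
  assumes P: "finite P" "cball 0 1 \<subseteq> (\<Union>c\<in>P. cball c (1/2))" and R: "R > 0" and [measurable]: "u \<in> borel_measurable borel"
    and p: "p > 0"
  shows "ball_moment u R (m * p) z \<tau> \<le> (\<Sum>c\<in>P. ennreal (4 powr p) * (\<integral>\<^sup>+x. ennreal ((exp (m * u (\<tau>, x)) * (zeta R (x - (z + R *\<^sub>R c)))\<^sup>2) powr p) \<partial>lborel))"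
proof -
  have "ball_moment u R (m * p) z \<tau> \<le> (\<Sum>c\<in>P. \<integral>\<^sup>+x. ennreal (exp (m * p * u (\<tau>, x))) * indicator (cball (z + R *\<^sub>R c) (R / 2)) x \<partial>lborel)"
    unfolding ball_moment_def by (rule nn_integral_half_ball_cover[OF P R]) measurable
  also have "\<dots> \<le> (\<Sum>c\<in>P. ennreal (4 powr p) * (\<integral>\<^sup>+x. ennreal ((exp (m * u (\<tau>, x)) * (zeta R (x - (z + R *\<^sub>R c)))\<^sup>2) powr p) \<partial>lborel))"
  proof (rule sum_mono)
    fix c
    let ?z = "z + R *\<^sub>R c"
    have "(\<integral>\<^sup>+x. ennreal (exp (m * p * u (\<tau>, x))) * indicator (cball ?z (R / 2)) x \<partial>lborel) \<le>
      (\<integral>\<^sup>+x. ennreal (4 powr p) * ennreal ((exp (m * u (\<tau>, x)) * (zeta R (x - ?z))\<^sup>2) powr p) \<partial>lborel)"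
    proof (rule nn_integral_mono)
      fix x
      show "ennreal (exp (m * p * u (\<tau>, x))) * indicator (cball ?z (R / 2)) x \<le>
        ennreal (4 powr p) * ennreal ((exp (m * u (\<tau>, x)) * (zeta R (x - ?z))\<^sup>2) powr p)"
      proof (cases "x \<in> cball ?z (R / 2)")
        case True
        have "exp (m * u (\<tau>, x)) * 1 \<le> exp (m * u (\<tau>, x)) * (4 * (zeta R (x - ?z))\<^sup>2)"
          using half_ball_zeta[OF R True] by (intro mult_left_mono) auto
        then have "exp (m * u (\<tau>, x)) powr p \<le> (4 * (exp (m * u (\<tau>, x)) * (zeta R (x - ?z))\<^sup>2)) powr p"
          using p by (intro powr_mono2) (auto simp: mult_ac)
        then have "exp (m * p * u (\<tau>, x)) \<le> 4 powr p * (exp (m * u (\<tau>, x)) * (zeta R (x - ?z))\<^sup>2) powr p"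
          by (simp add: powr_mult exp_powr_real mult_ac)
        then show ?thesis using True by (simp add: ennreal_leI ennreal_mult'[symmetric])
      qed simp
    qed
    also have "\<dots> = ennreal (4 powr p) * (\<integral>\<^sup>+x. ennreal ((exp (m * u (\<tau>, x)) * (zeta R (x - ?z))\<^sup>2) powr p) \<partial>lborel)"
      by (rule nn_integral_cmult) measurable
    finally show "(\<integral>\<^sup>+x. ennreal (exp (m * p * u (\<tau>, x))) * indicator (cball ?z (R / 2)) x \<partial>lborel) \<le> \<dots>" .
  qed
  finally show ?thesis .
qed

text \<open>Splitting \<phi> by its Young-type hypothesis at level \<open>W / T\<close> pairs the
  constant part with the integral of \<open>h\<close> and the \<psi>-part with its supremum. The
  choice \<open>W / T\<close> cancels all powers of \<open>T\<close> against the normalisation of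
  \<psi>, and large \<open>W\<close> makes the factor of the supremum small since
  \<open>\<rho> > 1\<close>.\<close>

lemma source_term_bound:
  assumes "moser_data T M B L a \<rho> u b f \<beta> \<phi> \<psi>" and W: "W > 0" and [measurable]: "h \<in> borel_measurable borel"
    and L: "L \<ge> 0" and s: "0 \<le> s" and \<Gamma>: "\<Gamma> \<ge> 0" "\<And>\<tau>. \<tau> \<in> {s<..<T} \<Longrightarrow> h \<tau> \<le> ennreal \<Gamma>"
    and q: "q \<ge> 0" "(\<integral>\<^sup>+\<tau>. h \<tau> * indicator {s<..<T} \<tau> \<partial>lborel) \<le> ennreal q"
  shows "(\<integral>\<^sup>+\<tau>. \<phi> \<tau> * h \<tau> * indicator {s<..<T} \<tau> \<partial>lborel) \<le> ennreal (W / T * q + W powr (1 - \<rho>) * L * \<Gamma>)"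
proof -
  have T: "T > 0" and [measurable]: "\<phi> \<in> borel_measurable borel" "\<psi> \<in> borel_measurable borel"
    and y: "\<And>\<mu> \<tau>. \<mu> > 0 \<Longrightarrow> \<phi> \<tau> \<le> ennreal \<mu> + ennreal (\<mu> powr (1 - \<rho>)) * \<psi> \<tau>"
    and \<psi>: "(\<integral>\<^sup>+\<tau>. \<psi> \<tau> * indicator {0<..<T} \<tau> \<partial>lborel) \<le> ennreal (L * T powr (1 - \<rho>))"
    using assms(1) unfolding moser_data_def by auto
  let ?\<mu> = "W / T"
  have \<mu>: "?\<mu> > 0" using W T by simp
  have "(\<integral>\<^sup>+\<tau>. \<phi> \<tau> * h \<tau> * indicator {s<..<T} \<tau> \<partial>lborel) \<le>
     (\<integral>\<^sup>+\<tau>. ennreal ?\<mu> * (h \<tau> * indicator {s<..<T} \<tau>) + ennreal (?\<mu> powr (1 - \<rho>)) * (ennreal \<Gamma> * (\<psi> \<tau> * indicator {0<..<T} \<tau>)) \<partial>lborel)"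
  proof (rule nn_integral_mono)
    fix \<tau>
    show "\<phi> \<tau> * h \<tau> * indicator {s<..<T} \<tau> \<le> ennreal ?\<mu> * (h \<tau> * indicator {s<..<T} \<tau>) + ennreal (?\<mu> powr (1 - \<rho>)) * (ennreal \<Gamma> * (\<psi> \<tau> * indicator {0<..<T} \<tau>))"
    proof (cases "\<tau> \<in> {s<..<T}")
      case True
      have "\<phi> \<tau> * h \<tau> \<le> (ennreal ?\<mu> + ennreal (?\<mu> powr (1 - \<rho>)) * \<psi> \<tau>) * h \<tau>"
        by (intro mult_right_mono y \<mu>) auto
      also have "\<dots> = ennreal ?\<mu> * h \<tau> + ennreal (?\<mu> powr (1 - \<rho>)) * \<psi> \<tau> * h \<tau>" by (rule distrib_right)
      also have "\<dots> \<le> ennreal ?\<mu> * h \<tau> + ennreal (?\<mu> powr (1 - \<rho>)) * \<psi> \<tau> * ennreal \<Gamma>"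
        by (intro add_left_mono mult_left_mono \<Gamma> True) auto
      finally show ?thesis using True s by (simp add: mult_ac)
    qed simp
  qed
  also have "\<dots> = ennreal ?\<mu> * (\<integral>\<^sup>+\<tau>. h \<tau> * indicator {s<..<T} \<tau> \<partial>lborel) +
     ennreal (?\<mu> powr (1 - \<rho>)) * (ennreal \<Gamma> * (\<integral>\<^sup>+\<tau>. \<psi> \<tau> * indicator {0<..<T} \<tau> \<partial>lborel))"
    by (simp add: nn_integral_add nn_integral_cmult)
  also have "\<dots> \<le> ennreal ?\<mu> * ennreal q + ennreal (?\<mu> powr (1 - \<rho>)) * (ennreal \<Gamma> * ennreal (L * T powr (1 - \<rho>)))"
    by (intro add_mono mult_left_mono q \<psi>) auto
  also have "\<dots> = ennreal (?\<mu> * q + ?\<mu> powr (1 - \<rho>) * (\<Gamma> * (L * T powr (1 - \<rho>))))"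
  proof -
    have "ennreal x1 * ennreal x2 + ennreal x3 * (ennreal x4 * ennreal x5) = ennreal (x1 * x2 + x3 * (x4 * x5))"
      if "x1 \<ge> 0" "x2 \<ge> 0" "x3 \<ge> 0" "x4 \<ge> 0" "x5 \<ge> 0" for x1 x2 x3 x4 x5
      using that by (simp add: ennreal_mult ennreal_plus)
    then show ?thesis using \<mu> W T q(1) \<Gamma>(1) L by (simp add: ennreal_plus)
  qed
  also have "?\<mu> powr (1 - \<rho>) * (\<Gamma> * (L * T powr (1 - \<rho>))) = W powr (1 - \<rho>) * L * \<Gamma>"
    using W T by (simp add: powr_divide)
  finally show ?thesis .
qed

text \<open>The parabolic radius \<open>sqrt T\<close> turns the cutoff factor
  \<open>96 / R\<^sup>2\<close> into \<open>96 / T\<close>, which integrates over the time interval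
  to a number free of \<open>T\<close>.\<close>

lemma exp_moment_inequality:
  assumes md: "moser_data T M B L a \<rho> u b f \<beta> \<phi> \<psi>" and m: "m \<ge> 1" and s: "0 < s" "s < T"
  fixes z :: "real^'d"
  shows "exp_moment u (sqrt T) m z s \<le> ennreal (unit_ball_vol (real CARD('d)) * sqrt T ^ CARD('d)) +
    (ennreal (96 / T) * (\<integral>\<^sup>+\<tau>. ball_moment u (sqrt T) m z \<tau> * indicator {s<..<T} \<tau> \<partial>lborel) +
     (\<integral>\<^sup>+\<tau>. \<beta> \<tau> * exp_moment u (sqrt T) m z \<tau> * indicator {s<..<T} \<tau> \<partial>lborel) +
     ennreal (m powr a) * (\<integral>\<^sup>+\<tau>. \<phi> \<tau> * exp_moment u (sqrt T) m z \<tau> * indicator {s<..<T} \<tau> \<partial>lborel))"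
proof -
  have T: "T > 0" and [measurable]: "b \<in> borel_measurable borel" "f \<in> borel_measurable borel" "u \<in> borel_measurable borel"
    "\<beta> \<in> borel_measurable borel" "\<phi> \<in> borel_measurable borel"
    and M: "\<And>z. \<bar>u z\<bar> \<le> M" and ap: "smooth_approximable T b f u"
    and tm: "\<And>z R \<delta>. \<delta> > 0 \<Longrightarrow> \<exists>t0<T. \<forall>t\<in>{t0<..<T}. \<forall>x\<in>cball z R. u (t, x) \<le> \<delta>"
    and fb: "form_bounded T b f m (\<lambda>\<tau>. \<beta> \<tau> + ennreal (m powr a) * \<phi> \<tau>)"
    using md m unfolding moser_data_def by auto
  have R: "sqrt T > 0" using T by simp
  have m0: "m > 0" using m by simp
  have "exp_moment u (sqrt T) m z s \<le> ennreal (unit_ball_vol (real CARD('d)) * sqrt T ^ CARD('d)) +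
    (\<integral>\<^sup>+\<tau>. (ennreal (96 / (sqrt T)\<^sup>2) * ball_moment u (sqrt T) m z \<tau> + (\<beta> \<tau> + ennreal (m powr a) * \<phi> \<tau>) * exp_moment u (sqrt T) m z \<tau>) * indicator {s<..<T} \<tau> \<partial>lborel)"
    by (rule moser_terminal(1)[OF _ _ _ M ap T R m0 fb tm s]) measurable
  also have "(\<integral>\<^sup>+\<tau>. (ennreal (96 / (sqrt T)\<^sup>2) * ball_moment u (sqrt T) m z \<tau> + (\<beta> \<tau> + ennreal (m powr a) * \<phi> \<tau>) * exp_moment u (sqrt T) m z \<tau>) * indicator {s<..<T} \<tau> \<partial>lborel) =
    (\<integral>\<^sup>+\<tau>. ennreal (96 / T) * (ball_moment u (sqrt T) m z \<tau> * indicator {s<..<T} \<tau>) + \<beta> \<tau> * exp_moment u (sqrt T) m z \<tau> * indicator {s<..<T} \<tau> +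
      ennreal (m powr a) * (\<phi> \<tau> * exp_moment u (sqrt T) m z \<tau> * indicator {s<..<T} \<tau>) \<partial>lborel)"
    using T by (intro nn_integral_cong) (simp add: distrib_right mult.assoc add.assoc)
  also have "\<dots> = ennreal (96 / T) * (\<integral>\<^sup>+\<tau>. ball_moment u (sqrt T) m z \<tau> * indicator {s<..<T} \<tau> \<partial>lborel) +
     (\<integral>\<^sup>+\<tau>. \<beta> \<tau> * exp_moment u (sqrt T) m z \<tau> * indicator {s<..<T} \<tau> \<partial>lborel) +
     ennreal (m powr a) * (\<integral>\<^sup>+\<tau>. \<phi> \<tau> * exp_moment u (sqrt T) m z \<tau> * indicator {s<..<T} \<tau> \<partial>lborel)"
    by (simp add: nn_integral_add nn_integral_cmult)
  finally show ?thesis .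
qed


text \<open>At \<open>m = 1\<close> no cylinder bound is available, so the ball moment is fed back
  through the covering and the cutoff and source terms join the drift in the Gronwall weight. For
  large \<open>m\<close> this would put \<open>m powr a\<close> into that weight, which is why the
  iteration step treats these terms differently.\<close>

lemma moser_base:
  assumes L: "L \<ge> 0" and B: "B \<ge> 0"
  shows "\<exists>A\<ge>1. \<forall>T M (u :: real \<times> (real^'d) \<Rightarrow> real) b f \<beta> \<phi> \<psi>.
    moser_data T M B L a \<rho> u b f \<beta> \<phi> \<psi> \<longrightarrow> cylinder_bound T u 1 A"
proof -
  obtain P :: "(real^'d) set" where P: "finite P" "P \<noteq> {}" "cball 0 1 \<subseteq> (\<Union>c\<in>P. cball c (1/2))"
    by (rule exists_half_ball_cover)
  define N where "N = real (card P)"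
  have N: "N \<ge> 0" by (simp add: N_def)
  define v where "v = unit_ball_vol (real CARD('d))"
  have v: "v \<ge> 0" by (simp add: v_def)
  \<comment> \<open>Total Gronwall mass: 384 = 96 * 4, with 4 from the squared cutoff on half balls
    and \<open>N\<close> the size of the cover; \<open>B\<close> from the drift;
    \<open>1 + L\<close> from \<open>source_term_bound\<close> with \<open>W = 1\<close>.\<close>
  define B1 where "B1 = 384 * N + B + (1 + L)"
  have B1: "B1 \<ge> 0" using N B L by (simp add: B1_def)
  define c where "c = gronwall_const B1 (nat \<lceil>4 * B1\<rceil>)"
  have c: "c \<ge> 0" using gronwall_const_ge[OF B1] by (auto simp: c_def intro: order_trans[of 0 2])
  show ?thesis
  proof (rule exI[of _ "max 1 (4 * N * c * v)"], intro conjI allI impI)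
    fix T M b f \<beta> \<phi> \<psi> and u :: "real \<times> (real^'d) \<Rightarrow> real"
    assume md: "moser_data T M B L a \<rho> u b f \<beta> \<phi> \<psi>"
    have T: "T > 0" and [measurable]: "b \<in> borel_measurable borel" "f \<in> borel_measurable borel" "u \<in> borel_measurable borel"
      "\<beta> \<in> borel_measurable borel" "\<phi> \<in> borel_measurable borel"
      and M: "\<And>z. \<bar>u z\<bar> \<le> M" and \<beta>B: "(\<integral>\<^sup>+\<tau>. \<beta> \<tau> * indicator {0<..<T} \<tau> \<partial>lborel) \<le> ennreal B"
      using md unfolding moser_data_def by auto
    define R where "R = sqrt T"
    have R: "R > 0" using T by (simp add: R_def)
    define H where "H = v * R ^ CARD('d)"
    have H: "H \<ge> 0" using v R by (simp add: H_def)
    define \<nu> where "\<nu> \<tau> = ennreal (384 * N / T) + \<beta> \<tau> + \<phi> \<tau>" for \<tau>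
    have [measurable]: "\<nu> \<in> borel_measurable borel" unfolding \<nu>_def[abs_def] by measurable
    have \<phi>1: "(\<integral>\<^sup>+\<tau>. \<phi> \<tau> * indicator {0<..<T} \<tau> \<partial>lborel) \<le> ennreal (1 + L)"
      using source_term_bound[OF md, of 1 "\<lambda>_. 1" 0 1 T] L T by (simp add: nn_integral_cmult_indicator)
    have \<nu>B: "(\<integral>\<^sup>+\<tau>. \<nu> \<tau> * indicator {0<..<T} \<tau> \<partial>lborel) \<le> ennreal B1"
    proof -
      have "(\<integral>\<^sup>+\<tau>. \<nu> \<tau> * indicator {0<..<T} \<tau> \<partial>lborel) =
        (\<integral>\<^sup>+\<tau>. ennreal (384 * N / T) * indicator {0<..<T} \<tau> + \<beta> \<tau> * indicator {0<..<T} \<tau> + \<phi> \<tau> * indicator {0<..<T} \<tau> \<partial>lborel)"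
        by (intro nn_integral_cong) (simp add: \<nu>_def distrib_right)
      also have "\<dots> = ennreal (384 * N / T) * ennreal T + (\<integral>\<^sup>+\<tau>. \<beta> \<tau> * indicator {0<..<T} \<tau> \<partial>lborel) + (\<integral>\<^sup>+\<tau>. \<phi> \<tau> * indicator {0<..<T} \<tau> \<partial>lborel)"
        using T by (simp add: nn_integral_add nn_integral_cmult_indicator)
      also have "\<dots> \<le> ennreal (384 * N) + ennreal B + ennreal (1 + L)"
        using T N by (intro add_mono \<beta>B \<phi>1) (simp add: ennreal_mult[symmetric])
      also have "\<dots> = ennreal B1"
        using N B L by (simp add: B1_def ennreal_plus[symmetric] del: ennreal_plus)
      finally show ?thesis .
    qed
    have EF: "ball_moment u R 1 z \<tau> \<le> ennreal (4 * N) * g" if "\<And>z. exp_moment u R 1 z \<tau> \<le> g" for z \<tau> g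
    proof -
      have "ball_moment u R (1 * 1) z \<tau> \<le> (\<Sum>c\<in>P. ennreal (4 powr 1) * (\<integral>\<^sup>+x. ennreal ((exp (1 * u (\<tau>, x)) * (zeta R (x - (z + R *\<^sub>R c)))\<^sup>2) powr 1) \<partial>lborel))"
        by (rule ball_moment_cover[OF P(1,3) R]) auto
      also have "\<dots> = (\<Sum>c\<in>P. 4 * exp_moment u R 1 (z + R *\<^sub>R c) \<tau>)"
        by (simp add: exp_moment_def)
      also have "\<dots> \<le> (\<Sum>c\<in>P. 4 * g)" by (intro sum_mono mult_left_mono that) auto
      also have "\<dots> = ennreal (4 * N) * g"
        by (simp add: N_def ennreal_mult' ennreal_of_nat_eq_real_of_nat mult_ac)
      finally show ?thesis by simp
    qed
    have Fb: "exp_moment u R 1 z \<tau> \<le> ennreal (c * H)" if \<tau>: "\<tau> \<in> {0<..<T}" for z \<tau>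
      unfolding c_def
    proof (rule gronwall_family[where F = "exp_moment u R 1", OF B1 _ \<nu>B H _ _ \<tau>])
      show "\<nu> \<in> borel_measurable borel" by measurable
      show "exp_moment u R 1 z \<tau> \<le> ennreal (exp (1 * M) * (unit_ball_vol (real CARD('d)) * R ^ CARD('d)))" for z \<tau>
        by (rule order_trans[OF exp_moment_le_ball_moment[OF R] ball_moment_bounded[OF R _ M]]) simp
      fix s g \<Gamma> z
      assume s: "0 < s" "s < T" and [measurable]: "g \<in> borel_measurable borel" and Fg: "\<And>z \<tau>. \<tau> \<in> {s..<T} \<Longrightarrow> exp_moment u R 1 z \<tau> \<le> g \<tau>"
      have "exp_moment u R 1 z s \<le> ennreal H + (ennreal (96 / T) * (\<integral>\<^sup>+\<tau>. ball_moment u R 1 z \<tau> * indicator {s<..<T} \<tau> \<partial>lborel) +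
         (\<integral>\<^sup>+\<tau>. \<beta> \<tau> * exp_moment u R 1 z \<tau> * indicator {s<..<T} \<tau> \<partial>lborel) +
         (\<integral>\<^sup>+\<tau>. \<phi> \<tau> * exp_moment u R 1 z \<tau> * indicator {s<..<T} \<tau> \<partial>lborel))"
        using exp_moment_inequality[OF md order_refl s, of z] by (simp add: R_def H_def v_def)
      also have "\<dots> \<le> ennreal H + (ennreal (96 / T) * (\<integral>\<^sup>+\<tau>. ennreal (4 * N) * g \<tau> * indicator {s<..<T} \<tau> \<partial>lborel) +
         (\<integral>\<^sup>+\<tau>. \<beta> \<tau> * g \<tau> * indicator {s<..<T} \<tau> \<partial>lborel) +
         (\<integral>\<^sup>+\<tau>. \<phi> \<tau> * g \<tau> * indicator {s<..<T} \<tau> \<partial>lborel))"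
        by (intro add_left_mono add_mono mult_left_mono nn_integral_mono)
           (auto simp: indicator_def intro!: mult_left_mono EF Fg)
      also have "\<dots> = ennreal H + (\<integral>\<^sup>+\<tau>. \<nu> \<tau> * g \<tau> * indicator {s<..<T} \<tau> \<partial>lborel)"
      proof -
        have "(\<integral>\<^sup>+\<tau>. \<nu> \<tau> * g \<tau> * indicator {s<..<T} \<tau> \<partial>lborel) =
          (\<integral>\<^sup>+\<tau>. ennreal (96 / T) * (ennreal (4 * N) * g \<tau> * indicator {s<..<T} \<tau>) + \<beta> \<tau> * g \<tau> * indicator {s<..<T} \<tau> + \<phi> \<tau> * g \<tau> * indicator {s<..<T} \<tau> \<partial>lborel)"
        proof (intro nn_integral_cong)
          fix \<tau>
          have "ennreal (384 * N / T) = ennreal (96 / T) * ennreal (4 * N)"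
            using T N by (subst ennreal_mult[symmetric]) auto
          then show "\<nu> \<tau> * g \<tau> * indicator {s<..<T} \<tau> = ennreal (96 / T) * (ennreal (4 * N) * g \<tau> * indicator {s<..<T} \<tau>) + \<beta> \<tau> * g \<tau> * indicator {s<..<T} \<tau> + \<phi> \<tau> * g \<tau> * indicator {s<..<T} \<tau>"
            unfolding \<nu>_def by (simp only: distrib_right mult.assoc)
        qed
        then show ?thesis by (simp add: nn_integral_add nn_integral_cmult)
      qed
      also have "\<dots> \<le> ennreal H + ennreal (\<Gamma> / 4) + (\<integral>\<^sup>+\<tau>. \<nu> \<tau> * g \<tau> * indicator {s<..<T} \<tau> \<partial>lborel)"
        by (intro add_right_mono) simp
      finally show "exp_moment u R 1 z s \<le> ennreal H + ennreal (\<Gamma> / 4) + (\<integral>\<^sup>+\<tau>. \<nu> \<tau> * g \<tau> * indicator {s<..<T} \<tau> \<partial>lborel)" .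
    qed
    show "cylinder_bound T u 1 (max 1 (4 * N * c * v))"
      unfolding cylinder_bound_def R_def[symmetric]
    proof
      fix z
      have "(\<integral>\<^sup>+\<tau>. ball_moment u R 1 z \<tau> * indicator {0<..<T} \<tau> \<partial>lborel) \<le> (\<integral>\<^sup>+\<tau>. ennreal (4 * N) * ennreal (c * H) * indicator {0<..<T} \<tau> \<partial>lborel)"
        by (rule nn_integral_mono) (auto simp: indicator_def intro!: EF Fb)
      also have "\<dots> = ennreal (4 * N) * ennreal (c * H) * ennreal T"
        using T by (simp add: nn_integral_cmult_indicator)
      also have "\<dots> = ennreal (4 * N * (c * H) * T)"
        using N c H T by (simp add: ennreal_mult)
      also have "\<dots> \<le> ennreal (max 1 (4 * N * c * v) * T * R ^ CARD('d))"
      proof (rule ennreal_leI)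
        have "4 * N * (c * H) * T = (4 * N * c * v) * (T * R ^ CARD('d))" by (simp add: H_def)
        also have "\<dots> \<le> max 1 (4 * N * c * v) * (T * R ^ CARD('d))" using T R by (intro mult_right_mono) auto
        finally show "4 * N * (c * H) * T \<le> max 1 (4 * N * c * v) * T * R ^ CARD('d)" by (simp add: mult.assoc)
      qed
      finally show "(\<integral>\<^sup>+\<tau>. ball_moment u R 1 z \<tau> * indicator {0<..<T} \<tau> \<partial>lborel) \<le> ennreal (max 1 (4 * N * c * v) * T * R ^ CARD('d))" .
    qed
  qed simp
qed

text \<open>Gronwall runs with the drift weight \<beta> alone, so its constant is the same for all
  \<open>m\<close>. The cutoff term is controlled by the given cylinder bound, and the source by
  that bound times a power of \<open>m\<close> plus a quarter of the supremum. The gain then raises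
  the exponent and the covering returns to full balls.\<close>

lemma moser_step:
  assumes L: "L \<ge> 0" and B: "B \<ge> 0" and a: "a \<ge> 0" and \<rho>: "\<rho> > 1"
  shows "\<exists>C\<ge>1. \<exists>c\<ge>0. \<forall>T M (u :: real \<times> (real^'d) \<Rightarrow> real) b f \<beta> \<phi> \<psi> m A.
    moser_data T M B L a \<rho> u b f \<beta> \<phi> \<psi> \<longrightarrow> 1 \<le> m \<longrightarrow> 1 \<le> A \<longrightarrow> cylinder_bound T u m A \<longrightarrow>
    cylinder_bound T u (m * (1 + 1 / CARD('d))) (C * (A * m powr c) powr (1 + 1 / CARD('d)))"
proof -
  let ?d = "real CARD('d)"
  obtain P :: "(real^'d) set" where P: "finite P" "P \<noteq> {}" "cball 0 1 \<subseteq> (\<Union>c\<in>P. cball c (1/2))"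
    by (rule exists_half_ball_cover)
  obtain Cg where Cg: "gain_constant TYPE('d) Cg" using exists_gain_constant by blast
  have Cg0: "Cg > 0" using Cg unfolding gain_constant_def by blast
  define N where "N = real (card P)"
  have N: "N \<ge> 0" by (simp add: N_def)
  define p where "p = 1 + 1 / ?d"
  have p: "p > 1" by (simp add: p_def)
  define v where "v = unit_ball_vol ?d"
  have v: "v \<ge> 0" by (simp add: v_def)
  \<comment> \<open>The exponent of \<open>m\<close> in \<open>m powr a * W\<close>, where
    \<open>W\<close> grows like \<open>m powr (a / (\<rho> - 1))\<close>.\<close>
  define c where "c = a + a / (\<rho> - 1)"
  have c: "c \<ge> 0" using a \<rho> by (simp add: c_def)
  define w0 where "w0 = (4 * (L + 1)) powr (1 / (\<rho> - 1))"
  have w0: "w0 \<ge> 0" by (simp add: w0_def)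
  define h0 where "h0 = v + 96 + w0"
  have h0: "h0 \<ge> 96" using v w0 by (simp add: h0_def)
  define cB where "cB = gronwall_const B (nat \<lceil>4 * B\<rceil>)"
  have cB: "cB \<ge> 2" using gronwall_const_ge[OF B] by (simp add: cB_def)
  \<comment> \<open>In the last factor, \<open>2 * X\<close> contributes
    \<open>2 + cB / 2 + 2 * B * cB\<close> in units of \<open>H\<close>, and the zeroth-order term
    of the gain at most 1.\<close>
  define c2 where "c2 = Cg * (cB * h0) powr (1 / ?d) * h0 * (3 + cB / 2 + 2 * B * cB)"
  have c2: "c2 \<ge> 0" using Cg0 h0 cB B by (simp add: c2_def)
  show ?thesis
  proof (rule exI[of _ "max 1 (N * 4 powr p * c2)"], intro conjI, simp, rule exI[of _ c], intro conjI allI impI, rule c)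
    fix T M b f \<beta> \<phi> \<psi> m A and u :: "real \<times> (real^'d) \<Rightarrow> real"
    assume md: "moser_data T M B L a \<rho> u b f \<beta> \<phi> \<psi>" and m: "1 \<le> m" and A: "1 \<le> A" and cyl: "cylinder_bound T u m A"
    have T: "T > 0" and meas[measurable]: "b \<in> borel_measurable borel" "f \<in> borel_measurable borel" "u \<in> borel_measurable borel"
      and m2[measurable]: "\<beta> \<in> borel_measurable borel" "\<phi> \<in> borel_measurable borel"
      and M: "\<And>z. \<bar>u z\<bar> \<le> M" and ap: "smooth_approximable T b f u"
      and tm: "\<And>z R \<delta>. \<delta> > 0 \<Longrightarrow> \<exists>t0<T. \<forall>t\<in>{t0<..<T}. \<forall>x\<in>cball z R. u (t, x) \<le> \<delta>"
      and \<beta>B: "(\<integral>\<^sup>+\<tau>. \<beta> \<tau> * indicator {0<..<T} \<tau> \<partial>lborel) \<le> ennreal B"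
      and fb: "form_bounded T b f m (\<lambda>\<tau>. \<beta> \<tau> + ennreal (m powr a) * \<phi> \<tau>)"
      using md m unfolding moser_data_def by auto
    have m0: "m > 0" using m by simp
    define R where "R = sqrt T"
    have R: "R > 0" using T by (simp add: R_def)
    have RR: "R * R = T" using T by (simp add: R_def)
    define V where "V = R ^ CARD('d)"
    have V: "V > 0" using R by (simp add: V_def)
    have mc: "m powr c \<ge> 1" using m c by (simp add: ge_one_powr_ge_zero)
    define Am where "Am = A * m powr c"
    have Am: "Am \<ge> 1" "A \<le> Am" using A mc mult_mono[of 1 A 1 "m powr c"] mult_left_mono[OF mc, of A] by (auto simp: Am_def)
    \<comment> \<open>chosen so that the source contributes at most a quarter of \<open>\<Gamma>\<close>, see \<open>mWL\<close>\<close>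
    define W where "W = (4 * (L + 1) * m powr a) powr (1 / (\<rho> - 1))"
    have W: "W > 0" using L m by (simp add: W_def)
    have mW: "m powr a * W = w0 * m powr c"
      using L m by (simp add: W_def w0_def c_def powr_mult powr_powr powr_add)
    have mWL: "m powr a * (W powr (1 - \<rho>) * L) \<le> 1 / 4"
    proof -
      have "1 / (\<rho> - 1) * (1 - \<rho>) = - 1" using \<rho> by (simp add: field_simps)
      then have "W powr (1 - \<rho>) = 1 / (4 * (L + 1) * m powr a)"
        using L m by (simp add: W_def powr_powr powr_minus_divide)
      then have "m powr a * (W powr (1 - \<rho>) * L) = L / (4 * (L + 1))" using m by simp
      also have "\<dots> \<le> 1 / 4" using L by (simp add: field_simps)
      finally show ?thesis .
    qed
    define H where "H = V * h0 * Am"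
    have H: "H \<ge> 0" using V h0 Am by (simp add: H_def)
    have H2: "v * V + 96 * A * V + m powr a * (W * A * V) \<le> H"
    proof -
      have "v * V + 96 * A * V + m powr a * (W * A * V) = V * (v + 96 * A + w0 * (A * m powr c))"
        using mW by (simp add: algebra_simps)
      also have "\<dots> \<le> V * (v * Am + 96 * Am + w0 * Am)"
        using V Am w0 mult_left_mono[of 1 Am v] v by (intro mult_left_mono add_mono) (simp_all add: Am_def)
      finally show ?thesis by (simp add: H_def h0_def algebra_simps)
    qed
    have intE: "(\<integral>\<^sup>+\<tau>. ball_moment u R m z \<tau> * indicator {0<..<T} \<tau> \<partial>lborel) \<le> ennreal (A * T * V)" for z
      using cyl by (simp add: cylinder_bound_def R_def V_def)
    have intEs: "(\<integral>\<^sup>+\<tau>. ball_moment u R m z \<tau> * indicator {s<..<T} \<tau> \<partial>lborel) \<le> ennreal (A * T * V)" if "s \<ge> 0" for z s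
      by (rule order_trans[OF nn_integral_mono intE]) (use that in \<open>auto simp: indicator_def\<close>)
    have intF: "(\<integral>\<^sup>+\<tau>. exp_moment u R m z \<tau> * indicator {s<..<T} \<tau> \<partial>lborel) \<le> ennreal (A * T * V)" if "s \<ge> 0" for z s
      by (rule order_trans[OF nn_integral_mono intEs[OF that]]) (use exp_moment_le_ball_moment[OF R] in \<open>auto simp: indicator_def\<close>)
    have ATV: "A * T * V \<ge> 0" using A T V by simp
    have E96: "ennreal (96 / T) * (\<integral>\<^sup>+\<tau>. ball_moment u R m z \<tau> * indicator {s<..<T} \<tau> \<partial>lborel) \<le> ennreal (96 * A * V)" if "s \<ge> 0" for z s
    proof -
      have "ennreal (96 / T) * (\<integral>\<^sup>+\<tau>. ball_moment u R m z \<tau> * indicator {s<..<T} \<tau> \<partial>lborel) \<le> ennreal (96 / T) * ennreal (A * T * V)"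
        by (intro mult_left_mono intEs that) auto
      also have "\<dots> = ennreal (96 / T * (A * T * V))" using T ATV by (intro ennreal_mult[symmetric]) auto
      also have "96 / T * (A * T * V) = 96 * A * V" using T by simp
      finally show ?thesis .
    qed
    have Phi: "ennreal (m powr a) * (\<integral>\<^sup>+\<tau>. \<phi> \<tau> * exp_moment u R m z \<tau> * indicator {s<..<T} \<tau> \<partial>lborel) \<le> ennreal (m powr a * (W * A * V) + \<Gamma> / 4)"
      if s: "s \<ge> 0" and \<Gamma>: "\<Gamma> \<ge> 0" "\<And>\<tau>. \<tau> \<in> {s<..<T} \<Longrightarrow> exp_moment u R m z \<tau> \<le> ennreal \<Gamma>" for z s \<Gamma>
    proof -
      have "(\<integral>\<^sup>+\<tau>. \<phi> \<tau> * exp_moment u R m z \<tau> * indicator {s<..<T} \<tau> \<partial>lborel) \<le> ennreal (W / T * (A * T * V) + W powr (1 - \<rho>) * L * \<Gamma>)"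
        by (rule source_term_bound[OF md W _ L s \<Gamma> ATV intF[OF s]]) (auto intro: measurable_exp_moment)
      then have "ennreal (m powr a) * (\<integral>\<^sup>+\<tau>. \<phi> \<tau> * exp_moment u R m z \<tau> * indicator {s<..<T} \<tau> \<partial>lborel) \<le>
        ennreal (m powr a) * ennreal (W / T * (A * T * V) + W powr (1 - \<rho>) * L * \<Gamma>)" by (intro mult_left_mono) auto
      also have "\<dots> = ennreal (m powr a * (W / T * (A * T * V) + W powr (1 - \<rho>) * L * \<Gamma>))"
        by (rule ennreal_mult'[symmetric]) simp
      also have "\<dots> \<le> ennreal (m powr a * (W * A * V) + \<Gamma> / 4)"
      proof (rule ennreal_leI)
        have "m powr a * (W powr (1 - \<rho>) * L) * \<Gamma> \<le> 1 / 4 * \<Gamma>" by (intro mult_right_mono mWL \<Gamma>)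
        then show "m powr a * (W / T * (A * T * V) + W powr (1 - \<rho>) * L * \<Gamma>) \<le> m powr a * (W * A * V) + \<Gamma> / 4"
          using T by (simp add: distrib_left mult_ac)
      qed
      finally show ?thesis .
    qed
    have Fb: "exp_moment u R m z \<tau> \<le> ennreal (cB * H)" if \<tau>: "\<tau> \<in> {0<..<T}" for z \<tau>
      unfolding cB_def
    proof (rule gronwall_family[where F = "exp_moment u R m", OF B m2(1) \<beta>B H _ _ \<tau>])
      show "exp_moment u R m z \<tau> \<le> ennreal (exp (m * M) * (unit_ball_vol (real CARD('d)) * R ^ CARD('d)))" for z \<tau>
        by (rule order_trans[OF exp_moment_le_ball_moment[OF R] ball_moment_bounded[OF R _ M]]) (use m in simp)
      fix s g \<Gamma> z
      assume s: "0 < s" "s < T" and \<Gamma>0: "\<Gamma> \<ge> 0" and [measurable]: "g \<in> borel_measurable borel"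
        and Fg: "\<And>z \<tau>. \<tau> \<in> {s..<T} \<Longrightarrow> exp_moment u R m z \<tau> \<le> g \<tau>"
        and F\<Gamma>: "\<And>z \<tau>. \<tau> \<in> {s..<T} \<Longrightarrow> exp_moment u R m z \<tau> \<le> ennreal \<Gamma>"
      have "exp_moment u R m z s \<le> ennreal (v * V) + (ennreal (96 / T) * (\<integral>\<^sup>+\<tau>. ball_moment u R m z \<tau> * indicator {s<..<T} \<tau> \<partial>lborel) +
         (\<integral>\<^sup>+\<tau>. \<beta> \<tau> * exp_moment u R m z \<tau> * indicator {s<..<T} \<tau> \<partial>lborel) +
         ennreal (m powr a) * (\<integral>\<^sup>+\<tau>. \<phi> \<tau> * exp_moment u R m z \<tau> * indicator {s<..<T} \<tau> \<partial>lborel))"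
        using exp_moment_inequality[OF md m s, of z] by (simp add: R_def V_def v_def)
      also have "\<dots> \<le> ennreal (v * V) + (ennreal (96 * A * V) + (\<integral>\<^sup>+\<tau>. \<beta> \<tau> * g \<tau> * indicator {s<..<T} \<tau> \<partial>lborel) + ennreal (m powr a * (W * A * V) + \<Gamma> / 4))"
        using s \<Gamma>0 F\<Gamma>
        by (intro add_left_mono add_mono E96 Phi nn_integral_mono) (auto simp: indicator_def intro!: mult_left_mono Fg)
      also have "\<dots> = ennreal (v * V + 96 * A * V + (m powr a * (W * A * V) + \<Gamma> / 4)) + (\<integral>\<^sup>+\<tau>. \<beta> \<tau> * g \<tau> * indicator {s<..<T} \<tau> \<partial>lborel)"
      proof -
        have "ennreal x1 + (ennreal x2 + J + ennreal x3) = ennreal (x1 + x2 + x3) + J" if "x1 \<ge> 0" "x2 \<ge> 0" "x3 \<ge> 0" for x1 x2 x3 J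
          using that by (simp add: ennreal_plus ac_simps)
        then show ?thesis using v V A W \<Gamma>0 by simp
      qed
      also have "\<dots> \<le> ennreal (H + \<Gamma> / 4) + (\<integral>\<^sup>+\<tau>. \<beta> \<tau> * g \<tau> * indicator {s<..<T} \<tau> \<partial>lborel)"
        using H2 by (intro add_right_mono ennreal_leI) simp
      also have "ennreal (H + \<Gamma> / 4) = ennreal H + ennreal (\<Gamma> / 4)" using H \<Gamma>0 by (simp add: ennreal_plus)
      finally show "exp_moment u R m z s \<le> ennreal H + ennreal (\<Gamma> / 4) + (\<integral>\<^sup>+\<tau>. \<beta> \<tau> * g \<tau> * indicator {s<..<T} \<tau> \<partial>lborel)" .
    qed
    define S where "S = cB * H"
    have S: "S > 0" using cB V h0 Am by (simp add: S_def H_def)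
    \<comment> \<open>Bounds the terminal volume plus the whole right side: \<open>H\<close> covers
      the volume, the cutoff and the integral part of the source, \<open>S / 4\<close> the rest of
      the source, and \<open>B * S\<close> the drift.\<close>
    define X where "X = H + S / 4 + B * S"
    have X: "X \<ge> 0" using H S B by (simp add: X_def)
    have gain: "(\<integral>\<^sup>+\<tau>. (\<integral>\<^sup>+x. ennreal ((exp (m * u (\<tau>, x)) * (zeta R (x - z))\<^sup>2) powr p) \<partial>lborel) * indicator {0<..<T} \<tau> \<partial>lborel)
       \<le> ennreal (c2 * (T * V) * Am powr p)" for z
    proof -
      have "(\<integral>\<^sup>+\<tau>. (\<integral>\<^sup>+x. ennreal ((exp (m * u (\<tau>, x)) * (zeta R (x - z))\<^sup>2) powr (1 + 1 / ?d)) \<partial>lborel) * indicator {0<..<T} \<tau> \<partial>lborel)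
       \<le> ennreal (Cg * S powr (1 / ?d) * (2 * R * X + (A * T * V) / R))"
      proof (rule moser_terminal(2)[OF meas M ap T R m0 fb tm Cg S ATV X _ _ intF])
        show "exp_moment u R m z \<tau> \<le> ennreal S" if "\<tau> \<in> {0<..<T}" for \<tau> using Fb[OF that] by (simp add: S_def)
        have "(\<integral>\<^sup>+\<tau>. (ennreal (96 / R\<^sup>2) * ball_moment u R m z \<tau> + (\<beta> \<tau> + ennreal (m powr a) * \<phi> \<tau>) * exp_moment u R m z \<tau>) * indicator {0<..<T} \<tau> \<partial>lborel) =
          (\<integral>\<^sup>+\<tau>. ennreal (96 / T) * (ball_moment u R m z \<tau> * indicator {0<..<T} \<tau>) + \<beta> \<tau> * exp_moment u R m z \<tau> * indicator {0<..<T} \<tau> +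
            ennreal (m powr a) * (\<phi> \<tau> * exp_moment u R m z \<tau> * indicator {0<..<T} \<tau>) \<partial>lborel)"
          using RR by (intro nn_integral_cong) (simp add: distrib_right mult.assoc add.assoc power2_eq_square)
        also have "\<dots> = ennreal (96 / T) * (\<integral>\<^sup>+\<tau>. ball_moment u R m z \<tau> * indicator {0<..<T} \<tau> \<partial>lborel) +
           (\<integral>\<^sup>+\<tau>. \<beta> \<tau> * exp_moment u R m z \<tau> * indicator {0<..<T} \<tau> \<partial>lborel) +
           ennreal (m powr a) * (\<integral>\<^sup>+\<tau>. \<phi> \<tau> * exp_moment u R m z \<tau> * indicator {0<..<T} \<tau> \<partial>lborel)"
          by (simp add: nn_integral_add nn_integral_cmult)
        also have "\<dots> \<le> ennreal (96 * A * V) + ennreal (B * S) + ennreal (m powr a * (W * A * V) + S / 4)"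
        proof (intro add_mono E96 Phi order_refl)
          have "(\<integral>\<^sup>+\<tau>. \<beta> \<tau> * exp_moment u R m z \<tau> * indicator {0<..<T} \<tau> \<partial>lborel) \<le> (\<integral>\<^sup>+\<tau>. ennreal S * (\<beta> \<tau> * indicator {0<..<T} \<tau>) \<partial>lborel)"
          proof (rule nn_integral_mono)
            fix \<tau>
            show "\<beta> \<tau> * exp_moment u R m z \<tau> * indicator {0<..<T} \<tau> \<le> ennreal S * (\<beta> \<tau> * indicator {0<..<T} \<tau>)"
            proof (cases "\<tau> \<in> {0<..<T}")
              case True
              have "\<beta> \<tau> * exp_moment u R m z \<tau> \<le> \<beta> \<tau> * ennreal S"
                using Fb[OF True] by (intro mult_left_mono) (auto simp: S_def)
              then show ?thesis using True by (simp add: mult.commute)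
            qed simp
          qed
          also have "\<dots> = ennreal S * (\<integral>\<^sup>+\<tau>. \<beta> \<tau> * indicator {0<..<T} \<tau> \<partial>lborel)" by (simp add: nn_integral_cmult)
          also have "\<dots> \<le> ennreal S * ennreal B" by (intro mult_left_mono \<beta>B) auto
          also have "\<dots> = ennreal (B * S)" using S B by (simp add: ennreal_mult mult.commute)
          finally show "(\<integral>\<^sup>+\<tau>. \<beta> \<tau> * exp_moment u R m z \<tau> * indicator {0<..<T} \<tau> \<partial>lborel) \<le> ennreal (B * S)" .
          show "exp_moment u R m z \<tau> \<le> ennreal S" if "\<tau> \<in> {0<..<T}" for \<tau> using Fb[OF that] by (simp add: S_def)
        qed (use S in auto)
        finally have I: "(\<integral>\<^sup>+\<tau>. (ennreal (96 / R\<^sup>2) * ball_moment u R m z \<tau> + (\<beta> \<tau> + ennreal (m powr a) * \<phi> \<tau>) * exp_moment u R m z \<tau>) * indicator {0<..<T} \<tau> \<partial>lborel)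
          \<le> ennreal (96 * A * V) + ennreal (B * S) + ennreal (m powr a * (W * A * V) + S / 4)" .
        have "ennreal (v * V) + (\<integral>\<^sup>+\<tau>. (ennreal (96 / R\<^sup>2) * ball_moment u R m z \<tau> + (\<beta> \<tau> + ennreal (m powr a) * \<phi> \<tau>) * exp_moment u R m z \<tau>) * indicator {0<..<T} \<tau> \<partial>lborel)
           \<le> ennreal (v * V) + (ennreal (96 * A * V) + ennreal (B * S) + ennreal (m powr a * (W * A * V) + S / 4))"
          by (intro add_left_mono I)
        also have "\<dots> = ennreal (v * V + (96 * A * V + B * S + (m powr a * (W * A * V) + S / 4)))"
        proof -
          have "ennreal x1 + (ennreal x2 + ennreal x4 + ennreal x3) = ennreal (x1 + (x2 + x4 + x3))" if "x1 \<ge> 0" "x2 \<ge> 0" "x3 \<ge> 0" "x4 \<ge> 0" for x1 x2 x3 x4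
            using that by (simp add: ennreal_plus)
          then show ?thesis using v V A W S B by simp
        qed
        also have "\<dots> \<le> ennreal X" using H2 by (intro ennreal_leI) (simp add: X_def)
        finally show "ennreal (unit_ball_vol ?d * R ^ CARD('d)) + (\<integral>\<^sup>+\<tau>. (ennreal (96 / R\<^sup>2) * ball_moment u R m z \<tau> + (\<beta> \<tau> + ennreal (m powr a) * \<phi> \<tau>) * exp_moment u R m z \<tau>) * indicator {0<..<T} \<tau> \<partial>lborel) \<le> ennreal X"
          by (simp add: v_def V_def)
      qed simp_all
      also have "\<dots> \<le> ennreal (c2 * (T * V) * Am powr p)"
      proof (rule ennreal_leI)
        \<comment> \<open>\<open>S powr (1/d)\<close> contributes one factor \<open>R\<close> and
          the gain inequality another; \<open>R * R = T\<close> restores the normalisation of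
          \<open>cylinder_bound\<close>.\<close>
        have VR: "V powr (1 / ?d) = R" using R by (simp add: V_def powr_powr flip: powr_realpow)
        have Sp: "S powr (1 / ?d) = (cB * h0) powr (1 / ?d) * R * Am powr (1 / ?d)"
        proof -
          have "S = (cB * h0) * V * Am" by (simp add: S_def H_def)
          then show ?thesis using cB h0 V Am by (simp add: powr_mult VR)
        qed
        have "2 * R * X + (A * T * V) / R \<le> R * (V * h0 * Am) * (3 + cB / 2 + 2 * B * cB)"
        proof -
          have "(A * T * V) / R = R * (A * V)" using R by (simp add: RR[symmetric])
          also have "\<dots> \<le> R * H"
          proof (rule mult_left_mono)
            have "A * V \<le> Am * V" using Am V by (intro mult_right_mono) auto
            also have "\<dots> \<le> Am * V * h0" using mult_left_mono[of 1 h0 "Am * V"] h0 Am V by simp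
            finally show "A * V \<le> H" by (simp add: H_def mult_ac)
          qed (use R in simp)
          finally have "2 * R * X + (A * T * V) / R \<le> 2 * R * X + R * H" by simp
          also have "\<dots> = R * H * (3 + cB / 2 + 2 * B * cB)" by (simp add: X_def S_def algebra_simps)
          finally show ?thesis by (simp add: H_def)
        qed
        then have "Cg * S powr (1 / ?d) * (2 * R * X + (A * T * V) / R) \<le> Cg * S powr (1 / ?d) * (R * (V * h0 * Am) * (3 + cB / 2 + 2 * B * cB))"
          using Cg0 by (intro mult_left_mono) auto
        also have "\<dots> = c2 * ((R * R) * V) * (Am * Am powr (1 / ?d))"
          unfolding Sp c2_def by (simp add: mult_ac)
        also have "Am * Am powr (1 / ?d) = Am powr p" using Am by (simp add: p_def powr_add)
        finally show "Cg * S powr (1 / ?d) * (2 * R * X + (A * T * V) / R) \<le> c2 * (T * V) * Am powr p" by (simp add: RR)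
      qed
      finally show ?thesis by (simp add: p_def)
    qed
    show "cylinder_bound T u (m * (1 + 1 / ?d)) (max 1 (N * 4 powr p * c2) * (A * m powr c) powr (1 + 1 / ?d))"
      unfolding cylinder_bound_def R_def[symmetric] V_def[symmetric] p_def[symmetric] Am_def[symmetric]
    proof
      fix z
      have "(\<integral>\<^sup>+\<tau>. ball_moment u R (m * p) z \<tau> * indicator {0<..<T} \<tau> \<partial>lborel) \<le>
        (\<integral>\<^sup>+\<tau>. (\<Sum>c\<in>P. ennreal (4 powr p) * ((\<integral>\<^sup>+x. ennreal ((exp (m * u (\<tau>, x)) * (zeta R (x - (z + R *\<^sub>R c)))\<^sup>2) powr p) \<partial>lborel) * indicator {0<..<T} \<tau>)) \<partial>lborel)"
      proof (rule nn_integral_mono)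
        fix \<tau>
        have "ball_moment u R (m * p) z \<tau> \<le> (\<Sum>c\<in>P. ennreal (4 powr p) * (\<integral>\<^sup>+x. ennreal ((exp (m * u (\<tau>, x)) * (zeta R (x - (z + R *\<^sub>R c)))\<^sup>2) powr p) \<partial>lborel))"
          by (rule ball_moment_cover[OF P(1,3) R]) (use p in auto)
        then show "ball_moment u R (m * p) z \<tau> * indicator {0<..<T} \<tau> \<le> (\<Sum>c\<in>P. ennreal (4 powr p) * ((\<integral>\<^sup>+x. ennreal ((exp (m * u (\<tau>, x)) * (zeta R (x - (z + R *\<^sub>R c)))\<^sup>2) powr p) \<partial>lborel) * indicator {0<..<T} \<tau>))"
          by (cases "\<tau> \<in> {0<..<T}") auto
      qed
      also have "\<dots> = (\<Sum>c\<in>P. ennreal (4 powr p) * (\<integral>\<^sup>+\<tau>. (\<integral>\<^sup>+x. ennreal ((exp (m * u (\<tau>, x)) * (zeta R (x - (z + R *\<^sub>R c)))\<^sup>2) powr p) \<partial>lborel) * indicator {0<..<T} \<tau> \<partial>lborel))"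
        by (subst nn_integral_sum, measurable) (simp add: nn_integral_cmult)
      also have "\<dots> \<le> (\<Sum>c\<in>P. ennreal (4 powr p) * ennreal (c2 * (T * V) * Am powr p))"
        by (intro sum_mono mult_left_mono gain) auto
      also have "\<dots> = ennreal (N * (4 powr p * (c2 * (T * V) * Am powr p)))"
        using c2 T V by (simp add: N_def ennreal_mult ennreal_of_nat_eq_real_of_nat)
      also have "\<dots> \<le> ennreal (max 1 (N * 4 powr p * c2) * Am powr p * T * V)"
      proof (rule ennreal_leI)
        have "N * (4 powr p * (c2 * (T * V) * Am powr p)) = (N * 4 powr p * c2) * (Am powr p * T * V)" by (simp add: mult_ac)
        also have "\<dots> \<le> max 1 (N * 4 powr p * c2) * (Am powr p * T * V)" using T V by (intro mult_right_mono) auto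
        finally show "N * (4 powr p * (c2 * (T * V) * Am powr p)) \<le> max 1 (N * 4 powr p * c2) * Am powr p * T * V" by (simp add: mult_ac)
      qed
      finally show "(\<integral>\<^sup>+\<tau>. ball_moment u R (m * p) z \<tau> * indicator {0<..<T} \<tau> \<partial>lborel) \<le> ennreal (max 1 (N * 4 powr p * c2) * Am powr p * T * V)" .
    qed
  qed
qed

text \<open>In logarithms the recursion is affine with slope \<open>p\<close> and an inhomogeneity
  linear in \<open>n\<close>, so \<open>ln (A n)\<close> grows at most like \<open>p ^ n\<close>,
  the very exponent \<open>m\<close> of step \<open>n\<close>. Losses that are powers of
  \<open>m\<close> at each step are therefore harmless.\<close>

lemma moser_sequence_bound:
  fixes C c p A0 :: real
  assumes p: "p > 1" and C: "C \<ge> 1" and c: "c \<ge> 0" and A0: "A0 \<ge> 1"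
  obtains \<Lambda> A where "A 0 = A0" "\<And>n. A (Suc n) = C * (A n * (p ^ n) powr c) powr p" "\<And>n. A n \<ge> (1::real)" "\<And>n. A n \<le> exp (\<Lambda> * p ^ n)"
proof -
  define A where "A = rec_nat A0 (\<lambda>n x. C * (x * (p ^ n) powr c) powr p)"
  have A_0: "A 0 = A0" and A_S: "A (Suc n) = C * (A n * (p ^ n) powr c) powr p" for n by (simp_all add: A_def)
  have A1: "A n \<ge> 1" for n
  proof (induction n)
    case (Suc n)
    have "1 \<le> (p ^ n) powr c" using p c by (intro ge_one_powr_ge_zero) auto
    then have "1 * 1 \<le> A n * (p ^ n) powr c" using Suc by (intro mult_mono) auto
    then have "1 \<le> (A n * (p ^ n) powr c) powr p" using p by (intro ge_one_powr_ge_zero) auto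
    then have "1 * 1 \<le> C * (A n * (p ^ n) powr c) powr p" using C by (intro mult_mono) auto
    then show ?case by (simp add: A_S)
  qed (simp add: A_0 A0)
  \<comment> \<open>\<open>\<Lambda> * p ^ n - (\<alpha> * n + \<beta>)\<close> solves the recursion for \<open>ln (A n)\<close> exactly\<close>
  define \<alpha> where "\<alpha> = p * c * ln p / (p - 1)"
  define \<beta> where "\<beta> = (ln C + \<alpha>) / (p - 1)"
  define \<Lambda> where "\<Lambda> = ln A0 + \<beta>"
  have \<alpha>: "\<alpha> \<ge> 0" "\<alpha> * (p - 1) = p * c * ln p" using p c by (auto simp: \<alpha>_def)
  have \<beta>: "\<beta> \<ge> 0" "\<beta> * (p - 1) = ln C + \<alpha>" using p C \<alpha> by (auto simp: \<beta>_def)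
  have bound: "ln (A n) \<le> \<Lambda> * p ^ n - (\<alpha> * n + \<beta>)" for n
  proof (induction n)
    case (Suc n)
    have "ln (A (Suc n)) = ln C + p * (ln (A n) + c * (n * ln p))"
      using A1[of n] p C by (simp add: A_S ln_mult ln_powr ln_realpow)
    also have "\<dots> \<le> ln C + p * ((\<Lambda> * p ^ n - (\<alpha> * n + \<beta>)) + c * (n * ln p))"
      using Suc p by (intro add_left_mono mult_left_mono add_right_mono) auto
    also have "\<dots> = \<Lambda> * p ^ Suc n - (\<alpha> * Suc n + \<beta>) + ((ln C + \<alpha> - \<beta> * (p - 1)) + n * (p * c * ln p - \<alpha> * (p - 1)))"
      by (simp add: algebra_simps)
    also have "\<dots> = \<Lambda> * p ^ Suc n - (\<alpha> * Suc n + \<beta>)" using \<alpha>(2) \<beta>(2) by simp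
    finally show ?case .
  qed (simp add: A_0 \<Lambda>_def)
  have "A n \<le> exp (\<Lambda> * p ^ n)" for n
  proof -
    have "ln (A n) \<le> \<Lambda> * p ^ n" using bound[of n] \<alpha>(1) \<beta>(1) by (smt (verit) mult_nonneg_nonneg of_nat_0_le_iff)
    then show ?thesis using A1[of n] by (metis exp_le_cancel_iff exp_ln less_le_trans zero_less_one)
  qed
  then show ?thesis using that[OF A_0 A_S A1] by blast
qed

text \<open>If \<open>u\<close> exceeded some \<open>l > \<Lambda>\<close> at a point, it would do
  so on a small cylinder by continuity, and the cylinder integral of \<open>exp (m * u)\<close>
  would be at least a constant times \<open>exp (m * l)\<close>. For \<open>m = p ^ n\<close> this
  outgrows the bound \<open>exp (\<Lambda> * m)\<close>.\<close>

lemma moser_sup_bound: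
  assumes L: "L \<ge> 0" and B: "B \<ge> 0" and a: "a \<ge> 0" and \<rho>: "\<rho> > 1"
  shows "\<exists>\<Lambda>. \<forall>T M (u :: real \<times> (real^'d) \<Rightarrow> real) b f \<beta> \<phi> \<psi>. moser_data T M B L a \<rho> u b f \<beta> \<phi> \<psi> \<longrightarrow>
    continuous_on ({0<..<T} \<times> UNIV) u \<longrightarrow> (\<forall>t\<in>{0<..<T}. \<forall>x. u (t, x) \<le> \<Lambda>)"
proof -
  define p where "p = 1 + 1 / real CARD('d)"
  have p: "p > 1" by (simp add: p_def)
  obtain A0 where A0: "A0 \<ge> 1" "\<And>T M (u :: real \<times> (real^'d) \<Rightarrow> real) b f \<beta> \<phi> \<psi>.
    moser_data T M B L a \<rho> u b f \<beta> \<phi> \<psi> \<Longrightarrow> cylinder_bound T u 1 A0"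
    using moser_base[OF L B, of a \<rho>] by blast
  obtain C c where C: "C \<ge> 1" "c \<ge> 0" "\<And>T M (u :: real \<times> (real^'d) \<Rightarrow> real) b f \<beta> \<phi> \<psi> m A.
    moser_data T M B L a \<rho> u b f \<beta> \<phi> \<psi> \<Longrightarrow> 1 \<le> m \<Longrightarrow> 1 \<le> A \<Longrightarrow> cylinder_bound T u m A \<Longrightarrow>
    cylinder_bound T u (m * p) (C * (A * m powr c) powr p)"
    using moser_step[OF L B a \<rho>, where 'd='d] unfolding p_def by blast
  obtain \<Lambda> A where A: "A 0 = A0" "\<And>n. A (Suc n) = C * (A n * (p ^ n) powr c) powr p" "\<And>n. A n \<ge> 1" "\<And>n. A n \<le> exp (\<Lambda> * p ^ n)"
    using moser_sequence_bound[OF p C(1,2) A0(1)] by blast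
  show ?thesis
  proof (intro exI[of _ \<Lambda>] allI impI ballI)
    fix T M b f \<beta> \<phi> \<psi> t0 x0 and u :: "real \<times> (real^'d) \<Rightarrow> real"
    assume md: "moser_data T M B L a \<rho> u b f \<beta> \<phi> \<psi>" and cu: "continuous_on ({0<..<T} \<times> UNIV) u" and t0: "t0 \<in> {0<..<T}"
    have T: "T > 0" and [measurable]: "u \<in> borel_measurable borel" using md unfolding moser_data_def by auto
    have cyl: "cylinder_bound T u (p ^ n) (A n)" for n
    proof (induction n)
      case 0 show ?case using A0(2)[OF md] A(1) by simp
    next
      case (Suc n)
      have "1 \<le> p ^ n" using p by simp
      from C(3)[OF md this A(3) Suc] show ?case by (simp add: A(2) mult.commute)
    qed
    show "u (t0, x0) \<le> \<Lambda>"
    proof (rule ccontr)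
      assume "\<not> u (t0, x0) \<le> \<Lambda>"
      then obtain l where l: "\<Lambda> < l" "l < u (t0, x0)" using dense[of \<Lambda> "u (t0, x0)"] by auto
      define R where "R = sqrt T"
      have R: "R > 0" using T by (simp add: R_def)
      have "open ({0<..<T} \<times> (UNIV :: (real^'d) set))" by (intro open_Times) auto
      then have "open (({0<..<T} \<times> UNIV) \<inter> u -` {l<..})"
        using continuous_open_preimage[OF cu, of "{l<..}"] by auto
      then obtain e where e: "e > 0" "ball (t0, x0) e \<subseteq> ({0<..<T} \<times> UNIV) \<inter> u -` {l<..}"
        using t0 l unfolding open_contains_ball by (metis (no_types, lifting) Int_iff SigmaI UNIV_I greaterThan_iff vimageI)
      \<comment> \<open>Keeps the small cylinder inside both the neighbourhood on which
        \<open>u > l\<close> and the ball of radius \<open>R\<close> of the cylinder bound.\<close>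
      define \<delta> where "\<delta> = min R (e / 3)"
      have \<delta>: "\<delta> > 0" "\<delta> \<le> R" "\<delta> \<le> e / 3" using R e by (auto simp: \<delta>_def)
      have nb: "\<tau> \<in> {0<..<T} \<and> l < u (\<tau>, x)" if "\<tau> \<in> {t0..t0 + \<delta>}" "x \<in> cball x0 \<delta>" for \<tau> x
      proof -
        have "dist (t0, x0) (\<tau>, x) \<le> dist t0 \<tau> + dist x0 x"
          unfolding dist_prod_def by (simp add: sqrt_sum_squares_le_sum)
        also have "\<dots> \<le> e / 3 + e / 3" using that \<delta> by (intro add_mono) (auto simp: dist_real_def)
        also have "\<dots> < e" using e by simp
        finally have "(\<tau>, x) \<in> ball (t0, x0) e" by simp
        then show ?thesis using e(2) by auto
      qed
      define v where "v = unit_ball_vol (real CARD('d)) * \<delta> ^ CARD('d)"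
      have v: "v > 0" using \<delta> by (simp add: v_def)
      have lower: "exp (p ^ n * l) * v * \<delta> \<le> exp (\<Lambda> * p ^ n) * T * R ^ CARD('d)" for n
      proof -
        have "ennreal (exp (p ^ n * l) * v * \<delta>) = (\<integral>\<^sup>+\<tau>. ennreal (exp (p ^ n * l) * v) * indicator {t0..t0 + \<delta>} \<tau> \<partial>lborel)"
          using \<delta> v by (simp add: nn_integral_cmult_indicator ennreal_mult)
        also have "\<dots> \<le> (\<integral>\<^sup>+\<tau>. ball_moment u R (p ^ n) x0 \<tau> * indicator {0<..<T} \<tau> \<partial>lborel)"
        proof (rule nn_integral_mono)
          fix \<tau>
          show "ennreal (exp (p ^ n * l) * v) * indicator {t0..t0 + \<delta>} \<tau> \<le> ball_moment u R (p ^ n) x0 \<tau> * indicator {0<..<T} \<tau>"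
          proof (cases "\<tau> \<in> {t0..t0 + \<delta>}")
            case True
            have "ennreal (exp (p ^ n * l) * v) = (\<integral>\<^sup>+x. ennreal (exp (p ^ n * l)) * indicator (cball x0 \<delta>) x \<partial>lborel)"
              using \<delta> v by (simp add: nn_integral_cmult_indicator emeasure_cball v_def ennreal_mult)
            also have "\<dots> \<le> ball_moment u R (p ^ n) x0 \<tau>"
              unfolding ball_moment_def
            proof (rule nn_integral_mono)
              fix x
              show "ennreal (exp (p ^ n * l)) * indicator (cball x0 \<delta>) x \<le> ennreal (exp (p ^ n * u (\<tau>, x))) * indicator (cball x0 R) x"
              proof (cases "x \<in> cball x0 \<delta>")
                case x: True
                have "p ^ n * l \<le> p ^ n * u (\<tau>, x)" using nb[OF True x] p by (intro mult_left_mono) auto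
                then show ?thesis using x \<delta> by (auto intro!: ennreal_leI)
              qed simp
            qed
            finally show ?thesis using nb[OF True, of x0] True \<delta> by simp
          qed simp
        qed
        also have "\<dots> \<le> ennreal (A n * T * R ^ CARD('d))" using cyl[of n] unfolding cylinder_bound_def R_def by blast
        also have "\<dots> \<le> ennreal (exp (\<Lambda> * p ^ n) * T * R ^ CARD('d))"
          using A(4)[of n] T R by (intro ennreal_leI mult_right_mono) auto
        finally show ?thesis using T R by (subst (asm) ennreal_le_iff) auto
      qed
      define K where "K = T * R ^ CARD('d) / (v * \<delta>)"
      have K: "exp ((l - \<Lambda>) * p ^ n) \<le> K" for n
      proof -
        have "exp (p ^ n * l) = exp ((l - \<Lambda>) * p ^ n) * exp (\<Lambda> * p ^ n)" by (simp add: algebra_simps flip: exp_add)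
        then have "exp ((l - \<Lambda>) * p ^ n) * (v * \<delta>) * exp (\<Lambda> * p ^ n) \<le> T * R ^ CARD('d) * exp (\<Lambda> * p ^ n)"
          using lower[of n] by (simp add: mult_ac)
        then have "exp ((l - \<Lambda>) * p ^ n) * (v * \<delta>) \<le> T * R ^ CARD('d)" by simp
        then show ?thesis using v \<delta> by (simp add: K_def pos_le_divide_eq)
      qed
      obtain n where n: "K / (l - \<Lambda>) < p ^ n" using real_arch_pow[OF p] by blast
      then have "K < (l - \<Lambda>) * p ^ n" using l by (simp add: field_simps)
      also have "\<dots> \<le> exp ((l - \<Lambda>) * p ^ n)" by (rule order_trans[OF _ exp_ge_add_one_self]) simp
      finally show False using K[of n] by simp
    qed
  qed
qed

section \<open>Mixed norms and form bounds\<close>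

lemma measurable_epowr [measurable]:
  assumes [measurable]: "f \<in> borel_measurable M"
  shows "(\<lambda>x. epowr (f x) a) \<in> borel_measurable M"
  unfolding epowr_def by measurable

lemma epowr_ennreal: "r \<ge> 0 \<Longrightarrow> epowr (ennreal r) a = ennreal (r powr a)"
  by (simp add: epowr_def)

lemma epowr_epowr: "epowr (epowr x a) c = epowr x (a * c)"
  by (cases x) (auto simp: epowr_def powr_powr)

lemma epowr_one: "epowr x 1 = x"
  by (cases x) (auto simp: epowr_def)

lemma epowr_cmult:
  assumes "c > 0"
  shows "epowr (ennreal c * x) a = ennreal (c powr a) * epowr x a"
proof (cases x)
  case (real r)
  then have "ennreal c * x = ennreal (c * r)" using assms by (simp add: ennreal_mult)
  then have "epowr (ennreal c * x) a = ennreal ((c * r) powr a)"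
    using real assms by (simp only:) (intro epowr_ennreal, simp)
  also have "\<dots> = ennreal (c powr a * r powr a)" using real assms by (simp add: powr_mult)
  also have "\<dots> = ennreal (c powr a) * ennreal (r powr a)" by (rule ennreal_mult) simp_all
  finally show ?thesis using real by (simp add: epowr_ennreal)
next
  case top
  then show ?thesis using assms by (simp add: epowr_def ennreal_mult_top)
qed

lemma epowr_mono:
  assumes "x \<le> y" "a \<ge> 0"
  shows "epowr x a \<le> epowr y a"
proof (cases y)
  case (real r)
  moreover obtain s where "x = ennreal s" "s \<ge> 0" using assms(1) real by (cases x) (auto simp: top_unique)
  ultimately show ?thesis using assms by (auto simp: epowr_ennreal intro!: ennreal_leI powr_mono2)
qed (simp add: epowr_def)

lemma Lp_norm_real:
  assumes "p > 0"
  shows "Lp_norm M (ennreal p) g = epowr (\<integral>\<^sup>+x. epowr (g x) p \<partial>M) (1 / p)"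
  using assms by (simp add: Lp_norm_def)

lemma Lp_norm_cmult:
  assumes "p > 0" "c > 0" and [measurable]: "g \<in> borel_measurable M"
  shows "Lp_norm M (ennreal p) (\<lambda>x. ennreal c * g x) = ennreal c * Lp_norm M (ennreal p) g"
  using assms by (simp add: Lp_norm_real epowr_cmult nn_integral_cmult powr_powr)

lemma Lp_norm_space:
  fixes g :: "real \<times> (real^'d) \<Rightarrow> 'b::{real_normed_vector, second_countable_topology}"
  assumes "p > 0"
  shows "Lp_norm lborel (ennreal p) (\<lambda>x. ennreal (norm (g (t, x)))) = epowr (\<integral>\<^sup>+x. ennreal (norm (g (t, x)) powr p) \<partial>lborel) (1 / p)"
  using assms by (simp add: Lp_norm_real epowr_ennreal)

lemma mixed_norm_real:
  fixes g :: "real \<times> (real^'d) \<Rightarrow> 'b::{real_normed_vector, second_countable_topology}"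
  assumes p: "p > 0" and q: "q > 0"
  shows "mixed_norm T (ennreal q) (ennreal p) g =
    epowr (\<integral>\<^sup>+\<tau>. epowr (\<integral>\<^sup>+x. ennreal (norm (g (\<tau>, x)) powr p) \<partial>lborel) (q / p) * indicator {0..<T} \<tau> \<partial>lborel) (1 / q)"
  unfolding mixed_norm_def Lp_norm_space[OF p] Lp_norm_real[OF q] epowr_epowr
  by (subst nn_integral_restrict_space) auto

lemma mixed_norm_cmult:
  fixes f :: "real \<times> (real^'d) \<Rightarrow> real"
  assumes [measurable]: "f \<in> borel_measurable borel" and p: "p > 0" and q: "q > 0" and c: "c \<noteq> 0"
  shows "mixed_norm T (ennreal q) (ennreal p) (\<lambda>z. c * f z) = ennreal \<bar>c\<bar> * mixed_norm T (ennreal q) (ennreal p) f"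
proof -
  have "(\<lambda>t. Lp_norm lborel (ennreal p) (\<lambda>x. ennreal (norm (c * f (t, x))))) =
    (\<lambda>t. ennreal \<bar>c\<bar> * Lp_norm lborel (ennreal p) (\<lambda>x. ennreal (norm (f (t, x)))))"
  proof
    fix t
    have "(\<lambda>x. ennreal (norm (c * f (t, x)))) = (\<lambda>x. ennreal \<bar>c\<bar> * ennreal (norm (f (t, x))))"
      by (simp add: abs_mult ennreal_mult)
    then show "Lp_norm lborel (ennreal p) (\<lambda>x. ennreal (norm (c * f (t, x)))) = ennreal \<bar>c\<bar> * Lp_norm lborel (ennreal p) (\<lambda>x. ennreal (norm (f (t, x))))"
      using Lp_norm_cmult[OF p, of "\<bar>c\<bar>" "\<lambda>x. ennreal (norm (f (t, x)))" lborel] c by simp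
  qed
  moreover have "(\<lambda>t. Lp_norm lborel (ennreal p) (\<lambda>x. ennreal (norm (f (t, x))))) \<in> borel_measurable (restrict_space lborel {0..<T})"
    unfolding Lp_norm_space[OF p] by (rule measurable_restrict_space1) measurable
  ultimately show ?thesis
    unfolding mixed_norm_def using Lp_norm_cmult[OF q, of "\<bar>c\<bar>"] c by simp
qed

lemma nn_integral_eq_powr_mixed_norm:
  fixes g :: "real \<times> (real^'d) \<Rightarrow> 'b::{real_normed_vector, second_countable_topology}"
  assumes p: "p > 0" and q: "q > 0" and n: "n \<ge> 0" and le: "mixed_norm T (ennreal q) (ennreal p) g \<le> ennreal n"
  shows "(\<integral>\<^sup>+\<tau>. epowr (\<integral>\<^sup>+x. ennreal (norm (g (\<tau>, x)) powr p) \<partial>lborel) (q / p) * indicator {0<..<T} \<tau> \<partial>lborel) \<le> ennreal (n powr q)"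
proof -
  let ?J = "\<integral>\<^sup>+\<tau>. epowr (\<integral>\<^sup>+x. ennreal (norm (g (\<tau>, x)) powr p) \<partial>lborel) (q / p) * indicator {0..<T} \<tau> \<partial>lborel"
  have "?J = epowr (epowr ?J (1 / q)) q" using q by (simp add: epowr_epowr epowr_one)
  also have "\<dots> \<le> epowr (ennreal n) q"
    using le q unfolding mixed_norm_real[OF p q] by (intro epowr_mono) auto
  finally have "?J \<le> ennreal (n powr q)" using n by (simp add: epowr_ennreal)
  moreover have "(\<integral>\<^sup>+\<tau>. epowr (\<integral>\<^sup>+x. ennreal (norm (g (\<tau>, x)) powr p) \<partial>lborel) (q / p) * indicator {0<..<T} \<tau> \<partial>lborel) \<le> ?J"
    by (intro nn_integral_mono) (auto simp: indicator_def)
  ultimately show ?thesis by (rule order_trans[rotated])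
qed

section \<open>From mixed norms to form bounds\<close>

lemma AE_finite_of_epowr_integral:
  fixes I :: "real \<Rightarrow> ennreal"
  assumes [measurable]: "I \<in> borel_measurable borel"
    and "(\<integral>\<^sup>+\<tau>. epowr (I \<tau>) r * indicator {0<..<T} \<tau> \<partial>lborel) \<le> ennreal n"
  shows "AE \<tau> in lborel. \<tau> \<in> {0<..<T} \<longrightarrow> I \<tau> \<noteq> \<infinity>"
proof -
  have "(\<integral>\<^sup>+\<tau>. epowr (I \<tau>) r * indicator {0<..<T} \<tau> \<partial>lborel) \<noteq> \<infinity>"
    using assms(2) by (auto simp: top_unique)
  then have "AE \<tau> in lborel. epowr (I \<tau>) r * indicator {0<..<T} \<tau> \<noteq> \<infinity>"
    by (intro nn_integral_PInf_AE) auto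
  then show ?thesis by eventually_elim (auto simp: epowr_def)
qed

text \<open>Apply \<open>weighted_L2_absorb\<close> to the weight \<open>m * g\<close>, whose L_p
  norm is linear in \<open>m\<close>; the exponent \<open>a\<close> of that norm is the origin of
  \<open>m powr a\<close> in the whole iteration.\<close>

lemma form_bound_of_power_integral:
  fixes p :: real
  assumes p: "p \<ge> 1" "2 * p > CARD('d)"
  defines "a \<equiv> 1 / (1 - CARD('d) / (2 * p))"
  obtains K where "K > 0"
    "\<And>(g :: real^'d \<Rightarrow> real) y G I m. g \<in> borel_measurable borel \<Longrightarrow> (\<And>x. g x \<ge> 0) \<Longrightarrow> m > 0 \<Longrightarrow>
      (\<integral>\<^sup>+x. ennreal (g x powr p) \<partial>lborel) = I \<Longrightarrow> I \<noteq> \<infinity> \<Longrightarrow> C1_grad y G \<Longrightarrow>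
      (\<integral>\<^sup>+x. ennreal (m * (g x * (y x)\<^sup>2)) \<partial>lborel) \<le> ennreal (1/4) * (\<integral>\<^sup>+x. ennreal ((norm (G x))\<^sup>2) \<partial>lborel) +
        ennreal (m powr a) * (ennreal K * epowr I (a / p)) * (\<integral>\<^sup>+x. ennreal ((y x)\<^sup>2) \<partial>lborel)"
proof -
  have p2: "2 * p > real DIM(real^'d)" using p by simp
  have a': "1 / (1 - real DIM(real^'d) / (2 * p)) = a" by (simp add: a_def)
  obtain K where K: "K > 0"
    "\<And>(y::real^'d \<Rightarrow> real) G g P. C1_grad y G \<Longrightarrow> g \<in> borel_measurable borel \<Longrightarrow> (\<And>x. g x \<ge> 0) \<Longrightarrow> P \<ge> 0 \<Longrightarrow>
      (\<integral>\<^sup>+x. ennreal (g x powr p) \<partial>lborel) \<le> ennreal (P powr p) \<Longrightarrow>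
      (\<integral>\<^sup>+x. ennreal (g x * (y x)\<^sup>2) \<partial>lborel) \<le>
        ennreal (1/4) * (\<integral>\<^sup>+x. ennreal ((norm (G x))\<^sup>2) \<partial>lborel) +
        ennreal (K * P powr a) * (\<integral>\<^sup>+x. ennreal ((y x)\<^sup>2) \<partial>lborel)"
    using weighted_L2_absorb[OF p(1) p2] unfolding a' by blast
  show ?thesis
  proof (rule that[OF K(1)])
    fix g y :: "real^'d \<Rightarrow> real" and G I and m :: real
    assume [measurable]: "g \<in> borel_measurable borel" and g0: "\<And>x. g x \<ge> 0" and m: "m > 0"
      and I: "(\<integral>\<^sup>+x. ennreal (g x powr p) \<partial>lborel) = I" "I \<noteq> \<infinity>" and yG: "C1_grad y G"
    obtain i where i: "I = ennreal i" "i \<ge> 0" using I(2) by (cases I) auto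
    \<comment> \<open>The L_p norm of \<open>m * g\<close>.\<close>
    define P where "P = m * i powr (1 / p)"
    have P: "P \<ge> 0" using m by (simp add: P_def)
    have "(\<integral>\<^sup>+x. ennreal ((m * g x) powr p) \<partial>lborel) = (\<integral>\<^sup>+x. ennreal (m powr p) * ennreal (g x powr p) \<partial>lborel)"
      using m g0 by (simp add: powr_mult ennreal_mult)
    also have "\<dots> = ennreal (m powr p) * ennreal i" using I(1) i(1) by (simp add: nn_integral_cmult)
    also have "\<dots> = ennreal (P powr p)"
      using m p(1) i(2) by (simp add: P_def powr_mult powr_powr ennreal_mult)
    finally have le: "(\<integral>\<^sup>+x. ennreal ((m * g x) powr p) \<partial>lborel) \<le> ennreal (P powr p)" by simp
    have "(\<integral>\<^sup>+x. ennreal (m * g x * (y x)\<^sup>2) \<partial>lborel) \<le> ennreal (1/4) * (\<integral>\<^sup>+x. ennreal ((norm (G x))\<^sup>2) \<partial>lborel) +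
        ennreal (K * P powr a) * (\<integral>\<^sup>+x. ennreal ((y x)\<^sup>2) \<partial>lborel)"
      by (rule K(2)[OF yG _ _ P le]) (use m g0 in auto)
    moreover have "ennreal (K * P powr a) = ennreal (m powr a) * (ennreal K * epowr I (a / p))"
      using K(1) m i by (simp add: P_def powr_mult powr_powr epowr_ennreal ennreal_mult mult_ac)
    ultimately show "(\<integral>\<^sup>+x. ennreal (m * (g x * (y x)\<^sup>2)) \<partial>lborel) \<le> ennreal (1/4) * (\<integral>\<^sup>+x. ennreal ((norm (G x))\<^sup>2) \<partial>lborel) +
        ennreal (m powr a) * (ennreal K * epowr I (a / p)) * (\<integral>\<^sup>+x. ennreal ((y x)\<^sup>2) \<partial>lborel)"
      by (simp add: mult.assoc)
  qed
qed

text \<open>With \<open>I\<close> the integral of \<open>\<bar>f\<bar> powr p\<close> over space,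
  \<phi> is \<open>K * I powr (a / p)\<close> and \<psi> is its power with exponent
  \<open>\<rho> = q / a\<close>, so \<psi> is a multiple of the q-th power of the spatial norm. The
  subcriticality of \<open>p\<close> and \<open>q\<close> is exactly
  \<open>\<rho> > 1\<close>.\<close>

lemma source_form_bound:
  fixes p q :: real
  assumes p: "p > 1" and q: "q > 1" and pq: "CARD('d) / p + 2 / q < 2"
  defines "a \<equiv> 1 / (1 - CARD('d) / (2 * p))"
  obtains L where "L \<ge> 0"
    "\<And>T (f :: real \<times> (real^'d) \<Rightarrow> real). T > 0 \<Longrightarrow> f \<in> borel_measurable borel \<Longrightarrow>
      mixed_norm T (ennreal q) (ennreal p) f \<le> ennreal (T powr (- (1 - CARD('d) / (2 * p) - 1 / q))) \<Longrightarrow>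
      \<exists>\<phi> \<psi>. \<phi> \<in> borel_measurable borel \<and> \<psi> \<in> borel_measurable borel \<and>
        (AE \<tau> in lborel. \<tau> \<in> {0<..<T} \<longrightarrow> (\<forall>m\<ge>1. \<forall>y G. C1_grad y G \<longrightarrow>
          (\<integral>\<^sup>+x. ennreal (m * (\<bar>f (\<tau>, x)\<bar> * (y x)\<^sup>2)) \<partial>lborel) \<le> ennreal (1/4) * (\<integral>\<^sup>+x. ennreal ((norm (G x))\<^sup>2) \<partial>lborel) +
            ennreal (m powr a) * \<phi> \<tau> * (\<integral>\<^sup>+x. ennreal ((y x)\<^sup>2) \<partial>lborel))) \<and>
        (\<forall>\<mu>>0. \<forall>\<tau>. \<phi> \<tau> \<le> ennreal \<mu> + ennreal (\<mu> powr (1 - q / a)) * \<psi> \<tau>) \<and>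
        (\<integral>\<^sup>+\<tau>. \<psi> \<tau> * indicator {0<..<T} \<tau> \<partial>lborel) \<le> ennreal (L * T powr (1 - q / a))"
    "a > 0" "q / a > 1"
proof -
  let ?d = "real CARD('d)"
  have "1 / q > 0" using q by simp
  then have dp: "?d / (2 * p) + 1 / q < 1" using pq by (simp add: field_simps)
  have d2: "?d / (2 * p) < 1" using dp \<open>1 / q > 0\<close> by linarith
  have p2: "2 * p > ?d" using d2 p by (simp add: field_simps)
  have a: "a > 0" using d2 by (simp add: a_def)
  have a1: "1 / a = 1 - ?d / (2 * p)" by (simp add: a_def)
  define \<rho> where "\<rho> = q / a"
  have \<rho>1: "\<rho> = q * (1 - ?d / (2 * p))" unfolding \<rho>_def a1[symmetric] by simp
  have "q * (1 / q) < q * (1 - ?d / (2 * p))" using dp q by (intro mult_strict_left_mono) auto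
  then have \<rho>: "\<rho> > 1" using q by (simp add: \<rho>1)
  obtain K where K: "K > 0"
    "\<And>(g :: real^'d \<Rightarrow> real) y G I m. g \<in> borel_measurable borel \<Longrightarrow> (\<And>x. g x \<ge> 0) \<Longrightarrow> m > 0 \<Longrightarrow>
      (\<integral>\<^sup>+x. ennreal (g x powr p) \<partial>lborel) = I \<Longrightarrow> I \<noteq> \<infinity> \<Longrightarrow> C1_grad y G \<Longrightarrow>
      (\<integral>\<^sup>+x. ennreal (m * (g x * (y x)\<^sup>2)) \<partial>lborel) \<le> ennreal (1/4) * (\<integral>\<^sup>+x. ennreal ((norm (G x))\<^sup>2) \<partial>lborel) +
        ennreal (m powr a) * (ennreal K * epowr I (a / p)) * (\<integral>\<^sup>+x. ennreal ((y x)\<^sup>2) \<partial>lborel)"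
    using form_bound_of_power_integral[where 'd='d, OF less_imp_le[OF p] p2] unfolding a_def by blast
  show ?thesis
  proof (rule that[of "K powr \<rho>"])
    show "K powr \<rho> \<ge> 0" by simp
    show "a > 0" by (rule a)
    show "q / a > 1" using \<rho> by (simp add: \<rho>_def)
    fix T and f :: "real \<times> (real^'d) \<Rightarrow> real"
    assume T: "T > 0" and [measurable]: "f \<in> borel_measurable borel"
      and norm: "mixed_norm T (ennreal q) (ennreal p) f \<le> ennreal (T powr (- (1 - ?d / (2 * p) - 1 / q)))"
    define I where "I \<tau> = (\<integral>\<^sup>+x. ennreal (norm (f (\<tau>, x)) powr p) \<partial>lborel)" for \<tau>
    have [measurable]: "I \<in> borel_measurable borel" unfolding I_def[abs_def] by measurable
    define \<phi> where "\<phi> \<tau> = ennreal K * epowr (I \<tau>) (a / p)" for \<tau>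
    define \<psi> where "\<psi> \<tau> = ennreal (K powr \<rho>) * epowr (I \<tau>) (q / p)" for \<tau>
    have J: "(\<integral>\<^sup>+\<tau>. epowr (I \<tau>) (q / p) * indicator {0<..<T} \<tau> \<partial>lborel) \<le> ennreal (T powr (1 - \<rho>))"
    proof -
      \<comment> \<open>The normalisation of the norm of \<open>f\<close> is made for this: its q-th
        power is \<open>T powr (1 - \<rho>)\<close>, which leaves \<open>L\<close> free of
        \<open>T\<close>.\<close>
      have "(- (1 - ?d / (2 * p) - 1 / q)) * q = 1 - \<rho>" using q by (simp add: \<rho>1 algebra_simps)
      then show ?thesis
        using nn_integral_eq_powr_mixed_norm[OF _ _ _ norm] p q unfolding I_def by (simp add: powr_powr)
    qed
    have "AE \<tau> in lborel. \<tau> \<in> {0<..<T} \<longrightarrow> I \<tau> \<noteq> \<infinity>"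
      by (rule AE_finite_of_epowr_integral[OF _ J]) measurable
    then have AE: "AE \<tau> in lborel. \<tau> \<in> {0<..<T} \<longrightarrow> (\<forall>m\<ge>1. \<forall>y G. C1_grad y G \<longrightarrow>
          (\<integral>\<^sup>+x. ennreal (m * (\<bar>f (\<tau>, x)\<bar> * (y x)\<^sup>2)) \<partial>lborel) \<le> ennreal (1/4) * (\<integral>\<^sup>+x. ennreal ((norm (G x))\<^sup>2) \<partial>lborel) +
            ennreal (m powr a) * \<phi> \<tau> * (\<integral>\<^sup>+x. ennreal ((y x)\<^sup>2) \<partial>lborel))"
    proof eventually_elim
      case (elim \<tau>)
      show ?case
      proof (intro impI allI)
        fix m :: real and y :: "real^'d \<Rightarrow> real" and G assume \<tau>: "\<tau> \<in> {0<..<T}" and m: "m \<ge> 1" and y: "C1_grad y G"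
        show "(\<integral>\<^sup>+x. ennreal (m * (\<bar>f (\<tau>, x)\<bar> * (y x)\<^sup>2)) \<partial>lborel) \<le> ennreal (1/4) * (\<integral>\<^sup>+x. ennreal ((norm (G x))\<^sup>2) \<partial>lborel) +
            ennreal (m powr a) * \<phi> \<tau> * (\<integral>\<^sup>+x. ennreal ((y x)\<^sup>2) \<partial>lborel)"
          unfolding \<phi>_def by (rule K(2)[OF _ _ _ _ _ y]) (use m elim \<tau> in \<open>auto simp: I_def\<close>)
      qed
    qed
    have young: "\<phi> \<tau> \<le> ennreal \<mu> + ennreal (\<mu> powr (1 - \<rho>)) * \<psi> \<tau>" if \<mu>: "\<mu> > 0" for \<mu> \<tau>
    proof (cases "I \<tau>")
      case (real i)
      have "K * i powr (a / p) \<le> \<mu> + \<mu> powr (1 - \<rho>) * (K * i powr (a / p)) powr \<rho>"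
        using K(1) \<mu> \<rho> by (intro young_split) auto
      also have "(K * i powr (a / p)) powr \<rho> = K powr \<rho> * i powr (q / p)"
        using K(1) a by (simp add: powr_mult powr_powr \<rho>_def)
      finally have "ennreal (K * i powr (a / p)) \<le> ennreal (\<mu> + \<mu> powr (1 - \<rho>) * (K powr \<rho> * i powr (q / p)))"
        by (rule ennreal_leI)
      then show ?thesis using real K(1) \<mu> by (simp add: \<phi>_def \<psi>_def epowr_ennreal ennreal_mult ennreal_plus)
    next
      \<comment> \<open>If \<open>I \<tau>\<close> is infinite, so is \<open>\<psi> \<tau>\<close>,
        with a positive factor in front.\<close>
      case top
      then show ?thesis using K(1) \<mu> by (simp add: \<psi>_def epowr_def ennreal_mult_top)
    qed
    have "(\<integral>\<^sup>+\<tau>. \<psi> \<tau> * indicator {0<..<T} \<tau> \<partial>lborel) = ennreal (K powr \<rho>) * (\<integral>\<^sup>+\<tau>. epowr (I \<tau>) (q / p) * indicator {0<..<T} \<tau> \<partial>lborel)"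
      unfolding \<psi>_def mult.assoc by (rule nn_integral_cmult) measurable
    also have "\<dots> \<le> ennreal (K powr \<rho>) * ennreal (T powr (1 - \<rho>))" by (intro mult_left_mono J) auto
    also have "\<dots> = ennreal (K powr \<rho> * T powr (1 - \<rho>))" by (simp add: ennreal_mult)
    finally have int: "(\<integral>\<^sup>+\<tau>. \<psi> \<tau> * indicator {0<..<T} \<tau> \<partial>lborel) \<le> ennreal (K powr \<rho> * T powr (1 - \<rho>))" .
    have meas: "\<phi> \<in> borel_measurable borel" "\<psi> \<in> borel_measurable borel"
      unfolding \<phi>_def[abs_def] \<psi>_def[abs_def] by measurable
    show "\<exists>\<phi> \<psi>. \<phi> \<in> borel_measurable borel \<and> \<psi> \<in> borel_measurable borel \<and>
        (AE \<tau> in lborel. \<tau> \<in> {0<..<T} \<longrightarrow> (\<forall>m\<ge>1. \<forall>y G. C1_grad y G \<longrightarrow>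
          (\<integral>\<^sup>+x. ennreal (m * (\<bar>f (\<tau>, x)\<bar> * (y x)\<^sup>2)) \<partial>lborel) \<le> ennreal (1/4) * (\<integral>\<^sup>+x. ennreal ((norm (G x))\<^sup>2) \<partial>lborel) +
            ennreal (m powr a) * \<phi> \<tau> * (\<integral>\<^sup>+x. ennreal ((y x)\<^sup>2) \<partial>lborel))) \<and>
        (\<forall>\<mu>>0. \<forall>\<tau>. \<phi> \<tau> \<le> ennreal \<mu> + ennreal (\<mu> powr (1 - q / a)) * \<psi> \<tau>) \<and>
        (\<integral>\<^sup>+\<tau>. \<psi> \<tau> * indicator {0<..<T} \<tau> \<partial>lborel) \<le> ennreal (K powr \<rho> * T powr (1 - q / a))"
      using meas AE young int unfolding \<rho>_def by blast
  qed
qed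

definition drift_form_bounded :: "real \<Rightarrow> (real \<times> (real^'d) \<Rightarrow> real^'d) \<Rightarrow> (real \<Rightarrow> ennreal) \<Rightarrow> bool" where
  "drift_form_bounded T b \<beta> \<longleftrightarrow> \<beta> \<in> borel_measurable borel \<and>
    (AE \<tau> in lborel. \<tau> \<in> {0<..<T} \<longrightarrow> (\<forall>y G. C1_grad y G \<longrightarrow>
      (\<integral>\<^sup>+x. ennreal ((norm (b (\<tau>, x)))\<^sup>2 * (y x)\<^sup>2) \<partial>lborel) \<le> ennreal (1/4) * (\<integral>\<^sup>+x. ennreal ((norm (G x))\<^sup>2) \<partial>lborel) +
        \<beta> \<tau> * (\<integral>\<^sup>+x. ennreal ((y x)\<^sup>2) \<partial>lborel)))"

text \<open>The weight is the squared norm of \<open>b\<close>, taken with exponent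
  \<open>p0 / 2\<close>. The resulting time exponent is exactly \<open>q0 / p0\<close>, so \<beta>
  is a multiple of the q0-th power of the spatial norm of \<open>b\<close>: integrable, with no
  exponent to spare.\<close>

lemma drift_form_bound_finite:
  fixes p0 n :: real
  assumes p0: "p0 > CARD('d)" "p0 \<ge> 2" and n: "n \<ge> 0"
  defines "q0 \<equiv> 2 / (1 - CARD('d) / p0)"
  shows "\<exists>B\<ge>0. \<forall>T (b :: real \<times> (real^'d) \<Rightarrow> real^'d). b \<in> borel_measurable borel \<longrightarrow>
    mixed_norm T (ennreal q0) (ennreal p0) b \<le> ennreal n \<longrightarrow>
    (\<exists>\<beta>. drift_form_bounded T b \<beta> \<and> (\<integral>\<^sup>+\<tau>. \<beta> \<tau> * indicator {0<..<T} \<tau> \<partial>lborel) \<le> ennreal B)"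
proof -
  have p: "p0 / 2 \<ge> 1" "2 * (p0 / 2) > CARD('d)" using p0 by auto
  have p00: "p0 > 0" using p0 by simp
  have "real CARD('d) / p0 < 1" using p0(1) p00 by (simp add: field_simps)
  then have q0: "q0 > 0" by (simp add: q0_def)
  have e: "1 / (1 - CARD('d) / (2 * (p0 / 2))) / (p0 / 2) = q0 / p0" by (simp add: q0_def)
  obtain K where K: "K > 0"
    "\<And>(g :: real^'d \<Rightarrow> real) y G I m. g \<in> borel_measurable borel \<Longrightarrow> (\<And>x. g x \<ge> 0) \<Longrightarrow> m > 0 \<Longrightarrow>
      (\<integral>\<^sup>+x. ennreal (g x powr (p0 / 2)) \<partial>lborel) = I \<Longrightarrow> I \<noteq> \<infinity> \<Longrightarrow> C1_grad y G \<Longrightarrow>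
      (\<integral>\<^sup>+x. ennreal (m * (g x * (y x)\<^sup>2)) \<partial>lborel) \<le> ennreal (1/4) * (\<integral>\<^sup>+x. ennreal ((norm (G x))\<^sup>2) \<partial>lborel) +
        ennreal (m powr (1 / (1 - CARD('d) / (2 * (p0 / 2))))) * (ennreal K * epowr I (q0 / p0)) * (\<integral>\<^sup>+x. ennreal ((y x)\<^sup>2) \<partial>lborel)"
    using form_bound_of_power_integral[where 'd='d, OF p, unfolded e] by blast
  show ?thesis
  proof (intro exI[of _ "K * n powr q0"] conjI allI impI)
    show "K * n powr q0 \<ge> 0" using K(1) by simp
    fix T and b :: "real \<times> (real^'d) \<Rightarrow> real^'d"
    assume [measurable]: "b \<in> borel_measurable borel" and norm: "mixed_norm T (ennreal q0) (ennreal p0) b \<le> ennreal n"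
    define I where "I \<tau> = (\<integral>\<^sup>+x. ennreal (norm (b (\<tau>, x)) powr p0) \<partial>lborel)" for \<tau>
    have [measurable]: "I \<in> borel_measurable borel" unfolding I_def[abs_def] by measurable
    have J: "(\<integral>\<^sup>+\<tau>. epowr (I \<tau>) (q0 / p0) * indicator {0<..<T} \<tau> \<partial>lborel) \<le> ennreal (n powr q0)"
      unfolding I_def by (rule nn_integral_eq_powr_mixed_norm[OF p00 q0 n norm])
    define \<beta> where "\<beta> \<tau> = ennreal K * epowr (I \<tau>) (q0 / p0)" for \<tau>
    have "AE \<tau> in lborel. \<tau> \<in> {0<..<T} \<longrightarrow> I \<tau> \<noteq> \<infinity>"
      by (rule AE_finite_of_epowr_integral[OF _ J]) measurable
    then have "drift_form_bounded T b \<beta>"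
      unfolding drift_form_bounded_def
    proof (intro conjI, goal_cases)
      case 1 show ?case unfolding \<beta>_def[abs_def] by measurable
    next
      case 2 then show ?case
      proof eventually_elim
        case (elim \<tau>)
        show ?case
        proof (intro impI allI)
          fix y :: "real^'d \<Rightarrow> real" and G assume \<tau>: "\<tau> \<in> {0<..<T}" and y: "C1_grad y G"
          have "((norm (b (\<tau>, x)))\<^sup>2) powr (p0 / 2) = norm (b (\<tau>, x)) powr p0" for x
            by (cases "b (\<tau>, x) = 0") (auto simp: powr_powr simp flip: powr_numeral)
          then have "(\<integral>\<^sup>+x. ennreal (((norm (b (\<tau>, x)))\<^sup>2) powr (p0 / 2)) \<partial>lborel) = I \<tau>" by (simp add: I_def)
          from K(2)[OF _ _ zero_less_one this _ y] elim \<tau>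
          show "(\<integral>\<^sup>+x. ennreal ((norm (b (\<tau>, x)))\<^sup>2 * (y x)\<^sup>2) \<partial>lborel) \<le> ennreal (1/4) * (\<integral>\<^sup>+x. ennreal ((norm (G x))\<^sup>2) \<partial>lborel) +
            \<beta> \<tau> * (\<integral>\<^sup>+x. ennreal ((y x)\<^sup>2) \<partial>lborel)"
            by (simp add: \<beta>_def)
        qed
      qed
    qed
    moreover have "(\<integral>\<^sup>+\<tau>. \<beta> \<tau> * indicator {0<..<T} \<tau> \<partial>lborel) \<le> ennreal (K * n powr q0)"
    proof -
      have "(\<integral>\<^sup>+\<tau>. \<beta> \<tau> * indicator {0<..<T} \<tau> \<partial>lborel) = ennreal K * (\<integral>\<^sup>+\<tau>. epowr (I \<tau>) (q0 / p0) * indicator {0<..<T} \<tau> \<partial>lborel)"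
        unfolding \<beta>_def mult.assoc by (rule nn_integral_cmult) measurable
      also have "\<dots> \<le> ennreal K * ennreal (n powr q0)" by (intro mult_left_mono J) auto
      finally show ?thesis using K(1) by (simp add: ennreal_mult)
    qed
    ultimately show "\<exists>\<beta>. drift_form_bounded T b \<beta> \<and> (\<integral>\<^sup>+\<tau>. \<beta> \<tau> * indicator {0<..<T} \<tau> \<partial>lborel) \<le> ennreal (K * n powr q0)" by blast
  qed
qed

text \<open>The essential supremum is at most \<open>c\<close> at those \<tau> for which the set of
  \<open>x\<close> with \<open>c < g (\<tau>, x)\<close> is null, and the measure of that set is
  measurable in \<tau> by Tonelli.\<close>

lemma measurable_esssup_section:
  fixes g :: "real \<times> 'a::euclidean_space \<Rightarrow> ennreal"
  assumes [measurable]: "g \<in> borel_measurable borel"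
  shows "(\<lambda>\<tau>. esssup lborel (\<lambda>x. g (\<tau>, x))) \<in> borel_measurable borel"
proof (rule borel_measurableI_le)
  fix c :: ennreal
  have "esssup lborel (\<lambda>x. g (\<tau>, x)) \<le> c \<longleftrightarrow> (\<integral>\<^sup>+x. (if c < g (\<tau>, x) then 1 else 0) \<partial>lborel) = (0::ennreal)" for \<tau>
  proof -
    have "esssup lborel (\<lambda>x. g (\<tau>, x)) \<le> c \<longleftrightarrow> (AE x in lborel. g (\<tau>, x) \<le> c)"
    proof
      assume le: "esssup lborel (\<lambda>x. g (\<tau>, x)) \<le> c"
      show "AE x in lborel. g (\<tau>, x) \<le> c"
        using esssup_AE[of "\<lambda>x. g (\<tau>, x)" lborel] by eventually_elim (use le in auto)
    next
      assume "AE x in lborel. g (\<tau>, x) \<le> c"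
      then show "esssup lborel (\<lambda>x. g (\<tau>, x)) \<le> c" by (intro esssup_I) auto
    qed
    also have "\<dots> \<longleftrightarrow> (AE x in lborel. (if c < g (\<tau>, x) then 1 else 0) = (0::ennreal))"
      by (intro AE_cong) (auto simp: not_less)
    also have "\<dots> \<longleftrightarrow> (\<integral>\<^sup>+x. (if c < g (\<tau>, x) then 1 else 0) \<partial>lborel) = (0::ennreal)"
      by (subst nn_integral_0_iff_AE) auto
    finally show ?thesis .
  qed
  then show "{\<tau> \<in> space borel. esssup lborel (\<lambda>x. g (\<tau>, x)) \<le> c} \<in> sets borel" by simp
qed

text \<open>For \<open>p0 = \<infinity>\<close> the squared essential supremum of \<open>b\<close>
  over space serves as \<beta>; the gradient term is not called upon.\<close>

lemma drift_form_bound_infinite: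
  fixes n :: real
  assumes n: "n \<ge> 0"
  shows "\<exists>B\<ge>0. \<forall>T (b :: real \<times> (real^'d) \<Rightarrow> real^'d). b \<in> borel_measurable borel \<longrightarrow>
    mixed_norm T 2 \<infinity> b \<le> ennreal n \<longrightarrow>
    (\<exists>\<beta>. drift_form_bounded T b \<beta> \<and> (\<integral>\<^sup>+\<tau>. \<beta> \<tau> * indicator {0<..<T} \<tau> \<partial>lborel) \<le> ennreal B)"
proof (intro exI[of _ "n powr 2"] conjI allI impI)
  fix T and b :: "real \<times> (real^'d) \<Rightarrow> real^'d"
  assume [measurable]: "b \<in> borel_measurable borel" and norm: "mixed_norm T 2 \<infinity> b \<le> ennreal n"
  define e where "e \<tau> = esssup lborel (\<lambda>x. ennreal (norm (b (\<tau>, x))))" for \<tau>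
  have [measurable]: "e \<in> borel_measurable borel"
    unfolding e_def[abs_def] by (rule measurable_esssup_section[of "\<lambda>z. ennreal (norm (b z))"]) measurable
  let ?J = "\<integral>\<^sup>+\<tau>. epowr (e \<tau>) 2 * indicator {0..<T} \<tau> \<partial>lborel"
  have "mixed_norm T 2 \<infinity> b = Lp_norm (restrict_space lborel {0..<T}) (ennreal 2) e"
    unfolding mixed_norm_def e_def[abs_def] by (simp add: Lp_norm_def)
  also have "\<dots> = epowr ?J (1 / 2)"
    by (subst Lp_norm_real) (auto simp: nn_integral_restrict_space)
  finally have "epowr ?J (1 / 2) \<le> ennreal n" using norm by simp
  then have "epowr (epowr ?J (1 / 2)) 2 \<le> epowr (ennreal n) 2" by (rule epowr_mono) simp
  then have J: "?J \<le> ennreal (n powr 2)" using n by (simp add: epowr_epowr epowr_one epowr_ennreal)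
  have form: "(\<integral>\<^sup>+x. ennreal ((norm (b (\<tau>, x)))\<^sup>2 * (y x)\<^sup>2) \<partial>lborel) \<le> epowr (e \<tau>) 2 * (\<integral>\<^sup>+x. ennreal ((y x)\<^sup>2) \<partial>lborel)"
    if y: "C1_grad y G" for \<tau> y G
  proof -
    have [measurable]: "y \<in> borel_measurable borel" using y unfolding C1_grad_def by (auto intro: borel_measurable_continuous_onI)
    have "AE x in lborel. ennreal (norm (b (\<tau>, x))) \<le> e \<tau>"
      unfolding e_def by (rule esssup_AE)
    then have "(\<integral>\<^sup>+x. ennreal ((norm (b (\<tau>, x)))\<^sup>2 * (y x)\<^sup>2) \<partial>lborel) \<le> (\<integral>\<^sup>+x. epowr (e \<tau>) 2 * ennreal ((y x)\<^sup>2) \<partial>lborel)"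
    proof (intro nn_integral_mono_AE, eventually_elim)
      case (elim x)
      have "ennreal ((norm (b (\<tau>, x)))\<^sup>2) = epowr (ennreal (norm (b (\<tau>, x)))) 2" by (simp add: epowr_ennreal)
      also have "\<dots> \<le> epowr (e \<tau>) 2" using elim by (intro epowr_mono) auto
      finally show ?case by (simp add: ennreal_mult mult_right_mono)
    qed
    then show ?thesis by (simp add: nn_integral_cmult)
  qed
  have "drift_form_bounded T b (\<lambda>\<tau>. epowr (e \<tau>) 2)"
    unfolding drift_form_bounded_def using form by (auto intro!: AE_I2 add_increasing)
  moreover have "(\<integral>\<^sup>+\<tau>. epowr (e \<tau>) 2 * indicator {0<..<T} \<tau> \<partial>lborel) \<le> ennreal (n powr 2)"
    by (rule order_trans[OF nn_integral_mono J]) (auto simp: indicator_def)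
  ultimately show "\<exists>\<beta>. drift_form_bounded T b \<beta> \<and> (\<integral>\<^sup>+\<tau>. \<beta> \<tau> * indicator {0<..<T} \<tau> \<partial>lborel) \<le> ennreal (n powr 2)" by blast
qed simp

section \<open>The theorem\<close>

lemma smooth_fun_cmult:
  assumes "smooth_fun w wt W H"
  shows "smooth_fun (\<lambda>z. c * w z) (\<lambda>z. c * wt z) (\<lambda>z. c *\<^sub>R W z) (\<lambda>i z. c * H i z)"
proof -
  have 1: "continuous_on UNIV w" "continuous_on UNIV wt" "continuous_on UNIV W" "\<And>i. continuous_on UNIV (H i)"
    and 2: "\<And>t x. ((\<lambda>r. w (r, x)) has_real_derivative wt (t, x)) (at t)"
      "\<And>t x h. ((\<lambda>r. w (t, x + r *\<^sub>R h)) has_real_derivative W (t, x) \<bullet> h) (at 0)"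
      "\<And>t x i. ((\<lambda>r. W (t, x + r *\<^sub>R axis i 1) $ i) has_real_derivative H i (t, x)) (at 0)"
    using assms unfolding smooth_fun_def by blast+
  show ?thesis
    unfolding smooth_fun_def using DERIV_cmult[OF 2(1)] DERIV_cmult[OF 2(2)] DERIV_cmult[OF 2(3)]
    by (auto intro!: continuous_on_mult continuous_on_scaleR continuous_on_const 1)
qed

text \<open>By linearity the approximants of \<open>u\<close> are multiplied by \<open>c\<close>.
  \<open>U\<close> stands for \<open>u\<close> altered outside the closed time interval, so that it
  can be bounded and measurable everywhere.\<close>

lemma smooth_approximable_solution:
  fixes u f :: "real \<times> (real^'d) \<Rightarrow> real" and b :: "real \<times> (real^'d) \<Rightarrow> real^'d"
  assumes sol: "bounded_solution T b f u"
    and meas[measurable]: "b \<in> borel_measurable borel" "f \<in> borel_measurable borel" and bb: "bounded (range b)"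
    and c: "c \<noteq> 0" and uU: "\<And>t x. t \<in> {0..T} \<Longrightarrow> U (t, x) = u (t, x)"
  shows "smooth_approximable T b (\<lambda>z. c * f z) (\<lambda>z. c * U z)"
  unfolding smooth_approximable_def
proof (intro allI impI)
  fix s t \<delta> \<rho> :: real
  assume st: "0 < s" "s \<le> t" "t < T" and \<delta>: "0 < \<delta>"
  have \<delta>': "\<delta> / \<bar>c\<bar> > 0" using \<delta> c by simp
  obtain w wt W H where sm: "smooth_fun w wt W H"
    and cl: "\<And>\<tau> x. \<tau> \<in> {s..t} \<Longrightarrow> norm x \<le> \<rho> \<Longrightarrow> \<bar>w (\<tau>, x) - u (\<tau>, x)\<bar> \<le> \<delta> / \<bar>c\<bar>"
    and er: "(\<integral>\<^sup>+\<tau>. (\<integral>\<^sup>+x. ennreal \<bar>(wt (\<tau>, x) + (\<Sum>i\<in>UNIV. H i (\<tau>, x))) + b (\<tau>, x) \<bullet> W (\<tau>, x) + f (\<tau>, x)\<bar> * indicator (cball 0 \<rho>) x \<partial>lborel) * indicator {s..t} \<tau> \<partial>lborel) \<le> ennreal (\<delta> / \<bar>c\<bar>)"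
    by (rule exists_smooth_approximation[OF sol meas bb st \<delta>']) blast
  have [measurable]: "wt \<in> borel_measurable borel" "W \<in> borel_measurable borel" "\<And>i. H i \<in> borel_measurable borel"
    using sm unfolding smooth_fun_def by (auto intro: borel_measurable_continuous_onI)
  let ?e = "\<lambda>\<tau> x. \<bar>(wt (\<tau>, x) + (\<Sum>i\<in>UNIV. H i (\<tau>, x))) + b (\<tau>, x) \<bullet> W (\<tau>, x) + f (\<tau>, x)\<bar>"
  have eq: "\<bar>(c * wt (\<tau>, x) + (\<Sum>i\<in>UNIV. c * H i (\<tau>, x))) + b (\<tau>, x) \<bullet> (c *\<^sub>R W (\<tau>, x)) + c * f (\<tau>, x)\<bar> = \<bar>c\<bar> * ?e \<tau> x" for \<tau> x
    unfolding abs_mult[symmetric] by (simp add: sum_distrib_left distrib_left)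
  have "(\<integral>\<^sup>+\<tau>. (\<integral>\<^sup>+x. ennreal (\<bar>c\<bar> * ?e \<tau> x) * indicator (cball 0 \<rho>) x \<partial>lborel) * indicator {s..t} \<tau> \<partial>lborel) =
    ennreal \<bar>c\<bar> * (\<integral>\<^sup>+\<tau>. (\<integral>\<^sup>+x. ennreal (?e \<tau> x) * indicator (cball 0 \<rho>) x \<partial>lborel) * indicator {s..t} \<tau> \<partial>lborel)"
    by (simp add: ennreal_mult mult.assoc nn_integral_cmult)
  also have "\<dots> \<le> ennreal \<bar>c\<bar> * ennreal (\<delta> / \<bar>c\<bar>)" by (intro mult_left_mono er) auto
  also have "\<dots> = ennreal \<delta>" using c \<delta> by (simp flip: ennreal_mult)
  finally have er': "(\<integral>\<^sup>+\<tau>. (\<integral>\<^sup>+x. ennreal \<bar>(c * wt (\<tau>, x) + (\<Sum>i\<in>UNIV. c * H i (\<tau>, x))) + b (\<tau>, x) \<bullet> (c *\<^sub>R W (\<tau>, x)) + c * f (\<tau>, x)\<bar> * indicator (cball 0 \<rho>) x \<partial>lborel) * indicator {s..t} \<tau> \<partial>lborel) \<le> ennreal \<delta>"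
    unfolding eq .
  have cl': "\<bar>c * w (\<tau>, x) - c * U (\<tau>, x)\<bar> \<le> \<delta>" if "\<tau> \<in> {s..t}" "norm x \<le> \<rho>" for \<tau> x
  proof -
    have "U (\<tau>, x) = u (\<tau>, x)" using that st by (intro uU) auto
    then have "\<bar>c * w (\<tau>, x) - c * U (\<tau>, x)\<bar> = \<bar>c\<bar> * \<bar>w (\<tau>, x) - u (\<tau>, x)\<bar>"
      by (simp add: abs_mult[symmetric] right_diff_distrib)
    also have "\<dots> \<le> \<bar>c\<bar> * (\<delta> / \<bar>c\<bar>)" by (intro mult_left_mono cl that) auto
    finally show ?thesis using c by simp
  qed
  show "\<exists>w wt W H. smooth_fun w wt W H \<and>
    (\<forall>\<tau> x. \<tau> \<in> {s..t} \<longrightarrow> norm x \<le> \<rho> \<longrightarrow> \<bar>w (\<tau>, x) - c * U (\<tau>, x)\<bar> \<le> \<delta>) \<and>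
    (\<integral>\<^sup>+\<tau>. (\<integral>\<^sup>+x. ennreal \<bar>(wt (\<tau>, x) + (\<Sum>i\<in>UNIV. H i (\<tau>, x))) + b (\<tau>, x) \<bullet> W (\<tau>, x) + c * f (\<tau>, x)\<bar> * indicator (cball 0 \<rho>) x \<partial>lborel) * indicator {s..t} \<tau> \<partial>lborel) \<le> ennreal \<delta>"
    using smooth_fun_cmult[OF sm, of c] cl' er' by blast
qed

text \<open>Uniform continuity on the compact \<open>{0..T} \<times> cball z R\<close> makes the
  vanishing terminal value small uniformly over the ball shortly before \<open>T\<close>.\<close>

lemma terminal_decay:
  fixes u :: "real \<times> (real^'d) \<Rightarrow> real"
  assumes T: "T > 0" and cu: "continuous_on ({0..T} \<times> UNIV) u" and uT: "\<And>x. u (T, x) = 0" and \<delta>: "\<delta> > 0"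
  shows "\<exists>t0<T. \<forall>t\<in>{t0<..<T}. \<forall>x\<in>cball z R. \<bar>u (t, x)\<bar> \<le> \<delta>"
proof -
  let ?K = "{0..T} \<times> cball z R"
  have "continuous_on ?K u" by (rule continuous_on_subset[OF cu]) auto
  then have "uniformly_continuous_on ?K u" by (rule compact_uniformly_continuous) (intro compact_Times compact_Icc compact_cball)
  then obtain d where d: "d > 0" "\<And>y y'. y \<in> ?K \<Longrightarrow> y' \<in> ?K \<Longrightarrow> dist y' y < d \<Longrightarrow> dist (u y') (u y) < \<delta>"
    using \<delta> unfolding uniformly_continuous_on_def by blast
  show ?thesis
  proof (intro exI[of _ "max 0 (T - d)"] conjI ballI)
    show "max 0 (T - d) < T" using T d by simp
    fix t x assume "t \<in> {max 0 (T - d)<..<T}" "x \<in> cball z R"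
    then have "dist (u (t, x)) (u (T, x)) < \<delta>"
      by (intro d(2)) (auto simp: dist_Pair_Pair dist_real_def)
    then show "\<bar>u (t, x)\<bar> \<le> \<delta>" by (simp add: uT dist_real_def)
  qed
qed

text \<open>For finite \<open>p0\<close> the quotient is strictly below 1, so \<open>2 / q0\<close>
  is positive and finite and can be solved for in the reals; for \<open>p0 = \<infinity>\<close> the
  first summand is 0.\<close>

lemma exponent_relation:
  fixes p0 q0 :: ennreal
  assumes d: "of_nat n < p0" and pq: "of_nat n / p0 + 2 / q0 = 1"
  shows "p0 = \<infinity> \<Longrightarrow> q0 = 2"
    and "p0 = ennreal r \<Longrightarrow> q0 = ennreal (2 / (1 - real n / r))"
proof -
  \<comment> \<open>In \<open>ennreal\<close> division by 0 gives \<infinity>, which the relation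
    then excludes.\<close>
  have two: "2 / ennreal s = (if s = 0 then \<infinity> else ennreal (2 / s))" if "s \<ge> 0" for s
    using that divide_ennreal[of 2 s] by (auto simp: ennreal_divide_zero)
  show "q0 = 2" if "p0 = \<infinity>"
  proof (cases q0)
    case (real s)
    have "2 / ennreal s = 1" using pq that real by simp
    then have "s \<noteq> 0" "ennreal (2 / s) = 1" using two[OF real(1)] by (auto split: if_splits)
    then have "2 / s = 1" using real(1) by (metis divide_nonneg_nonneg ennreal_1 ennreal_inj zero_le_numeral zero_le_one)
    then have "s = 2" using \<open>s \<noteq> 0\<close> by (simp add: field_simps)
    then show ?thesis using real by simp
  next
    case top
    then show ?thesis using pq that by simp
  qed
  show "q0 = ennreal (2 / (1 - real n / r))" if p0: "p0 = ennreal r"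
  proof -
    have r: "real n < r" using d p0 by (metis ennreal_less_iff ennreal_of_nat_eq_real_of_nat of_nat_0_le_iff)
    have r0: "r > 0" using r by (rule order.strict_trans1[OF of_nat_0_le_iff])
    have dn: "of_nat n / p0 = ennreal (real n / r)"
      unfolding p0 using r0 by (simp add: divide_ennreal ennreal_of_nat_eq_real_of_nat)
    have nr: "real n / r < 1" "0 \<le> real n / r" using r r0 by auto
    show ?thesis
    proof (cases q0)
      case (real s)
      have "ennreal (real n / r) + 2 / ennreal s = 1" using pq real unfolding dn by simp
      then have s: "s \<noteq> 0" "ennreal (real n / r) + ennreal (2 / s) = 1"
        using two[OF real(1)] by (auto split: if_splits)
      then have "ennreal (real n / r + 2 / s) = ennreal 1" using nr real(1) by (simp add: ennreal_plus)
      then have "real n / r + 2 / s = 1" using nr(2) real(1) by (subst (asm) ennreal_inj) auto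
      then have "2 / s = 1 - real n / r" by simp
      then have "2 = (1 - real n / r) * s" unfolding nonzero_divide_eq_eq[OF s(1)] .
      then have "s * (1 - real n / r) = 2" by (simp only: mult.commute)
      moreover have "1 - real n / r \<noteq> 0" using nr(1) by linarith
      ultimately have "s = 2 / (1 - real n / r)" by (subst nonzero_eq_divide_eq)
      then show ?thesis using real by simp
    next
      case top
      then have "ennreal (real n / r) = ennreal 1" using pq unfolding dn by simp
      then show ?thesis using nr by (subst (asm) ennreal_inj) auto
    qed
  qed
qed

text \<open>The relation determines \<open>q0\<close> from \<open>p0\<close>, so \<open>B\<close>
  can be chosen before \<open>q0\<close>. Dimension at least 3 gives \<open>p0 > 2\<close>, hence an
  exponent \<open>p0 / 2\<close> of at least 1 for the squared drift.\<close>

lemma drift_form_bound: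
  fixes n :: real
  assumes d: "CARD('d::finite) \<ge> 3" and p0: "of_nat CARD('d) < p0" and n: "n \<ge> 0"
  shows "\<exists>B\<ge>0. \<forall>T q0 (b :: real \<times> (real^'d) \<Rightarrow> real^'d). b \<in> borel_measurable borel \<longrightarrow>
    of_nat CARD('d) / p0 + 2 / q0 = 1 \<longrightarrow> mixed_norm T q0 p0 b \<le> ennreal n \<longrightarrow>
    (\<exists>\<beta>. drift_form_bounded T b \<beta> \<and> (\<integral>\<^sup>+\<tau>. \<beta> \<tau> * indicator {0<..<T} \<tau> \<partial>lborel) \<le> ennreal B)"
proof (cases p0)
  case (real r)
  have r: "real CARD('d) < r" using p0 real by (metis ennreal_less_iff ennreal_of_nat_eq_real_of_nat of_nat_0_le_iff)
  have "r \<ge> 2" using r d by simp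
  then show ?thesis
    using drift_form_bound_finite[OF r _ n] exponent_relation(2)[OF p0 _ real(2)] real(2) by blast
next
  case top
  obtain B where B: "B \<ge> 0" "\<And>T (b :: real \<times> (real^'d) \<Rightarrow> real^'d). b \<in> borel_measurable borel \<Longrightarrow> mixed_norm T 2 \<infinity> b \<le> ennreal n \<Longrightarrow>
    \<exists>\<beta>. drift_form_bounded T b \<beta> \<and> (\<integral>\<^sup>+\<tau>. \<beta> \<tau> * indicator {0<..<T} \<tau> \<partial>lborel) \<le> ennreal B"
    using drift_form_bound_infinite[OF n, where 'd='d] by blast
  show ?thesis
  proof (intro exI[of _ B] conjI allI impI B(1))
    fix T q0 and b :: "real \<times> (real^'d) \<Rightarrow> real^'d"
    assume b: "b \<in> borel_measurable borel" "of_nat CARD('d) / p0 + 2 / q0 = 1" "mixed_norm T q0 p0 b \<le> ennreal n"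
    have "q0 = 2" using exponent_relation(1)[OF p0 b(2)] top by simp
    then show "\<exists>\<beta>. drift_form_bounded T b \<beta> \<and> (\<integral>\<^sup>+\<tau>. \<beta> \<tau> * indicator {0<..<T} \<tau> \<partial>lborel) \<le> ennreal B"
      using B(2)[OF b(1)] b(3) top by simp
  qed
qed

text \<open>By linearity it suffices to bound \<open>c * u\<close> from above when the norm of
  \<open>c * f\<close> is at most \<open>T powr (- \<gamma>)\<close>; applying this to both signs of
  \<open>c\<close> and undoing the scaling gives the factor \<open>T powr \<gamma>\<close>.\<close>

lemma pointwise_bound:
  fixes n p q :: real
  assumes d: "CARD('d::finite) \<ge> 3" and p0: "of_nat CARD('d) < p0" and n: "n \<ge> 0"
    and p: "1 < p" and q: "1 < q" and pq: "real CARD('d) / p + 2 / q < 2"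
  shows "\<exists>N>0. \<forall>T q0 (b :: real \<times> (real^'d) \<Rightarrow> real^'d) f u. 0 < T \<longrightarrow> b \<in> borel_measurable borel \<longrightarrow> bounded (range b) \<longrightarrow>
    of_nat CARD('d) / p0 + 2 / q0 = 1 \<longrightarrow> mixed_norm T q0 p0 b \<le> ennreal n \<longrightarrow> f \<in> borel_measurable borel \<longrightarrow>
    bounded_solution T b f u \<longrightarrow>
    ennreal \<bar>u (0, 0)\<bar> \<le> ennreal (N * T powr (1 - real CARD('d) / (2 * p) - 1 / q)) * mixed_norm T (ennreal q) (ennreal p) f"
proof -
  define \<gamma> where "\<gamma> = 1 - real CARD('d) / (2 * p) - 1 / q"
  define a where "a = 1 / (1 - real CARD('d) / (2 * p))"
  obtain L where L: "L \<ge> 0"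
    and src: "\<And>T (f :: real \<times> (real^'d) \<Rightarrow> real). T > 0 \<Longrightarrow> f \<in> borel_measurable borel \<Longrightarrow>
      mixed_norm T (ennreal q) (ennreal p) f \<le> ennreal (T powr (- \<gamma>)) \<Longrightarrow>
      \<exists>\<phi> \<psi>. \<phi> \<in> borel_measurable borel \<and> \<psi> \<in> borel_measurable borel \<and>
        (AE \<tau> in lborel. \<tau> \<in> {0<..<T} \<longrightarrow> (\<forall>m\<ge>1. \<forall>y G. C1_grad y G \<longrightarrow>
          (\<integral>\<^sup>+x. ennreal (m * (\<bar>f (\<tau>, x)\<bar> * (y x)\<^sup>2)) \<partial>lborel) \<le> ennreal (1/4) * (\<integral>\<^sup>+x. ennreal ((norm (G x))\<^sup>2) \<partial>lborel) +
            ennreal (m powr a) * \<phi> \<tau> * (\<integral>\<^sup>+x. ennreal ((y x)\<^sup>2) \<partial>lborel))) \<and>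
        (\<forall>\<mu>>0. \<forall>\<tau>. \<phi> \<tau> \<le> ennreal \<mu> + ennreal (\<mu> powr (1 - q / a)) * \<psi> \<tau>) \<and>
        (\<integral>\<^sup>+\<tau>. \<psi> \<tau> * indicator {0<..<T} \<tau> \<partial>lborel) \<le> ennreal (L * T powr (1 - q / a))"
    and a: "a > 0" and \<rho>: "q / a > 1"
    using source_form_bound[OF p q pq] unfolding \<gamma>_def a_def by blast
  obtain B where B: "B \<ge> 0" and drift: "\<And>T q0 (b :: real \<times> (real^'d) \<Rightarrow> real^'d). b \<in> borel_measurable borel \<Longrightarrow>
    of_nat CARD('d) / p0 + 2 / q0 = 1 \<Longrightarrow> mixed_norm T q0 p0 b \<le> ennreal n \<Longrightarrow>
    \<exists>\<beta>. drift_form_bounded T b \<beta> \<and> (\<integral>\<^sup>+\<tau>. \<beta> \<tau> * indicator {0<..<T} \<tau> \<partial>lborel) \<le> ennreal B"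
    using drift_form_bound[OF d p0 n] by blast
  obtain \<Lambda> where sup: "\<And>T M (u :: real \<times> (real^'d) \<Rightarrow> real) b f \<beta> \<phi> \<psi>. moser_data T M B L a (q / a) u b f \<beta> \<phi> \<psi> \<Longrightarrow>
    continuous_on ({0<..<T} \<times> UNIV) u \<Longrightarrow> (\<forall>t\<in>{0<..<T}. \<forall>x. u (t, x) \<le> \<Lambda>)"
    using moser_sup_bound[OF L B less_imp_le[OF a] \<rho>, where 'd='d] by blast
  \<comment> \<open>The bound \<Lambda> need not be positive, whereas the rescaling divides by
    \<open>N\<close>.\<close>
  define N where "N = max \<Lambda> 1"
  have N: "N > 0" by (simp add: N_def)
  show ?thesis
    unfolding \<gamma>_def[symmetric]
  proof (intro exI[of _ N] conjI allI impI N)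
    fix T q0 f u and b :: "real \<times> (real^'d) \<Rightarrow> real^'d"
    assume T: "0 < T" and meas[measurable]: "b \<in> borel_measurable borel" and bb: "bounded (range b)"
      and q0: "of_nat CARD('d) / p0 + 2 / q0 = 1" and bn: "mixed_norm T q0 p0 b \<le> ennreal n"
      and measf[measurable]: "f \<in> borel_measurable borel" and sol: "bounded_solution T b f u"
    have cu: "continuous_on ({0..T} \<times> UNIV) u" and bu: "bounded (u ` ({0..T} \<times> UNIV))" and uT: "\<And>x. u (T, x) = 0"
      using sol unfolding bounded_solution_def by auto
    obtain \<beta> where \<beta>: "drift_form_bounded T b \<beta>" "(\<integral>\<^sup>+\<tau>. \<beta> \<tau> * indicator {0<..<T} \<tau> \<partial>lborel) \<le> ennreal B"
      using drift[OF meas q0 bn] by blast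
    \<comment> \<open>The solution is specified on \<open>{0..T} \<times> UNIV\<close> only.
      Extension by 0 makes it Borel measurable and bounded everywhere, as \<open>moser_data\<close>
      demands.\<close>
    define U where "U z = indicator ({0..T} \<times> UNIV) z *\<^sub>R u z" for z
    have uU: "U (t, x) = u (t, x)" if "t \<in> {0..T}" for t x using that by (simp add: U_def)
    have mU[measurable]: "U \<in> borel_measurable borel"
      unfolding U_def[abs_def]
      by (rule borel_measurable_continuous_on_indicator[OF _ cu]) (intro borel_closed closed_Times closed_atLeastAtMost closed_UNIV)
    obtain M0 where M0: "M0 > 0" "\<And>z. z \<in> {0..T} \<times> UNIV \<Longrightarrow> \<bar>u z\<bar> \<le> M0"
      using bu unfolding bounded_pos by auto
    have UM: "\<bar>U z\<bar> \<le> M0" for z using M0 by (auto simp: U_def indicator_def)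
    have cU: "continuous_on ({0<..<T} \<times> UNIV) U"
      by (rule continuous_on_eq[OF continuous_on_subset[OF cu]]) (auto simp: U_def)
    have one_sided: "c * u (0, 0) \<le> \<Lambda>"
      if c: "c \<noteq> 0" and cn: "ennreal \<bar>c\<bar> * mixed_norm T (ennreal q) (ennreal p) f \<le> ennreal (T powr (- \<gamma>))" for c
    proof -
      have [measurable]: "(\<lambda>z. c * f z) \<in> borel_measurable borel" by measurable
      have "mixed_norm T (ennreal q) (ennreal p) (\<lambda>z. c * f z) \<le> ennreal (T powr (- \<gamma>))"
        using cn p q by (subst mixed_norm_cmult[OF measf _ _ c]) auto
      from src[OF T _ this] obtain \<phi> \<psi> where [measurable]: "\<phi> \<in> borel_measurable borel" "\<psi> \<in> borel_measurable borel"
        and form: "AE \<tau> in lborel. \<tau> \<in> {0<..<T} \<longrightarrow> (\<forall>m\<ge>1. \<forall>y G. C1_grad y G \<longrightarrow>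
          (\<integral>\<^sup>+x. ennreal (m * (\<bar>c * f (\<tau>, x)\<bar> * (y x)\<^sup>2)) \<partial>lborel) \<le> ennreal (1/4) * (\<integral>\<^sup>+x. ennreal ((norm (G x))\<^sup>2) \<partial>lborel) +
            ennreal (m powr a) * \<phi> \<tau> * (\<integral>\<^sup>+x. ennreal ((y x)\<^sup>2) \<partial>lborel))"
        and young: "\<forall>\<mu>>0. \<forall>\<tau>. \<phi> \<tau> \<le> ennreal \<mu> + ennreal (\<mu> powr (1 - q / a)) * \<psi> \<tau>"
        and int: "(\<integral>\<^sup>+\<tau>. \<psi> \<tau> * indicator {0<..<T} \<tau> \<partial>lborel) \<le> ennreal (L * T powr (1 - q / a))"
        by auto
      have m\<beta>[measurable]: "\<beta> \<in> borel_measurable borel" using \<beta>(1) unfolding drift_form_bounded_def by blast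
      have fb: "form_bounded T b (\<lambda>z. c * f z) m (\<lambda>\<tau>. \<beta> \<tau> + ennreal (m powr a) * \<phi> \<tau>)" if m: "m \<ge> 1" for m
        unfolding form_bounded_def
      proof (intro conjI)
        show "(\<lambda>\<tau>. \<beta> \<tau> + ennreal (m powr a) * \<phi> \<tau>) \<in> borel_measurable borel" by measurable
        show "AE \<tau> in lborel. \<tau> \<in> {0<..<T} \<longrightarrow> (\<forall>y G. C1_grad y G \<longrightarrow>
          (\<integral>\<^sup>+x. ennreal ((norm (b (\<tau>, x)))\<^sup>2 * (y x)\<^sup>2) + ennreal (m * (\<bar>c * f (\<tau>, x)\<bar> * (y x)\<^sup>2)) \<partial>lborel) \<le>
          ennreal (1/2) * (\<integral>\<^sup>+x. ennreal ((norm (G x))\<^sup>2) \<partial>lborel) + (\<beta> \<tau> + ennreal (m powr a) * \<phi> \<tau>) * (\<integral>\<^sup>+x. ennreal ((y x)\<^sup>2) \<partial>lborel))"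
          using form \<beta>(1)[unfolded drift_form_bounded_def, THEN conjunct2]
        proof eventually_elim
          case (elim \<tau>)
          show ?case
          proof (intro impI allI)
            fix y :: "real^'d \<Rightarrow> real" and G assume \<tau>: "\<tau> \<in> {0<..<T}" and yG: "C1_grad y G"
            have [measurable]: "y \<in> borel_measurable borel" using yG unfolding C1_grad_def by (auto intro: borel_measurable_continuous_onI)
            let ?G = "\<integral>\<^sup>+x. ennreal ((norm (G x))\<^sup>2) \<partial>lborel" and ?Y = "\<integral>\<^sup>+x. ennreal ((y x)\<^sup>2) \<partial>lborel"
            have "(\<integral>\<^sup>+x. ennreal ((norm (b (\<tau>, x)))\<^sup>2 * (y x)\<^sup>2) + ennreal (m * (\<bar>c * f (\<tau>, x)\<bar> * (y x)\<^sup>2)) \<partial>lborel) =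
              (\<integral>\<^sup>+x. ennreal ((norm (b (\<tau>, x)))\<^sup>2 * (y x)\<^sup>2) \<partial>lborel) + (\<integral>\<^sup>+x. ennreal (m * (\<bar>c * f (\<tau>, x)\<bar> * (y x)\<^sup>2)) \<partial>lborel)"
              by (rule nn_integral_add) measurable
            also have "\<dots> \<le> (ennreal (1/4) * ?G + \<beta> \<tau> * ?Y) + (ennreal (1/4) * ?G + ennreal (m powr a) * \<phi> \<tau> * ?Y)"
              using elim \<tau> yG m by (intro add_mono) blast+
            also have "\<dots> = (ennreal (1/4) + ennreal (1/4)) * ?G + (\<beta> \<tau> + ennreal (m powr a) * \<phi> \<tau>) * ?Y"
              by (simp only: distrib_right distrib_left ac_simps)
            also have "ennreal (1/4) + ennreal (1/4) = ennreal (1/2)" by (subst ennreal_plus[symmetric]) auto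
            finally show "(\<integral>\<^sup>+x. ennreal ((norm (b (\<tau>, x)))\<^sup>2 * (y x)\<^sup>2) + ennreal (m * (\<bar>c * f (\<tau>, x)\<bar> * (y x)\<^sup>2)) \<partial>lborel) \<le>
              ennreal (1/2) * ?G + (\<beta> \<tau> + ennreal (m powr a) * \<phi> \<tau>) * ?Y" .
          qed
        qed
      qed
      have tm: "\<exists>t0<T. \<forall>t\<in>{t0<..<T}. \<forall>x\<in>cball z R. c * U (t, x) \<le> \<delta>" if \<delta>: "\<delta> > 0" for z R \<delta>
      proof -
        have "\<delta> / \<bar>c\<bar> > 0" using \<delta> c by simp
        then obtain t0 where t0: "t0 < T" "\<forall>t\<in>{t0<..<T}. \<forall>x\<in>cball z R. \<bar>u (t, x)\<bar> \<le> \<delta> / \<bar>c\<bar>"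
          using terminal_decay[OF T cu uT] by blast
        have "c * U (t, x) \<le> \<delta>" if "t \<in> {max t0 0<..<T}" "x \<in> cball z R" for t x
        proof -
          have "\<bar>u (t, x)\<bar> \<le> \<delta> / \<bar>c\<bar>" using t0(2) that by auto
          then have "\<bar>c\<bar> * \<bar>u (t, x)\<bar> \<le> \<delta>" using c by (simp add: field_simps)
          then have "c * u (t, x) \<le> \<delta>" by (simp add: abs_mult[symmetric])
          then show ?thesis using that by (subst uU) auto
        qed
        then show ?thesis using t0(1) T by (intro exI[of _ "max t0 0"]) auto
      qed
      have ap: "smooth_approximable T b (\<lambda>z. c * f z) (\<lambda>z. c * U z)"
        by (rule smooth_approximable_solution[OF sol meas measf bb c uU])
      have cUM: "\<bar>c * U z\<bar> \<le> \<bar>c\<bar> * M0" for z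
        unfolding abs_mult by (intro mult_left_mono UM) auto
      have "moser_data T (\<bar>c\<bar> * M0) B L a (q / a) (\<lambda>z. c * U z) b (\<lambda>z. c * f z) \<beta> \<phi> \<psi>"
        unfolding moser_data_def using T meas ap cUM tm \<beta>(2) fb young int by simp
      then have le: "\<forall>t\<in>{0<..<T}. \<forall>x. c * U (t, x) \<le> \<Lambda>"
        by (rule sup) (intro continuous_on_mult continuous_on_const cU)
      \<comment> \<open>The iteration bounds \<open>u\<close> on the open time interval; continuity
        carries the bound to time 0.\<close>
      have "continuous_on {0..T} (\<lambda>t. c * u (t, 0))"
        by (intro continuous_on_mult continuous_on_const continuous_on_compose2[OF cu]) (auto intro!: continuous_intros)
      then have "((\<lambda>t. c * u (t, 0)) \<longlongrightarrow> c * u (0, 0)) (at_right 0)"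
        using continuous_on_Icc_at_rightD[of 0 T "\<lambda>t. c * u (t, 0)"] T by simp
      moreover have "\<forall>\<^sub>F t in at_right 0. c * u (t, 0) \<le> \<Lambda>"
        using eventually_at_right_real[OF T]
      proof eventually_elim
        case (elim t)
        then have "c * U (t, 0) \<le> \<Lambda>" using le by blast
        then show ?case using uU[of t 0] elim by simp
      qed
      ultimately show ?thesis by (rule tendsto_upperbound) simp
    qed
    show "ennreal \<bar>u (0, 0)\<bar> \<le> ennreal (N * T powr \<gamma>) * mixed_norm T (ennreal q) (ennreal p) f"
    proof (cases "mixed_norm T (ennreal q) (ennreal p) f")
      case top
      then show ?thesis using N T by (simp add: ennreal_mult_top)
    next
      case (real l)
      \<comment> \<open>A positive \<open>k\<close> above the scaled norm replaces the norm itself,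
        so that an \<open>f\<close> of norm 0 is covered; the multipliers \<open>1 / k\<close> and
        \<open>- 1 / k\<close> give the two signs.\<close>
      have bound: "\<bar>u (0, 0)\<bar> \<le> N * k" if k: "k > 0" "l * T powr \<gamma> \<le> k" for k
      proof -
        have "1 / k * l \<le> T powr (- \<gamma>)" using k T by (simp add: powr_minus_divide field_simps)
        then have le: "ennreal (1 / k) * mixed_norm T (ennreal q) (ennreal p) f \<le> ennreal (T powr (- \<gamma>))"
          unfolding real using real(1) k by (simp add: ennreal_leI flip: ennreal_mult)
        have "(1 / k) * u (0, 0) \<le> \<Lambda>" "(- 1 / k) * u (0, 0) \<le> \<Lambda>"
          using one_sided[of "1 / k"] one_sided[of "- 1 / k"] le k(1) by auto
        then have "\<bar>u (0, 0)\<bar> / k \<le> N" unfolding N_def by (auto simp: abs_if)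
        then show ?thesis using k(1) by (simp add: pos_divide_le_eq)
      qed
      have "\<bar>u (0, 0)\<bar> \<le> N * T powr \<gamma> * l"
      proof (rule field_le_epsilon)
        fix e :: real assume e: "e > 0"
        have "\<bar>u (0, 0)\<bar> \<le> N * (l * T powr \<gamma> + e / N)"
          using real(1) e N by (intro bound) (auto intro: add_nonneg_pos)
        then show "\<bar>u (0, 0)\<bar> \<le> N * T powr \<gamma> * l + e" using N by (simp add: distrib_left mult_ac)
      qed
      then show ?thesis
        unfolding real using N T real(1) by (simp add: ennreal_leI flip: ennreal_mult)
    qed
  qed
qed

theorem theorem1p1:
  assumes "CARD('d::finite) \<ge> 3"
  shows "\<exists>(N1 :: real \<Rightarrow> real \<Rightarrow> real \<Rightarrow> real)
          (N2 :: real \<Rightarrow> ennreal \<Rightarrow> real \<Rightarrow> real \<Rightarrow> (real \<Rightarrow> ennreal) \<Rightarrow> real).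
    \<forall>(T::real) (b :: real \<times> (real^'d) \<Rightarrow> real^'d) (p0::ennreal) (q0::ennreal) (p::real) (q::real)
     (f :: real \<times> (real^'d) \<Rightarrow> real) (u :: real \<times> (real^'d) \<Rightarrow> real).
      0 < T \<longrightarrow>
      b \<in> borel_measurable borel \<longrightarrow> bounded (range b) \<longrightarrow>
      of_nat CARD('d) < p0 \<longrightarrow> of_nat CARD('d) / p0 + 2 / q0 = 1 \<longrightarrow>
      mixed_norm T q0 p0 b < \<infinity> \<longrightarrow>
      1 < p \<longrightarrow> 1 < q \<longrightarrow> real CARD('d) / p + 2 / q < 2 \<longrightarrow>
      f \<in> borel_measurable borel \<longrightarrow> bounded (range f) \<longrightarrow>
      bounded_solution T b f u \<longrightarrow>
      (let bbar = enn2real (mixed_norm T q0 p0 b);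
           N' = (if p0 = \<infinity> then N1 bbar q p
                 else N2 bbar p0 q p (drift_profile (enn2real p0) b))
       in ennreal \<bar>u (0, 0)\<bar> \<le>
            ennreal (N' * T powr (1 - real CARD('d) / (2 * p) - 1 / q)) *
            mixed_norm T (ennreal q) (ennreal p) f)"
proof -
  define good where "good n p0 q p N \<longleftrightarrow> (\<forall>T q0 (b :: real \<times> (real^'d) \<Rightarrow> real^'d) f u. 0 < T \<longrightarrow> b \<in> borel_measurable borel \<longrightarrow> bounded (range b) \<longrightarrow>
    of_nat CARD('d) / p0 + 2 / q0 = 1 \<longrightarrow> mixed_norm T q0 p0 b \<le> ennreal n \<longrightarrow> f \<in> borel_measurable borel \<longrightarrow>
    bounded_solution T b f u \<longrightarrow>
    ennreal \<bar>u (0, 0)\<bar> \<le> ennreal (N * T powr (1 - real CARD('d) / (2 * p) - 1 / q)) * mixed_norm T (ennreal q) (ennreal p) f)"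
    for n :: real and p0 :: ennreal and q p N :: real
  \<comment> \<open>Choice turns the existence of a constant into a function of the listed data. In
    \<open>good\<close> the constant comes before \<open>T\<close>, \<open>q0\<close>,
    \<open>b\<close>, \<open>f\<close> and \<open>u\<close>, and the mixed norm of \<open>b\<close>
    enters as the number \<open>n\<close>.\<close>
  define N where "N n p0 q p = (SOME N. good n p0 q p N)" for n p0 q p
  have good: "good n p0 q p (N n p0 q p)"
    if "of_nat CARD('d) < p0" "n \<ge> 0" "1 < p" "1 < q" "real CARD('d) / p + 2 / q < 2" for n p0 q p
  proof -
    have "\<exists>N. good n p0 q p N" using pointwise_bound[OF assms that] unfolding good_def by blast
    then show ?thesis unfolding N_def by (rule someI_ex)
  qed
  show ?thesis
  proof (rule exI[of _ "\<lambda>n. N n \<infinity>"], rule exI[of _ "\<lambda>n p0 q p _. N n p0 q p"], intro allI impI)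
    fix T p0 q0 p q f u and b :: "real \<times> (real^'d) \<Rightarrow> real^'d"
    assume *: "0 < T" "b \<in> borel_measurable borel" "bounded (range b)" "of_nat CARD('d) < p0" "of_nat CARD('d) / p0 + 2 / q0 = 1"
      "mixed_norm T q0 p0 b < \<infinity>" "1 < p" "1 < q" "real CARD('d) / p + 2 / q < 2" "f \<in> borel_measurable borel" "bounded_solution T b f u"
    define n where "n = enn2real (mixed_norm T q0 p0 b)"
    have n: "n \<ge> 0" "mixed_norm T q0 p0 b \<le> ennreal n" using *(6) by (auto simp: n_def)
    have "ennreal \<bar>u (0, 0)\<bar> \<le> ennreal (N n p0 q p * T powr (1 - real CARD('d) / (2 * p) - 1 / q)) * mixed_norm T (ennreal q) (ennreal p) f"
      using good[OF *(4) n(1) *(7,8,9)] * n(2) unfolding good_def by blast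
    then show "let bbar = enn2real (mixed_norm T q0 p0 b);
           N' = (if p0 = \<infinity> then N bbar \<infinity> q p else N bbar p0 q p)
       in ennreal \<bar>u (0, 0)\<bar> \<le> ennreal (N' * T powr (1 - real CARD('d) / (2 * p) - 1 / q)) * mixed_norm T (ennreal q) (ennreal p) f"
      by (cases "p0 = \<infinity>") (simp_all add: Let_def n_def)
  qed
qed

end
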